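(* Let $m\ge 1$ be an integer, $\delta\in\mathbb{R}$, and let $p,q,k\in\mathbb{N}=\{0,1,2,\dots\}$. (a) If $p<q$, then $H(s\ell_{m+1},\mathcal{D}^k(\mathcal{S}^p_\delta(\mathbb{R}^m),\mathcal{S}^q_\delta(\mathbb{R}^m)))=0$. (b) Let $n\in\mathbb{N}$ (so $n\geq 0$). Then: (i) if $k<n-1$, then $H(s\ell_{m+1},\mathcal{D}^k(\mathcal{S}^{q+n}_\delta(\mathbb{R}^m),\mathcal{S}^q_\delta(\mathbb{R}^m)))=0$; (ii) if $n\ge 1$, then $H(s\ell_{m+1},\mathcal{D}^{n-1}(\mathcal{S}^{q+n}_\delta(\mathbb{R}^m),\mathcal{S}^q_\delta(\mathbb{R}^m)))$ is isomorphic to $(\Lambda\, g\ell(m,\mathbb{R})^* )_{g\text{-}inv}$; (iii) for each $k>n$, the inclusion of $\mathcal{D}^{n}(\mathcal{S}^{q+n}_\delta(\mathbb{R}^m),\mathcal{S}^q_\delta(\mathbb{R}^m))$ into $\mathcal{D}^{k}(\mathcal{S}^{q+n}_\delta(\mathbb{R}^m),\mathcal{S}^q_\delta(\mathbb{R}^m))$ induces an isomorphism $$H(s\ell_{m+1},\mathcal{D}^{n}(\mathcal{S}^{q+n}_\delta(\mathbb{R}^m),\mathcal{S}^q_\delta(\mathbb{R}^m)))\to H(s\ell_{m+1},\mathcal{D}^{k}(\mathcal{S}^{q+n}_\delta(\mathbb{R}^m),\mathcal{S}^q_\delta(\mathbb{R}^m))).$$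
   Context: $s\ell_{m+1}$ denotes the Lie subalgebra of the Lie algebra $Vect(\mathbb{R}^m)$ of smooth vector fields on $\mathbb{R}^m$ spanned by $\partial_i$, $x^j\partial_i$ and $x^jE$ ($1\le i,j\le m$), where $E=\sum_i x^i\partial_i$; it is isomorphic to $s\ell(m+1,\mathbb{R})$. $\mathcal{S}^k_\delta(\mathbb{R}^m)$ is the space of smooth symmetric $k$-contravariant tensor fields on $\mathbb{R}^m$ with values in the $\delta$-densities. It is identified with $C_\infty(\mathbb{R}^m,\vee^k\mathbb{R}^m)$, with Lie derivative $L_XP=X.P-\rho(DX)P+\delta\,\mathrm{tr}(DX)P$, where $X.P=\sum_i X^i\partial_iP$, $DX=(\partial_jX^i)$ and $\rho$ is the natural representation of $g\ell(m,\mathbb{R})$ on $\vee^k\mathbb{R}^m$. $\mathcal{D}^k(\mathcal{S}^p_\delta(\mathbb{R}^m),\mathcal{S}^q_\delta(\mathbb{R}^m))$ is the space of linear differential operators of order $\le k$ (with smooth coefficients) from $\mathcal{S}^p_\delta(\mathbb{R}^m)$ into $\mathcal{S}^q_\delta(\mathbb{R}^m)$, on which $X\in s\ell_{m+1}$ acts by $D\mapsto L_X\circ D-D\circ L_X$. $H(s\ell_{m+1},W)=\bigoplus_u H^u(s\ell_{m+1},W)$ is the Chevalley–Eilenberg cohomology of $s\ell_{m+1}$ with coefficients in the module $W$; "isomorphic" means isomorphic as real vector spaces. $(\Lambda\, g\ell(m,\mathbb{R})^* )_{g\text{-}inv}$ is the space of alternating multilinear forms on $g\ell(m,\mathbb{R})$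 (all degrees) that are invariant under the adjoint action of $g\ell(m,\mathbb{R})$. *)

theory Defs
  imports
    "HOL-Analysis.Analysis"
    "HOL-Library.Function_Algebras"
    "Jordan_Normal_Form.Missing_VectorSpace"
begin

section \<open>Real vector spaces as module records\<close>

text \<open>
  Tensor fields, differential operators and cochains are all functions; with the pointwise structure
  they become elements of ambient real vector spaces.
\<close>

instantiation "fun" :: (type, real_vector) real_vector
begin

definition scaleR_fun_def: "r *\<^sub>R f = (\<lambda>x. r *\<^sub>R f x)"

instance
  by standard (simp_all add: scaleR_fun_def plus_fun_def fun_eq_iff algebra_simps)

end

definition real_scalars :: "real ring" where
  "real_scalars = \<lparr>carrier = UNIV, mult = (*), one = 1, zero = 0, add = (+)\<rparr>"

text \<open>
  The fields \<open>mult\<close> and \<open>one\<close> of a module record play no role in the locale \<open>vectorspace\<close>.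
\<close>

definition subspace_module :: "'v::real_vector set \<Rightarrow> (real, 'v) module" where
  "subspace_module S =
     \<lparr>carrier = S, mult = undefined, one = undefined, zero = 0, add = (+), smult = (*\<^sub>R)\<rparr>"

text \<open>
  \<open>Z / B\<close> as a space of cosets \<open>z + B\<close>, with sums of sets from \<^theory>\<open>HOL-Library.Set_Algebras\<close>.
  Adding \<open>B\<close> in the scalar multiplication matters only for the scalar \<open>0\<close>.
\<close>

definition quotient_module :: "'v::real_vector set \<Rightarrow> 'v set \<Rightarrow> (real, 'v set) module" where
  "quotient_module Z B =
     \<lparr>carrier = (\<lambda>z. z +o B) ` Z, mult = undefined, one = undefined, zero = B,
      add = (+), smult = (\<lambda>r A. ((*\<^sub>R) r) ` A + B)\<rparr>"

definition direct_sum_module :: "(nat \<Rightarrow> (real, 'v) module) \<Rightarrow> (real, nat \<Rightarrow> 'v) module" where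
  "direct_sum_module M =
     \<lparr>carrier = {h. (\<forall>u. h u \<in> carrier (M u)) \<and> finite {u. h u \<noteq> \<zero>\<^bsub>M u\<^esub>}},
      mult = undefined, one = undefined,
      zero = (\<lambda>u. \<zero>\<^bsub>M u\<^esub>),
      add = (\<lambda>h h'. \<lambda>u. h u \<oplus>\<^bsub>M u\<^esub> h' u),
      smult = (\<lambda>r h. \<lambda>u. r \<odot>\<^bsub>M u\<^esub> h u)\<rparr>"

definition vs_iso :: "(real, 'v) module \<Rightarrow> (real, 'w) module \<Rightarrow> ('v \<Rightarrow> 'w) \<Rightarrow> bool" where
  "vs_iso V W \<phi> \<longleftrightarrow> linear_map real_scalars V W \<phi> \<and> bij_betw \<phi> (carrier V) (carrier W)"

definition vs_isomorphic :: "(real, 'v) module \<Rightarrow> (real, 'w) module \<Rightarrow> bool" where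
  "vs_isomorphic V W \<longleftrightarrow> (\<exists>\<phi>. vs_iso V W \<phi>)"

definition zero_module :: "(real, 'v) module \<Rightarrow> bool" where
  "zero_module V \<longleftrightarrow> vectorspace real_scalars V \<and> carrier V = {\<zero>\<^bsub>V\<^esub>}"


section \<open>Chevalley--Eilenberg cohomology\<close>

text \<open>
  A Lie algebra is given by its carrier \<open>g\<close> (a subspace of an ambient real vector space) and its
  bracket \<open>br\<close>, a module by its carrier \<open>W\<close> and the action \<open>act\<close>. A \<open>u\<close>-cochain is an alternating
  multilinear map on argument lists of length \<open>u\<close> from \<open>g\<close>; it is set to \<open>0\<close> on all other lists.
\<close>

definition cochains :: "'g::real_vector set \<Rightarrow> 'w::real_vector set \<Rightarrow> nat \<Rightarrow> ('g list \<Rightarrow> 'w) set" where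
  "cochains g W u = {c.
     (\<forall>xs. \<not> (length xs = u \<and> set xs \<subseteq> g) \<longrightarrow> c xs = 0) \<and>
     (\<forall>xs. length xs = u \<and> set xs \<subseteq> g \<longrightarrow> c xs \<in> W) \<and>
     (\<forall>xs. length xs = u \<and> set xs \<subseteq> g \<longrightarrow>
        (\<forall>i<u. \<forall>x\<in>g. \<forall>y\<in>g. \<forall>a b.
           c (xs[i := a *\<^sub>R x + b *\<^sub>R y]) = a *\<^sub>R c (xs[i := x]) + b *\<^sub>R c (xs[i := y]))) \<and>
     (\<forall>xs. length xs = u \<and> set xs \<subseteq> g \<and> \<not> distinct xs \<longrightarrow> c xs = 0)}"

definition omit :: "nat \<Rightarrow> 'g list \<Rightarrow> 'g list" where
  "omit i xs = take i xs @ drop (Suc i) xs"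

definition ce_diff ::
  "'g set \<Rightarrow> ('g \<Rightarrow> 'g \<Rightarrow> 'g) \<Rightarrow> ('g \<Rightarrow> 'w \<Rightarrow> 'w::real_vector) \<Rightarrow> ('g list \<Rightarrow> 'w) \<Rightarrow> 'g list \<Rightarrow> 'w"
where
  "ce_diff g br act c xs =
     (if set xs \<subseteq> g
      then (\<Sum>i<length xs. (-1) ^ i *\<^sub>R act (xs ! i) (c (omit i xs)))
         + (\<Sum>j<length xs. \<Sum>i<j. (-1) ^ (i + j) *\<^sub>R c (br (xs ! i) (xs ! j) # omit i (omit j xs)))
      else 0)"

definition cocycles ::
  "'g::real_vector set \<Rightarrow> ('g \<Rightarrow> 'g \<Rightarrow> 'g) \<Rightarrow> ('g \<Rightarrow> 'w \<Rightarrow> 'w) \<Rightarrow> 'w::real_vector set \<Rightarrow> nat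
     \<Rightarrow> ('g list \<Rightarrow> 'w) set"
where
  "cocycles g br act W u = {c \<in> cochains g W u. ce_diff g br act c = 0}"

definition coboundaries ::
  "'g::real_vector set \<Rightarrow> ('g \<Rightarrow> 'g \<Rightarrow> 'g) \<Rightarrow> ('g \<Rightarrow> 'w \<Rightarrow> 'w) \<Rightarrow> 'w::real_vector set \<Rightarrow> nat
     \<Rightarrow> ('g list \<Rightarrow> 'w) set"
where
  "coboundaries g br act W u =
     (case u of 0 \<Rightarrow> {0} | Suc v \<Rightarrow> ce_diff g br act ` cochains g W v)"

definition cohomology ::
  "'g::real_vector set \<Rightarrow> ('g \<Rightarrow> 'g \<Rightarrow> 'g) \<Rightarrow> ('g \<Rightarrow> 'w \<Rightarrow> 'w) \<Rightarrow> 'w::real_vector set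
     \<Rightarrow> (real, nat \<Rightarrow> ('g list \<Rightarrow> 'w) set) module"
where
  "cohomology g br act W =
     direct_sum_module (\<lambda>u. quotient_module (cocycles g br act W u) (coboundaries g br act W u))"

text \<open>
  The map in cohomology induced by a module homomorphism \<open>f\<close> into \<open>(W', act')\<close>: in degree \<open>u\<close> the
  class \<open>z + B\<^sup>u(W)\<close> goes to \<open>f \<circ> z + B\<^sup>u(W')\<close>.
\<close>

definition cohomology_map ::
  "'g::real_vector set \<Rightarrow> ('g \<Rightarrow> 'g \<Rightarrow> 'g) \<Rightarrow> ('v \<Rightarrow> 'w) \<Rightarrow> ('g \<Rightarrow> 'w \<Rightarrow> 'w) \<Rightarrow> 'w::real_vector set
     \<Rightarrow> (nat \<Rightarrow> ('g list \<Rightarrow> 'v) set) \<Rightarrow> (nat \<Rightarrow> ('g list \<Rightarrow> 'w) set)"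
where
  "cohomology_map g br f act' W' h = (\<lambda>u. (\<lambda>c. f \<circ> c) ` h u + coboundaries g br act' W' u)"


section \<open>Smooth functions and vector fields\<close>

definition pd :: "'m \<Rightarrow> (real^'m::finite \<Rightarrow> real) \<Rightarrow> real^'m \<Rightarrow> real" where
  "pd i f = (\<lambda>x. frechet_derivative f (at x) (axis i 1))"

definition pds :: "'m list \<Rightarrow> (real^'m::finite \<Rightarrow> real) \<Rightarrow> real^'m \<Rightarrow> real" where
  "pds \<alpha> f = foldr pd \<alpha> f"

text \<open>
  Class \<open>C\<^sup>\<infinity>\<close>: differentiability of every iterated partial derivative gives both the existence of
  the partial derivatives of the next order and the continuity of those of the present one.
\<close>

definition smooth :: "(real^'m::finite \<Rightarrow> real) \<Rightarrow> bool" where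
  "smooth f \<longleftrightarrow> (\<forall>\<alpha>. pds \<alpha> f differentiable_on UNIV)"

definition lie_bracket ::
  "(real^'m::finite \<Rightarrow> real^'m) \<Rightarrow> (real^'m \<Rightarrow> real^'m) \<Rightarrow> real^'m \<Rightarrow> real^'m"
where
  "lie_bracket X Y =
     (\<lambda>x. frechet_derivative Y (at x) (X x) - frechet_derivative X (at x) (Y x))"

text \<open>The projective embedding of \<open>sl(m+1,\<real>)\<close>; the Euler field \<open>E\<close> is the identity map.\<close>

definition sl_fields :: "(real^'m::finite \<Rightarrow> real^'m) set" where
  "sl_fields = span
     (range (\<lambda>i. \<lambda>x. axis i 1)
      \<union> range (\<lambda>(i, j). \<lambda>x. (x $ j) *\<^sub>R axis i 1)
      \<union> range (\<lambda>j. \<lambda>x. (x $ j) *\<^sub>R x))"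


section \<open>Symmetric contravariant tensor fields with values in densities\<close>

text \<open>
  An element of \<open>\<or>\<^sup>k \<real>\<^sup>m\<close> is represented by its components, indexed by
  lists of length \<open>k\<close> and invariant under permutation of the indices, extended by \<open>0\<close> to lists of any other length.
\<close>

definition sym_tensors :: "nat \<Rightarrow> ('m list \<Rightarrow> real) set" where
  "sym_tensors k = {T.
     (\<forall>I. length I \<noteq> k \<longrightarrow> T I = 0) \<and> (\<forall>I J. mset I = mset J \<longrightarrow> T I = T J)}"

definition tensor_rep :: "real^'m^'m \<Rightarrow> ('m::finite list \<Rightarrow> real) \<Rightarrow> 'm list \<Rightarrow> real" where
  "tensor_rep A T = (\<lambda>I. \<Sum>r<length I. \<Sum>j\<in>UNIV. A $ (I ! r) $ j * T (I[r := j]))"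

type_synonym 'm field = "real^'m \<Rightarrow> 'm list \<Rightarrow> real"

definition sym_fields :: "nat \<Rightarrow> 'm::finite field set" where
  "sym_fields k = {P. (\<forall>x. P x \<in> sym_tensors k) \<and> (\<forall>I. smooth (\<lambda>x. P x I))}"

text \<open>
  The weight \<open>\<delta>\<close> enters through the Lie derivative only; \<open>jacobian X (at x) $ i $ j = \<partial>\<^sub>j X\<^sup>i\<close>.
\<close>

definition lie_deriv ::
  "real \<Rightarrow> (real^'m::finite \<Rightarrow> real^'m) \<Rightarrow> 'm field \<Rightarrow> 'm field"
where
  "lie_deriv \<delta> X P = (\<lambda>x I.
     (\<Sum>i\<in>UNIV. X x $ i * pd i (\<lambda>y. P y I) x)
     - tensor_rep (jacobian X (at x)) (P x) I
     + \<delta> * trace (jacobian X (at x)) * P x I)"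


section \<open>Differential operators\<close>

text \<open>
  Operators of order at most \<open>k\<close> from \<open>sym_fields p\<close> to \<open>sym_fields q\<close>, set to \<open>0\<close> outside
  \<open>sym_fields p\<close> so that they are determined by their values there. The multi-indices \<open>\<alpha>\<close> are lists
  of directions, hence the coefficients \<open>a\<close> are not unique.
\<close>

definition diff_ops :: "nat \<Rightarrow> nat \<Rightarrow> nat \<Rightarrow> ('m::finite field \<Rightarrow> 'm field) set" where
  "diff_ops k p q = {D.
     (\<forall>P. P \<notin> sym_fields p \<longrightarrow> D P = 0) \<and>
     (\<forall>P\<in>sym_fields p. D P \<in> sym_fields q) \<and>
     (\<exists>a. (\<forall>\<alpha> J I. smooth (a \<alpha> J I)) \<and>
        (\<forall>P\<in>sym_fields p. \<forall>x I. length I = q \<longrightarrow>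
           D P x I = (\<Sum>\<alpha> | length \<alpha> \<le> k. \<Sum>J | length J = p. a \<alpha> J I x * pds \<alpha> (\<lambda>y. P y J) x)))}"

definition op_action ::
  "real \<Rightarrow> nat \<Rightarrow> (real^'m::finite \<Rightarrow> real^'m) \<Rightarrow> ('m field \<Rightarrow> 'm field) \<Rightarrow> 'm field \<Rightarrow> 'm field"
where
  "op_action \<delta> p X D = (\<lambda>P.
     if P \<in> sym_fields p then lie_deriv \<delta> X (D P) - D (lie_deriv \<delta> X P) else 0)"

definition sl_cohomology ::
  "'m::finite itself \<Rightarrow> real \<Rightarrow> nat \<Rightarrow> nat \<Rightarrow> nat
     \<Rightarrow> (real, nat \<Rightarrow> ((real^'m \<Rightarrow> real^'m) list \<Rightarrow> 'm field \<Rightarrow> 'm field) set) module"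
where
  "sl_cohomology _ \<delta> k p q =
     cohomology sl_fields lie_bracket (op_action \<delta> p) (diff_ops k p q)"

text \<open>The map induced by the inclusion of some \<open>diff_ops k' p q\<close> into \<open>diff_ops k p q\<close>.\<close>

definition inclusion_map ::
  "'m::finite itself \<Rightarrow> real \<Rightarrow> nat \<Rightarrow> nat \<Rightarrow> nat
     \<Rightarrow> (nat \<Rightarrow> ((real^'m \<Rightarrow> real^'m) list \<Rightarrow> 'm field \<Rightarrow> 'm field) set)
     \<Rightarrow> (nat \<Rightarrow> ((real^'m \<Rightarrow> real^'m) list \<Rightarrow> 'm field \<Rightarrow> 'm field) set)"
where
  "inclusion_map _ \<delta> k p q =
     cohomology_map sl_fields lie_bracket (\<lambda>D. D) (op_action \<delta> p) (diff_ops k p q)"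


section \<open>Invariant alternating forms on \<open>gl(m,\<real>)\<close>\<close>

definition gl_inv_forms :: "nat \<Rightarrow> ((real^'m^'m::finite) list \<Rightarrow> real) set" where
  "gl_inv_forms u = {c \<in> cochains UNIV UNIV u.
     \<forall>A xs. length xs = u \<longrightarrow> (\<Sum>i<u. c (xs[i := A ** xs ! i - xs ! i ** A])) = 0}"

definition gl_inv_algebra :: "'m::finite itself \<Rightarrow> (real, nat \<Rightarrow> (real^'m^'m) list \<Rightarrow> real) module" where
  "gl_inv_algebra _ = direct_sum_module (\<lambda>u. subspace_module (gl_inv_forms u))"

end

theory Submission
  imports Defs "HOL-Combinatorics.Multiset_Permutations"
begin

text \<open>
  Differential operators are filtered by their order. Since source and target carry the same density
  weight, the principal symbol is an equivariant map (\<open>symb_op_action\<close>): the operators of order \<open>l\<close> modulo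
  those of lower order form the module of tensor fields with \<open>l + q\<close> contravariant and \<open>p\<close> covariant indices.
  The theorem is a computation of the cohomology of these modules, followed by an induction on the order.

  A module of tensor fields is induced from the isotropy algebra of a point, and its cohomology is that
  of the isotropy algebra with values in the tensors at that point, which can be made explicit. Describing
  each vector field by its Taylor coefficients at the point where the value is taken replaces the
  projective algebra by the direct product of the translations with the isotropy algebra of the origin
  (\<open>smap_ced\<close>), and the Poincare lemma then removes the translations (\<open>eval_homotopy\<close>).

  The isotropy algebra consists of the pairs of a matrix and a covector, and a cochain is a form on the
  matrices with values in the forms on the covectors. The matrices are reductive, and this is exploited
  by a Hodge decomposition: contracting with the elementary matrices gives a homotopy between zero and a
  Laplacian (\<open>laplace_homotopy\<close>), which is a sum of squares because transposed matrices act as adjoints.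
  Every class therefore has exactly one harmonic representative, a cochain that is annihilated by all
  matrices, both under the Lie derivative and under the action on values and covector arguments alone
  (\<open>hodge_decomposition\<close>, \<open>exact_harmonic\<close>).

  The diagonal matrices now decide which harmonic cochains exist (\<open>harmonic_weights\<close>): the covariant indices
  must be matched by the contravariant ones together with the covector arguments, and by alternation
  there is at most one of the latter. Hence only the orders with \<open>l + q = p\<close> or \<open>l + q + 1 = p\<close> contribute
  (\<open>harmonic_vanish\<close>). In the second case a harmonic cochain is determined by an invariant form on the matrices
  of one degree less, and every such form occurs (\<open>harmonic_determined\<close>, \<open>base_form_inv_cochain\<close>).

  Orders that do not contribute can be split off one at a time (\<open>descent\<close>). For \<open>p < q\<close> no order contributes;
  for \<open>p = q + n\<close> the orders below \<open>n - 1\<close> and above \<open>n\<close> do not, so that the cohomology vanishes below order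
  \<open>n - 1\<close>, is that of the symbols at order \<open>n - 1\<close>, and no longer changes above order \<open>n\<close>.
\<close>

section \<open>Alternating functions on lists\<close>

text \<open>
  A multilinear function of all lists is a family of multilinear maps, one in each degree. Fixing
  the first entry of a list gives such a function again, so that the operations on cochains can be
  defined, and their identities proved, by recursion on the argument list.
\<close>

abbreviation real_subspace :: "'v::real_vector set \<Rightarrow> bool" where
  "real_subspace \<equiv> Real_Vector_Spaces.subspace"

definition multilin :: "('g::real_vector list \<Rightarrow> 'w::real_vector) \<Rightarrow> bool" where
  "multilin c \<longleftrightarrow> (\<forall>us vs. linear (\<lambda>x. c (us @ x # vs)))"

definition altern :: "('g::real_vector list \<Rightarrow> 'w::real_vector) \<Rightarrow> bool" where
  "altern c \<longleftrightarrow> multilin c \<and> (\<forall>us x vs. c (us @ x # x # vs) = 0)"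

lemma altern_multilin: "altern c \<Longrightarrow> multilin c"
  by (simp add: altern_def)

lemma linear_lam_iff: "linear f \<longleftrightarrow> (\<forall>x y. f (x + y) = f x + f y) \<and> (\<forall>r x. f (r *\<^sub>R x) = r *\<^sub>R f x)"
  by (simp add: linear_iff)

lemma multilin_prefix: "multilin c \<Longrightarrow> multilin (\<lambda>ys. c (us @ ys))"
  by (simp add: multilin_def flip: append_assoc)

lemma altern_prefix: "altern c \<Longrightarrow> altern (\<lambda>ys. c (us @ ys))"
  by (simp add: altern_def multilin_prefix flip: append_assoc)

lemma multilin_Cons: "multilin c \<Longrightarrow> multilin (\<lambda>ys. c (x # ys))"
  using multilin_prefix[of c "[x]"] by simp

lemma altern_Cons: "altern c \<Longrightarrow> altern (\<lambda>ys. c (x # ys))"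
  using altern_prefix[of c "[x]"] by simp

lemma multilin_linear: "multilin c \<Longrightarrow> linear (\<lambda>x. c (us @ x # vs))"
  by (simp add: multilin_def)

lemma multilin_linear_hd: "multilin c \<Longrightarrow> linear (\<lambda>x. c (x # vs))"
  using multilin_linear[of c "[]"] by simp

lemma multilin_hd:
  assumes "multilin c"
  shows "c ((x + y) # vs) = c (x # vs) + c (y # vs)" "c (r *\<^sub>R x # vs) = r *\<^sub>R c (x # vs)"
    "c ((x - y) # vs) = c (x # vs) - c (y # vs)" "c (0 # vs) = 0" "c ((- x) # vs) = - c (x # vs)"
proof -
  note l = multilin_linear_hd[OF assms, of vs]
  show "c ((x + y) # vs) = c (x # vs) + c (y # vs)" "c (r *\<^sub>R x # vs) = r *\<^sub>R c (x # vs)"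
    "c ((x - y) # vs) = c (x # vs) - c (y # vs)" "c (0 # vs) = 0" "c ((- x) # vs) = - c (x # vs)"
    using linear_add[OF l, of x y] linear_scale[OF l, of r x] linear_diff[OF l, of x y] linear_0[OF l]
      linear_neg[OF l, of x] by simp_all
qed

lemma multilin_sum_hd:
  "multilin c \<Longrightarrow> c (sum g A # vs) = (\<Sum>a\<in>A. c (g a # vs))"
  using linear_sum[OF multilin_linear_hd[of c vs]] by simp

lemma altern_swap:
  assumes "altern c"
  shows "c (us @ x # y # vs) = - c (us @ y # x # vs)"
proof -
  have e: "c (us @ (x + y) # (x + y) # vs) = 0" and xx: "c (us @ x # x # vs) = 0"
    and yy: "c (us @ y # y # vs) = 0"
    using assms by (auto simp: altern_def)
  have m: "multilin (\<lambda>ys. c (us @ ys))"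
    by (intro multilin_prefix altern_multilin assms)
  have m2: "multilin (\<lambda>ys. c (us @ z # ys))" for z
    using multilin_Cons[OF m] .
  show ?thesis
    using e xx yy multilin_hd(1)[OF m, of x y "(x+y)#vs"]
      multilin_hd(1)[OF m2[of x], of x y vs] multilin_hd(1)[OF m2[of y], of x y vs]
    by (simp add: add_eq_0_iff)
qed

lemma altern_swap_hd: "altern c \<Longrightarrow> c (x # y # vs) = - c (y # x # vs)"
  using altern_swap[of c "[]" x y vs] by simp

lemma altern_move:
  assumes "altern c"
  shows "c (us @ x # vs) = (-1) ^ length us *\<^sub>R c (x # us @ vs)"
  using assms
proof (induction us arbitrary: c)
  case (Cons u us)
  have "c ((u # us) @ x # vs) = (-1) ^ length us *\<^sub>R c (u # x # us @ vs)"
    using Cons.IH[OF altern_Cons[OF Cons.prems, of u]] by simp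
  then show ?case
    using altern_swap_hd[OF Cons.prems, of u x "us @ vs"] by simp
qed simp

lemma altern_not_distinct:
  assumes "altern c" "\<not> distinct xs"
  shows "c xs = 0"
proof -
  obtain as y bs cs where xs: "xs = as @ [y] @ bs @ [y] @ cs"
    using assms(2) not_distinct_decomp by blast
  have "altern (\<lambda>ys. c ((as @ [y]) @ ys))"
    by (rule altern_prefix[OF assms(1)])
  from altern_move[OF this, of bs y cs] show ?thesis
    using assms(1) xs by (simp add: altern_def)
qed

subsection \<open>Derivations, antisymmetrized insertions and contractions with a bracket\<close>

text \<open>
  The differential of a cochain is the sum of \<open>alts\<close>, which extracts one argument with a sign, and of
  \<open>pairs\<close>, which contracts two arguments by a bracket; \<open>der\<close> extends a map of the arguments as a
  derivation. The recursive equations separate the first argument; the usual sums over positions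
  are recovered in \<open>alts_closed\<close> and \<open>pairs_closed\<close>.
\<close>

fun der :: "('g \<Rightarrow> 'g) \<Rightarrow> ('g list \<Rightarrow> 'w::real_vector) \<Rightarrow> 'g list \<Rightarrow> 'w" where
  "der f c [] = 0"
| "der f c (x # xs) = c (f x # xs) + der f (\<lambda>ys. c (x # ys)) xs"

fun alts :: "('g \<Rightarrow> 'g list \<Rightarrow> 'w::real_vector) \<Rightarrow> 'g list \<Rightarrow> 'w" where
  "alts F [] = 0"
| "alts F (x # xs) = F x xs - alts (\<lambda>y ys. F y (x # ys)) xs"

fun pairs :: "('g \<Rightarrow> 'g \<Rightarrow> 'g) \<Rightarrow> ('g list \<Rightarrow> 'w::real_vector) \<Rightarrow> 'g list \<Rightarrow> 'w" where
  "pairs \<gamma> c [] = 0"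
| "pairs \<gamma> c (x # xs) = - der (\<gamma> x) c xs - pairs \<gamma> (\<lambda>ys. c (x # ys)) xs"

lemma der_append:
  "der f c (us @ vs) = der f (\<lambda>ws. c (ws @ vs)) us + der f (\<lambda>ws. c (us @ ws)) vs"
  by (induction us arbitrary: c) (auto simp: add.assoc)

lemma der_zero [simp]: "der f (\<lambda>_. 0) xs = 0"
  by (induction xs) auto

lemma der_add: "der f (\<lambda>ys. c ys + e ys) xs = der f c xs + der f e xs"
  by (induction xs arbitrary: c e) auto

lemma der_diff: "der f (\<lambda>ys. c ys - e ys) xs = der f c xs - der f e xs"
  by (induction xs arbitrary: c e) auto

lemma der_neg: "der f (\<lambda>ys. - c ys) xs = - der f c xs"
  by (induction xs arbitrary: c) auto

lemma der_scale: "der f (\<lambda>ys. r *\<^sub>R c ys) xs = r *\<^sub>R der f c xs"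
  by (induction xs arbitrary: c) (auto simp: scaleR_add_right)

lemma der_fun_zero: "multilin c \<Longrightarrow> der (\<lambda>x. 0) c xs = 0"
  by (induction xs arbitrary: c) (auto simp: multilin_hd multilin_Cons)

lemma der_fun_add: "multilin c \<Longrightarrow> der (\<lambda>x. f x + g x) c xs = der f c xs + der g c xs"
  by (induction xs arbitrary: c) (auto simp: multilin_hd multilin_Cons)

lemma der_fun_diff: "multilin c \<Longrightarrow> der (\<lambda>x. f x - g x) c xs = der f c xs - der g c xs"
  by (induction xs arbitrary: c) (auto simp: multilin_hd multilin_Cons)

lemma der_fun_scale: "multilin c \<Longrightarrow> der (\<lambda>x. r *\<^sub>R f x) c xs = r *\<^sub>R der f c xs"
  by (induction xs arbitrary: c) (auto simp: multilin_hd multilin_Cons scaleR_add_right)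

lemma der_fun_sum:
  "multilin c \<Longrightarrow> der (\<lambda>x. \<Sum>a\<in>A. f a x) c xs = (\<Sum>a\<in>A. der (f a) c xs)"
  by (induction A rule: infinite_finite_induct) (auto simp: der_fun_zero der_fun_add)

lemma der_push:
  assumes "\<And>ys. c ys \<in> W" "real_subspace W" "\<And>v w. v \<in> W \<Longrightarrow> w \<in> W \<Longrightarrow> s (v + w) = s v + s w" "s 0 = 0"
  shows "s (der f c xs) = der f (\<lambda>ys. s (c ys)) xs" "der f c xs \<in> W"
proof -
  have P: "(\<forall>ys. c ys \<in> W) \<longrightarrow> s (der f c xs) = der f (\<lambda>ys. s (c ys)) xs \<and> der f c xs \<in> W" for c
    by (induction xs arbitrary: c) (auto simp: assms(2-4) subspace_0 subspace_add)
  show "s (der f c xs) = der f (\<lambda>ys. s (c ys)) xs" "der f c xs \<in> W"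
    using P assms(1) by auto
qed

lemma der_in:
  "real_subspace W \<Longrightarrow> (\<And>ys. c ys \<in> W) \<Longrightarrow> der f c xs \<in> W"
  by (induction xs arbitrary: c) (auto simp: subspace_0 subspace_add)

lemma der_apply: "der f c xs K = der f (\<lambda>ys. c ys K) xs"
  by (induction xs arbitrary: c) auto

lemma linear_der:
  assumes "\<And>ws. linear (\<lambda>x. c x ws)"
  shows "linear (\<lambda>x. der f (c x) xs)"
proof -
  have "c (x + y) = (\<lambda>ws. c x ws + c y ws)" "c (r *\<^sub>R x) = (\<lambda>ws. r *\<^sub>R c x ws)" for x y r
    using assms by (auto simp: linear_lam_iff)
  then show ?thesis by (simp add: linear_lam_iff der_add der_scale)
qed

lemma multilin_der:
  assumes "linear f" "multilin c"
  shows "multilin (der f c)"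
  unfolding multilin_def
proof (intro allI)
  fix us vs
  have "linear (\<lambda>x. der f (\<lambda>ws. c (ws @ x # vs)) us)"
    by (rule linear_der) (rule multilin_linear[OF assms(2)])
  moreover have "linear (\<lambda>x. c (us @ f x # vs))"
    using linear_compose[OF assms(1) multilin_linear[OF assms(2), of us vs]] by (simp add: o_def)
  moreover have "linear (\<lambda>x. der f (\<lambda>ws. c (us @ x # ws)) vs)"
    by (rule linear_der) (rule multilin_linear[OF assms(2)])
  ultimately show "linear (\<lambda>x. der f c (us @ x # vs))"
    by (simp add: der_append linear_lam_iff scaleR_add_right)
qed

lemma altern_der:
  assumes "linear f" "altern c"
  shows "altern (der f c)"
  unfolding altern_def
proof (intro conjI allI)
  show "multilin (der f c)"
    by (intro multilin_der assms altern_multilin)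
  fix us x vs
  have "c (ws @ x # x # vs') = 0" for ws vs'
    using assms(2) by (simp add: altern_def)
  then show "der f c (us @ x # x # vs) = 0"
    using altern_swap[OF assms(2), of us "f x" x vs] by (simp add: der_append)
qed

lemma der_comm:
  "der f (der g c) xs - der g (der f c) xs = der (\<lambda>x. g (f x)) c xs - der (\<lambda>x. f (g x)) c xs"
proof (induction xs arbitrary: c)
  case (Cons x xs)
  show ?case
    using Cons[of "\<lambda>ys. c (x # ys)"] by (simp add: der_add algebra_simps)
qed simp

lemma alts_zero [simp]: "alts (\<lambda>_ _. 0) xs = 0"
  by (induction xs) auto

lemma alts_add: "alts (\<lambda>y ys. F y ys + G y ys) xs = alts F xs + alts G xs"
  by (induction xs arbitrary: F G) (auto simp: algebra_simps)

lemma alts_diff: "alts (\<lambda>y ys. F y ys - G y ys) xs = alts F xs - alts G xs"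
  by (induction xs arbitrary: F G) (auto simp: algebra_simps)

lemma alts_neg: "alts (\<lambda>y ys. - F y ys) xs = - alts F xs"
  by (induction xs arbitrary: F) auto

lemma alts_scale: "alts (\<lambda>y ys. r *\<^sub>R F y ys) xs = r *\<^sub>R alts F xs"
  by (induction xs arbitrary: F) (auto simp: scaleR_diff_right)

lemma alts_sum: "alts (\<lambda>y ys. \<Sum>a\<in>A. F a y ys) xs = (\<Sum>a\<in>A. alts (F a) xs)"
  by (induction A rule: infinite_finite_induct) (auto simp: alts_add)

lemma alts_apply: "alts F xs K = alts (\<lambda>y ys. F y ys K) xs"
  by (induction xs arbitrary: F) auto

lemma alts_in:
  "real_subspace W \<Longrightarrow> (\<And>y ys. F y ys \<in> W) \<Longrightarrow> alts F xs \<in> W"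
  by (induction xs arbitrary: F) (auto simp: subspace_0 subspace_diff)

lemma linear_alts:
  assumes "\<And>y ys. linear (\<lambda>x. F x y ys)"
  shows "linear (\<lambda>x. alts (F x) xs)"
proof -
  have "F (x + z) = (\<lambda>y ys. F x y ys + F z y ys)" "F (r *\<^sub>R x) = (\<lambda>y ys. r *\<^sub>R F x y ys)" for x z r
    using assms by (simp_all add: linear_lam_iff fun_eq_iff)
  then show ?thesis by (simp add: linear_lam_iff alts_add alts_scale)
qed

lemma altern_alts:
  assumes "\<And>y. altern (F y)" "\<And>ys. linear (\<lambda>y. F y ys)"
  shows "altern (alts F)"
proof -
  have lin: "linear (\<lambda>x. alts F (us @ x # vs))" for us vs
    using assms
  proof (induction us arbitrary: F)
    case Nil
    have "linear (\<lambda>x. alts (\<lambda>y ys. F y (x # ys)) vs)"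
      by (intro linear_alts multilin_linear_hd altern_multilin Nil)
    then show ?case using Nil(2)[of vs] by (simp add: linear_compose_sub)
  next
    case (Cons u us)
    have "linear (\<lambda>x. alts (\<lambda>y ys. F y (u # ys)) (us @ x # vs))"
      using Cons.IH[of "\<lambda>y ys. F y (u # ys)"] Cons.prems by (auto intro: altern_Cons)
    moreover have "linear (\<lambda>x. F u (us @ x # vs))"
      using Cons.prems(1) by (intro multilin_linear altern_multilin)
    ultimately show ?case by (simp add: linear_compose_sub)
  qed
  have z: "alts F (us @ x # x # vs) = 0" for us x vs
    using assms
  proof (induction us arbitrary: F)
    case Nil
    have "F y (x # x # ys) = 0" for y ys
      using Nil(1)[of y] unfolding altern_def by (metis append_Nil)
    then show ?case by simp
  next
    case (Cons u us)
    have "alts (\<lambda>y ys. F y (u # ys)) (us @ x # x # vs) = 0"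
      using Cons.IH[of "\<lambda>y ys. F y (u # ys)"] Cons.prems by (auto intro: altern_Cons)
    moreover have "F u (us @ x # x # vs) = 0"
      using Cons.prems(1)[of u] by (simp add: altern_def)
    ultimately show ?case by simp
  qed
  show ?thesis
    using lin z by (simp add: altern_def multilin_def)
qed

text \<open>
  Bringing the replaced argument back to its place cancels the sign with which it was extracted.
\<close>

lemma alts_insert:
  assumes "altern c"
  shows "alts (\<lambda>y ys. c (f y # ys)) xs = der f c xs"
  using assms
proof (induction xs arbitrary: c)
  case (Cons x xs)
  have "c (f y # x # ys) = - c (x # f y # ys)" for y ys
    by (rule altern_swap_hd[OF Cons.prems])
  then show ?case
    using Cons.IH[OF altern_Cons[OF Cons.prems, of x]] by (simp add: alts_neg)
qed simp

lemma der_alts: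
  "der f (alts F) xs = alts (\<lambda>x ys. F (f x) ys + der f (F x) ys) xs"
proof (induction xs arbitrary: F)
  case (Cons x xs)
  show ?case
    using Cons[of "\<lambda>y ys. F y (x # ys)"] by (simp add: der_diff alts_add algebra_simps)
qed simp

lemma pairs_zero [simp]: "pairs \<gamma> (\<lambda>_. 0) xs = 0"
  by (induction xs) auto

lemma pairs_add: "pairs \<gamma> (\<lambda>ys. c ys + e ys) xs = pairs \<gamma> c xs + pairs \<gamma> e xs"
  by (induction xs arbitrary: c e) (auto simp: der_add algebra_simps)

lemma pairs_scale: "pairs \<gamma> (\<lambda>ys. r *\<^sub>R c ys) xs = r *\<^sub>R pairs \<gamma> c xs"
  by (induction xs arbitrary: c) (auto simp: der_scale algebra_simps)

lemma pairs_apply: "pairs \<gamma> c xs K = pairs \<gamma> (\<lambda>ys. c ys K) xs"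
  by (induction xs arbitrary: c) (auto simp: der_apply)

lemma pairs_in: "real_subspace W \<Longrightarrow> (\<And>ys. c ys \<in> W) \<Longrightarrow> pairs \<gamma> c xs \<in> W"
  by (induction xs arbitrary: c)
    (auto simp: subspace_0 intro!: subspace_diff subspace_neg der_in)

lemma pairs_fun_add:
  "multilin c \<Longrightarrow> pairs (\<lambda>x y. \<beta> x y + \<gamma> x y) c xs = pairs \<beta> c xs + pairs \<gamma> c xs"
  by (induction xs arbitrary: c) (auto simp: der_fun_add multilin_Cons)

lemma pairs_fun_diff:
  "multilin c \<Longrightarrow> pairs (\<lambda>x y. \<beta> x y - \<gamma> x y) c xs = pairs \<beta> c xs - pairs \<gamma> c xs"
  by (induction xs arbitrary: c) (auto simp: der_fun_diff multilin_Cons)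

lemma linear_pairs:
  assumes "\<And>ws. linear (\<lambda>x. c x ws)"
  shows "linear (\<lambda>x. pairs \<gamma> (c x) xs)"
proof -
  have "c (x + y) = (\<lambda>ws. c x ws + c y ws)" "c (r *\<^sub>R x) = (\<lambda>ws. r *\<^sub>R c x ws)" for x y r
    using assms by (auto simp: linear_lam_iff)
  then show ?thesis by (simp add: linear_lam_iff pairs_add pairs_scale)
qed

lemma altern_pairs:
  assumes "altern c" "\<And>x. linear (\<gamma> x)" "\<And>y. linear (\<lambda>x. \<gamma> x y)" "\<And>x. \<gamma> x x = 0"
  shows "altern (pairs \<gamma> c)"
proof -
  have lin: "linear (\<lambda>x. pairs \<gamma> c (us @ x # vs))" for us vs
    using assms(1)
  proof (induction us arbitrary: c)
    case Nil
    have "linear (\<lambda>x. der (\<gamma> x) c vs)"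
    proof -
      have "\<gamma> (x + y) = (\<lambda>z. \<gamma> x z + \<gamma> y z)" "\<gamma> (r *\<^sub>R x) = (\<lambda>z. r *\<^sub>R \<gamma> x z)" for x y r
        using assms(3) by (auto simp: linear_lam_iff)
      then show ?thesis
        using altern_multilin[OF Nil] by (simp add: linear_lam_iff der_fun_add der_fun_scale)
    qed
    moreover have "linear (\<lambda>x. pairs \<gamma> (\<lambda>ys. c (x # ys)) vs)"
      by (intro linear_pairs multilin_linear_hd altern_multilin Nil)
    ultimately show ?case by (simp add: linear_lam_iff algebra_simps)
  next
    case (Cons u us)
    have "linear (\<lambda>x. pairs \<gamma> (\<lambda>ys. c (u # ys)) (us @ x # vs))"
      using Cons.IH[OF altern_Cons[OF Cons.prems]] by blast
    moreover have "linear (\<lambda>x. der (\<gamma> u) c (us @ x # vs))"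
      by (intro multilin_linear multilin_der assms altern_multilin Cons.prems)
    ultimately show ?case by (simp add: linear_lam_iff algebra_simps)
  qed
  have z: "pairs \<gamma> c (us @ x # x # vs) = 0" for us x vs
    using assms(1)
  proof (induction us arbitrary: c)
    case Nil
    have "c (x # x # ys) = 0" for ys
      using Nil unfolding altern_def by (metis append_Nil)
    moreover have "c (0 # vs) = 0"
      using multilin_hd(4) altern_multilin[OF Nil] by blast
    ultimately show ?case by (simp add: assms(4))
  next
    case (Cons u us)
    have "der (\<gamma> u) c (us @ x # x # vs) = 0"
      using altern_der[OF assms(2) Cons.prems] by (simp add: altern_def)
    then show ?case
      using Cons.IH[OF altern_Cons[OF Cons.prems]] by simp
  qed
  show ?thesis
    using lin z by (simp add: altern_def multilin_def)
qed

text \<open>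
  Inserting \<open>x\<^sub>i\<close> into the remaining arguments through a bilinear map amounts, after moving the
  modified argument to the front, to contracting with the antisymmetrized bilinear map.
\<close>

lemma alts_der:
  assumes "altern c"
  shows "alts (\<lambda>x ys. der (\<beta> x) c ys) xs = - pairs (\<lambda>x y. \<beta> x y - \<beta> y x) c xs"
  using assms
proof (induction xs arbitrary: c)
  case (Cons x xs)
  have "alts (\<lambda>y ys. c (\<beta> y x # ys)) xs = der (\<lambda>y. \<beta> y x) c xs"
    by (rule alts_insert[OF Cons.prems])
  then show ?case
    using Cons.IH[OF altern_Cons[OF Cons.prems, of x]]
      der_fun_diff[OF altern_multilin[OF Cons.prems], of "\<beta> x" "\<lambda>y. \<beta> y x" xs]
    by (simp add: alts_add)
qed simp

lemma der_pairs:
  assumes "\<And>x y. f (\<gamma> x y) = \<gamma> (f x) y + \<gamma> x (f y)" "multilin c"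
  shows "der f (pairs \<gamma> c) xs = pairs \<gamma> (der f c) xs"
  using assms(2)
proof (induction xs arbitrary: c)
  case (Cons x xs)
  have 1: "der f (der (\<gamma> x) c) xs =
      der (\<gamma> x) (der f c) xs + der (\<lambda>y. \<gamma> x (f y)) c xs - der (\<lambda>y. f (\<gamma> x y)) c xs"
    using der_comm[of f "\<gamma> x" c xs] by (simp add: algebra_simps)
  have 2: "der (\<lambda>y. f (\<gamma> x y)) c xs = der (\<gamma> (f x)) c xs + der (\<lambda>y. \<gamma> x (f y)) c xs"
    unfolding assms(1) by (rule der_fun_add[OF Cons.prems])
  show ?case
    using Cons.IH[OF multilin_Cons[OF Cons.prems, of x]] 1 2
    by (simp add: der_diff der_neg pairs_add algebra_simps)
qed simp

section \<open>The Chevalley--Eilenberg differential as a recursion on lists\<close>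

lemma alts_closed: "alts F xs = (\<Sum>i<length xs. (-1) ^ i *\<^sub>R F (xs ! i) (omit i xs))"
  by (induction xs arbitrary: F)
    (simp_all add: sum.lessThan_Suc_shift omit_def sum_negf del: sum.lessThan_Suc)

lemma pairs_closed:
  assumes "altern c"
  shows "pairs \<gamma> c xs =
    (\<Sum>j<length xs. \<Sum>i<j. (-1) ^ (i + j) *\<^sub>R c (\<gamma> (xs ! i) (xs ! j) # omit i (omit j xs)))"
  using assms
proof (induction xs arbitrary: c)
  case (Cons x xs)
  let ?t = "\<lambda>i j. (-1) ^ (i + j) *\<^sub>R c (\<gamma> (xs ! i) (xs ! j) # x # omit i (omit j xs))"
  have "der (\<gamma> x) c xs = (\<Sum>j<length xs. (-1) ^ j *\<^sub>R c (\<gamma> x (xs ! j) # omit j xs))"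
    unfolding alts_insert[OF Cons.prems, symmetric] alts_closed ..
  moreover have "pairs \<gamma> (\<lambda>ys. c (x # ys)) xs = - (\<Sum>j<length xs. \<Sum>i<j. ?t i j)"
    unfolding Cons.IH[OF altern_Cons[OF Cons.prems]] sum_negf[symmetric]
    using altern_swap_hd[OF Cons.prems, of x] by (intro sum.cong refl) simp
  ultimately show ?case
    by (simp add: sum.lessThan_Suc_shift omit_def sum.distrib sum_negf sum_subtractf
        del: sum.lessThan_Suc)
qed simp

definition ced ::
  "('g \<Rightarrow> 'g \<Rightarrow> 'g) \<Rightarrow> ('g \<Rightarrow> 'w \<Rightarrow> 'w::real_vector) \<Rightarrow> ('g list \<Rightarrow> 'w) \<Rightarrow> 'g list \<Rightarrow> 'w"
where
  "ced br act c xs = alts (\<lambda>x ys. act x (c ys)) xs + pairs br c xs"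

definition ceL ::
  "('g \<Rightarrow> 'g \<Rightarrow> 'g) \<Rightarrow> ('g \<Rightarrow> 'w \<Rightarrow> 'w::real_vector) \<Rightarrow> 'g \<Rightarrow> ('g list \<Rightarrow> 'w) \<Rightarrow> 'g list \<Rightarrow> 'w"
where
  "ceL br act x c xs = act x (c xs) - der (br x) c xs"

lemma ce_diff_eq_ced: "altern c \<Longrightarrow> ce_diff UNIV br act c = ced br act c"
  by (simp add: fun_eq_iff ce_diff_def ced_def alts_closed pairs_closed)

text \<open>
  Cochains of degree \<open>n - m\<close>. With \<open>m = 1\<close> these are the cochains whose differentials are the
  coboundaries of degree \<open>n\<close>, also for \<open>n = 0\<close>.
\<close>

definition altcochains ::
  "'w::real_vector set \<Rightarrow> nat \<Rightarrow> nat \<Rightarrow> ('g::real_vector list \<Rightarrow> 'w) set"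
where
  "altcochains W n m = {c. altern c \<and> (\<forall>xs. length xs + m \<noteq> n \<longrightarrow> c xs = 0) \<and> (\<forall>xs. c xs \<in> W)}"

lemma altcochainsD:
  assumes "c \<in> altcochains W n m"
  shows "altern c" "multilin c" "c xs \<in> W" "length xs + m \<noteq> n \<Longrightarrow> c xs = 0"
  using assms by (auto simp: altcochains_def altern_multilin)

lemma cochains_UNIV:
  fixes W :: "'w::real_vector set"
  assumes "0 \<in> W"
  shows "cochains (UNIV :: 'g::real_vector set) W n = altcochains W n 0"
proof (rule Set.set_eqI, rule iffI)
  fix c :: "'g list \<Rightarrow> 'w" assume c: "c \<in> cochains UNIV W n"
  have l: "c (us @ (a *\<^sub>R x + b *\<^sub>R y) # vs) = a *\<^sub>R c (us @ x # vs) + b *\<^sub>R c (us @ y # vs)"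
    for us vs a b x y
  proof (cases "length us + Suc (length vs) = n")
    case True
    have "\<forall>xs. length xs = n \<longrightarrow> (\<forall>i<n. \<forall>x y a b.
       c (xs[i := a *\<^sub>R x + b *\<^sub>R y]) = a *\<^sub>R c (xs[i := x]) + b *\<^sub>R c (xs[i := y]))"
      using c by (simp add: cochains_def)
    from this[rule_format, of "us @ 0 # vs" "length us" a x b y] show ?thesis
      using True by simp
  next
    case False
    then show ?thesis using c by (simp add: cochains_def)
  qed
  have "multilin c"
    unfolding multilin_def linear_lam_iff
    using l[of _ 1 _ 1] l[of _ _ _ 0 0] by simp
  moreover have "c (us @ x # x # vs) = 0" for us x vs
    using c by (cases "length (us @ x # x # vs) = n") (auto simp: cochains_def)
  ultimately show "c \<in> altcochains W n 0"
    using c assms by (auto simp: altcochains_def altern_def cochains_def)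
next
  fix c :: "'g list \<Rightarrow> 'w" assume c: "c \<in> altcochains W n 0"
  then have ml: "multilin c" and a: "altern c" by (auto simp: altcochains_def altern_multilin)
  have "c (xs[i := r *\<^sub>R x + s *\<^sub>R y]) = r *\<^sub>R c (xs[i := x]) + s *\<^sub>R c (xs[i := y])"
    if "i < length xs" for xs i x y r s
    using multilin_linear[OF ml, of "take i xs" "drop (Suc i) xs"] that
    by (simp add: upd_conv_take_nth_drop linear_lam_iff)
  then show "c \<in> cochains UNIV W n"
    using c altern_not_distinct[OF a] by (auto simp: cochains_def altcochains_def)
qed

lemma altcochains_0_1: "0 \<in> W \<Longrightarrow> altcochains W 0 (Suc 0) = {0}"
  by (auto simp: altcochains_def fun_eq_iff altern_def multilin_def linear_lam_iff)

lemma altcochains_Suc_Suc: "altcochains W (Suc n) (Suc m) = altcochains W n m"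
  by (simp add: altcochains_def)

lemma altern_zero: "altern (\<lambda>_. 0)"
  by (simp add: altern_def multilin_def linear_lam_iff)

lemma altern_add: "altern c \<Longrightarrow> altern e \<Longrightarrow> altern (\<lambda>xs. c xs + e xs)"
  by (simp add: altern_def multilin_def linear_lam_iff scaleR_add_right)

lemma altern_scale: "altern c \<Longrightarrow> altern (\<lambda>xs. r *\<^sub>R c xs)"
  by (simp add: altern_def multilin_def linear_lam_iff scaleR_add_right)

lemma subspace_altcochains: "real_subspace W \<Longrightarrow> real_subspace (altcochains W n m)"
  using altern_zero
  by (auto simp: real_vector.subspace_def altcochains_def plus_fun_def scaleR_fun_def zero_fun_def
      altern_add altern_scale)

lemma altcochains_mono: "W \<subseteq> W' \<Longrightarrow> altcochains W n m \<subseteq> altcochains W' n m"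
  by (auto simp: altcochains_def)

locale lie_module =
  fixes br :: "'g::real_vector \<Rightarrow> 'g \<Rightarrow> 'g" and act :: "'g \<Rightarrow> 'w::real_vector \<Rightarrow> 'w" and W :: "'w set"
  assumes br_lin: "linear (br x)" "linear (\<lambda>x. br x y)"
    and br_self: "br x x = 0"
    and br_jacobi: "br x (br y z) = br (br x y) z + br y (br x z)"
    and W_sub: "real_subspace W"
    and act_in: "w \<in> W \<Longrightarrow> act x w \<in> W"
    and act_add: "v \<in> W \<Longrightarrow> w \<in> W \<Longrightarrow> act x (v + w) = act x v + act x w"
    and act_scale: "w \<in> W \<Longrightarrow> act x (r *\<^sub>R w) = r *\<^sub>R act x w"
    and act_lin: "w \<in> W \<Longrightarrow> linear (\<lambda>x. act x w)"
    and act_rep: "w \<in> W \<Longrightarrow> act (br x y) w = act x (act y w) - act y (act x w)"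
begin

abbreviation "d \<equiv> ced br act"
abbreviation "L \<equiv> ceL br act"

lemma act_0: "act x 0 = 0"
  using act_scale[of 0 x 0] W_sub by (simp add: subspace_0)

lemma act_neg: "w \<in> W \<Longrightarrow> act x (- w) = - act x w"
  using act_scale[of w x "-1"] by simp

lemma act_diff: "v \<in> W \<Longrightarrow> w \<in> W \<Longrightarrow> act x (v - w) = act x v - act x w"
  using act_add[of v "- w" x] W_sub by (simp add: subspace_neg act_neg)

lemma d_Nil: "d c [] = 0"
  by (simp add: ced_def)

text \<open>
  Cartan's formula, with the contraction by \<open>x\<close> given by fixing the first argument. It makes the
  facts about the differential accessible to induction on the argument list.
\<close>

lemma d_Cons: "d c (x # xs) = L x c xs - d (\<lambda>ys. c (x # ys)) xs"
  by (simp add: ced_def ceL_def)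

lemma d_add:
  assumes "\<And>xs. c xs \<in> W" "\<And>xs. e xs \<in> W"
  shows "d (\<lambda>xs. c xs + e xs) xs = d c xs + d e xs"
  using assms by (simp add: ced_def act_add alts_add pairs_add)

lemma d_scale:
  assumes "\<And>xs. c xs \<in> W"
  shows "d (\<lambda>xs. r *\<^sub>R c xs) xs = r *\<^sub>R d c xs"
  using assms by (simp add: ced_def act_scale alts_scale pairs_scale algebra_simps)

lemma d_diff:
  assumes "\<And>xs. c xs \<in> W" "\<And>xs. e xs \<in> W"
  shows "d (\<lambda>xs. c xs - e xs) xs = d c xs - d e xs"
  using d_add[of c "\<lambda>xs. (-1) *\<^sub>R e xs" xs] d_scale[of e "-1" xs] assms W_sub
  by (simp add: subspace_neg)

lemma L_in: "(\<And>xs. c xs \<in> W) \<Longrightarrow> L x c xs \<in> W"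
  by (simp add: ceL_def W_sub act_in subspace_diff der_in)

lemma d_in: "(\<And>xs. c xs \<in> W) \<Longrightarrow> d c xs \<in> W"
  by (simp add: ced_def W_sub act_in subspace_add alts_in pairs_in)

lemma L_diff:
  assumes "\<And>xs. c xs \<in> W" "\<And>xs. e xs \<in> W"
  shows "L x (\<lambda>xs. c xs - e xs) xs = L x c xs - L x e xs"
  using assms by (simp add: ceL_def act_diff der_diff)

lemma L_Cons: "L x c (y # xs) = L x (\<lambda>ys. c (y # ys)) xs - c (br x y # xs)"
  by (simp add: ceL_def)

lemma multilin_act: "multilin c \<Longrightarrow> (\<And>xs. c xs \<in> W) \<Longrightarrow> multilin (\<lambda>xs. act x (c xs))"
  by (simp add: multilin_def linear_lam_iff act_add act_scale)

lemma act_der: "(\<And>ys. c ys \<in> W) \<Longrightarrow> act x (der f c xs) = der f (\<lambda>ys. act x (c ys)) xs"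
  by (rule der_push(1)[OF _ W_sub]) (auto simp: act_add act_0)

lemma L_comm:
  assumes "multilin c" "\<And>ys. c ys \<in> W"
  shows "L x (L y c) xs - L y (L x c) xs = L (br x y) c xs"
proof -
  have 1: "L x (L y c) xs = act x (act y (c xs)) - der (br y) (\<lambda>ys. act x (c ys)) xs
      - der (br x) (\<lambda>ys. act y (c ys)) xs + der (br x) (der (br y) c) xs" for x y
    using assms W_sub
    by (simp add: ceL_def[abs_def] act_diff act_in der_in act_der der_diff)
  have "der (br (br x y)) c xs = der (\<lambda>z. br x (br y z)) c xs - der (\<lambda>z. br y (br x z)) c xs"
    using der_fun_diff[OF assms(1), of "\<lambda>z. br x (br y z)" "\<lambda>z. br y (br x z)" xs]
    by (simp add: br_jacobi[of x y])
  then show ?thesis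
    using der_comm[of "br x" "br y" c xs]
    unfolding 1 by (simp add: ceL_def act_rep[OF assms(2)])
qed

lemma d_L:
  assumes "multilin c" "\<And>ys. c ys \<in> W"
  shows "d (L x c) xs = L x (d c) xs"
  using assms
proof (induction xs arbitrary: c)
  case Nil
  then show ?case by (simp add: d_Nil ceL_def[of _ _ _ "d c"] act_0)
next
  case (Cons y xs)
  have m: "multilin (\<lambda>ys. c (z # ys))" for z
    by (rule multilin_Cons[OF Cons.prems(1)])
  have "d (L x c) (y # xs) = L y (L x c) xs - d (\<lambda>ys. L x (\<lambda>ys. c (y # ys)) ys - c (br x y # ys)) xs"
    by (simp add: d_Cons L_Cons)
  also have "\<dots> = L y (L x c) xs - (d (L x (\<lambda>ys. c (y # ys))) xs - d (\<lambda>ys. c (br x y # ys)) xs)"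
    by (subst d_diff) (auto simp: L_in Cons.prems)
  finally have 1: "d (L x c) (y # xs) =
     L y (L x c) xs - L x (d (\<lambda>ys. c (y # ys))) xs + d (\<lambda>ys. c (br x y # ys)) xs"
    using Cons.IH[OF m] Cons.prems by simp
  have "L x (d c) (y # xs) =
     L x (\<lambda>ys. L y c ys - d (\<lambda>ys. c (y # ys)) ys) xs - (L (br x y) c xs - d (\<lambda>ys. c (br x y # ys)) xs)"
    by (simp add: L_Cons d_Cons)
  also have "L x (\<lambda>ys. L y c ys - d (\<lambda>ys. c (y # ys)) ys) xs =
     L x (L y c) xs - L x (d (\<lambda>ys. c (y # ys))) xs"
    by (subst L_diff) (auto simp: L_in d_in Cons.prems)
  finally have 2: "L x (d c) (y # xs) = L x (L y c) xs - L x (d (\<lambda>ys. c (y # ys))) xs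
      - (L (br x y) c xs - d (\<lambda>ys. c (br x y # ys)) xs)" .
  show ?case
    unfolding 1 2 using L_comm[OF Cons.prems, of x y xs] by (simp add: algebra_simps)
qed

text \<open>
  Fixing the first argument \<open>x\<close> turns the square of the differential into the commutator of the
  differential with the Lie derivative along \<open>x\<close>, plus the square in one degree less.
\<close>

lemma d_d:
  assumes "multilin c" "\<And>ys. c ys \<in> W"
  shows "d (d c) xs = 0"
  using assms
proof (induction xs arbitrary: c)
  case (Cons x xs)
  have "d (d c) (x # xs) = L x (d c) xs - d (\<lambda>ys. L x c ys - d (\<lambda>ys. c (x # ys)) ys) xs"
    by (simp add: d_Cons)
  also have "d (\<lambda>ys. L x c ys - d (\<lambda>ys. c (x # ys)) ys) xs =
      d (L x c) xs - d (d (\<lambda>ys. c (x # ys))) xs"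
    by (subst d_diff) (auto simp: L_in d_in Cons.prems)
  finally show ?case
    using d_L[OF Cons.prems, of x xs] Cons.IH[OF multilin_Cons[OF Cons.prems(1), of x]] Cons.prems
    by simp
qed (simp add: d_Nil)

lemma altern_act: "altern c \<Longrightarrow> (\<And>xs. c xs \<in> W) \<Longrightarrow> altern (\<lambda>xs. act x (c xs))"
  using multilin_act[of c x] by (simp add: altern_def act_0)

lemma altern_d:
  assumes "altern c" "\<And>xs. c xs \<in> W"
  shows "altern (d c)"
proof -
  have "altern (alts (\<lambda>x ys. act x (c ys)))"
    by (intro altern_alts altern_act act_lin assms)
  moreover have "altern (pairs br c)"
    by (intro altern_pairs assms br_lin br_self)
  ultimately show ?thesis
    unfolding ced_def[abs_def] by (rule altern_add)
qed

lemma d_altcochains: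
  assumes "c \<in> altcochains W n (Suc m)"
  shows "d c \<in> altcochains W n m"
proof -
  note c = altcochainsD[OF assms]
  have "d c xs = 0" if "length xs + m \<noteq> n" for xs
  proof (cases xs)
    case (Cons x ys)
    have z: "c zs = 0" if "length zs = length ys" for zs
      using c(4)[of zs] that \<open>length xs + m \<noteq> n\<close> Cons by auto
    have 1: "alts F zs = 0" if "\<And>y vs. Suc (length vs) = length zs \<Longrightarrow> F y vs = 0"
      for F :: "'x \<Rightarrow> 'x list \<Rightarrow> 'y::real_vector" and zs
      using that by (induction zs arbitrary: F) auto
    have 2: "der f e zs = 0" if "\<And>vs. length vs = length zs \<Longrightarrow> e vs = 0"
      for f and e :: "'x list \<Rightarrow> 'y::real_vector" and zs
      using that by (induction zs arbitrary: e) auto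
    have 3: "pairs \<gamma> e zs = 0" if "\<And>vs. Suc (length vs) = length zs \<Longrightarrow> e vs = 0"
      for \<gamma> and e :: "'x list \<Rightarrow> 'y::real_vector" and zs
      using that by (induction zs arbitrary: e) (auto simp: 2)
    have "alts (\<lambda>x ys. act x (c ys)) xs = 0"
      by (rule 1) (auto simp: z Cons act_0)
    moreover have "pairs br c xs = 0"
      by (rule 3) (auto simp: z Cons)
    ultimately show ?thesis by (simp add: ced_def)
  qed (simp add: d_Nil)
  then show ?thesis
    using c altern_d[of c] d_in[of c] by (simp add: altcochains_def)
qed

lemma d_zero: "d (\<lambda>_. 0) xs = 0"
  by (simp add: ced_def act_0)

lemma coboundaries_iff:
  "coboundaries UNIV br act W n = d ` altcochains W n (Suc 0)"
proof (cases n)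
  case 0
  have "d 0 = 0" by (simp add: fun_eq_iff zero_fun_def d_zero)
  then show ?thesis
    using W_sub 0 by (simp add: coboundaries_def altcochains_0_1 subspace_0)
next
  case (Suc v)
  then show ?thesis
    using W_sub
    by (auto simp: coboundaries_def cochains_UNIV subspace_0 altcochains_Suc_Suc
        ce_diff_eq_ced altcochainsD image_iff)
qed

end

section \<open>Calculus of smooth functions\<close>

lemma smooth_differentiable: "smooth f \<Longrightarrow> f differentiable (at x)"
  unfolding smooth_def by (drule spec[of _ "[]"]) (simp add: pds_def differentiable_on_def)

lemma smooth_continuous: "smooth f \<Longrightarrow> continuous_on S f"
  by (meson UNIV_I continuous_at_imp_continuous_on differentiable_imp_continuous_within smooth_differentiable)

lemma pds_Nil [simp]: "pds [] f = f" and pds_Cons [simp]: "pds (i # \<alpha>) f = pd i (pds \<alpha> f)"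
  by (simp_all add: pds_def)

lemma pds_append: "pds (\<alpha> @ \<beta>) f = pds \<alpha> (pds \<beta> f)"
  by (simp add: pds_def)

lemma smooth_pd: "smooth f \<Longrightarrow> smooth (pd i f)"
  unfolding smooth_def
proof
  fix \<alpha> assume "\<forall>\<alpha>. pds \<alpha> f differentiable_on UNIV"
  then have "pds (\<alpha> @ [i]) f differentiable_on UNIV" by blast
  then show "pds \<alpha> (pd i f) differentiable_on UNIV" by (simp add: pds_append)
qed

lemma smooth_pds: "smooth f \<Longrightarrow> smooth (pds \<alpha> f)"
  by (induction \<alpha>) (auto simp: smooth_pd)

text \<open>
  Smoothness order by order, for proofs by induction: the derivatives of a product or of an
  integral are of the same kind again, with one order less to go.
\<close>

primrec Ck :: "nat \<Rightarrow> (real^'m::finite \<Rightarrow> real) \<Rightarrow> bool" where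
  "Ck 0 f \<longleftrightarrow> (\<forall>x. f differentiable (at x))"
| "Ck (Suc n) f \<longleftrightarrow> (\<forall>x. f differentiable (at x)) \<and> (\<forall>i. Ck n (pd i f))"

lemma Ck_differentiable: "Ck n f \<Longrightarrow> f differentiable (at x)"
  by (cases n) auto

lemma smooth_iff_Ck: "smooth f \<longleftrightarrow> (\<forall>n. Ck n f)"
proof
  have "smooth f \<Longrightarrow> Ck n f" for n
    by (induction n arbitrary: f) (auto simp: smooth_differentiable smooth_pd)
  then show "smooth f \<Longrightarrow> \<forall>n. Ck n f" by blast
next
  assume "\<forall>n. Ck n f"
  then have "pds \<alpha> f differentiable_on UNIV" for \<alpha>
  proof (induction \<alpha> arbitrary: f rule: rev_induct)
    case Nil
    then show ?case using Ck_differentiable by (auto simp: differentiable_on_def)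
  next
    case (snoc i \<alpha>)
    have "\<forall>n. Ck n (pd i f)" using snoc.prems Ck.simps(2) by blast
    then show ?case using snoc.IH by (simp add: pds_append)
  qed
  then show "smooth f" by (simp add: smooth_def)
qed

lemma Ck_Suc: "Ck (Suc n) f \<Longrightarrow> Ck n f"
  by (induction n arbitrary: f) auto

lemma pd_eqI: "(f has_derivative D) (at x) \<Longrightarrow> pd i f x = D (axis i 1)"
  using frechet_derivative_at[of f D x] by (simp add: pd_def)

lemma has_derivative_frechet:
  "f differentiable (at x) \<Longrightarrow> (f has_derivative frechet_derivative f (at x)) (at x)"
  using frechet_derivative_works by blast

lemma pd_add':
  assumes "\<And>x. f differentiable (at x)" "\<And>x. g differentiable (at x)"
  shows "pd i (\<lambda>x. f x + g x) = (\<lambda>x. pd i f x + pd i g x)"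
proof
  fix x
  show "pd i (\<lambda>x. f x + g x) x = pd i f x + pd i g x"
    using pd_eqI[OF has_derivative_add[OF has_derivative_frechet[OF assms(1)[of x]]
        has_derivative_frechet[OF assms(2)[of x]]], of i]
    by (simp add: pd_def)
qed

lemma pd_mult':
  assumes "\<And>x. f differentiable (at x)" "\<And>x. g differentiable (at x)"
  shows "pd i (\<lambda>x. f x * g x) = (\<lambda>x. f x * pd i g x + pd i f x * g x)"
proof
  fix x
  show "pd i (\<lambda>x. f x * g x) x = f x * pd i g x + pd i f x * g x"
    using pd_eqI[OF has_derivative_mult[OF has_derivative_frechet[OF assms(1)[of x]]
        has_derivative_frechet[OF assms(2)[of x]]], of i]
    by (simp add: pd_def)
qed

lemma pd_linear:
  assumes "linear f"
  shows "pd i f = (\<lambda>_. f (axis i 1))"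
  using pd_eqI[OF linear_imp_has_derivative[OF assms]] by auto

lemma pd_const [simp]: "pd i (\<lambda>_. c) = (\<lambda>_. 0)"
  using pd_eqI[OF has_derivative_const] by auto

lemma Ck_const: "Ck n (\<lambda>_. c)"
  by (induction n arbitrary: c) auto

lemma Ck_add: "Ck n f \<Longrightarrow> Ck n g \<Longrightarrow> Ck n (\<lambda>x. f x + g x)"
  by (induction n arbitrary: f g) (auto simp: pd_add')

lemma Ck_mult: "Ck n f \<Longrightarrow> Ck n g \<Longrightarrow> Ck n (\<lambda>x. f x * g x)"
proof (induction n arbitrary: f g)
  case (Suc n)
  have "Ck n (\<lambda>x. f x * pd i g x + pd i f x * g x)" for i
    using Suc.prems Ck_Suc by (intro Ck_add Suc.IH) auto
  then show ?case using Suc.prems by (auto simp: pd_mult')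
qed auto

lemma smooth_const [simp]: "smooth (\<lambda>_. c)"
  by (simp add: smooth_iff_Ck Ck_const)

lemma smooth_linear: "linear f \<Longrightarrow> smooth f"
proof -
  assume l: "linear f"
  have "f differentiable (at x)" for x
    using linear_imp_has_derivative[OF l] by (auto simp: differentiable_def)
  then have "Ck n f" for n
    by (cases n) (auto simp: pd_linear[OF l] Ck_const)
  then show "smooth f" by (simp add: smooth_iff_Ck)
qed

lemma smooth_add: "smooth f \<Longrightarrow> smooth g \<Longrightarrow> smooth (\<lambda>x. f x + g x)"
  and smooth_mult: "smooth f \<Longrightarrow> smooth g \<Longrightarrow> smooth (\<lambda>x. f x * g x)"
  by (simp_all add: smooth_iff_Ck Ck_add Ck_mult)

lemma smooth_cmult: "smooth f \<Longrightarrow> smooth (\<lambda>x. c * f x)"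
  by (rule smooth_mult) auto

lemma smooth_minus: "smooth f \<Longrightarrow> smooth (\<lambda>x. - f x)"
  using smooth_cmult[of f "-1"] by simp

lemma smooth_diff: "smooth f \<Longrightarrow> smooth g \<Longrightarrow> smooth (\<lambda>x. f x - g x)"
  using smooth_add[of f "\<lambda>x. - g x"] smooth_minus by auto

lemma smooth_sum: "(\<And>a. a \<in> A \<Longrightarrow> smooth (f a)) \<Longrightarrow> smooth (\<lambda>x. \<Sum>a\<in>A. f a x)"
  by (induction A rule: infinite_finite_induct) (auto simp: smooth_add)

lemma smooth_coord [simp]: "smooth (\<lambda>x. x $ i)"
  by (rule smooth_linear) (simp add: linear_iff)

lemma smooth_prod_list: "(\<And>a. a \<in> set as \<Longrightarrow> smooth (f a)) \<Longrightarrow> smooth (\<lambda>x. \<Prod>a\<leftarrow>as. f a x)"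
  by (induction as) (auto simp: smooth_mult)

lemmas smooth_intros = smooth_const smooth_add smooth_mult smooth_diff smooth_minus smooth_sum
  smooth_coord smooth_pd smooth_pds smooth_prod_list

lemma pd_add: "smooth f \<Longrightarrow> smooth g \<Longrightarrow> pd i (\<lambda>x. f x + g x) = (\<lambda>x. pd i f x + pd i g x)"
  and pd_mult: "smooth f \<Longrightarrow> smooth g \<Longrightarrow> pd i (\<lambda>x. f x * g x) = (\<lambda>x. f x * pd i g x + pd i f x * g x)"
  by (simp_all add: pd_add' pd_mult' smooth_differentiable)

lemma pd_cmult: "smooth f \<Longrightarrow> pd i (\<lambda>x. c * f x) = (\<lambda>x. c * pd i f x)"
  by (simp add: pd_mult)

lemma pd_minus: "smooth f \<Longrightarrow> pd i (\<lambda>x. - f x) = (\<lambda>x. - pd i f x)"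
  using pd_cmult[of f i "-1"] by simp

lemma pd_diff: "smooth f \<Longrightarrow> smooth g \<Longrightarrow> pd i (\<lambda>x. f x - g x) = (\<lambda>x. pd i f x - pd i g x)"
  using pd_add[of f "\<lambda>x. - g x" i] by (simp add: pd_minus smooth_minus)

lemma pd_sum:
  "(\<And>a. a \<in> A \<Longrightarrow> smooth (f a)) \<Longrightarrow> pd i (\<lambda>x. \<Sum>a\<in>A. f a x) = (\<lambda>x. \<Sum>a\<in>A. pd i (f a) x)"
  by (induction A rule: infinite_finite_induct) (auto simp: pd_add smooth_sum)

lemma pd_coord: "pd i (\<lambda>x. x $ j) = (\<lambda>_. if i = j then 1 else 0)"
  by (subst pd_linear) (auto simp: linear_iff axis_def fun_eq_iff)

lemma pds_zero [simp]: "pds \<alpha> (\<lambda>_. 0) = (\<lambda>_. 0)"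
  by (induction \<alpha>) auto

lemma pds_add: "smooth f \<Longrightarrow> smooth g \<Longrightarrow> pds \<alpha> (\<lambda>x. f x + g x) = (\<lambda>x. pds \<alpha> f x + pds \<alpha> g x)"
  by (induction \<alpha>) (auto simp: pd_add smooth_pds)

lemma pds_cmult: "smooth f \<Longrightarrow> pds \<alpha> (\<lambda>x. c * f x) = (\<lambda>x. c * pds \<alpha> f x)"
  by (induction \<alpha>) (auto simp: pd_cmult smooth_pds)

lemma frechet_pd:
  assumes "f differentiable (at x)"
  shows "frechet_derivative f (at x) v = (\<Sum>i\<in>UNIV. v $ i * pd i f x)"
proof -
  have l: "linear (frechet_derivative f (at x))"
    using assms linear_frechet_derivative by blast
  have "frechet_derivative f (at x) v = frechet_derivative f (at x) (\<Sum>i\<in>UNIV. v $ i *s axis i 1)"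
    by (simp add: basis_expansion)
  also have "\<dots> = (\<Sum>i\<in>UNIV. v $ i * pd i f x)"
    by (simp add: linear_sum[OF l] linear_scale[OF l] pd_def scalar_mult_eq_scaleR)
  finally show ?thesis .
qed

lemma has_derivative_pd:
  "f differentiable (at x) \<Longrightarrow> (f has_derivative (\<lambda>v. \<Sum>i\<in>UNIV. v $ i * pd i f x)) (at x)"
  using has_derivative_frechet[of f x] frechet_pd[of f x] by (simp flip: frechet_pd)

lemma pd_scaling:
  assumes "\<And>x. f differentiable (at x)"
  shows "pd i (\<lambda>x. f (t *\<^sub>R x)) = (\<lambda>x. t * pd i f (t *\<^sub>R x))"
    "(\<lambda>x. f (t *\<^sub>R x)) differentiable (at x)"
proof -
  have *: "((\<lambda>x. f (t *\<^sub>R x)) has_derivative (\<lambda>v. frechet_derivative f (at (t *\<^sub>R x)) (t *\<^sub>R v))) (at x)" for x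
    by (rule has_derivative_compose[OF _ has_derivative_frechet[OF assms]])
      (intro derivative_intros)
  have "linear (frechet_derivative f (at (t *\<^sub>R x)))" for x
    using assms linear_frechet_derivative by blast
  then show "pd i (\<lambda>x. f (t *\<^sub>R x)) = (\<lambda>x. t * pd i f (t *\<^sub>R x))"
    using pd_eqI[OF *] by (simp add: fun_eq_iff linear_scale pd_def)
  show "(\<lambda>x. f (t *\<^sub>R x)) differentiable (at x)"
    using * by (auto simp: differentiable_def)
qed

lemma smooth_scaling: "smooth f \<Longrightarrow> smooth (\<lambda>x. f (t *\<^sub>R x))"
proof -
  have "Ck n f \<Longrightarrow> Ck n (\<lambda>x. f (t *\<^sub>R x))" for n
  proof (induction n arbitrary: f)
    case (Suc n)
    then show ?case
      by (auto simp: pd_scaling intro!: Ck_mult Ck_const)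
  qed (auto simp: pd_scaling)
  then show "smooth f \<Longrightarrow> smooth (\<lambda>x. f (t *\<^sub>R x))" by (simp add: smooth_iff_Ck)
qed

subsection \<open>Symmetry of the partial derivatives\<close>

lemma mvt_pd:
  assumes "\<And>x. f differentiable (at x)" "0 < h"
  shows "\<exists>\<xi>. 0 < \<xi> \<and> \<xi> < h \<and> f (y + h *\<^sub>R axis i 1) - f y = h * pd i f (y + \<xi> *\<^sub>R axis i 1)"
proof -
  have "((\<lambda>s. f (y + s *\<^sub>R axis i 1)) has_real_derivative pd i f (y + s *\<^sub>R axis i 1)) (at s)" for s
  proof -
    let ?D = "frechet_derivative f (at (y + s *\<^sub>R axis i 1))"
    have l: "linear ?D" using assms linear_frechet_derivative by blast
    have "((\<lambda>s. f (y + s *\<^sub>R axis i 1)) has_derivative (\<lambda>r. ?D (r *\<^sub>R axis i 1))) (at s)"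
      by (rule has_derivative_compose[OF _ has_derivative_frechet[OF assms(1)]])
        (auto intro!: derivative_eq_intros)
    then have "((\<lambda>s. f (y + s *\<^sub>R axis i 1)) has_derivative
        (\<lambda>r. pd i f (y + s *\<^sub>R axis i 1) * r)) (at s)"
      by (rule has_derivative_eq_rhs) (auto simp: linear_scale[OF l] pd_def)
    then show ?thesis
      by (simp add: has_field_derivative_def)
  qed
  from MVT2[OF assms(2) this] show ?thesis by auto
qed

lemma second_difference:
  assumes "smooth f" "0 < h"
  shows "\<exists>\<xi> \<eta>. 0 < \<xi> \<and> \<xi> < h \<and> 0 < \<eta> \<and> \<eta> < h \<and>
    f (x + h *\<^sub>R axis i 1 + h *\<^sub>R axis j 1) - f (x + h *\<^sub>R axis i 1) - f (x + h *\<^sub>R axis j 1) + f x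
      = h * (h * pd j (pd i f) (x + \<xi> *\<^sub>R axis i 1 + \<eta> *\<^sub>R axis j 1))"
proof -
  let ?g = "\<lambda>z. f (z + h *\<^sub>R axis j 1) - f z"
  have D: "(?g has_derivative (\<lambda>v. frechet_derivative f (at (z + h *\<^sub>R axis j 1)) v
      - frechet_derivative f (at z) v)) (at z)" for z
  proof (rule has_derivative_diff)
    show "((\<lambda>z. f (z + h *\<^sub>R axis j 1)) has_derivative
        frechet_derivative f (at (z + h *\<^sub>R axis j 1))) (at z)"
      by (rule has_derivative_eq_rhs,
          rule has_derivative_compose[OF _ has_derivative_frechet[OF smooth_differentiable[OF assms(1)]]])
        (auto intro!: derivative_eq_intros)
    show "(f has_derivative frechet_derivative f (at z)) (at z)"
      by (intro has_derivative_frechet smooth_differentiable assms)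
  qed
  have "?g differentiable (at z)" for z using D by (auto simp: differentiable_def)
  from mvt_pd[OF this assms(2), of x i] obtain \<xi> where \<xi>: "0 < \<xi>" "\<xi> < h"
    "?g (x + h *\<^sub>R axis i 1) - ?g x = h * pd i ?g (x + \<xi> *\<^sub>R axis i 1)" by blast
  have "pd i f differentiable (at z)" for z by (intro smooth_differentiable smooth_pd assms)
  from mvt_pd[OF this assms(2), of "x + \<xi> *\<^sub>R axis i 1" j] obtain \<eta> where \<eta>: "0 < \<eta>" "\<eta> < h"
    "pd i f (x + \<xi> *\<^sub>R axis i 1 + h *\<^sub>R axis j 1) - pd i f (x + \<xi> *\<^sub>R axis i 1)
      = h * pd j (pd i f) (x + \<xi> *\<^sub>R axis i 1 + \<eta> *\<^sub>R axis j 1)" by blast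
  have "pd i ?g (x + \<xi> *\<^sub>R axis i 1) =
     pd i f (x + \<xi> *\<^sub>R axis i 1 + h *\<^sub>R axis j 1) - pd i f (x + \<xi> *\<^sub>R axis i 1)"
    using pd_eqI[OF D] by (simp add: pd_def)
  then show ?thesis using \<xi> \<eta> by (intro exI[of _ \<xi>] exI[of _ \<eta>]) auto
qed

text \<open>
  Both mixed derivatives are limits of the same second difference quotient.
\<close>

lemma pd_commute:
  assumes "smooth f"
  shows "pd i (pd j f) = pd j (pd i f)"
proof (rule ext, rule ccontr)
  fix x
  assume ne: "pd i (pd j f) x \<noteq> pd j (pd i f) x"
  define \<epsilon> where "\<epsilon> = \<bar>pd i (pd j f) x - pd j (pd i f) x\<bar> / 2"
  have e: "\<epsilon> > 0" using ne by (simp add: \<epsilon>_def)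
  have c: "continuous (at x) (pd i (pd j f))" for i j
    by (intro differentiable_imp_continuous_within smooth_differentiable smooth_pd assms)
  obtain r where r: "r > 0" "\<And>y. dist y x < r \<Longrightarrow> dist (pd i (pd j f) y) (pd i (pd j f) x) < \<epsilon>"
    using c[of i j] e unfolding continuous_at_eps_delta by blast
  obtain s where s: "s > 0" "\<And>y. dist y x < s \<Longrightarrow> dist (pd j (pd i f) y) (pd j (pd i f) x) < \<epsilon>"
    using c[of j i] e unfolding continuous_at_eps_delta by blast
  define h where "h = min r s / 2"
  have h: "h > 0" "2 * h \<le> r" "2 * h \<le> s" using r s by (auto simp: h_def)
  have near: "dist (x + \<xi> *\<^sub>R axis k 1 + \<eta> *\<^sub>R axis l 1) x < 2 * h"
    if "0 < \<xi>" "\<xi> < h" "0 < \<eta>" "\<eta> < h" for \<xi> \<eta> and k l :: 'a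
  proof -
    have "dist (x + \<xi> *\<^sub>R axis k 1 + \<eta> *\<^sub>R axis l 1) x = norm (\<xi> *\<^sub>R axis k (1::real) + \<eta> *\<^sub>R axis l 1)"
      by (simp add: dist_norm add.assoc)
    also have "\<dots> \<le> norm (\<xi> *\<^sub>R axis k (1::real)) + norm (\<eta> *\<^sub>R axis l (1::real))"
      by (rule norm_triangle_ineq)
    also have "\<dots> = \<xi> + \<eta>" using that by (simp add: norm_axis_1)
    finally show ?thesis using that by linarith
  qed
  obtain \<xi> \<eta> where 1: "0 < \<xi>" "\<xi> < h" "0 < \<eta>" "\<eta> < h"
    "f (x + h *\<^sub>R axis i 1 + h *\<^sub>R axis j 1) - f (x + h *\<^sub>R axis i 1) - f (x + h *\<^sub>R axis j 1) + f x
      = h * (h * pd j (pd i f) (x + \<xi> *\<^sub>R axis i 1 + \<eta> *\<^sub>R axis j 1))"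
    using second_difference[OF assms h(1)] by blast
  obtain \<xi>' \<eta>' where 2: "0 < \<xi>'" "\<xi>' < h" "0 < \<eta>'" "\<eta>' < h"
    "f (x + h *\<^sub>R axis j 1 + h *\<^sub>R axis i 1) - f (x + h *\<^sub>R axis j 1) - f (x + h *\<^sub>R axis i 1) + f x
      = h * (h * pd i (pd j f) (x + \<xi>' *\<^sub>R axis j 1 + \<eta>' *\<^sub>R axis i 1))"
    using second_difference[OF assms h(1)] by blast
  have "h * (h * pd j (pd i f) (x + \<xi> *\<^sub>R axis i 1 + \<eta> *\<^sub>R axis j 1)) =
    h * (h * pd i (pd j f) (x + \<xi>' *\<^sub>R axis j 1 + \<eta>' *\<^sub>R axis i 1))"
    using 1(5) 2(5) by (simp add: algebra_simps)
  then have "pd j (pd i f) (x + \<xi> *\<^sub>R axis i 1 + \<eta> *\<^sub>R axis j 1) =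
    pd i (pd j f) (x + \<xi>' *\<^sub>R axis j 1 + \<eta>' *\<^sub>R axis i 1)" using h(1) by simp
  moreover have "dist (pd j (pd i f) (x + \<xi> *\<^sub>R axis i 1 + \<eta> *\<^sub>R axis j 1)) (pd j (pd i f) x) < \<epsilon>"
    using near[OF 1(1-4)] h by (intro s(2)) (meson order_less_le_trans)
  moreover have "dist (pd i (pd j f) (x + \<xi>' *\<^sub>R axis j 1 + \<eta>' *\<^sub>R axis i 1)) (pd i (pd j f) x) < \<epsilon>"
    using near[OF 2(1-4)] h by (intro r(2)) (meson order_less_le_trans)
  ultimately show False unfolding \<epsilon>_def dist_real_def by argo
qed

lemma pd_pds: "smooth f \<Longrightarrow> pd i (pds \<alpha> f) = pds \<alpha> (pd i f)"
proof (induction \<alpha>)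
  case (Cons j \<alpha>)
  then show ?case using pd_commute[OF smooth_pds[OF Cons.prems], of i j \<alpha>] by simp
qed simp

lemma pds_mset:
  assumes "smooth f" "mset \<alpha> = mset \<beta>"
  shows "pds \<alpha> f = pds \<beta> f"
  using assms(2)
proof (induction \<alpha> arbitrary: \<beta>)
  case (Cons i \<alpha>)
  have "i \<in> set \<beta>" using Cons.prems by (metis list.set_intros(1) set_mset_mset)
  then obtain us vs where \<beta>: "\<beta> = us @ i # vs" by (meson split_list)
  then have "pds \<alpha> f = pds (us @ vs) f" using Cons by simp
  then show ?case
    using pd_pds[OF smooth_pds[OF assms(1)], of i us vs] by (simp add: \<beta> pds_append)
qed simp

subsection \<open>Averages over rays\<close>

text \<open>
  The coefficients of the contraction along the rays. A derivative only raises the power of \<open>t\<close>, so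
  that the family is closed under differentiation.
\<close>

definition ray_mean :: "nat \<Rightarrow> (real^'m::finite \<Rightarrow> real) \<Rightarrow> real^'m \<Rightarrow> real" where
  "ray_mean a f x = integral {0..1} (\<lambda>t. t ^ a * f (t *\<^sub>R x))"

lemma continuous_ray:
  "smooth f \<Longrightarrow> continuous_on S (\<lambda>t. t ^ a * f (t *\<^sub>R x))"
  by (intro continuous_intros continuous_on_compose2[OF smooth_continuous[where S = UNIV]]) auto

lemma pd_ray_mean:
  assumes "smooth f"
  shows "ray_mean a f differentiable (at x)" "pd i (ray_mean a f) = ray_mean (Suc a) (pd i f)"
proof -
  let ?fx = "\<lambda>x t. \<Sum>i\<in>UNIV. (t ^ Suc a * pd i f (t *\<^sub>R x)) *\<^sub>R blinfun_inner_right (axis i (1::real))"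
  have c: "continuous_on S (\<lambda>z. pd i f (snd z *\<^sub>R fst z))" for i S
    by (intro continuous_intros continuous_on_compose2[OF smooth_continuous[where S = UNIV]])
      (auto intro: smooth_pd assms)
  have D: "((\<lambda>x. integral (cbox 0 1) (\<lambda>t. t ^ a * f (t *\<^sub>R x))) has_derivative
      integral (cbox 0 1) (?fx x)) (at x within UNIV)" for x
  proof (rule leibniz_rule)
    fix x and t :: real
    have "((\<lambda>x. f (t *\<^sub>R x)) has_derivative (\<lambda>v. \<Sum>i\<in>UNIV. (t *\<^sub>R v) $ i * pd i f (t *\<^sub>R x))) (at x)"
      by (rule has_derivative_compose[OF _ has_derivative_pd[OF smooth_differentiable[OF assms]]])
        (intro derivative_intros)
    then have "((\<lambda>x. t ^ a * f (t *\<^sub>R x)) has_derivative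
        (\<lambda>v. t ^ a * (\<Sum>i\<in>UNIV. (t *\<^sub>R v) $ i * pd i f (t *\<^sub>R x)))) (at x)"
      by (rule has_derivative_mult_right)
    then show "((\<lambda>x. t ^ a * f (t *\<^sub>R x)) has_derivative blinfun_apply (?fx x t)) (at x within UNIV)"
      by (rule has_derivative_eq_rhs)
        (auto simp: fun_eq_iff blinfun.sum_left blinfun.scaleR_left sum_distrib_left
          inner_axis' mult_ac intro!: sum.cong)
  next
    show "(\<lambda>t. t ^ a * f (t *\<^sub>R x)) integrable_on cbox 0 1" for x
      by (intro integrable_continuous continuous_ray assms)
  next
    show "continuous_on (UNIV \<times> cbox 0 1) (\<lambda>(x, t). ?fx x t)"
      unfolding split_beta by (intro continuous_intros c)
  qed auto
  have R: "ray_mean a f = (\<lambda>x. integral (cbox 0 1) (\<lambda>t. t ^ a * f (t *\<^sub>R x)))"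
    by (simp add: fun_eq_iff ray_mean_def)
  show "ray_mean a f differentiable (at x)"
    using D[of x] unfolding R differentiable_def by blast
  show "pd i (ray_mean a f) = ray_mean (Suc a) (pd i f)"
  proof
    fix x
    have ci: "continuous_on {0..1} (?fx x)"
      by (intro continuous_intros continuous_on_compose2[OF smooth_continuous[where S = UNIV]])
        (auto intro: smooth_pd assms)
    have "pd i (ray_mean a f) x = integral (cbox 0 1) (?fx x) (axis i 1)"
      unfolding R by (rule pd_eqI[OF D[of x]])
    also have "\<dots> = integral (cbox 0 1) (\<lambda>t. ?fx x t (axis i 1))"
      by (rule blinfun_apply_integral) (use ci in \<open>auto intro: integrable_continuous_real\<close>)
    also have "\<dots> = ray_mean (Suc a) (pd i f) x"
      unfolding ray_mean_def
      by (simp add: blinfun.sum_left blinfun.scaleR_left inner_axis_axis if_distrib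
          sum.If_cases cong: if_cong)
    finally show "pd i (ray_mean a f) x = ray_mean (Suc a) (pd i f) x" .
  qed
qed

lemma smooth_ray_mean: "smooth f \<Longrightarrow> smooth (ray_mean a f)"
proof -
  have "smooth f \<Longrightarrow> Ck n (ray_mean a f)" for n
    by (induction n arbitrary: f a) (auto simp: pd_ray_mean smooth_pd)
  then show "smooth f \<Longrightarrow> smooth (ray_mean a f)" by (simp add: smooth_iff_Ck)
qed

subsection \<open>Substituting functions into a multilinear map\<close>

lemma multilin_expand_hd:
  fixes c :: "'g::euclidean_space list \<Rightarrow> 'w::real_vector"
  assumes "multilin c"
  shows "c (v # vs) = (\<Sum>b\<in>Basis. (v \<bullet> b) *\<^sub>R c (b # vs))"
proof -
  have "c (v # vs) = c ((\<Sum>b\<in>Basis. (v \<bullet> b) *\<^sub>R b) # vs)"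
    by (simp add: euclidean_representation)
  then show ?thesis by (simp add: multilin_sum_hd[OF assms] multilin_hd(2)[OF assms])
qed

lemma sum_fun_apply: "(sum f A) x = (\<Sum>a\<in>A. f a x)"
  by (induction A rule: infinite_finite_induct) auto

lemma multilin_expand_hd_apply:
  fixes c :: "'g::euclidean_space list \<Rightarrow> 'a \<Rightarrow> real"
  assumes "multilin c"
  shows "c (v # vs) x = (\<Sum>b\<in>Basis. (v \<bullet> b) * c (b # vs) x)"
  by (subst multilin_expand_hd[OF assms]) (simp add: sum_fun_apply scaleR_fun_def)

text \<open>
  Expanding the point-dependent arguments in a basis leaves sums of products of smooth functions.
\<close>

lemma smooth_multilin_subst:
  fixes c :: "'g::euclidean_space list \<Rightarrow> real^'m::finite \<Rightarrow> real"
  assumes "multilin c" "\<And>vs. smooth (c vs)"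
    "\<And>f b. f \<in> set fs \<Longrightarrow> b \<in> Basis \<Longrightarrow> smooth (\<lambda>x. f x \<bullet> b)"
  shows "smooth (\<lambda>x. c (map (\<lambda>f. f x) fs) x)"
  using assms
proof (induction fs arbitrary: c)
  case Nil
  then show ?case using Nil(2)[of "[]"] by simp
next
  case (Cons f fs)
  have "smooth (\<lambda>x. c (b # map (\<lambda>f. f x) fs) x)" for b
    using Cons.prems by (intro Cons.IH[of "\<lambda>ys. c (b # ys)"] multilin_Cons) auto
  then have "smooth (\<lambda>x. \<Sum>b\<in>Basis. (f x \<bullet> b) * c (b # map (\<lambda>f. f x) fs) x)"
    using Cons.prems by (intro smooth_intros) auto
  then show ?case
    by (simp flip: multilin_expand_hd_apply[OF Cons.prems(1)])
qed

lemma pd_multilin_subst: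
  fixes c :: "'g::euclidean_space list \<Rightarrow> real^'m::finite \<Rightarrow> real"
  assumes "multilin c" "\<And>vs. smooth (c vs)"
    "\<And>f b. f \<in> set fs \<Longrightarrow> b \<in> Basis \<Longrightarrow> smooth (\<lambda>x. f x \<bullet> b)"
    "\<And>f b. f \<in> set fs \<Longrightarrow> b \<in> Basis \<Longrightarrow> pd i (\<lambda>x. f x \<bullet> b) z = \<phi> (f z) \<bullet> b"
  shows "pd i (\<lambda>x. c (map (\<lambda>f. f x) fs) x) z =
    pd i (c (map (\<lambda>f. f z) fs)) z + der \<phi> c (map (\<lambda>f. f z) fs) z"
  using assms
proof (induction fs arbitrary: c)
  case (Cons f fs)
  note m = Cons.prems(1)
  let ?vs = "map (\<lambda>f. f z) fs"
  have s: "smooth (\<lambda>x. c (b # map (\<lambda>f. f x) fs) x)" for b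
    using Cons.prems by (intro smooth_multilin_subst[of "\<lambda>ys. c (b # ys)"] multilin_Cons) auto
  have IH: "pd i (\<lambda>x. c (b # map (\<lambda>f. f x) fs) x) z = pd i (c (b # ?vs)) z + der \<phi> (\<lambda>ys. c (b # ys)) ?vs z" for b
    using Cons.prems by (intro Cons.IH[of "\<lambda>ys. c (b # ys)"] multilin_Cons) auto
  have "pd i (\<lambda>x. c (map (\<lambda>f. f x) (f # fs)) x) z =
      pd i (\<lambda>x. \<Sum>b\<in>Basis. (f x \<bullet> b) * c (b # map (\<lambda>f. f x) fs) x) z"
    by (simp flip: multilin_expand_hd_apply[OF m])
  also have "\<dots> = (\<Sum>b\<in>Basis. (f z \<bullet> b) * (pd i (c (b # ?vs)) z + der \<phi> (\<lambda>ys. c (b # ys)) ?vs z)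
      + (\<phi> (f z) \<bullet> b) * c (b # ?vs) z)"
    using Cons.prems by (simp add: pd_sum pd_mult s smooth_mult IH)
  also have "\<dots> = (\<Sum>b\<in>Basis. (f z \<bullet> b) * pd i (c (b # ?vs)) z)
      + (\<Sum>b\<in>Basis. (f z \<bullet> b) * der \<phi> (\<lambda>ys. c (b # ys)) ?vs z) + c (\<phi> (f z) # ?vs) z"
    by (simp add: algebra_simps sum.distrib multilin_expand_hd_apply[OF m, of "\<phi> (f z)"])
  also have "(\<Sum>b\<in>Basis. (f z \<bullet> b) * pd i (c (b # ?vs)) z) = pd i (c (f z # ?vs)) z"
  proof -
    have "c (f z # ?vs) = (\<lambda>x. \<Sum>b\<in>Basis. (f z \<bullet> b) * c (b # ?vs) x)"
      by (rule ext) (rule multilin_expand_hd_apply[OF m])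
    then show ?thesis
      using Cons.prems(2) by (simp add: pd_sum pd_cmult smooth_cmult)
  qed
  also have "(\<Sum>b\<in>Basis. (f z \<bullet> b) * der \<phi> (\<lambda>ys. c (b # ys)) ?vs z) = der \<phi> (\<lambda>ys. c (f z # ys)) ?vs z"
  proof -
    have "der \<phi> (\<lambda>ys. c (f z # ys)) ?vs = (\<Sum>b\<in>Basis. (f z \<bullet> b) *\<^sub>R der \<phi> (\<lambda>ys. c (b # ys)) ?vs)"
      using linear_sum[OF linear_der[of "\<lambda>v ys. c (v # ys)" \<phi> ?vs],
          of "\<lambda>b. (f z \<bullet> b) *\<^sub>R b" Basis]
        linear_scale[OF linear_der[of "\<lambda>v ys. c (v # ys)" \<phi> ?vs]]
      by (simp add: multilin_linear_hd[OF m] euclidean_representation)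
    then show ?thesis by (simp add: sum_fun_apply scaleR_fun_def)
  qed
  finally show ?case by simp
qed simp

section \<open>Symmetric functions of index lists\<close>

definition msym :: "('m list \<Rightarrow> 'w) \<Rightarrow> bool" where
  "msym T \<longleftrightarrow> (\<forall>I J. mset I = mset J \<longrightarrow> T I = T J)"

lemma msymD: "msym T \<Longrightarrow> mset I = mset J \<Longrightarrow> T I = T J"
  unfolding msym_def by blast

lemma msymI:
  assumes "\<And>us a b vs. T (us @ a # b # vs) = T (us @ b # a # vs)"
  shows "msym T"
proof -
  have mv: "T (us @ i # vs) = T (i # us @ vs)"
    if "\<And>us a b vs. T (us @ a # b # vs) = T (us @ b # a # vs)" for us vs i and T :: "'a list \<Rightarrow> 'b"
    using that
  proof (induction us arbitrary: T)
    case (Cons u us)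
    have "T (u # us @ i # vs) = T (u # i # us @ vs)"
      using Cons.IH[of "\<lambda>I. T (u # I)"] Cons.prems[of "u # _"] by simp
    then show ?case using Cons.prems[of "[]"] by simp
  qed simp
  have "T I = T J"
    if "\<And>us a b vs. T (us @ a # b # vs) = T (us @ b # a # vs)" "mset I = mset J"
    for I J and T :: "'a list \<Rightarrow> 'b"
    using that
  proof (induction I arbitrary: T J)
    case (Cons i I)
    have "i \<in> set J" using Cons.prems(2) by (metis list.set_intros(1) set_mset_mset)
    then obtain us vs where J: "J = us @ i # vs" by (meson split_list)
    have "T (i # I) = T (i # us @ vs)"
      using Cons.IH[of "\<lambda>I. T (i # I)" "us @ vs"] Cons.prems(1)[of "i # _"] Cons.prems(2) J by simp
    then show ?case using mv[of T us i vs] Cons.prems(1) J by simp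
  qed simp
  then show ?thesis using assms by (simp add: msym_def)
qed

lemma finite_lists_length [simp]: "finite {I :: 'm::finite list. length I = k}"
  using finite_lists_length_eq[of "UNIV :: 'm set" k] by simp

lemma finite_lists_length_le [simp]: "finite {I :: 'm::finite list. length I \<le> k}"
  using finite_lists_length_le[of "UNIV :: 'm set" k] by simp

lemma tensor_rep_Nil [simp]: "tensor_rep A T [] = 0"
  by (simp add: tensor_rep_def)

lemma tensor_rep_Cons:
  "tensor_rep A T (i # I) = (\<Sum>j\<in>UNIV. A $ i $ j * T (j # I)) + tensor_rep A (\<lambda>I. T (i # I)) I"
  by (simp add: tensor_rep_def sum.lessThan_Suc_shift del: sum.lessThan_Suc)

lemma tensor_rep_append:
  "tensor_rep A T (I @ J) = tensor_rep A (\<lambda>K. T (K @ J)) I + tensor_rep A (\<lambda>K. T (I @ K)) J"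
  by (induction I arbitrary: T) (auto simp: tensor_rep_Cons)

lemma tensor_rep_cong:
  "(\<And>K. length K = length I \<Longrightarrow> T K = T' K) \<Longrightarrow> tensor_rep A T I = tensor_rep A T' I"
  by (simp add: tensor_rep_def)

lemma tensor_rep_zero [simp]: "tensor_rep A (\<lambda>_. 0) I = 0" "tensor_rep 0 T I = 0"
  by (simp_all add: tensor_rep_def)

lemma tensor_rep_add: "tensor_rep A (\<lambda>I. S I + T I) I = tensor_rep A S I + tensor_rep A T I"
  by (simp add: tensor_rep_def sum.distrib algebra_simps)

lemma tensor_rep_diff: "tensor_rep A (\<lambda>I. S I - T I) I = tensor_rep A S I - tensor_rep A T I"
  by (simp add: tensor_rep_def sum_subtractf algebra_simps)

lemma tensor_rep_scale: "tensor_rep A (\<lambda>I. r * T I) I = r * tensor_rep A T I"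
  by (simp add: tensor_rep_def sum_distrib_left mult_ac)

lemma tensor_rep_sum:
  "tensor_rep A (\<lambda>I. \<Sum>s\<in>S. T s I) I = (\<Sum>s\<in>S. tensor_rep A (T s) I)"
  by (induction S rule: infinite_finite_induct) (auto simp: tensor_rep_add)

lemma tensor_rep_mat_add: "tensor_rep (A + B) T I = tensor_rep A T I + tensor_rep B T I"
  by (simp add: tensor_rep_def sum.distrib algebra_simps)

lemma tensor_rep_mat_diff: "tensor_rep (A - B) T I = tensor_rep A T I - tensor_rep B T I"
  by (simp add: tensor_rep_def sum_subtractf algebra_simps)

lemma tensor_rep_mat_scale: "tensor_rep (r *\<^sub>R A) T I = r * tensor_rep A T I"
  by (simp add: tensor_rep_def sum_distrib_left mult_ac)

lemma tensor_rep_mat_sum: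
  "tensor_rep (\<Sum>s\<in>S. A s) T I = (\<Sum>s\<in>S. tensor_rep (A s) T I)"
  by (induction S rule: infinite_finite_induct) (auto simp: tensor_rep_mat_add)

lemma sum_delta_mult:
  fixes f :: "'m::finite \<Rightarrow> real"
  shows "(\<Sum>j\<in>UNIV. (if i = j then 1 else 0) * f j) = f i"
    "(\<Sum>j\<in>UNIV. (if j = i then 1 else 0) * f j) = f i"
  by (subst sum.remove[of UNIV i]; auto intro!: sum.neutral)+

lemma tensor_rep_mat_1: "tensor_rep (mat 1) T I = real (length I) * T I"
  by (induction I arbitrary: T) (simp_all add: tensor_rep_Cons mat_def sum_delta_mult distrib_right)

lemma tensor_rep_comm:
  "tensor_rep A (tensor_rep B T) I - tensor_rep B (tensor_rep A T) I =
     tensor_rep (A ** B - B ** A) T I"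
proof (induction I arbitrary: T)
  case (Cons i I)
  have 1: "tensor_rep A (tensor_rep B T) (i # I) =
      (\<Sum>j\<in>UNIV. (A ** B) $ i $ j * T (j # I)) + (\<Sum>j\<in>UNIV. A $ i $ j * tensor_rep B (\<lambda>I. T (j # I)) I)
      + (\<Sum>j\<in>UNIV. B $ i $ j * tensor_rep A (\<lambda>I. T (j # I)) I)
      + tensor_rep A (tensor_rep B (\<lambda>I. T (i # I))) I" for A B
  proof -
    have "(\<Sum>j\<in>UNIV. (A ** B) $ i $ j * T (j # I)) =
        (\<Sum>j\<in>UNIV. A $ i $ j * (\<Sum>k\<in>UNIV. B $ j $ k * T (k # I)))"
      unfolding matrix_matrix_mult_def
      by (simp add: sum_distrib_left sum_distrib_right mult.assoc) (rule sum.swap)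
    then show ?thesis
      by (simp add: tensor_rep_Cons tensor_rep_add tensor_rep_sum tensor_rep_scale sum.distrib
          distrib_left)
  qed
  show ?case
    unfolding 1 using Cons[of "\<lambda>I. T (i # I)"]
    by (simp add: tensor_rep_Cons left_diff_distrib sum_subtractf algebra_simps)
qed simp

lemma msym_tensor_rep:
  assumes "msym T"
  shows "msym (tensor_rep A T)"
proof (rule msymI)
  have s: "T I = T J" if "mset I = mset J" for I J
    by (rule msymD[OF assms that])
  have c: "T (I @ a # b # J) = T (I @ b # a # J)" for I J a b by (rule s) simp
  fix us a b vs
  show "tensor_rep A T (us @ a # b # vs) = tensor_rep A T (us @ b # a # vs)"
  proof -
    have 1: "tensor_rep A (\<lambda>K. T (K @ a # b # vs)) us = tensor_rep A (\<lambda>K. T (K @ b # a # vs)) us"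
      by (intro tensor_rep_cong c)
    have 2: "(\<Sum>j\<in>UNIV. A $ i $ j * T (us @ j # k # vs)) = (\<Sum>j\<in>UNIV. A $ i $ j * T (us @ k # j # vs))" for i k
      by (intro sum.cong refl arg_cong2[where f = "(*)"] c)
    have 3: "tensor_rep A (\<lambda>K. T (us @ a # b # K)) vs = tensor_rep A (\<lambda>K. T (us @ b # a # K)) vs"
      by (intro tensor_rep_cong c)
    show ?thesis
      using 1 2[of a b] 2[of b a] 3 by (simp add: tensor_rep_append tensor_rep_Cons)
  qed
qed

lemma sum_nth_count: "(\<Sum>r<length I. g (I ! r)) = (\<Sum>a\<in>UNIV. real (count (mset I) a) * g a)"
  for I :: "'m::finite list" and g :: "'m \<Rightarrow> real"
proof (induction I)
  case (Cons i I)
  have "(\<Sum>a\<in>UNIV. real (count (mset (i # I)) a) * g a) =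
      (\<Sum>a\<in>UNIV. real (count (mset I) a) * g a + (if a = i then 1 else 0) * g a)"
    by (intro sum.cong) (auto simp: algebra_simps)
  then show ?case
    using Cons by (simp add: sum.distrib sum_delta_mult sum.lessThan_Suc_shift del: sum.lessThan_Suc)
qed simp

lemma tensor_rep_msym:
  assumes "msym T"
  shows "tensor_rep A T I =
    (\<Sum>a\<in>UNIV. real (count (mset I) a) * (\<Sum>j\<in>UNIV. A $ a $ j * T (j # remove1 a I)))"
proof -
  have "T (I[r := j]) = T (j # remove1 (I ! r) I)" if "r < length I" for r j
  proof -
    have "mset (I[r := j]) = mset (j # remove1 (I ! r) I)"
      using that by (simp add: mset_update)
    then show ?thesis by (rule msymD[OF assms])
  qed
  then show ?thesis
    unfolding tensor_rep_def
    using sum_nth_count[of "\<lambda>a. \<Sum>j\<in>UNIV. A $ a $ j * T (j # remove1 a I)" I] by simp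
qed

text \<open>
  The number of permutations that carry \<open>I\<close> to \<open>J\<close>; it is the pairing of the monomials
  \<open>\<xi>\<^sup>I\<close> and \<open>x\<^sup>J\<close>.
\<close>

definition perm :: "'m::finite list \<Rightarrow> 'm list \<Rightarrow> real" where
  "perm I J = (if mset I = mset J then \<Prod>i\<in>UNIV. fact (count (mset J) i) else 0)"

lemma perm_sym: "perm I J = perm J I"
  by (simp add: perm_def)

lemma msym_perm: "msym (\<lambda>I. perm I J)" "msym (perm I)"
  by (auto simp: msym_def perm_def)

lemma perm_length: "length I \<noteq> length J \<Longrightarrow> perm I J = 0"
  by (auto simp: perm_def dest: arg_cong[where f = size])

lemma perm_Nil: "perm [] L = (if L = [] then 1 else 0)"
  by (simp add: perm_def)

lemma perm_Cons: "perm (i # I) L = count (mset L) i * perm I (remove1 i L)"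
proof (cases "i \<in> set L")
  case True
  have "mset (i # I) = mset L \<longleftrightarrow> mset I = mset (remove1 i L)"
    using True by (metis mset.simps(2) mset_remove1 add_mset_remove_trivial
        insert_DiffM set_mset_mset)
  moreover have "(\<Prod>j\<in>UNIV. fact (count (mset L) j)) =
      (count (mset L) i * (\<Prod>j\<in>UNIV. fact (count (mset (remove1 i L)) j)) :: real)"
  proof -
    have "(\<Prod>j\<in>UNIV. fact (count (mset L) j)) =
        (fact (count (mset L) i) * (\<Prod>j\<in>UNIV - {i}. fact (count (mset L) j)) :: real)"
      by (simp add: prod.remove)
    moreover have "(\<Prod>j\<in>UNIV. fact (count (mset (remove1 i L)) j)) =
        (fact (count (mset L) i - 1) * (\<Prod>j\<in>UNIV - {i}. fact (count (mset L) j)) :: real)"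
      by (simp add: prod.remove[of UNIV i])
    moreover have "(fact (count (mset L) i) :: real) = count (mset L) i * fact (count (mset L) i - 1)"
      using True by (simp add: fact_reduce count_greater_zero_iff)
    ultimately show ?thesis by (simp add: mult.assoc)
  qed
  ultimately show ?thesis by (simp add: perm_def)
next
  case False
  then have "count (mset L) i = 0" by (simp add: count_eq_zero_iff)
  moreover have "mset (i # I) \<noteq> mset L" using False by (metis list.set_intros(1) set_mset_mset)
  ultimately show ?thesis by (simp add: perm_def)
qed

text \<open>
  Invariance of the pairing under the general linear algebra.
\<close>

lemma perm_adjoint:
  "tensor_rep A (\<lambda>I. perm I J) I = tensor_rep (transpose A) (perm I) J"
proof -
  have *: "count (mset I) a * perm (j # remove1 a I) J = count (mset J) j * perm I (a # remove1 j J)" for a j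
    using perm_Cons[of j "remove1 a I" J] perm_Cons[of a "remove1 j J" I]
    by (simp add: perm_sym[of I] perm_sym[of "remove1 j J"])
  have "tensor_rep A (\<lambda>I. perm I J) I =
     (\<Sum>a\<in>UNIV. \<Sum>j\<in>UNIV. A $ a $ j * (count (mset I) a * perm (j # remove1 a I) J))"
    by (subst tensor_rep_msym[OF msym_perm(1)]) (simp add: sum_distrib_left mult_ac)
  also have "\<dots> = (\<Sum>a\<in>UNIV. \<Sum>j\<in>UNIV. A $ a $ j * (count (mset J) j * perm I (a # remove1 j J)))"
    by (simp only: *)
  also have "\<dots> = (\<Sum>j\<in>UNIV. \<Sum>a\<in>UNIV. A $ a $ j * (count (mset J) j * perm I (a # remove1 j J)))"
    by (rule sum.swap)
  also have "\<dots> = tensor_rep (transpose A) (perm I) J"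
    by (subst tensor_rep_msym[OF msym_perm(2)]) (simp add: sum_distrib_left mult_ac transpose_def)
  finally show ?thesis .
qed

lemma sum_perm:
  assumes "msym G" "length L = k"
  shows "(\<Sum>I | length I = k. perm I L * G I) = fact k * G L"
proof -
  have s: "{I. mset I = mset L} \<subseteq> {I. length I = k}"
    using assms(2) by (metis (mono_tags, lifting) mem_Collect_eq size_mset subsetI)
  have "(\<Sum>I | length I = k. perm I L * G I) = (\<Sum>I | mset I = mset L. perm I L * G I)"
    by (rule sum.mono_neutral_right) (use s in \<open>auto simp: perm_def\<close>)
  also have "\<dots> = (\<Sum>I | mset I = mset L. (\<Prod>i\<in>UNIV. fact (count (mset L) i)) * G L)"
    by (intro sum.cong refl arg_cong2[where f = "(*)"]) (auto simp: perm_def intro: msymD[OF assms(1)])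
  also have "\<dots> = real (card (permutations_of_multiset (mset L)) *
      (\<Prod>i\<in>UNIV. fact (count (mset L) i))) * G L"
    by (simp add: permutations_of_multiset_def)
  also have "(\<Prod>i\<in>UNIV. fact (count (mset L) i)) =
      (\<Prod>i\<in>set_mset (mset L). fact (count (mset L) i) :: nat)"
  proof -
    have "fact (count (mset L) i) = (1::nat)" if "i \<notin> set L" for i
      using that by (metis count_eq_zero_iff fact_0 set_mset_mset)
    then show ?thesis by (intro prod.mono_neutral_right) auto
  qed
  also have "card (permutations_of_multiset (mset L)) *
      (\<Prod>i\<in>set_mset (mset L). fact (count (mset L) i)) = fact k"
    using card_permutations_of_multiset_aux[of "mset L"] assms(2) by simp
  finally show ?thesis by simp
qed

definition mono_at :: "real^'m \<Rightarrow> 'm list \<Rightarrow> real^'m::finite \<Rightarrow> real" where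
  "mono_at x L y = (\<Prod>i\<leftarrow>L. y $ i - x $ i)"

lemma mono_at_simps [simp]:
  "mono_at x [] = (\<lambda>_. 1)" "mono_at x (i # L) = (\<lambda>y. (y $ i - x $ i) * mono_at x L y)"
  by (simp_all add: mono_at_def fun_eq_iff)

lemma smooth_mono_at [simp]: "smooth (mono_at x L)"
  unfolding mono_at_def[abs_def] by (intro smooth_intros)

lemma msym_mono_at: "msym (\<lambda>L. mono_at x L y)"
  by (rule msymI) (simp add: mono_at_def)

lemma pd_coord_diff: "pd i (\<lambda>y. y $ j - c) = (\<lambda>_. if i = j then 1 else 0)"
  by (simp add: pd_diff pd_coord)

lemma pd_mono_at: "pd i (mono_at x L) = (\<lambda>y. count (mset L) i * mono_at x (remove1 i L) y)"
proof (induction L)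
  case (Cons j L)
  have "pd i (mono_at x (j # L)) =
      (\<lambda>y. (y $ j - x $ j) * (count (mset L) i * mono_at x (remove1 i L) y)
        + (if i = j then 1 else 0) * mono_at x L y)"
    by (simp add: pd_mult smooth_diff pd_coord_diff Cons)
  moreover have "(y $ i - x $ i) * mono_at x (remove1 i L) y = mono_at x L y" if "i \<in> set L" for y
  proof -
    have "mset (i # remove1 i L) = mset L" using that by simp
    then have "mono_at x (i # remove1 i L) y = mono_at x L y"
      by (rule msymD[OF msym_mono_at])
    then show ?thesis by simp
  qed
  then have "real (count (mset L) i) * ((y $ i - x $ i) * mono_at x (remove1 i L) y) =
      real (count (mset L) i) * mono_at x L y" for y
    by (cases "i \<in> set L") (simp_all add: count_eq_zero_iff)
  ultimately show ?case
    by (cases "i = j") (auto simp: fun_eq_iff distrib_right mult.left_commute)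
qed simp

lemma pds_mono_at: "pds \<alpha> (mono_at x L) x = perm \<alpha> L"
proof (induction \<alpha> arbitrary: L)
  case Nil
  then show ?case by (cases L) (auto simp: perm_Nil)
next
  case (Cons i \<alpha>)
  have "pds (i # \<alpha>) (mono_at x L) = pds \<alpha> (\<lambda>y. count (mset L) i * mono_at x (remove1 i L) y)"
    by (simp add: pd_pds pd_mono_at)
  then show ?case by (simp add: pds_cmult Cons perm_Cons)
qed

lemma tensor_rep_mono_at:
  "(\<Sum>i\<in>UNIV. (\<Sum>j\<in>UNIV. A $ i $ j * (y $ j - x $ j)) * pd i (mono_at x L) y) =
    tensor_rep A (\<lambda>L. mono_at x L y) L"
  by (subst tensor_rep_msym[OF msym_mono_at])
    (auto simp: pd_mono_at sum_distrib_left sum_distrib_right mult_ac intro!: sum.cong)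

section \<open>The projective Lie algebra and its Lie derivatives\<close>

type_synonym 'm sl = "(real^'m) \<times> (real^'m^'m) \<times> (real^'m)"

definition outer :: "real^'m \<Rightarrow> real^'m \<Rightarrow> real^'m^'m" where
  "outer u w = (\<chi> i j. u $ i * w $ j)"

definition fld :: "'m::finite sl \<Rightarrow> real^'m \<Rightarrow> real^'m" where
  "fld = (\<lambda>(u, A, w) y. u + A *v y + (w \<bullet> y) *\<^sub>R y)"

definition jac :: "'m::finite sl \<Rightarrow> real^'m \<Rightarrow> real^'m^'m" where
  "jac = (\<lambda>(u, A, w) x. A + (w \<bullet> x) *\<^sub>R mat 1 + outer x w)"

text \<open>The directional derivative of \<^term>\<open>jac\<close>; it does not depend on the base point.\<close>

definition hess :: "'m::finite sl \<Rightarrow> real^'m \<Rightarrow> real^'m^'m" where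
  "hess = (\<lambda>(u, A, w) v. (w \<bullet> v) *\<^sub>R mat 1 + outer v w)"

definition slbr :: "'m::finite sl \<Rightarrow> 'm sl \<Rightarrow> 'm sl" where
  "slbr = (\<lambda>(u, A, w) (v, B, z).
     (B *v u - A *v v,
      B ** A - A ** B + ((z \<bullet> u) *\<^sub>R mat 1 + outer u z) - ((w \<bullet> v) *\<^sub>R mat 1 + outer v w),
      transpose A *v z - transpose B *v w))"

lemma outer_vec: "outer u w *v v = (w \<bullet> v) *\<^sub>R u"
  by (simp add: vec_eq_iff outer_def matrix_vector_mult_def inner_vec_def sum_distrib_left mult_ac)

lemma outer_linear:
  "outer (u + v) w = outer u w + outer v w" "outer u (w + z) = outer u w + outer u z"
  "outer (r *\<^sub>R u) w = r *\<^sub>R outer u w" "outer u (r *\<^sub>R w) = r *\<^sub>R outer u w"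
  by (simp_all add: vec_eq_iff outer_def algebra_simps)

lemma transpose_linear:
  "transpose (A + B) = transpose A + transpose B" "transpose (r *\<^sub>R A) = r *\<^sub>R transpose A"
  for A :: "real^'m^'n"
  by (simp_all add: vec_eq_iff transpose_def)

lemma mv_linear:
  fixes A B :: "real^'m::finite^'n::finite"
  shows "(A + B) *v x = A *v x + B *v x" "(A - B) *v x = A *v x - B *v x"
    "(r *\<^sub>R A) *v x = r *\<^sub>R (A *v x)" "A *v (x + y) = A *v x + A *v y"
    "A *v (x - y) = A *v x - A *v y" "A *v (r *\<^sub>R x) = r *\<^sub>R (A *v x)" "A *v (- x) = - (A *v x)"
    "(r *\<^sub>R y') v* A = r *\<^sub>R (y' v* A)" "y' v* (r *\<^sub>R A) = r *\<^sub>R (y' v* A)"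
  by (simp_all add: vec_eq_iff matrix_vector_mult_def vector_matrix_mult_def distrib_left distrib_right
      left_diff_distrib right_diff_distrib sum.distrib sum_subtractf sum_distrib_left sum_negf mult_ac)

lemmas mv_simps = mv_linear matrix_vector_mul_assoc[symmetric]

lemma mm_simps:
  fixes A B :: "real^'m::finite^'n" and C D :: "real^'k^'m"
  shows "(A + B) ** C = A ** C + B ** C" "A ** (C + D) = A ** C + A ** D"
    "(r *\<^sub>R A) ** C = r *\<^sub>R (A ** C)" "A ** (r *\<^sub>R C) = r *\<^sub>R (A ** C)"
  by (simp_all add: vec_eq_iff matrix_matrix_mult_def algebra_simps sum.distrib sum_distrib_left)

lemma axis_nth: "axis i (c :: real) $ j = (if i = j then c else 0)"
  by (simp add: axis_def)

lemma jac_vec: "jac (u, A, w) x *v v = A *v v + (w \<bullet> x) *\<^sub>R v + (w \<bullet> v) *\<^sub>R x"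
  by (simp add: jac_def mv_simps outer_vec)

lemma hess_vec: "hess (u, A, w) v *v v' = (w \<bullet> v) *\<^sub>R v' + (w \<bullet> v') *\<^sub>R v"
  by (simp add: hess_def mv_simps outer_vec)

lemma hess_sym: "hess g v *v v' = hess g v' *v v"
  by (cases g) (simp add: hess_vec add.commute)

lemma fld_linear: "fld (g + h) y = fld g y + fld h y" "fld (r *\<^sub>R g) y = r *\<^sub>R fld g y"
  by (cases g; cases h; simp add: fld_def mv_simps inner_add_left algebra_simps)+

lemma jac_linear: "jac (g + h) y = jac g y + jac h y" "jac (r *\<^sub>R g) y = r *\<^sub>R jac g y"
  by (cases g; cases h; simp add: jac_def outer_linear inner_add_left algebra_simps)+

lemma fld_br: "fld (slbr g h) x = jac h x *v fld g x - jac g x *v fld h x"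
proof (cases g, cases h)
  fix u A w v B z assume "g = (u, A, w)" "h = (v, B, z)"
  then show ?thesis
    by (simp add: slbr_def fld_def jac_vec mv_simps outer_vec inner_add_left inner_add_right inner_diff_left
        dot_lmul_matrix algebra_simps)
qed

lemma jac_br:
  "jac (slbr g h) x = hess h (fld g x) - hess g (fld h x) - jac g x ** jac h x + jac h x ** jac g x"
proof (cases g, cases h)
  fix u A w v B z assume "g = (u, A, w)" "h = (v, B, z)"
  then have "jac (slbr g h) x *v y = (hess h (fld g x) - hess g (fld h x) - jac g x ** jac h x + jac h x ** jac g x) *v y" for y
    by (simp add: slbr_def fld_def jac_vec hess_vec mv_simps outer_vec inner_add_left inner_add_right
        inner_diff_left dot_lmul_matrix algebra_simps)
  then show ?thesis by (simp add: matrix_eq)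
qed

lemma fld_zero_iff: "(\<forall>y. fld g y = 0) \<longleftrightarrow> g = 0"
proof
  assume *: "\<forall>y. fld g y = 0"
  obtain u A w where g: "g = (u, A, w)" by (cases g)
  have u: "u = 0" using spec[OF *, of 0] by (simp add: g fld_def)
  have 1: "A *v y + (w \<bullet> y) *\<^sub>R y = 0" for y using spec[OF *, of y] by (simp add: g fld_def u)
  have 2: "- (A *v y) + (w \<bullet> y) *\<^sub>R y = 0" for y
    using 1[of "- y"] by (simp add: mv_simps)
  have A: "A *v y = 0" for y
  proof -
    have "2 *\<^sub>R (A *v y) = (A *v y + (w \<bullet> y) *\<^sub>R y) - (- (A *v y) + (w \<bullet> y) *\<^sub>R y)"
      by (simp add: scaleR_2)
    then show ?thesis using 1[of y] 2[of y] by simp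
  qed
  have "A = 0" using A by (simp add: matrix_eq)
  moreover have "w = 0" using 1[of w] A by simp
  ultimately show "g = 0" using u g by (simp add: zero_prod_def)
qed (auto simp: fld_def zero_prod_def)

lemma inj_fld: "inj fld"
proof (rule injI)
  fix g h :: "'m::finite sl" assume "fld g = fld h"
  then have "fld (g + (-1) *\<^sub>R h) y = 0" for y by (simp only: fld_linear) simp
  then have "g + (-1) *\<^sub>R h = 0" using fld_zero_iff by blast
  then show "g = h" by simp
qed

lemma linear_fld: "linear fld"
  by (simp add: linear_lam_iff fun_eq_iff fld_linear scaleR_fun_def)

lemma linear_slbr: "linear (slbr g)" "linear (\<lambda>g. slbr g h)"
  unfolding linear_lam_iff
  by (auto simp: slbr_def mv_simps outer_linear transpose_linear
      inner_add_left inner_add_right mm_simps algebra_simps split: prod.splits)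

lemma slbr_self: "slbr g g = 0"
  by (cases g) (simp add: slbr_def zero_prod_def)

text \<open>
  The Jacobi identity is inherited from vector fields: the second derivatives cancel because
  \<^term>\<open>hess g v *v v'\<close> is symmetric in \<open>v\<close> and \<open>v'\<close>.
\<close>

lemma slbr_jacobi: "slbr x (slbr y z) = slbr (slbr x y) z + slbr y (slbr x z)"
proof -
  have "fld (slbr x (slbr y z)) p = fld (slbr (slbr x y) z + slbr y (slbr x z)) p" for p
    using hess_sym[of z "fld y p" "fld x p"] hess_sym[of y "fld z p" "fld x p"]
      hess_sym[of x "fld z p" "fld y p"]
    by (simp add: fld_linear fld_br jac_br mv_simps algebra_simps)
  then have "fld (slbr x (slbr y z)) = fld (slbr (slbr x y) z + slbr y (slbr x z))" by (rule ext)
  then show ?thesis by (rule injD[OF inj_fld])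
qed

lemma fld_has_derivative: "(fld g has_derivative (\<lambda>v. jac g x *v v)) (at x)"
proof (cases g)
  fix u A w assume g: "g = (u, A, w)"
  have "((\<lambda>y. u + A *v y + (w \<bullet> y) *\<^sub>R y) has_derivative
      (\<lambda>v. 0 + A *v v + ((w \<bullet> x) *\<^sub>R v + (w \<bullet> v) *\<^sub>R x))) (at x)"
    by (auto intro!: derivative_eq_intros
        bounded_linear_imp_has_derivative[OF matrix_vector_mul_bounded_linear])
  then show ?thesis
    by (rule has_derivative_transform_within[OF has_derivative_eq_rhs, where d = 1])
      (auto simp: g fld_def jac_vec)
qed

lemma jacobian_fld: "jacobian (fld g) (at x) = jac g x"
  unfolding jacobian_def frechet_derivative_at[OF fld_has_derivative, symmetric]
  by (rule matrix_of_matrix_vector_mul)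

lemma lie_bracket_fld: "lie_bracket (fld g) (fld h) = fld (slbr g h)"
  by (simp add: fun_eq_iff lie_bracket_def fld_br frechet_derivative_at[OF fld_has_derivative, symmetric])

lemma fld_nth: "fld (u, A, w) x $ i = u $ i + (\<Sum>j\<in>UNIV. A $ i $ j * x $ j) + (\<Sum>j\<in>UNIV. w $ j * x $ j) * x $ i"
  by (simp add: fld_def matrix_vector_mult_def inner_vec_def)

lemma jac_nth: "jac (u, A, w) x $ i $ j = A $ i $ j + (\<Sum>j\<in>UNIV. w $ j * x $ j) * mat 1 $ i $ j + x $ i * w $ j"
  by (simp add: jac_def outer_def inner_vec_def)

lemma smooth_fld: "smooth (\<lambda>x. fld g x $ i)"
  by (cases g) (simp only: fld_nth, intro smooth_intros)

lemma smooth_jac: "smooth (\<lambda>x. jac g x $ i $ j)"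
  by (cases g) (simp only: jac_nth, intro smooth_intros)

lemma pd_fld: "pd i (\<lambda>x. fld g x $ j) x = jac g x $ j $ i"
proof -
  have "((\<lambda>x. fld g x $ j) has_derivative (\<lambda>v. (jac g x *v v) $ j)) (at x)"
    by (rule bounded_linear.has_derivative[OF bounded_linear_vec_nth fld_has_derivative])
  from pd_eqI[OF this, of i] show ?thesis
    by (simp add: matrix_vector_mult_basis column_def)
qed

lemma pd_jac: "pd k (\<lambda>x. jac g x $ i $ j) = (\<lambda>_. hess g (axis k 1) $ i $ j)"
proof (cases g)
  fix u A w assume g: "g = (u, A, w)"
  show ?thesis
    unfolding g jac_nth
    by (simp add: pd_add pd_mult pd_sum smooth_intros pd_coord hess_def outer_def inner_axis fun_eq_iff)
      (simp add: axis_def mult.commute[of _ "if _ then _ else _"] sum_delta_mult)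
qed

lemma fld_range: "range fld = (sl_fields :: (real^'m::finite \<Rightarrow> real^'m) set)"
proof
  let ?G = "range (\<lambda>i. \<lambda>x. axis i 1) \<union> range (\<lambda>(i, j). \<lambda>x. (x $ j) *\<^sub>R axis i 1)
      \<union> range (\<lambda>j. \<lambda>x. (x $ j) *\<^sub>R x) :: (real^'m \<Rightarrow> real^'m) set"
  show "range fld \<subseteq> (sl_fields :: (real^'m \<Rightarrow> real^'m) set)"
  proof
    fix X :: "real^'m \<Rightarrow> real^'m" assume "X \<in> range fld"
    then obtain u A w where X: "X = fld (u, A, w)" by auto
    have "X = (\<Sum>i\<in>UNIV. u $ i *\<^sub>R (\<lambda>x. axis i 1))
        + (\<Sum>i\<in>UNIV. \<Sum>j\<in>UNIV. A $ i $ j *\<^sub>R (\<lambda>x. (x $ j) *\<^sub>R axis i 1))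
        + (\<Sum>j\<in>UNIV. w $ j *\<^sub>R (\<lambda>x. (x $ j) *\<^sub>R x))"
      unfolding X
    proof (intro ext, simp only: vec_eq_iff, intro allI)
      fix x :: "real^'m" and k
      have "(\<Sum>i\<in>UNIV. \<Sum>j\<in>UNIV. A $ i $ j * (x $ j * (if k = i then 1 else 0))) =
          (\<Sum>i\<in>UNIV. (if k = i then 1 else 0) * (\<Sum>j\<in>UNIV. A $ i $ j * x $ j))"
        by (simp add: sum_distrib_left mult_ac)
      then show "fld (u, A, w) x $ k = ((\<Sum>i\<in>UNIV. u $ i *\<^sub>R (\<lambda>x. axis i 1))
        + (\<Sum>i\<in>UNIV. \<Sum>j\<in>UNIV. A $ i $ j *\<^sub>R (\<lambda>x. (x $ j) *\<^sub>R axis i 1))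
        + (\<Sum>j\<in>UNIV. w $ j *\<^sub>R (\<lambda>x. (x $ j) *\<^sub>R x))) x $ k"
        by (simp add: sum_fun_apply scaleR_fun_def fld_nth axis_def sum_delta_mult
            mult.commute[of "u $ _"] sum_distrib_right mult.assoc)
    qed
    also have "\<dots> \<in> span ?G"
      by (intro span_add span_sum span_scale span_base) auto
    finally show "X \<in> sl_fields" by (simp add: sl_fields_def)
  qed
  show "(sl_fields :: (real^'m \<Rightarrow> real^'m) set) \<subseteq> range fld"
    unfolding sl_fields_def
  proof (rule span_minimal)
    show "real_subspace (range fld)"
      using linear_fld linear_subspace_image[OF linear_fld subspace_UNIV] by simp
    have "(\<lambda>x. axis i 1) = fld (axis i 1, 0, 0)" for i :: 'm
      by (simp add: fld_def fun_eq_iff)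
    moreover have "(\<lambda>x. (x $ j) *\<^sub>R axis i 1) = fld (0, outer (axis i 1) (axis j 1), 0)" for i j :: 'm
      by (simp add: fld_def fun_eq_iff outer_vec inner_axis')
    moreover have "(\<lambda>x. (x $ j) *\<^sub>R x) = fld (0, 0, axis j 1)" for j :: 'm
      by (simp add: fld_def fun_eq_iff inner_axis')
    ultimately show "?G \<subseteq> range fld" by auto
  qed
qed

subsection \<open>The Lie derivative is a representation\<close>

definition vd :: "real^'m::finite \<Rightarrow> (real^'m \<Rightarrow> real) \<Rightarrow> real^'m \<Rightarrow> real" where
  "vd v f x = (\<Sum>i\<in>UNIV. v $ i * pd i f x)"

lemma lie_deriv_fld:
  "lie_deriv \<delta> (fld g) P x I = vd (fld g x) (\<lambda>y. P y I) x - tensor_rep (jac g x) (P x) I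
     + \<delta> * trace (jac g x) * P x I"
  by (simp add: lie_deriv_def jacobian_fld vd_def)

lemma vd_rules:
  assumes "smooth f" "smooth h"
  shows "vd v (\<lambda>x. f x + h x) x = vd v f x + vd v h x"
    "vd v (\<lambda>x. f x - h x) x = vd v f x - vd v h x"
    "vd v (\<lambda>x. f x * h x) x = f x * vd v h x + vd v f x * h x"
    "vd v (\<lambda>x. c * f x) x = c * vd v f x"
  using assms
  by (simp_all add: vd_def pd_add pd_diff pd_mult pd_cmult sum.distrib sum_subtractf
      sum_distrib_left sum_distrib_right algebra_simps)

lemma vd_const [simp]: "vd v (\<lambda>_. c) x = 0"
  by (simp add: vd_def)

lemma vd_sum: "(\<And>a. a \<in> A \<Longrightarrow> smooth (f a)) \<Longrightarrow> vd v (\<lambda>x. \<Sum>a\<in>A. f a x) x = (\<Sum>a\<in>A. vd v (f a) x)"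
  by (simp add: vd_def pd_sum sum_distrib_left) (rule sum.swap)

lemma vd_linear:
  "vd (u + v) f x = vd u f x + vd v f x" "vd (u - v) f x = vd u f x - vd v f x"
  "vd (r *\<^sub>R v) f x = r * vd v f x" "vd 0 f x = 0"
  by (simp_all add: vd_def sum.distrib sum_subtractf sum_distrib_left algebra_simps)

lemma smooth_vd: "smooth f \<Longrightarrow> (\<And>i. smooth (\<lambda>x. v x $ i)) \<Longrightarrow> smooth (\<lambda>x. vd (v x) f x)"
  unfolding vd_def by (intro smooth_intros)

lemma smooth_tensor_rep:
  "(\<And>i j. smooth (\<lambda>x. A x $ i $ j)) \<Longrightarrow> (\<And>I. smooth (\<lambda>x. T x I)) \<Longrightarrow>
    smooth (\<lambda>x. tensor_rep (A x) (T x) I)"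
  unfolding tensor_rep_def by (intro smooth_intros)

lemma smooth_trace_jac: "smooth (\<lambda>x. trace (jac g x))"
  unfolding trace_def by (intro smooth_sum smooth_jac)

lemma vd_jac: "vd v (\<lambda>x. jac g x $ i $ j) x = hess g v $ i $ j"
proof (cases g)
  fix u A w assume g: "g = (u, A, w)"
  have "vd v (\<lambda>x. jac g x $ i $ j) x = (\<Sum>k\<in>UNIV. v $ k * hess g (axis k 1) $ i $ j)"
    by (simp add: vd_def pd_jac)
  also have "\<dots> = (\<Sum>k\<in>UNIV. v $ k * w $ k * mat 1 $ i $ j + (if i = k then 1 else 0) * (v $ k * w $ j))"
    unfolding g by (intro sum.cong) (auto simp: hess_def outer_def inner_axis algebra_simps axis_nth)
  also have "\<dots> = hess g v $ i $ j"
    unfolding g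
    by (simp add: sum.distrib hess_def outer_def inner_vec_def mult.commute[of "w $ _"]
        sum_delta_mult flip: sum_distrib_right)
  finally show ?thesis .
qed

lemma vd_tensor_rep:
  assumes "\<And>I. smooth (\<lambda>x. T x I)"
  shows "vd v (\<lambda>x. tensor_rep (jac g x) (T x) I) x =
    tensor_rep (hess g v) (T x) I + tensor_rep (jac g x) (\<lambda>I. vd v (\<lambda>y. T y I) x) I"
  unfolding tensor_rep_def
  by (simp add: vd_sum smooth_intros smooth_jac assms vd_rules vd_jac sum.distrib)

lemma vd_trace_jac: "vd v (\<lambda>x. trace (jac g x)) x = trace (hess g v)"
  unfolding trace_def by (simp add: vd_sum smooth_jac vd_jac)

lemma vd_vd_fld:
  assumes "smooth f"
  shows "vd v (\<lambda>y. vd (fld h y) f y) x =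
    vd (jac h x *v v) f x + (\<Sum>i\<in>UNIV. \<Sum>j\<in>UNIV. v $ i * fld h x $ j * pd i (pd j f) x)"
proof -
  have "vd v (\<lambda>y. vd (fld h y) f y) x = (\<Sum>j\<in>UNIV. fld h x $ j * vd v (pd j f) x)
      + (\<Sum>j\<in>UNIV. vd v (\<lambda>y. fld h y $ j) x * pd j f x)"
    unfolding vd_def[of "fld h _"]
    by (simp add: vd_sum smooth_intros smooth_fld assms vd_rules smooth_pd sum.distrib)
  also have "(\<Sum>j\<in>UNIV. fld h x $ j * vd v (pd j f) x) =
      (\<Sum>i\<in>UNIV. \<Sum>j\<in>UNIV. v $ i * fld h x $ j * pd i (pd j f) x)"
    unfolding vd_def by (subst sum.swap) (simp add: sum_distrib_left mult_ac)
  also have "(\<Sum>j\<in>UNIV. vd v (\<lambda>y. fld h y $ j) x * pd j f x) = vd (jac h x *v v) f x"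
    by (simp add: vd_def pd_fld matrix_vector_mult_def sum_distrib_right mult_ac)
  finally show ?thesis by simp
qed

lemma smooth_lie_deriv:
  assumes "\<And>I. smooth (\<lambda>x. P x I)"
  shows "smooth (\<lambda>x. lie_deriv \<delta> (fld g) P x I)"
  unfolding lie_deriv_fld
  by (intro smooth_intros smooth_vd smooth_tensor_rep smooth_trace_jac smooth_jac smooth_fld assms)

lemma lie_deriv_comm:
  assumes P: "\<And>I. smooth (\<lambda>x. P x I)"
  shows "lie_deriv \<delta> (fld g) (lie_deriv \<delta> (fld h) P) x I
      - lie_deriv \<delta> (fld h) (lie_deriv \<delta> (fld g) P) x I = lie_deriv \<delta> (fld (slbr g h)) P x I"
proof -
  let ?f = "\<lambda>y. P y I"
  define S where "S = (\<lambda>v w. \<Sum>i\<in>UNIV. \<Sum>j\<in>UNIV. v $ i * w $ j * pd i (pd j ?f) x)"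
  have S: "S v w = S w v" for v w
    unfolding S_def by (subst sum.swap) (simp add: pd_commute[OF P] mult_ac)
  have 1: "lie_deriv \<delta> (fld g) (lie_deriv \<delta> (fld h) P) x I =
      vd (jac h x *v fld g x) ?f x + S (fld g x) (fld h x)
      - tensor_rep (hess h (fld g x)) (P x) I - tensor_rep (jac h x) (\<lambda>I. vd (fld g x) (\<lambda>y. P y I) x) I
      + \<delta> * (trace (hess h (fld g x)) * P x I + trace (jac h x) * vd (fld g x) ?f x)
      - tensor_rep (jac g x) (\<lambda>I. vd (fld h x) (\<lambda>y. P y I) x) I
      + tensor_rep (jac g x) (tensor_rep (jac h x) (P x)) I
      - \<delta> * trace (jac h x) * tensor_rep (jac g x) (P x) I
      + \<delta> * trace (jac g x) * (vd (fld h x) ?f x - tensor_rep (jac h x) (P x) I + \<delta> * trace (jac h x) * P x I)"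
    for g h
  proof -
    have v: "vd (fld g x) (\<lambda>y. lie_deriv \<delta> (fld h) P y I) x =
        vd (jac h x *v fld g x) ?f x + S (fld g x) (fld h x)
        - (tensor_rep (hess h (fld g x)) (P x) I + tensor_rep (jac h x) (\<lambda>I. vd (fld g x) (\<lambda>y. P y I) x) I)
        + \<delta> * (trace (jac h x) * vd (fld g x) ?f x + trace (hess h (fld g x)) * P x I)"
      unfolding lie_deriv_fld mult.assoc
      by (simp add: vd_rules vd_vd_fld vd_tensor_rep vd_trace_jac smooth_intros smooth_vd smooth_tensor_rep
          smooth_trace_jac smooth_jac smooth_fld P S_def)
    have t: "tensor_rep (jac g x) (lie_deriv \<delta> (fld h) P x) I =
        tensor_rep (jac g x) (\<lambda>I. vd (fld h x) (\<lambda>y. P y I) x) I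
        - tensor_rep (jac g x) (tensor_rep (jac h x) (P x)) I
        + \<delta> * trace (jac h x) * tensor_rep (jac g x) (P x) I"
    proof -
      have "lie_deriv \<delta> (fld h) P x = (\<lambda>I. vd (fld h x) (\<lambda>y. P y I) x - tensor_rep (jac h x) (P x) I
         + \<delta> * trace (jac h x) * P x I)"
        by (simp add: fun_eq_iff lie_deriv_fld)
      then show ?thesis by (simp add: tensor_rep_add tensor_rep_diff tensor_rep_scale)
    qed
    show ?thesis
      unfolding lie_deriv_fld[of \<delta> g] v t unfolding lie_deriv_fld by (simp add: algebra_simps)
  qed
  have tr: "trace (jac g x ** jac h x) = trace (jac h x ** jac g x)"
    by (rule trace_mul_sym)
  have 2: "lie_deriv \<delta> (fld (slbr g h)) P x I =
      vd (jac h x *v fld g x) ?f x - vd (jac g x *v fld h x) ?f x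
      - tensor_rep (hess h (fld g x)) (P x) I + tensor_rep (hess g (fld h x)) (P x) I
      + (tensor_rep (jac g x) (tensor_rep (jac h x) (P x)) I - tensor_rep (jac h x) (tensor_rep (jac g x) (P x)) I)
      + \<delta> * (trace (hess h (fld g x)) - trace (hess g (fld h x))) * P x I"
    unfolding lie_deriv_fld fld_br jac_br vd_linear tensor_rep_comm
    using tr by (simp add: tensor_rep_mat_add tensor_rep_mat_diff trace_add trace_sub)
  show ?thesis
    unfolding 1 2 using S[of "fld g x" "fld h x"] by (simp add: algebra_simps)
qed

section \<open>Differential operators and their symbols\<close>

lemma sym_fields_iff:
  "P \<in> sym_fields p \<longleftrightarrow> (\<forall>x I. length I \<noteq> p \<longrightarrow> P x I = 0) \<and> (\<forall>x. msym (P x)) \<and> (\<forall>I. smooth (\<lambda>x. P x I))"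
  unfolding sym_fields_def sym_tensors_def msym_def by blast

lemma sym_fieldsD:
  assumes "P \<in> sym_fields p"
  shows "length I \<noteq> p \<Longrightarrow> P x I = 0" "msym (P x)" "smooth (\<lambda>x. P x I)"
  using assms by (auto simp: sym_fields_iff)

lemma msym_add: "msym S \<Longrightarrow> msym T \<Longrightarrow> msym (\<lambda>I. S I + T I)"
  and msym_diff: "msym S' \<Longrightarrow> msym T' \<Longrightarrow> msym (\<lambda>I. S' I - T' I)"
  and msym_scale: "msym T'' \<Longrightarrow> msym (\<lambda>I. r * T'' I)"
  and msym_const: "msym (\<lambda>_. c)"
  unfolding msym_def by metis+

lemma subspace_sym_fields: "real_subspace (sym_fields p)"
  unfolding real_vector.subspace_def
  by (auto simp: sym_fields_iff zero_fun_def plus_fun_def scaleR_fun_def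
      intro: msym_add msym_scale msym_const smooth_intros)

lemmas sym_fields_closed = subspace_0[OF subspace_sym_fields] subspace_add[OF subspace_sym_fields]
  subspace_diff[OF subspace_sym_fields] subspace_scale[OF subspace_sym_fields]

lemma lie_deriv_in:
  assumes "P \<in> sym_fields p"
  shows "lie_deriv \<delta> (fld g) P \<in> sym_fields p"
  unfolding sym_fields_iff
proof (intro conjI allI impI)
  note P = sym_fieldsD[OF assms]
  show "lie_deriv \<delta> (fld g) P x I = 0" if "length I \<noteq> p" for x I
  proof -
    have "tensor_rep (jac g x) (P x) I = tensor_rep (jac g x) (\<lambda>_. 0) I"
      using that by (intro tensor_rep_cong) (simp add: P(1))
    moreover have "(\<lambda>y. P y I) = (\<lambda>_. 0)" using that by (simp add: P(1))
    ultimately show ?thesis using that by (simp add: lie_deriv_fld P(1))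
  qed
  show "msym (lie_deriv \<delta> (fld g) P x)" for x
  proof -
    have "msym (\<lambda>I. vd (fld g x) (\<lambda>y. P y I) x)"
      unfolding msym_def
    proof (intro allI impI)
      fix I J :: "'a list" assume "mset I = mset J"
      then have "(\<lambda>y. P y I) = (\<lambda>y. P y J)" by (auto intro: msymD[OF P(2)])
      then show "vd (fld g x) (\<lambda>y. P y I) x = vd (fld g x) (\<lambda>y. P y J) x" by simp
    qed
    then show ?thesis
      unfolding lie_deriv_fld by (intro msym_add msym_diff msym_scale msym_tensor_rep P)
  qed
  show "smooth (\<lambda>x. lie_deriv \<delta> (fld g) P x I)" for I
    by (rule smooth_lie_deriv) (rule P)
qed

lemma lie_deriv_linear:
  assumes "P \<in> sym_fields p" "Q \<in> sym_fields p"
  shows "lie_deriv \<delta> (fld g) (P + Q) = lie_deriv \<delta> (fld g) P + lie_deriv \<delta> (fld g) Q"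
    "lie_deriv \<delta> (fld g) (P - Q) = lie_deriv \<delta> (fld g) P - lie_deriv \<delta> (fld g) Q"
    "lie_deriv \<delta> (fld g) (r *\<^sub>R P) = r *\<^sub>R lie_deriv \<delta> (fld g) P"
proof -
  note s = sym_fieldsD(3)[OF assms(1)] sym_fieldsD(3)[OF assms(2)]
  have "S + T = (\<lambda>I. S I + T I)" "S - T = (\<lambda>I. S I - T I)" "r *\<^sub>R S = (\<lambda>I. r * S I)"
    for S T :: "'a list \<Rightarrow> real"
    by (auto simp: scaleR_fun_def)
  then have e: "tensor_rep A (S + T) I = tensor_rep A S I + tensor_rep A T I"
    "tensor_rep A (S - T) I = tensor_rep A S I - tensor_rep A T I" for A and S T :: "'a list \<Rightarrow> real" and I
    by (simp_all add: tensor_rep_add tensor_rep_diff)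
  show "lie_deriv \<delta> (fld g) (P + Q) = lie_deriv \<delta> (fld g) P + lie_deriv \<delta> (fld g) Q"
    "lie_deriv \<delta> (fld g) (P - Q) = lie_deriv \<delta> (fld g) P - lie_deriv \<delta> (fld g) Q"
    "lie_deriv \<delta> (fld g) (r *\<^sub>R P) = r *\<^sub>R lie_deriv \<delta> (fld g) P"
    by (simp_all add: fun_eq_iff lie_deriv_fld e vd_rules s tensor_rep_add tensor_rep_diff
        tensor_rep_scale scaleR_fun_def algebra_simps)
qed

lemma lie_deriv_field_linear:
  "lie_deriv \<delta> (fld (g + h)) P = lie_deriv \<delta> (fld g) P + lie_deriv \<delta> (fld h) P"
  "lie_deriv \<delta> (fld (r *\<^sub>R g)) P = r *\<^sub>R lie_deriv \<delta> (fld g) P"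
  by (simp_all add: fun_eq_iff lie_deriv_fld fld_linear jac_linear vd_linear tensor_rep_mat_add
      tensor_rep_mat_scale trace_add scaleR_fun_def trace_def sum.distrib sum_distrib_left algebra_simps)

lemma lie_deriv_rep:
  assumes "P \<in> sym_fields p"
  shows "lie_deriv \<delta> (fld (slbr g h)) P =
    lie_deriv \<delta> (fld g) (lie_deriv \<delta> (fld h) P) - lie_deriv \<delta> (fld h) (lie_deriv \<delta> (fld g) P)"
  using lie_deriv_comm[of P \<delta> g h] sym_fieldsD(3)[OF assms] by (simp add: fun_eq_iff)

subsection \<open>Scalar-valued operators\<close>

text \<open>
  The components of a differential operator. Unlike the operators themselves they can be multiplied
  by functions and differentiated one at a time.
\<close>

definition scalar_ops :: "nat \<Rightarrow> nat \<Rightarrow> ('m::finite field \<Rightarrow> real^'m \<Rightarrow> real) set" where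
  "scalar_ops k p = {\<phi>. \<exists>a. (\<forall>\<alpha> J. smooth (a \<alpha> J)) \<and> (\<forall>P\<in>sym_fields p. \<forall>x.
     \<phi> P x = (\<Sum>\<alpha> | length \<alpha> \<le> k. \<Sum>J | length J = p. a \<alpha> J x * pds \<alpha> (\<lambda>y. P y J) x))}"

lemma scalar_ops_cong:
  assumes "\<phi> \<in> scalar_ops k p" "\<And>P x. P \<in> sym_fields p \<Longrightarrow> \<psi> P x = \<phi> P x"
  shows "\<psi> \<in> scalar_ops k p"
  using assms unfolding scalar_ops_def by auto

lemma scalar_ops_zero: "(\<lambda>P x. 0) \<in> scalar_ops k p"
  unfolding scalar_ops_def by (rule CollectI, rule exI[of _ "\<lambda>_ _ _. 0"]) simp

lemma scalar_ops_add:
  assumes "\<phi> \<in> scalar_ops k p" "\<psi> \<in> scalar_ops k p"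
  shows "(\<lambda>P x. \<phi> P x + \<psi> P x) \<in> scalar_ops k p"
proof -
  obtain a b where "\<forall>\<alpha> J. smooth (a \<alpha> J)" "\<forall>\<alpha> J. smooth (b \<alpha> J)"
    "\<forall>P\<in>sym_fields p. \<forall>x. \<phi> P x = (\<Sum>\<alpha> | length \<alpha> \<le> k. \<Sum>J | length J = p. a \<alpha> J x * pds \<alpha> (\<lambda>y. P y J) x)"
    "\<forall>P\<in>sym_fields p. \<forall>x. \<psi> P x = (\<Sum>\<alpha> | length \<alpha> \<le> k. \<Sum>J | length J = p. b \<alpha> J x * pds \<alpha> (\<lambda>y. P y J) x)"
    using assms unfolding scalar_ops_def by blast
  then show ?thesis
    unfolding scalar_ops_def
    by (intro CollectI exI[of _ "\<lambda>\<alpha> J x. a \<alpha> J x + b \<alpha> J x"])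
      (simp add: smooth_add sum.distrib distrib_right)
qed

lemma scalar_ops_mult:
  assumes "\<phi> \<in> scalar_ops k p" "smooth f"
  shows "(\<lambda>P x. f x * \<phi> P x) \<in> scalar_ops k p"
proof -
  obtain a where "\<forall>\<alpha> J. smooth (a \<alpha> J)"
    "\<forall>P\<in>sym_fields p. \<forall>x. \<phi> P x = (\<Sum>\<alpha> | length \<alpha> \<le> k. \<Sum>J | length J = p. a \<alpha> J x * pds \<alpha> (\<lambda>y. P y J) x)"
    using assms(1) unfolding scalar_ops_def by blast
  then show ?thesis
    using assms(2) unfolding scalar_ops_def
    by (intro CollectI exI[of _ "\<lambda>\<alpha> J x. f x * a \<alpha> J x"])
      (simp add: smooth_mult sum_distrib_left mult.assoc)
qed

lemma scalar_ops_sum: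
  "(\<And>s. s \<in> S \<Longrightarrow> \<phi> s \<in> scalar_ops k p) \<Longrightarrow> (\<lambda>P x. \<Sum>s\<in>S. \<phi> s P x) \<in> scalar_ops k p"
  by (induction S rule: infinite_finite_induct) (auto simp: scalar_ops_zero scalar_ops_add)

lemma scalar_ops_mono:
  assumes "\<phi> \<in> scalar_ops k p" "k \<le> k'"
  shows "\<phi> \<in> scalar_ops k' p"
proof -
  obtain a where a: "\<forall>\<alpha> J. smooth (a \<alpha> J)"
    "\<forall>P\<in>sym_fields p. \<forall>x. \<phi> P x = (\<Sum>\<alpha> | length \<alpha> \<le> k. \<Sum>J | length J = p. a \<alpha> J x * pds \<alpha> (\<lambda>y. P y J) x)"
    using assms(1) unfolding scalar_ops_def by blast
  have "(\<Sum>\<alpha> | length \<alpha> \<le> k. \<Sum>J | length J = p. a \<alpha> J x * pds \<alpha> (\<lambda>y. P y J) x) =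
     (\<Sum>\<alpha> | length \<alpha> \<le> k'. \<Sum>J | length J = p. (if length \<alpha> \<le> k then a \<alpha> J else (\<lambda>_. 0)) x * pds \<alpha> (\<lambda>y. P y J) x)"
    for P :: "'a field" and x
    using assms(2) by (intro sum.mono_neutral_cong_left) auto
  then show ?thesis
    using a unfolding scalar_ops_def
    by (intro CollectI exI[of _ "\<lambda>\<alpha> J. if length \<alpha> \<le> k then a \<alpha> J else (\<lambda>_. 0)"]) auto
qed

lemma scalar_ops_base:
  assumes "length J = p" "length \<alpha> \<le> k"
  shows "(\<lambda>P. pds \<alpha> (\<lambda>y. P y J)) \<in> scalar_ops k p"
  unfolding scalar_ops_def
proof (intro CollectI exI[of _ "\<lambda>\<alpha>' J' x. if \<alpha>' = \<alpha> then (if J' = J then 1 else 0) else 0"] conjI allI ballI)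
  fix P :: "'a field" and x
  have "(\<Sum>\<alpha>' | length \<alpha>' \<le> k. \<Sum>J' | length J' = p.
      (if \<alpha>' = \<alpha> then (if J' = J then 1 else 0) else 0) * pds \<alpha>' (\<lambda>y. P y J') x) =
    (\<Sum>\<alpha>' | length \<alpha>' \<le> k. if \<alpha>' = \<alpha> then (\<Sum>J' | length J' = p. if J' = J then pds \<alpha> (\<lambda>y. P y J) x else 0) else 0)"
  proof (intro sum.cong refl)
    fix \<alpha>' :: "'a list"
    have "(if J' = J then 1 else 0) * c = (if J' = J then c else 0)" for J' and c :: real by simp
    then show "(\<Sum>J' | length J' = p.
      (if \<alpha>' = \<alpha> then (if J' = J then 1 else 0) else 0) * pds \<alpha>' (\<lambda>y. P y J') x) =
      (if \<alpha>' = \<alpha> then (\<Sum>J' | length J' = p. if J' = J then pds \<alpha> (\<lambda>y. P y J) x else 0) else 0)"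
      by (cases "\<alpha>' = \<alpha>") (auto intro!: sum.cong)
  qed
  also have "\<dots> = pds \<alpha> (\<lambda>y. P y J) x" using assms by simp
  finally show "pds \<alpha> (\<lambda>y. P y J) x = (\<Sum>\<alpha>' | length \<alpha>' \<le> k. \<Sum>J' | length J' = p.
      (if \<alpha>' = \<alpha> then (if J' = J then 1 else 0) else 0) * pds \<alpha>' (\<lambda>y. P y J') x)" by simp
qed simp

lemma scalar_ops_pd:
  assumes "\<phi> \<in> scalar_ops k p"
  shows "(\<lambda>P. pd i (\<phi> P)) \<in> scalar_ops (Suc k) p"
proof -
  obtain a where a: "\<forall>\<alpha> J. smooth (a \<alpha> J)"
    "\<forall>P\<in>sym_fields p. \<forall>x. \<phi> P x = (\<Sum>\<alpha> | length \<alpha> \<le> k. \<Sum>J | length J = p. a \<alpha> J x * pds \<alpha> (\<lambda>y. P y J) x)"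
    using assms unfolding scalar_ops_def by blast
  have "(\<lambda>P x. \<Sum>\<alpha> | length \<alpha> \<le> k. \<Sum>J | length J = p.
      a \<alpha> J x * pds (i # \<alpha>) (\<lambda>y. P y J) x + pd i (a \<alpha> J) x * pds \<alpha> (\<lambda>y. P y J) x) \<in> scalar_ops (Suc k) p"
    using a(1) by (intro scalar_ops_sum scalar_ops_add scalar_ops_mult scalar_ops_base smooth_pd) auto
  then show ?thesis
  proof (rule scalar_ops_cong)
    fix P :: "'a field" and x assume P: "P \<in> sym_fields p"
    have "\<phi> P = (\<lambda>x. \<Sum>\<alpha> | length \<alpha> \<le> k. \<Sum>J | length J = p. a \<alpha> J x * pds \<alpha> (\<lambda>y. P y J) x)"
      using a(2) P by auto
    then show "pd i (\<phi> P) x = (\<Sum>\<alpha> | length \<alpha> \<le> k. \<Sum>J | length J = p.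
      a \<alpha> J x * pds (i # \<alpha>) (\<lambda>y. P y J) x + pd i (a \<alpha> J) x * pds \<alpha> (\<lambda>y. P y J) x)"
      using a(1) sym_fieldsD(3)[OF P] by (simp add: pd_sum smooth_intros pd_mult)
  qed
qed

lemma scalar_ops_pds: "\<phi> \<in> scalar_ops k p \<Longrightarrow> (\<lambda>P. pds \<alpha> (\<phi> P)) \<in> scalar_ops (length \<alpha> + k) p"
  by (induction \<alpha>) (auto dest: scalar_ops_pd)

lemma diff_ops_iff:
  "D \<in> diff_ops k p q \<longleftrightarrow> (\<forall>P. P \<notin> sym_fields p \<longrightarrow> D P = 0) \<and> (\<forall>P\<in>sym_fields p. D P \<in> sym_fields q) \<and>
     (\<forall>I. length I = q \<longrightarrow> (\<lambda>P x. D P x I) \<in> scalar_ops k p)"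
proof -
  have "(\<exists>a. (\<forall>\<alpha> J I. smooth (a \<alpha> J I)) \<and>
        (\<forall>P\<in>sym_fields p. \<forall>x I. length I = q \<longrightarrow>
           D P x I = (\<Sum>\<alpha> | length \<alpha> \<le> k. \<Sum>J | length J = p. a \<alpha> J I x * pds \<alpha> (\<lambda>y. P y J) x)))
     \<longleftrightarrow> (\<forall>I. length I = q \<longrightarrow> (\<lambda>P x. D P x I) \<in> scalar_ops k p)" (is "?l \<longleftrightarrow> ?r")
  proof
    assume ?l
    then obtain a where a: "\<forall>\<alpha> J I. smooth (a \<alpha> J I)" "\<forall>P\<in>sym_fields p. \<forall>x I. length I = q \<longrightarrow>
           D P x I = (\<Sum>\<alpha> | length \<alpha> \<le> k. \<Sum>J | length J = p. a \<alpha> J I x * pds \<alpha> (\<lambda>y. P y J) x)"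
      by blast
    show ?r
    proof (intro allI impI)
      fix I :: "'a list" assume "length I = q"
      then show "(\<lambda>P x. D P x I) \<in> scalar_ops k p"
        unfolding scalar_ops_def using a by (intro CollectI exI[of _ "\<lambda>\<alpha> J. a \<alpha> J I"]) auto
    qed
  next
    assume ?r
    have "\<forall>I. \<exists>a. (\<forall>\<alpha> J. smooth (a \<alpha> J)) \<and> (length I = q \<longrightarrow> (\<forall>P\<in>sym_fields p. \<forall>x.
       D P x I = (\<Sum>\<alpha> | length \<alpha> \<le> k. \<Sum>J | length J = p. a \<alpha> J x * pds \<alpha> (\<lambda>y. P y J) x)))"
    proof (intro allI)
      fix I :: "'a list"
      have r: ?r by fact
      show "\<exists>a. (\<forall>\<alpha> J. smooth (a \<alpha> J)) \<and> (length I = q \<longrightarrow> (\<forall>P\<in>sym_fields p. \<forall>x.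
       D P x I = (\<Sum>\<alpha> | length \<alpha> \<le> k. \<Sum>J | length J = p. a \<alpha> J x * pds \<alpha> (\<lambda>y. P y J) x)))"
      proof (cases "length I = q")
        case True
        with r have "(\<lambda>P x. D P x I) \<in> scalar_ops k p" by blast
        then show ?thesis unfolding scalar_ops_def by blast
      next
        case False
        then show ?thesis by (intro exI[of _ "\<lambda>_ _ _. 0"]) simp
      qed
    qed
    from choice[OF this] obtain a where "\<forall>I. (\<forall>\<alpha> J. smooth (a I \<alpha> J)) \<and> (length I = q \<longrightarrow> (\<forall>P\<in>sym_fields p. \<forall>x.
       D P x I = (\<Sum>\<alpha> | length \<alpha> \<le> k. \<Sum>J | length J = p. a I \<alpha> J x * pds \<alpha> (\<lambda>y. P y J) x)))" ..
    then show ?l by (intro exI[of _ "\<lambda>\<alpha> J I. a I \<alpha> J"]) blast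
  qed
  then show ?thesis unfolding diff_ops_def by simp
qed

lemma diff_opsD:
  assumes "D \<in> diff_ops k p q"
  shows "P \<notin> sym_fields p \<Longrightarrow> D P = 0" "P \<in> sym_fields p \<Longrightarrow> D P \<in> sym_fields q" "(\<lambda>P x. D P x I) \<in> scalar_ops k p"
proof -
  show 1: "P \<in> sym_fields p \<Longrightarrow> D P \<in> sym_fields q" and "P \<notin> sym_fields p \<Longrightarrow> D P = 0" for P
    using assms by (auto simp: diff_ops_iff)
  show "(\<lambda>P x. D P x I) \<in> scalar_ops k p"
  proof (cases "length I = q")
    case False
    then show ?thesis
      using scalar_ops_cong[OF scalar_ops_zero, of p "\<lambda>P x. D P x I" k] sym_fieldsD(1)[OF 1] by blast
  qed (use assms in \<open>auto simp: diff_ops_iff\<close>)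
qed

lemma diff_ops_coeff:
  assumes "D \<in> diff_ops k p q"
  shows "\<exists>a. (\<forall>\<alpha> J I. smooth (a \<alpha> J I)) \<and> (\<forall>P\<in>sym_fields p. \<forall>x I. length I = q \<longrightarrow>
     D P x I = (\<Sum>\<alpha> | length \<alpha> \<le> k. \<Sum>J | length J = p. a \<alpha> J I x * pds \<alpha> (\<lambda>y. P y J) x))"
  using assms unfolding diff_ops_def by simp

lemma diff_ops_mono: "k \<le> k' \<Longrightarrow> diff_ops k p q \<subseteq> diff_ops k' p q"
  using scalar_ops_mono by (fastforce simp: diff_ops_iff)

lemma subspace_diff_ops: "real_subspace (diff_ops k p q)"
  unfolding real_vector.subspace_def
proof (intro conjI ballI allI)
  show "0 \<in> diff_ops k p q"
    by (auto simp: diff_ops_iff sym_fields_closed scalar_ops_zero)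
  fix D :: "'a field \<Rightarrow> 'a field" assume D: "D \<in> diff_ops k p q"
  show "r *\<^sub>R D \<in> diff_ops k p q" for r
    using scalar_ops_mult[OF diff_opsD(3)[OF D] smooth_const, of r] diff_opsD(1,2)[OF D]
    by (auto simp: diff_ops_iff scaleR_fun_def[of r D] sym_fields_closed) (simp add: scaleR_fun_def)
  fix E :: "'a field \<Rightarrow> 'a field" assume E: "E \<in> diff_ops k p q"
  show "D + E \<in> diff_ops k p q"
    using scalar_ops_add[OF diff_opsD(3)[OF D] diff_opsD(3)[OF E]] diff_opsD(1,2)[OF D] diff_opsD(1,2)[OF E]
    by (auto simp: diff_ops_iff sym_fields_closed)
qed

lemma diff_ops_linear:
  assumes D: "D \<in> diff_ops k p q" and P: "P \<in> sym_fields p" and Q: "Q \<in> sym_fields p"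
  shows "D (P + Q) = D P + D Q" "D (r *\<^sub>R P) = r *\<^sub>R D P" "D (P - Q) = D P - D Q"
proof -
  obtain a where a0: "\<forall>\<alpha> J I. smooth (a \<alpha> J I)" "\<forall>P\<in>sym_fields p. \<forall>x I. length I = q \<longrightarrow>
     D P x I = (\<Sum>\<alpha> | length \<alpha> \<le> k. \<Sum>J | length J = p. a \<alpha> J I x * pds \<alpha> (\<lambda>y. P y J) x)"
    using diff_ops_coeff[OF D] by (elim exE conjE)
  note a = a0(2)[rule_format]
  note in1 = sym_fields_closed(2) and in2 = sym_fields_closed(4)
  have z: "D P x I = 0" if "P \<in> sym_fields p" "length I \<noteq> q" for P x I
    using sym_fieldsD(1)[OF diff_opsD(2)[OF D that(1)] that(2)] .
  have add: "D (P + Q) = D P + D Q" if P: "P \<in> sym_fields p" and Q: "Q \<in> sym_fields p" for P Q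
  proof (intro ext)
    fix x I
    show "D (P + Q) x I = (D P + D Q) x I"
      using in1[OF P Q] P Q
      by (cases "length I = q")
        (simp_all add: a z pds_add sym_fieldsD(3)[OF P] sym_fieldsD(3)[OF Q] sum.distrib distrib_left)
  qed
  have scale: "D (r *\<^sub>R P) = r *\<^sub>R D P" if P: "P \<in> sym_fields p" for r P
  proof (intro ext)
    fix x I
    show "D (r *\<^sub>R P) x I = (r *\<^sub>R D P) x I"
      using in2[OF P, of r] P
      by (cases "length I = q")
        (simp_all add: a z scaleR_fun_def pds_cmult sym_fieldsD(3)[OF P] sum_distrib_left mult.left_commute)
  qed
  have "(-1) *\<^sub>R Q \<in> sym_fields p" by (rule in2[OF Q])
  from add[OF P this] show "D (P - Q) = D P - D Q"
    using scale[OF Q, of "-1"] by simp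
  show "D (P + Q) = D P + D Q" "D (r *\<^sub>R P) = r *\<^sub>R D P"
    by (rule add[OF P Q], rule scale[OF P])
qed

lemma lie_deriv_scalar_ops:
  assumes "\<And>I. (\<lambda>P x. F P x I) \<in> scalar_ops k p"
  shows "(\<lambda>P x. lie_deriv \<delta> (fld g) (F P) x I) \<in> scalar_ops (Suc k) p"
proof -
  have F: "(\<lambda>P x. F P x I) \<in> scalar_ops (Suc k) p" for I
    by (rule scalar_ops_mono[OF assms]) simp
  have "(\<lambda>P x. (\<Sum>i\<in>UNIV. fld g x $ i * pd i (\<lambda>y. F P y I) x)
      + (-1) * (\<Sum>r<length I. \<Sum>j\<in>UNIV. jac g x $ (I ! r) $ j * F P x (I[r := j]))
      + (\<delta> * trace (jac g x)) * F P x I) \<in> scalar_ops (Suc k) p"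
    by (intro scalar_ops_add scalar_ops_sum scalar_ops_mult scalar_ops_pd F assms smooth_intros
        smooth_fld smooth_jac smooth_trace_jac)
  then show ?thesis
    by (rule scalar_ops_cong) (simp add: lie_deriv_fld vd_def tensor_rep_def)
qed

lemma op_action_order:
  assumes D: "D \<in> diff_ops k p q"
  shows "op_action \<delta> p (fld g) D \<in> diff_ops (Suc k) p q"
  unfolding diff_ops_iff
proof (intro conjI allI ballI impI)
  show "op_action \<delta> p (fld g) D P = 0" if "P \<notin> sym_fields p" for P
    using that by (simp add: op_action_def)
  show "op_action \<delta> p (fld g) D P \<in> sym_fields q" if "P \<in> sym_fields p" for P
    using that by (simp add: op_action_def sym_fields_closed diff_opsD(2)[OF D] lie_deriv_in)
  fix I :: "'a list" assume I: "length I = q"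
  obtain a where a0: "\<forall>\<alpha> J I. smooth (a \<alpha> J I)" "\<forall>P\<in>sym_fields p. \<forall>x I. length I = q \<longrightarrow>
     D P x I = (\<Sum>\<alpha> | length \<alpha> \<le> k. \<Sum>J | length J = p. a \<alpha> J I x * pds \<alpha> (\<lambda>y. P y J) x)"
    using diff_ops_coeff[OF D] by (elim exE conjE)
  note a = a0(1)[rule_format] a0(2)[rule_format]
  have id: "(\<lambda>P x. P x J) \<in> scalar_ops 0 p" for J :: "'a list"
  proof (cases "length J = p")
    case True
    then show ?thesis using scalar_ops_base[of J p "[]" 0] by simp
  next
    case False
    then show ?thesis
      using scalar_ops_cong[OF scalar_ops_zero, of p "\<lambda>P x. P x J" 0] sym_fieldsD(1) by blast
  qed
  have L: "(\<lambda>P x. lie_deriv \<delta> (fld g) P x J) \<in> scalar_ops (Suc 0) p" for J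
    by (rule lie_deriv_scalar_ops[of "\<lambda>P. P", OF id])
  have "(\<lambda>P. pds \<alpha> (\<lambda>y. lie_deriv \<delta> (fld g) P y J)) \<in> scalar_ops (Suc k) p" if "length \<alpha> \<le> k" for \<alpha> J
    using scalar_ops_pds[OF L, of \<alpha> J] by (rule scalar_ops_mono) (use that in simp)
  then have "(\<lambda>P x. \<Sum>\<alpha> | length \<alpha> \<le> k. \<Sum>J | length J = p. a \<alpha> J I x * pds \<alpha> (\<lambda>y. lie_deriv \<delta> (fld g) P y J) x)
     \<in> scalar_ops (Suc k) p"
    by (intro scalar_ops_sum scalar_ops_mult a(1)) auto
  then have 1: "(\<lambda>P x. lie_deriv \<delta> (fld g) (D P) x I + (-1) * (\<Sum>\<alpha> | length \<alpha> \<le> k. \<Sum>J | length J = p.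
      a \<alpha> J I x * pds \<alpha> (\<lambda>y. lie_deriv \<delta> (fld g) P y J) x)) \<in> scalar_ops (Suc k) p"
    by (intro scalar_ops_add scalar_ops_mult lie_deriv_scalar_ops diff_opsD(3)[OF D] smooth_const)
  show "(\<lambda>P x. op_action \<delta> p (fld g) D P x I) \<in> scalar_ops (Suc k) p"
    by (rule scalar_ops_cong[OF 1]) (simp add: op_action_def a(2) I lie_deriv_in)
qed

subsection \<open>The principal symbol\<close>

text \<open>
  The symbol of order \<open>l\<close> at \<open>x\<close> is found by applying the operator to the symmetrized basis
  tensors times the monomials of degree \<open>l\<close> centred at \<open>x\<close>. The indices of the monomial and of the
  value are contravariant and are joined into one list; those of the argument are covariant.
\<close>

definition test :: "real^'m \<Rightarrow> 'm list \<Rightarrow> 'm::finite list \<Rightarrow> 'm field" where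
  "test x L J = (\<lambda>y J'. perm J' J * mono_at x L y)"

type_synonym 'm tens = "'m list \<Rightarrow> 'm list \<Rightarrow> real"

definition symb :: "nat \<Rightarrow> nat \<Rightarrow> nat \<Rightarrow> ('m::finite field \<Rightarrow> 'm field) \<Rightarrow> real^'m \<Rightarrow> 'm tens" where
  "symb l p q D = (\<lambda>x K J. if length K = l + q \<and> length J = p
     then D (test x (take l K) J) x (drop l K) else 0)"

definition tens :: "nat \<Rightarrow> nat \<Rightarrow> nat \<Rightarrow> 'm tens set" where
  "tens l p q = {T. (\<forall>K J. \<not> (length K = l + q \<and> length J = p) \<longrightarrow> T K J = 0) \<and>
     (\<forall>I J. length I = q \<longrightarrow> msym (\<lambda>L. T (L @ I) J)) \<and>
     (\<forall>L J. length L = l \<longrightarrow> msym (\<lambda>I. T (L @ I) J)) \<and> (\<forall>K. msym (T K))}"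

definition tens_fields :: "nat \<Rightarrow> nat \<Rightarrow> nat \<Rightarrow> (real^'m::finite \<Rightarrow> 'm tens) set" where
  "tens_fields l p q = {T. (\<forall>x. T x \<in> tens l p q) \<and> (\<forall>K J. smooth (\<lambda>x. T x K J))}"

definition trep :: "real^'m^'m \<Rightarrow> 'm::finite tens \<Rightarrow> 'm tens" where
  "trep A T = (\<lambda>K J. tensor_rep A (\<lambda>K. T K J) K - tensor_rep (transpose A) (T K) J)"

definition ltens :: "'m::finite sl \<Rightarrow> (real^'m \<Rightarrow> 'm tens) \<Rightarrow> real^'m \<Rightarrow> 'm tens" where
  "ltens g T = (\<lambda>x K J. vd (fld g x) (\<lambda>y. T y K J) x - trep (jac g x) (T x) K J)"

lemma test_in: "length J = p \<Longrightarrow> test x L J \<in> sym_fields p"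
  unfolding sym_fields_iff test_def
  by (auto simp: perm_length intro!: smooth_intros smooth_mono_at)
    (auto simp: msym_def intro!: arg_cong2[where f = "(*)"] intro: msymD[OF msym_perm(1)])

lemma test_cong: "mset L = mset L' \<Longrightarrow> mset J = mset J' \<Longrightarrow> test x L J = test x L' J'"
  unfolding test_def
  by (intro ext arg_cong2[where f = "(*)"]) (auto intro: msymD[OF msym_perm(2)] msymD[OF msym_mono_at])

lemma pds_test: "pds \<alpha> (\<lambda>y. perm J' J * mono_at x L y) x = perm J' J * perm \<alpha> L"
  by (simp add: pds_cmult pds_mono_at)

lemma symb_coeff:
  assumes "\<forall>P\<in>sym_fields p. \<forall>x I. length I = q \<longrightarrow>
     D P x I = (\<Sum>\<alpha> | length \<alpha> \<le> k. \<Sum>J | length J = p. a \<alpha> J I x * pds \<alpha> (\<lambda>y. P y J) x)"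
    "length L = l" "length I = q" "length J = p"
  shows "symb l p q D x (L @ I) J =
    (\<Sum>\<alpha> | length \<alpha> \<le> k. \<Sum>J' | length J' = p. a \<alpha> J' I x * (perm \<alpha> L * perm J' J))"
  using assms(2-4) test_in[OF assms(4), of x L]
  by (simp add: symb_def assms(1)[rule_format]) (simp add: test_def pds_test mult.commute)

lemma symb_in:
  assumes "D \<in> diff_ops k p q"
  shows "symb l p q D \<in> tens_fields l p q"
proof -
  obtain a where a0: "\<forall>\<alpha> J I. smooth (a \<alpha> J I)" "\<forall>P\<in>sym_fields p. \<forall>x I. length I = q \<longrightarrow>
     D P x I = (\<Sum>\<alpha> | length \<alpha> \<le> k. \<Sum>J | length J = p. a \<alpha> J I x * pds \<alpha> (\<lambda>y. P y J) x)"
    using diff_ops_coeff[OF assms] by (elim exE conjE)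
  note a = a0(1)[rule_format] a0(2)
  have "smooth (\<lambda>x. symb l p q D x K J)" for K J
  proof (cases "length K = l + q \<and> length J = p")
    case True
    then have K: "K = take l K @ drop l K" "length (take l K) = l" "length (drop l K) = q" by auto
    show ?thesis
      by (subst K(1), subst symb_coeff[OF a(2) K(2,3)]) (use True in \<open>auto intro!: smooth_intros a(1)\<close>)
  next
    case False
    then have "symb l p q D x K J = 0" for x by (auto simp: symb_def)
    then show ?thesis by simp
  qed
  moreover have "symb l p q D x \<in> tens l p q" for x
    unfolding tens_def
  proof (intro CollectI conjI allI impI)
    show "\<not> (length K = l + q \<and> length J = p) \<Longrightarrow> symb l p q D x K J = 0" for K J
      by (auto simp: symb_def)
    show "msym (\<lambda>L. symb l p q D x (L @ I) J)" if "length I = q" for I J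
      unfolding msym_def
    proof (intro allI impI)
      fix L L' :: "'a list" assume m: "mset L = mset L'"
      then have "length L = length L'" by (rule mset_eq_length)
      then show "symb l p q D x (L @ I) J = symb l p q D x (L' @ I) J"
        using that test_cong[OF m refl, of x J] by (auto simp: symb_def)
    qed
    show "msym (\<lambda>I. symb l p q D x (L @ I) J)" if "length L = l" for L J
      unfolding msym_def
    proof (intro allI impI)
      fix I I' :: "'a list" assume m: "mset I = mset I'"
      then have "length I = length I'" by (rule mset_eq_length)
      moreover have "D (test x L J) x I = D (test x L J) x I'" if "length J = p"
        by (rule msymD[OF sym_fieldsD(2)[OF diff_opsD(2)[OF assms test_in[OF that]]] m])
      ultimately show "symb l p q D x (L @ I) J = symb l p q D x (L @ I') J"
        using that by (auto simp: symb_def)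
    qed
    show "msym (symb l p q D x K)" for K
      unfolding msym_def
    proof (intro allI impI)
      fix J J' :: "'a list" assume m: "mset J = mset J'"
      then have "length J = length J'" by (rule mset_eq_length)
      then show "symb l p q D x K J = symb l p q D x K J'"
        using test_cong[OF refl m, of x "take l K"] by (auto simp: symb_def)
    qed
  qed
  ultimately show ?thesis by (simp add: tens_fields_def)
qed

lemma sum_perm_pair:
  assumes "\<And>J. msym (\<lambda>\<alpha>. G \<alpha> J)" "\<And>\<alpha>. msym (G \<alpha>)" "length \<alpha> = l" "length J = p"
  shows "(\<Sum>L | length L = l. \<Sum>J' | length J' = p. (perm \<alpha> L * perm J J') * G L J') = fact l * fact p * G \<alpha> J"
proof -
  have "(\<Sum>L | length L = l. \<Sum>J' | length J' = p. (perm \<alpha> L * perm J J') * G L J') =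
      (\<Sum>L | length L = l. perm L \<alpha> * (\<Sum>J' | length J' = p. perm J' J * G L J'))"
    by (simp add: sum_distrib_left perm_sym[of \<alpha>] perm_sym[of J] mult.assoc)
  also have "\<dots> = (\<Sum>L | length L = l. perm L \<alpha> * (fact p * G L J))"
    by (simp add: sum_perm[OF assms(2,4)])
  also have "\<dots> = fact p * (\<Sum>L | length L = l. perm L \<alpha> * G L J)"
    by (simp add: sum_distrib_left mult.left_commute)
  finally show ?thesis
    using sum_perm[OF assms(1,3)] by simp
qed

lemma sum_perm_polarize:
  fixes G :: "'m::finite list \<Rightarrow> 'm list \<Rightarrow> real"
  assumes "\<And>J. msym (\<lambda>\<alpha>. G \<alpha> J)" "\<And>\<alpha>. msym (G \<alpha>)"
  shows "(\<Sum>L | length L = l. \<Sum>J' | length J' = p.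
      (\<Sum>\<alpha> | length \<alpha> = l. \<Sum>J | length J = p. b \<alpha> J * (perm \<alpha> L * perm J J')) * G L J') =
    fact l * fact p * (\<Sum>\<alpha> | length \<alpha> = l. \<Sum>J | length J = p. b \<alpha> J * G \<alpha> J)"
proof -
  let ?A = "{L :: 'm list. length L = l} \<times> {J :: 'm list. length J = p}"
  have c: "(\<Sum>L | length L = l. \<Sum>J | length J = p. f L J) = (\<Sum>u\<in>?A. f (fst u) (snd u))" for f :: "'m list \<Rightarrow> 'm list \<Rightarrow> real"
    by (simp add: sum.cartesian_product split_beta)
  have "(\<Sum>L | length L = l. \<Sum>J' | length J' = p.
      (\<Sum>\<alpha> | length \<alpha> = l. \<Sum>J | length J = p. b \<alpha> J * (perm \<alpha> L * perm J J')) * G L J') =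
    (\<Sum>u\<in>?A. \<Sum>v\<in>?A. b (fst v) (snd v) * ((perm (fst v) (fst u) * perm (snd v) (snd u)) * G (fst u) (snd u)))"
    unfolding c by (simp add: sum_distrib_right mult.assoc)
  also have "\<dots> = (\<Sum>v\<in>?A. b (fst v) (snd v) *
      (\<Sum>u\<in>?A. (perm (fst v) (fst u) * perm (snd v) (snd u)) * G (fst u) (snd u)))"
    by (subst sum.swap) (simp add: sum_distrib_left)
  also have "\<dots> = (\<Sum>v\<in>?A. b (fst v) (snd v) * (fact l * fact p * G (fst v) (snd v)))"
  proof (intro sum.cong refl arg_cong2[where f = "(*)"])
    fix v assume v: "v \<in> ?A"
    show "(\<Sum>u\<in>?A. (perm (fst v) (fst u) * perm (snd v) (snd u)) * G (fst u) (snd u)) =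
        fact l * fact p * G (fst v) (snd v)"
      using sum_perm_pair[OF assms, of "fst v" l "snd v" p] v unfolding c by auto
  qed
  finally show ?thesis unfolding c by (simp add: sum_distrib_left mult_ac)
qed

text \<open>
  Partial derivatives commute and the components are symmetric, so that only the symmetric part of
  the leading coefficients matters; up to factorials that part is the symbol.
\<close>

lemma symb_top:
  assumes a: "\<forall>P\<in>sym_fields p. \<forall>x I. length I = q \<longrightarrow>
     D P x I = (\<Sum>\<alpha> | length \<alpha> \<le> l. \<Sum>J | length J = p. a \<alpha> J I x * pds \<alpha> (\<lambda>y. P y J) x)"
    and P: "P \<in> sym_fields p" and I: "length I = q"
  shows "D P x I = (\<Sum>\<alpha> | length \<alpha> < l. \<Sum>J | length J = p. a \<alpha> J I x * pds \<alpha> (\<lambda>y. P y J) x) +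
    (\<Sum>L | length L = l. \<Sum>J | length J = p. symb l p q D x (L @ I) J * pds L (\<lambda>y. P y J) x) / (fact l * fact p)"
proof -
  let ?G = "\<lambda>\<alpha> J. pds \<alpha> (\<lambda>y. P y J) x"
  have G1: "msym (\<lambda>\<alpha>. ?G \<alpha> J)" for J
    unfolding msym_def using pds_mset[OF sym_fieldsD(3)[OF P]] by metis
  have G2: "msym (?G \<alpha>)" for \<alpha>
    unfolding msym_def
  proof (intro allI impI)
    fix J J' :: "'a list" assume "mset J = mset J'"
    then have "(\<lambda>y. P y J) = (\<lambda>y. P y J')" by (auto intro: msymD[OF sym_fieldsD(2)[OF P]])
    then show "?G \<alpha> J = ?G \<alpha> J'" by simp
  qed
  have "{\<alpha> :: 'a list. length \<alpha> \<le> l} = {\<alpha>. length \<alpha> < l} \<union> {\<alpha>. length \<alpha> = l}" by auto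
  moreover have "finite {\<alpha> :: 'a list. length \<alpha> < l}"
    by (rule finite_subset[OF _ finite_lists_length_le[of l]]) auto
  ultimately have 1: "D P x I = (\<Sum>\<alpha> | length \<alpha> < l. \<Sum>J | length J = p. a \<alpha> J I x * ?G \<alpha> J) +
      (\<Sum>\<alpha> | length \<alpha> = l. \<Sum>J | length J = p. a \<alpha> J I x * ?G \<alpha> J)"
    unfolding a[rule_format, OF P I] by (subst sum.union_disjoint[symmetric]) auto
  have 2: "symb l p q D x (L @ I) J' = (\<Sum>\<alpha> | length \<alpha> = l. \<Sum>J | length J = p. a \<alpha> J I x * (perm \<alpha> L * perm J J'))"
    if "length L = l" "length J' = p" for L J'
    unfolding symb_coeff[OF a that(1) I that(2)]
    by (rule sum.mono_neutral_right) (use that in \<open>auto simp: perm_length intro!: sum.neutral\<close>)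
  have "(\<Sum>L | length L = l. \<Sum>J | length J = p. symb l p q D x (L @ I) J * ?G L J) =
      fact l * fact p * (\<Sum>\<alpha> | length \<alpha> = l. \<Sum>J | length J = p. a \<alpha> J I x * ?G \<alpha> J)"
    unfolding sum_perm_polarize[where G = ?G and b = "\<lambda>\<alpha> J. a \<alpha> J I x", OF G1 G2, symmetric]
    by (intro sum.cong refl arg_cong2[where f = "(*)"]) (simp add: 2)
  then show ?thesis unfolding 1 by simp
qed

text \<open>\<open>dops l\<close> consists of the operators of order less than \<open>l\<close>.\<close>

definition dops :: "nat \<Rightarrow> nat \<Rightarrow> nat \<Rightarrow> ('m::finite field \<Rightarrow> 'm field) set" where
  "dops l p q = (case l of 0 \<Rightarrow> {0} | Suc k \<Rightarrow> diff_ops k p q)"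

lemma dops_Suc [simp]: "dops (Suc k) p q = diff_ops k p q"
  by (simp add: dops_def)

lemma dops_subset: "dops l p q \<subseteq> diff_ops l p q"
proof (cases l)
  case 0
  then show ?thesis using subspace_0[OF subspace_diff_ops] by (simp add: dops_def)
next
  case (Suc k)
  then show ?thesis using diff_ops_mono[of k "Suc k"] by simp
qed

lemma symb_dops:
  assumes "D \<in> dops l p q"
  shows "symb l p q D = 0"
proof (cases l)
  case 0
  then show ?thesis using assms by (auto simp: dops_def symb_def fun_eq_iff)
next
  case (Suc k)
  then have D: "D \<in> diff_ops k p q" using assms by simp
  obtain a where a0: "\<forall>\<alpha> J I. smooth (a \<alpha> J I)" "\<forall>P\<in>sym_fields p. \<forall>x I. length I = q \<longrightarrow>
     D P x I = (\<Sum>\<alpha> | length \<alpha> \<le> k. \<Sum>J | length J = p. a \<alpha> J I x * pds \<alpha> (\<lambda>y. P y J) x)"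
    using diff_ops_coeff[OF D] by (elim exE conjE)
  note a = a0(2)
  have "symb l p q D x K J = 0" for x K J
  proof (cases "length K = l + q \<and> length J = p")
    case True
    then have K: "K = take l K @ drop l K" "length (take l K) = l" "length (drop l K) = q" by auto
    have "perm \<alpha> (take l K) = 0" if "length \<alpha> \<le> k" for \<alpha>
      using that K(2) Suc by (intro perm_length) auto
    then show ?thesis
      by (subst K(1), subst symb_coeff[OF a K(2,3)]) (use True in \<open>auto intro!: sum.neutral\<close>)
  next
    case False
    then show ?thesis by (auto simp: symb_def)
  qed
  then show ?thesis by (simp add: fun_eq_iff)
qed

lemma symb_kernel:
  assumes D: "D \<in> diff_ops l p q" and s: "symb l p q D = 0"
  shows "D \<in> dops l p q"
proof -
  obtain a where a0: "\<forall>\<alpha> J I. smooth (a \<alpha> J I)" "\<forall>P\<in>sym_fields p. \<forall>x I. length I = q \<longrightarrow>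
     D P x I = (\<Sum>\<alpha> | length \<alpha> \<le> l. \<Sum>J | length J = p. a \<alpha> J I x * pds \<alpha> (\<lambda>y. P y J) x)"
    using diff_ops_coeff[OF D] by (elim exE conjE)
  note a = a0(1)[rule_format] a0(2)
  have t: "D P x I = (\<Sum>\<alpha> | length \<alpha> < l. \<Sum>J | length J = p. a \<alpha> J I x * pds \<alpha> (\<lambda>y. P y J) x)"
    if "P \<in> sym_fields p" "length I = q" for P x I
    using symb_top[OF a(2) that] by (simp add: s)
  show ?thesis
  proof (cases l)
    case 0
    have "D P x I = 0" for P x I
    proof (cases "P \<in> sym_fields p")
      case True
      then show ?thesis
        using t[OF True, of I x] 0 sym_fieldsD(1)[OF diff_opsD(2)[OF D True], of I x]
        by (cases "length I = q") auto
    qed (simp add: diff_opsD(1)[OF D])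
    then show ?thesis using 0 by (simp add: dops_def fun_eq_iff)
  next
    case (Suc k)
    then have "D \<in> diff_ops k p q"
      unfolding diff_ops_def using t a0(1) diff_opsD(1,2)[OF D]
      by (intro CollectI conjI ballI allI impI exI[of _ a]) (auto simp: less_Suc_eq_le)
    then show ?thesis using Suc by simp
  qed
qed

text \<open>A linear right inverse of the symbol map.\<close>

definition quant :: "nat \<Rightarrow> nat \<Rightarrow> nat \<Rightarrow> (real^'m::finite \<Rightarrow> 'm tens) \<Rightarrow> 'm field \<Rightarrow> 'm field" where
  "quant l p q T = (\<lambda>P. if P \<in> sym_fields p then (\<lambda>x I. if length I = q
     then \<Sum>L | length L = l. \<Sum>J | length J = p. (T x (L @ I) J / (fact l * fact p)) * pds L (\<lambda>y. P y J) x
     else 0) else 0)"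

lemma quant_linear:
  "quant l p q (S + T) = quant l p q S + quant l p q T" "quant l p q (r *\<^sub>R T) = r *\<^sub>R quant l p q T"
  "quant l p q 0 = 0"
  by (simp_all add: fun_eq_iff quant_def scaleR_fun_def sum.distrib sum_distrib_left distrib_right
      add_divide_distrib mult.assoc)

lemma quant_in:
  assumes "T \<in> tens_fields l p q"
  shows "quant l p q T \<in> diff_ops l p q"
  unfolding diff_ops_iff
proof (intro conjI allI ballI impI)
  have T: "T x \<in> tens l p q" "smooth (\<lambda>x. T x K J)" for x K J
    using assms by (auto simp: tens_fields_def)
  show "quant l p q T P = 0" if "P \<notin> sym_fields p" for P using that by (simp add: quant_def)
  have s: "smooth (\<lambda>x. T x K J / c)" for K J c
    using smooth_mult[OF T(2) smooth_const, of K J "inverse c"] by (simp add: divide_inverse)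
  show "quant l p q T P \<in> sym_fields q" if P: "P \<in> sym_fields p" for P
    unfolding sym_fields_iff
  proof (intro conjI allI impI)
    show "length I \<noteq> q \<Longrightarrow> quant l p q T P x I = 0" for x I by (simp add: quant_def)
    show "msym (quant l p q T P x)" for x
      unfolding msym_def
    proof (intro allI impI)
      fix I I' :: "'a list" assume m: "mset I = mset I'"
      have "T x (L @ I) J = T x (L @ I') J" if "length L = l" for L J
        using T(1)[of x] that m unfolding tens_def by (auto intro: msymD[of "\<lambda>I. T x (L @ I) J"])
      then show "quant l p q T P x I = quant l p q T P x I'"
        using P mset_eq_length[OF m] by (auto simp: quant_def)
    qed
    show "smooth (\<lambda>x. quant l p q T P x I)" for I
    proof -
      have "smooth (\<lambda>x. \<Sum>L | length L = l. \<Sum>J | length J = p. (T x (L @ I) J / (fact l * fact p)) * pds L (\<lambda>y. P y J) x)"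
        by (intro smooth_intros s sym_fieldsD(3)[OF P])
      then show ?thesis using P by (cases "length I = q") (simp_all add: quant_def)
    qed
  qed
  fix I :: "'a list" assume "length I = q"
  have "(\<lambda>P x. \<Sum>L | length L = l. \<Sum>J | length J = p. (T x (L @ I) J / (fact l * fact p)) * pds L (\<lambda>y. P y J) x)
      \<in> scalar_ops l p"
    by (intro scalar_ops_sum scalar_ops_mult scalar_ops_base s) auto
  then show "(\<lambda>P x. quant l p q T P x I) \<in> scalar_ops l p"
    by (rule scalar_ops_cong) (simp add: quant_def \<open>length I = q\<close>)
qed

lemma symb_quant:
  assumes "T \<in> tens_fields l p q"
  shows "symb l p q (quant l p q T) = T"
proof (intro ext)
  fix x K J
  have T: "T x \<in> tens l p q" using assms by (auto simp: tens_fields_def)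
  show "symb l p q (quant l p q T) x K J = T x K J"
  proof (cases "length K = l + q \<and> length J = p")
    case True
    define L I where "L = take l K" and "I = drop l K"
    have K: "K = L @ I" "length L = l" "length I = q" using True by (auto simp: L_def I_def)
    have "symb l p q (quant l p q T) x K J =
       (\<Sum>L' | length L' = l. \<Sum>J' | length J' = p. (T x (L' @ I) J' / (fact l * fact p)) * (perm J' J * perm L' L))"
      using True test_in[of J p x L]
      by (simp add: symb_def quant_def K) (simp add: test_def pds_test)
    also have "\<dots> = (\<Sum>L' | length L' = l. \<Sum>J' | length J' = p. (perm L L' * perm J J') * T x (L' @ I) J') / (fact l * fact p)"
      by (simp add: sum_divide_distrib perm_sym[of L] perm_sym[of J] mult_ac)
    also have "\<dots> = T x K J"
      using T K True by (subst sum_perm_pair) (auto simp: tens_def)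
    finally show ?thesis .
  qed (use T in \<open>auto simp: symb_def tens_def\<close>)
qed

lemma symb_linear:
  "symb l p q (D + E) = symb l p q D + symb l p q E" "symb l p q (r *\<^sub>R D) = r *\<^sub>R symb l p q D"
  "symb l p q (D - E) = symb l p q D - symb l p q E" "symb l p q 0 = 0"
  by (simp_all add: fun_eq_iff symb_def scaleR_fun_def)

subsection \<open>Equivariance of the symbol\<close>

lemma fld_taylor: "fld (u, A, w) y = fld (u, A, w) x + jac (u, A, w) x *v (y - x) + (w \<bullet> (y - x)) *\<^sub>R (y - x)"
  by (simp add: fld_def jac_vec mv_simps inner_diff_right algebra_simps)

lemma vec_basis: "z = (\<Sum>k\<in>UNIV. (z $ k) *\<^sub>R axis k 1)" for z :: "real^'m::finite"
  using basis_expansion[of z] by (simp add: scalar_mult_eq_scaleR)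

lemma linear_hess: "linear (hess g)"
  by (cases g) (simp add: linear_lam_iff hess_def outer_linear inner_add_right algebra_simps)

lemma jac_taylor: "jac g y = jac g x + (\<Sum>k\<in>UNIV. (y $ k - x $ k) *\<^sub>R hess g (axis k 1))"
proof -
  have "jac g y = jac g x + hess g (y - x)"
    by (cases g) (simp add: jac_def hess_def outer_def inner_diff_right vec_eq_iff algebra_simps)
  also have "hess g (y - x) = hess g (\<Sum>k\<in>UNIV. ((y - x) $ k) *\<^sub>R axis k 1)"
    by (rule arg_cong[OF vec_basis])
  finally show ?thesis by (simp add: linear_sum[OF linear_hess] linear_scale[OF linear_hess])
qed

text \<open>
  Beyond the linear terms of the field, the Lie derivative of a test field only produces monomials
  of degree one more.
\<close>

lemma lie_deriv_test:
  fixes g :: "'m::finite sl" and x :: "real^'m"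
  defines "M \<equiv> jac g x"
  shows "\<exists>c. \<forall>J' y. lie_deriv \<delta> (fld g) (test x L J) y J' =
      (\<Sum>i\<in>UNIV. fld g x $ i * (perm J' J * pd i (mono_at x L) y))
      + tensor_rep M (\<lambda>L. perm J' J * mono_at x L y) L
      - tensor_rep (transpose M) (\<lambda>J. perm J' J * mono_at x L y) J
      + \<delta> * trace M * (perm J' J * mono_at x L y)
      + (\<Sum>k\<in>UNIV. c k J' * mono_at x (k # L) y)"
proof -
  obtain u A w where g: "g = (u, A, w)" by (cases g)
  define c where "c = (\<lambda>k J'. w $ k * real (length L) * perm J' J
      - tensor_rep (hess g (axis k 1)) (\<lambda>J'. perm J' J) J' + \<delta> * trace (hess g (axis k 1)) * perm J' J)"
  have "lie_deriv \<delta> (fld g) (test x L J) y J' =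
      (\<Sum>i\<in>UNIV. fld g x $ i * (perm J' J * pd i (mono_at x L) y))
      + tensor_rep M (\<lambda>L. perm J' J * mono_at x L y) L
      - tensor_rep (transpose M) (\<lambda>J. perm J' J * mono_at x L y) J
      + \<delta> * trace M * (perm J' J * mono_at x L y)
      + (\<Sum>k\<in>UNIV. c k J' * mono_at x (k # L) y)" for J' y
  proof -
    let ?z = "y - x" and ?m = "mono_at x L y" and ?s = "perm J' J"
    have v: "vd (B *v ?z) (mono_at x L) y = tensor_rep B (\<lambda>L. mono_at x L y) L" for B
      by (simp add: vd_def matrix_vector_mult_def tensor_rep_mono_at)
    have "vd ?z (mono_at x L) y = length L * ?m"
      using v[of "mat 1"] by (simp add: tensor_rep_mat_1)
    then have 1: "vd (fld g y) (\<lambda>y. ?s * mono_at x L y) y = ?s * vd (fld g x) (mono_at x L) y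
        + ?s * tensor_rep M (\<lambda>L. mono_at x L y) L + ?s * ((w \<bullet> ?z) * (length L * ?m))"
      unfolding g fld_taylor[of u A w y x] vd_linear(1,3)
      by (simp add: vd_rules v M_def g distrib_left)
    have 2: "tensor_rep (jac g y) (\<lambda>J'. perm J' J * ?m) J' = tensor_rep (transpose M) (\<lambda>J. perm J' J * ?m) J
        + (\<Sum>k\<in>UNIV. (y $ k - x $ k) * (tensor_rep (hess g (axis k 1)) (\<lambda>J'. perm J' J) J' * ?m))"
      unfolding jac_taylor[of g y x] tensor_rep_mat_add tensor_rep_mat_sum tensor_rep_mat_scale M_def[symmetric]
      using tensor_rep_scale[of _ ?m "\<lambda>J'. perm J' J" J'] tensor_rep_scale[of _ ?m "perm J'" J]
      by (simp add: mult.commute[of _ ?m] perm_adjoint)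
    have 3: "trace (jac g y) = trace M + (\<Sum>k\<in>UNIV. (y $ k - x $ k) * trace (hess g (axis k 1)))"
      unfolding jac_taylor[of g y x] M_def
      by (simp add: trace_add trace_def sum.distrib sum_distrib_left sum.swap[of "\<lambda>i k. _ k * _ i k"])
    have 4: "w \<bullet> ?z = (\<Sum>k\<in>UNIV. w $ k * (y $ k - x $ k))" by (simp add: inner_vec_def)
    have "lie_deriv \<delta> (fld g) (test x L J) y J' =
        ?s * vd (fld g x) (mono_at x L) y + ?s * tensor_rep M (\<lambda>L. mono_at x L y) L
        - tensor_rep (transpose M) (\<lambda>J. perm J' J * ?m) J + \<delta> * trace M * (?s * ?m)
        + (?s * ((w \<bullet> ?z) * (length L * ?m))
         - (\<Sum>k\<in>UNIV. (y $ k - x $ k) * (tensor_rep (hess g (axis k 1)) (\<lambda>J'. perm J' J) J' * ?m))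
         + \<delta> * (\<Sum>k\<in>UNIV. (y $ k - x $ k) * trace (hess g (axis k 1))) * (?s * ?m))"
      unfolding lie_deriv_fld unfolding test_def 1 2 3 by (simp add: algebra_simps)
    also have "?s * ((w \<bullet> ?z) * (length L * ?m))
         - (\<Sum>k\<in>UNIV. (y $ k - x $ k) * (tensor_rep (hess g (axis k 1)) (\<lambda>J'. perm J' J) J' * ?m))
         + \<delta> * (\<Sum>k\<in>UNIV. (y $ k - x $ k) * trace (hess g (axis k 1))) * (?s * ?m)
       = (\<Sum>k\<in>UNIV. c k J' * mono_at x (k # L) y)"
      unfolding 4 c_def
      by (simp add: sum_distrib_left sum_distrib_right flip: sum_subtractf sum.distrib)
        (simp add: algebra_simps)
    finally show ?thesis
      using tensor_rep_scale[of M ?s "\<lambda>L. mono_at x L y" L]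
      by (simp add: vd_def sum_distrib_left mult.left_commute)
  qed
  then show ?thesis by blast
qed

text \<open>
  The traces cancel because both sides have the same density weight. The quadratic part of the field
  raises the degree of a test field above the order of the operator and does not contribute at its
  centre.
\<close>

theorem symb_op_action:
  fixes D :: "'m::finite field \<Rightarrow> 'm field"
  assumes D: "D \<in> diff_ops l p q"
  shows "symb l p q (op_action \<delta> p (fld g) D) = ltens g (symb l p q D)"
proof (intro ext)
  fix x K J
  define M where "M = jac g x"
  define T where "T = symb l p q D"
  show "symb l p q (op_action \<delta> p (fld g) D) x K J = ltens g (symb l p q D) x K J"
  proof (cases "length K = l + q \<and> length J = p")
    case False
    have z: "T y K' J' = 0" if "length K' = length K" "length J' = length J" for y K' J'
      using False that by (auto simp: T_def symb_def)
    have "tensor_rep A (\<lambda>K. T x K J) K = 0" "tensor_rep A (T x K) J = 0" for A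
      using tensor_rep_cong[of K "\<lambda>K. T x K J" "\<lambda>_. 0" A] tensor_rep_cong[of J "T x K" "\<lambda>_. 0" A]
      by (auto simp: z)
    then show ?thesis
      using False by (simp add: ltens_def trep_def z flip: T_def) (auto simp: symb_def)
  next
    case True
    define L I where "L = take l K" and "I = drop l K"
    have K: "K = L @ I" and L: "length L = l" and I: "length I = q" and J: "length J = p"
      using True by (auto simp: L_def I_def)
    obtain a where a: "\<forall>\<alpha> J I. smooth (a \<alpha> J I)" "\<forall>P\<in>sym_fields p. \<forall>x I. length I = q \<longrightarrow>
       D P x I = (\<Sum>\<alpha> | length \<alpha> \<le> l. \<Sum>J | length J = p. a \<alpha> J I x * pds \<alpha> (\<lambda>y. P y J) x)"
      using diff_ops_coeff[OF D] by (elim exE conjE)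
    define E where "E = (\<lambda>F. \<Sum>\<alpha> | length \<alpha> \<le> l. \<Sum>J' | length J' = p. a \<alpha> J' I x * pds \<alpha> (F J') x)"
    have E_add: "E (\<lambda>J' y. F J' y + G J' y) = E F + E G"
      if "\<And>J'. smooth (F J')" "\<And>J'. smooth (G J')" for F G
      unfolding E_def by (simp add: pds_add that distrib_left sum.distrib)
    have E_scale: "E (\<lambda>J' y. r * F J' y) = r * E F" if "\<And>J'. smooth (F J')" for F r
      unfolding E_def by (simp add: pds_cmult that mult.left_commute sum_distrib_left)
    have E_diff: "E (\<lambda>J' y. F J' y - G J' y) = E F - E G"
      if "\<And>J'. smooth (F J')" "\<And>J'. smooth (G J')" for F G
      using E_add[of F "\<lambda>J' y. (-1) * G J' y"] E_scale[of G "-1"] that by (simp add: smooth_minus)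
    have E_sum: "E (\<lambda>J' y. \<Sum>s\<in>S. F s J' y) = (\<Sum>s\<in>S. E (F s))"
      if "\<And>s J'. smooth (F s J')" for F and S :: "'x set"
      using that
    proof (induction S rule: infinite_finite_induct)
      case (insert s S)
      then show ?case by (simp add: E_add smooth_sum)
    qed (simp_all add: E_def)
    have E_sum': "E (\<lambda>J' y. \<Sum>s\<in>S. F s J' y) = (\<Sum>s\<in>S. E (F s))"
      if "\<And>s J'. smooth (F s J')" for F and S :: "nat set"
      using that
    proof (induction S rule: infinite_finite_induct)
      case (insert s S)
      then show ?case by (simp add: E_add smooth_sum)
    qed (simp_all add: E_def)
    have E_tr: "E (\<lambda>J' y. tensor_rep A (\<lambda>K. F K J' y) K0) = tensor_rep A (\<lambda>K. E (F K)) K0"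
      if "\<And>K J'. smooth (F K J')" for F A K0
      unfolding tensor_rep_def
      by (simp add: E_sum E_sum' E_scale that smooth_intros smooth_cmult)
    have DE: "D P x I = E (\<lambda>J' y. P y J')" if "P \<in> sym_fields p" for P
      using a(2) that I by (simp add: E_def)
    have sm: "smooth (\<lambda>y. perm J' J'' * mono_at x L' y)" "smooth (\<lambda>y. perm J' J'' * pd i (mono_at x L') y)"
      for J' J'' L' i by (intro smooth_intros smooth_mono_at)+
    have ET: "E (\<lambda>J' y. perm J' J'' * mono_at x L' y) = T x (L' @ I) J''"
      if "length L' = l" "length J'' = p" for L' J''
      unfolding T_def symb_coeff[OF a(2) that(1) I that(2)] E_def by (simp add: pds_test mult_ac)
    have E0: "E (\<lambda>J' y. c J' * mono_at x (k # L) y) = 0" for c k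
      unfolding E_def using L
      by (intro sum.neutral ballI) (auto simp: pds_cmult pds_mono_at perm_length simp del: mono_at_simps)
    let ?t = "test x L J"
    have t: "?t \<in> sym_fields p" by (rule test_in[OF J])
    define G where "G = (\<lambda>i. E (\<lambda>J' y. perm J' J * pd i (mono_at x L) y))"
    have T1: "tensor_rep M (\<lambda>L. E (\<lambda>J' y. perm J' J * mono_at x L y)) L = tensor_rep M (\<lambda>L. T x (L @ I) J) L"
      by (rule tensor_rep_cong) (simp add: ET L J)
    have T2: "tensor_rep (transpose M) (\<lambda>J. E (\<lambda>J' y. perm J' J * mono_at x L y)) J
        = tensor_rep (transpose M) (T x (L @ I)) J"
      by (rule tensor_rep_cong) (simp add: ET L J)
    have R: "D (lie_deriv \<delta> (fld g) ?t) x I = (\<Sum>i\<in>UNIV. fld g x $ i * G i)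
        + tensor_rep M (\<lambda>L. T x (L @ I) J) L - tensor_rep (transpose M) (T x (L @ I)) J
        + \<delta> * trace M * T x (L @ I) J"
    proof -
      obtain c where c: "\<forall>J' y. lie_deriv \<delta> (fld g) ?t y J' =
        (\<Sum>i\<in>UNIV. fld g x $ i * (perm J' J * pd i (mono_at x L) y))
        + tensor_rep M (\<lambda>L. perm J' J * mono_at x L y) L
        - tensor_rep (transpose M) (\<lambda>J. perm J' J * mono_at x L y) J
        + \<delta> * trace M * (perm J' J * mono_at x L y)
        + (\<Sum>k\<in>UNIV. c k J' * mono_at x (k # L) y)"
        using lie_deriv_test[of \<delta> g x L J] unfolding M_def by (elim exE)
      have "D (lie_deriv \<delta> (fld g) ?t) x I = E (\<lambda>J' y. (\<Sum>i\<in>UNIV. fld g x $ i * (perm J' J * pd i (mono_at x L) y))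
        + tensor_rep M (\<lambda>L. perm J' J * mono_at x L y) L
        - tensor_rep (transpose M) (\<lambda>J. perm J' J * mono_at x L y) J
        + \<delta> * trace M * (perm J' J * mono_at x L y)
        + (\<Sum>k\<in>UNIV. c k J' * mono_at x (k # L) y))"
        unfolding DE[OF lie_deriv_in[OF t]] using c by simp
      also have "\<dots> = (\<Sum>i\<in>UNIV. fld g x $ i * G i)
        + tensor_rep M (\<lambda>L. E (\<lambda>J' y. perm J' J * mono_at x L y)) L
        - tensor_rep (transpose M) (\<lambda>J. E (\<lambda>J' y. perm J' J * mono_at x L y)) J
        + \<delta> * trace M * T x (L @ I) J"
      proof -
        have s1: "smooth (\<lambda>y. \<Sum>i\<in>UNIV. fld g x $ i * (perm J' J * pd i (mono_at x L) y))" for J'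
          by (intro smooth_intros smooth_mono_at)
        have s2: "smooth (\<lambda>y. tensor_rep A (\<lambda>L. perm J' J * mono_at x L y) L)"
          "smooth (\<lambda>y. tensor_rep A (\<lambda>J. perm J' J * mono_at x L y) J)" for A J'
          by (intro smooth_tensor_rep smooth_intros smooth_mono_at)+
        have s3: "smooth (\<lambda>y. \<delta> * trace M * (perm J' J * mono_at x L y))" for J'
          by (intro smooth_intros smooth_mono_at)
        have s4: "smooth (\<lambda>y. \<Sum>k\<in>UNIV. c k J' * mono_at x (k # L) y)" for J'
          by (intro smooth_sum smooth_cmult smooth_mono_at)
        have e1: "E (\<lambda>J' y. \<Sum>i\<in>UNIV. fld g x $ i * (perm J' J * pd i (mono_at x L) y)) = (\<Sum>i\<in>UNIV. fld g x $ i * G i)"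
          by (subst E_sum) (auto simp: E_scale sm G_def smooth_cmult)
        have e3: "E (\<lambda>J' y. \<delta> * trace M * (perm J' J * mono_at x L y)) = \<delta> * trace M * T x (L @ I) J"
          by (subst E_scale) (auto simp: sm ET L J)
        have e4: "E (\<lambda>J' y. \<Sum>k\<in>UNIV. c k J' * mono_at x (k # L) y) = 0"
          by (subst E_sum) (auto simp: E0 simp del: mono_at_simps intro!: smooth_cmult smooth_mono_at sum.neutral)
        have e2: "E (\<lambda>J' y. tensor_rep M (\<lambda>L. perm J' J * mono_at x L y) L) =
            tensor_rep M (\<lambda>L. E (\<lambda>J' y. perm J' J * mono_at x L y)) L"
          "E (\<lambda>J' y. tensor_rep (transpose M) (\<lambda>J. perm J' J * mono_at x L y) J) =
            tensor_rep (transpose M) (\<lambda>J. E (\<lambda>J' y. perm J' J * mono_at x L y)) J"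
          by (rule E_tr, rule sm(1))+
        show ?thesis
          by (simp only: E_add E_diff s1 s2 s3 s4 smooth_add smooth_diff e1 e2 e3 e4 add_0_right)
      qed
      finally show ?thesis unfolding T1 T2 .
    qed
    have pT: "pd i (\<lambda>y. T y (L @ I) J) x + G i = pd i (\<lambda>y. D ?t y I) x" for i
    proof -
      have "(\<lambda>y. D ?t y I) = (\<lambda>y. \<Sum>\<alpha> | length \<alpha> \<le> l. \<Sum>J' | length J' = p. a \<alpha> J' I y * (perm J' J * pds \<alpha> (mono_at x L) y))"
        using a(2) t I by (simp add: fun_eq_iff test_def pds_cmult)
      moreover have "(\<lambda>y. T y (L @ I) J) = (\<lambda>y. \<Sum>\<alpha> | length \<alpha> \<le> l. \<Sum>J' | length J' = p. a \<alpha> J' I y * (perm \<alpha> L * perm J' J))"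
        unfolding T_def by (rule ext) (rule symb_coeff[OF a(2) L I J])
      ultimately show ?thesis
        using a(1)
        by (simp add: G_def E_def pd_sum pd_mult smooth_intros smooth_mono_at smooth_cmult pd_cmult pds_cmult
            pds_mono_at pd_pds sum.distrib[symmetric] algebra_simps)
    qed
    have "symb l p q (op_action \<delta> p (fld g) D) x K J = lie_deriv \<delta> (fld g) (D ?t) x I - D (lie_deriv \<delta> (fld g) ?t) x I"
      using True t by (simp add: symb_def op_action_def L_def I_def)
    also have "\<dots> = vd (fld g x) (\<lambda>y. T y (L @ I) J) x + (\<Sum>i\<in>UNIV. fld g x $ i * G i)
       - tensor_rep M (\<lambda>I. T x (L @ I) J) I + \<delta> * trace M * T x (L @ I) J - D (lie_deriv \<delta> (fld g) ?t) x I"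
    proof -
      have "tensor_rep M (D ?t x) I = tensor_rep M (\<lambda>I. T x (L @ I) J) I"
        using L I J by (intro tensor_rep_cong) (simp add: T_def symb_def)
      moreover have "D ?t x I = T x (L @ I) J" using L I J by (simp add: T_def symb_def)
      moreover have "vd (fld g x) (\<lambda>y. D ?t y I) x = vd (fld g x) (\<lambda>y. T y (L @ I) J) x + (\<Sum>i\<in>UNIV. fld g x $ i * G i)"
        unfolding vd_def pT[symmetric] by (simp add: distrib_left sum.distrib)
      ultimately show ?thesis by (simp add: lie_deriv_fld M_def)
    qed
    also have "\<dots> = ltens g (symb l p q D) x K J"
      unfolding R by (simp add: ltens_def trep_def K tensor_rep_append M_def T_def)
    finally show ?thesis .
  qed
qed

text \<open>
  A commutator with a Lie derivative a priori has order \<open>k + 1\<close>; but its symbol of that order is the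
  Lie derivative of the symbol of order \<open>k + 1\<close> of \<open>D\<close>, which is zero.
\<close>

lemma op_action_in:
  assumes D: "D \<in> diff_ops k p q"
  shows "op_action \<delta> p (fld g) D \<in> diff_ops k p q"
proof -
  have 1: "D \<in> diff_ops (Suc k) p q" using D diff_ops_mono[of k "Suc k"] by auto
  have "symb (Suc k) p q D = 0" using symb_dops[of D "Suc k"] D by simp
  then have "symb (Suc k) p q (op_action \<delta> p (fld g) D) = ltens g 0"
    using symb_op_action[OF 1] by simp
  also have "\<dots> = 0"
    by (simp add: fun_eq_iff ltens_def trep_def zero_fun_def)
  finally show ?thesis
    using symb_kernel[OF op_action_order[OF D]] by simp
qed

lemma scaleR_fun_apply: "(r *\<^sub>R f) x = r *\<^sub>R f x"
  by (simp add: scaleR_fun_def)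

lemma lie_module_diff_ops:
  "lie_module slbr (\<lambda>g. op_action \<delta> p (fld g)) (diff_ops k p q :: ('m::finite field \<Rightarrow> 'm field) set)"
proof -
  have scale: "op_action \<delta> p (fld x) (r *\<^sub>R D) = r *\<^sub>R op_action \<delta> p (fld x) D"
    if D: "D \<in> diff_ops k p q" for x :: "'m sl" and r D
  proof
    fix P
    show "op_action \<delta> p (fld x) (r *\<^sub>R D) P = (r *\<^sub>R op_action \<delta> p (fld x) D) P"
      unfolding scaleR_fun_apply[of r "op_action \<delta> p (fld x) D" P]
      using lie_deriv_linear(3)[OF diff_opsD(2)[OF D] diff_opsD(2)[OF D], of P P \<delta> x r]
      by (simp add: op_action_def scaleR_fun_apply[of _ D] scaleR_diff_right)
  qed
  have lin: "linear (\<lambda>x. op_action \<delta> p (fld x) D)" if D: "D \<in> diff_ops k p q" for D :: "'m field \<Rightarrow> 'm field"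
    unfolding linear_lam_iff
  proof (intro conjI allI; rule ext)
    fix x y r and P :: "'m field"
    show "op_action \<delta> p (fld (x + y)) D P = (op_action \<delta> p (fld x) D + op_action \<delta> p (fld y) D) P"
      by (simp add: op_action_def lie_deriv_field_linear diff_ops_linear[OF D lie_deriv_in lie_deriv_in])
    show "op_action \<delta> p (fld (r *\<^sub>R x)) D P = (r *\<^sub>R op_action \<delta> p (fld x) D) P"
      unfolding scaleR_fun_apply[of r "op_action \<delta> p (fld x) D" P]
      by (simp add: op_action_def lie_deriv_field_linear
          diff_ops_linear[OF D lie_deriv_in lie_deriv_in] scaleR_diff_right)
  qed
  have rep: "op_action \<delta> p (fld (slbr x y)) D =
     op_action \<delta> p (fld x) (op_action \<delta> p (fld y) D) - op_action \<delta> p (fld y) (op_action \<delta> p (fld x) D)"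
    if D: "D \<in> diff_ops k p q" for x y and D :: "'m field \<Rightarrow> 'm field"
  proof
    fix P :: "'m field"
    show "op_action \<delta> p (fld (slbr x y)) D P = (op_action \<delta> p (fld x) (op_action \<delta> p (fld y) D)
        - op_action \<delta> p (fld y) (op_action \<delta> p (fld x) D)) P"
    proof (cases "P \<in> sym_fields p")
      case True
      note DP = diff_opsD(2)[OF D]
      note l = lie_deriv_in[OF True] lie_deriv_in[OF lie_deriv_in[OF True]]
      show ?thesis
        using True l
        by (simp add: op_action_def lie_deriv_rep[OF True] lie_deriv_rep[OF DP[OF True]] diff_ops_linear(3)[OF D]
            lie_deriv_linear(2)[of _ q] DP lie_deriv_in algebra_simps)
    qed (simp add: op_action_def)
  qed
  have add: "op_action \<delta> p (fld x) (D + E) = op_action \<delta> p (fld x) D + op_action \<delta> p (fld x) E"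
    if D: "D \<in> diff_ops k p q" and E: "E \<in> diff_ops k p q" for x and D E :: "'m field \<Rightarrow> 'm field"
  proof
    fix P
    show "op_action \<delta> p (fld x) (D + E) P = (op_action \<delta> p (fld x) D + op_action \<delta> p (fld x) E) P"
      using lie_deriv_linear(1)[OF diff_opsD(2)[OF D] diff_opsD(2)[OF E], of P P \<delta> x]
      by (simp add: op_action_def algebra_simps)
  qed
  show ?thesis
    by (rule lie_module.intro)
      (rule linear_slbr slbr_self slbr_jacobi subspace_diff_ops |
        erule op_action_in scale lin rep | erule (1) add)+
qed

section \<open>Untwisting the translations\<close>

text \<open>
  The fields of the algebra are described by their Taylor coefficients at \<open>x\<close>: \<^term>\<open>shift x g\<close> has
  at \<open>x\<close> the expansion that \<open>g\<close> has at the origin.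
\<close>

definition shift :: "real^'m::finite \<Rightarrow> 'm sl \<Rightarrow> 'm sl" where
  "shift x = (\<lambda>(u, A, w). (u - A *v x + (w \<bullet> x) *\<^sub>R x, A - (w \<bullet> x) *\<^sub>R mat 1 - outer x w, w))"

lemma fld_shift: "fld (shift x g) y = fld g (y - x)"
  by (cases g) (simp add: shift_def fld_def mv_simps outer_vec inner_diff_right algebra_simps)

lemma jac_shift: "jac (shift x g) y = jac g (y - x)"
  by (cases g) (simp add: shift_def jac_def vec_eq_iff outer_def inner_diff_right algebra_simps)

lemma fld_eqI: "(\<And>y. fld g y = fld h y) \<Longrightarrow> g = h"
  using injD[OF inj_fld] by blast

lemma linear_shift: "linear (shift x)"
  unfolding linear_lam_iff by (intro conjI allI; rule fld_eqI; simp add: fld_shift fld_linear)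

lemma shift_br: "shift x (slbr g h) = slbr (shift x g) (shift x h)"
  by (rule fld_eqI) (simp add: fld_shift fld_br jac_shift)

lemma shift_minus: "shift (- x) (shift x g) = g" "shift x (shift (- x) g) = g"
  by (rule fld_eqI, simp add: fld_shift)+

lemma fld_0: "fld g 0 = fst g" and jac_0: "jac g 0 = fst (snd g)"
  by (cases g; simp add: fld_def jac_def outer_def vec_eq_iff)+

lemma shift_translation: "shift x (u, 0, 0) = (u, 0, 0)"
  by (rule fld_eqI, subst fld_shift, simp add: fld_def)

lemma outer_zero: "outer u 0 = 0" "outer 0 w = 0"
  by (simp_all add: outer_def vec_eq_iff)

lemma has_derivative_shift:
  "((\<lambda>x. shift x g) has_derivative (\<lambda>v. - slbr (v, 0, 0) (shift x g))) (at x)"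
proof (cases g)
  fix u A w assume g: "g = (u, A, w)"
  have o: "bounded_linear (\<lambda>x. outer x w)"
    by (rule linear_conv_bounded_linear[THEN iffD1]) (simp add: linear_lam_iff outer_linear)
  have "((\<lambda>x. (u - A *v x + (w \<bullet> x) *\<^sub>R x, A - (w \<bullet> x) *\<^sub>R mat 1 - outer x w, w)) has_derivative
      (\<lambda>v. (0 - A *v v + ((w \<bullet> x) *\<^sub>R v + (w \<bullet> v) *\<^sub>R x), 0 - (w \<bullet> v) *\<^sub>R mat 1 - outer v w, 0))) (at x)"
    by (auto intro!: derivative_eq_intros bounded_linear_imp_has_derivative[OF o]
        bounded_linear_imp_has_derivative[OF matrix_vector_mul_bounded_linear])
  then show ?thesis
    by (rule has_derivative_transform_within[OF has_derivative_eq_rhs, where d = 1])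
      (auto simp: g shift_def slbr_def mv_simps outer_vec outer_linear outer_zero algebra_simps)
qed

lemma has_derivative_linear_shift:
  assumes "linear (f :: 'm::finite sl \<Rightarrow> real)"
  shows "((\<lambda>x. f (shift x g)) has_derivative (\<lambda>v. f (- slbr (v, 0, 0) (shift x g)))) (at x)"
  by (rule bounded_linear.has_derivative[OF _ has_derivative_shift])
    (use assms linear_conv_bounded_linear in blast)

lemma pd_linear_shift:
  "linear f \<Longrightarrow> pd i (\<lambda>x. f (shift x g)) = (\<lambda>x. f (- slbr (axis i 1, 0, 0) (shift x g)))"
  using pd_eqI[OF has_derivative_linear_shift] by blast

lemma smooth_linear_shift: "linear f \<Longrightarrow> smooth (\<lambda>x. f (shift x g))"
proof -
  have "linear f \<Longrightarrow> Ck n (\<lambda>x. f (shift x g))" for n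
  proof (induction n arbitrary: f)
    case 0
    then show ?case
      using has_derivative_linear_shift[OF 0, of g] by (auto simp: differentiable_def)
  next
    case (Suc n)
    have "linear (\<lambda>h. f (- slbr (axis i 1, 0, 0) h))" for i
      using linear_compose[OF linear_compose[OF linear_slbr(1) linear_uminus] Suc.prems] by (simp add: o_def)
    then show ?case
      using Suc has_derivative_linear_shift[OF Suc.prems, of g] by (auto simp: differentiable_def pd_linear_shift)
  qed
  then show "linear f \<Longrightarrow> smooth (\<lambda>x. f (shift x g))" by (simp add: smooth_iff_Ck)
qed

subsection \<open>Substitutions in cochains\<close>

lemma alts_map: "alts F (map f xs) = alts (\<lambda>x ys. F (f x) (map f ys)) xs"
  by (induction xs arbitrary: F) auto

lemma der_map: "(\<And>x. g (f x) = f (h x)) \<Longrightarrow> der g c (map f xs) = der h (\<lambda>ys. c (map f ys)) xs"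
  by (induction xs arbitrary: c) auto

lemma pairs_map:
  "(\<And>x y. \<beta> (f x) (f y) = f (\<gamma> x y)) \<Longrightarrow> pairs \<beta> c (map f xs) = pairs \<gamma> (\<lambda>ys. c (map f ys)) xs"
  by (induction xs arbitrary: c) (auto simp: der_map[where h = "\<gamma> _"])

lemma der_linear_push: "linear s \<Longrightarrow> s (der f c xs) = der f (\<lambda>ys. s (c ys)) xs"
  by (induction xs arbitrary: c) (auto simp: linear_0 linear_add)

lemma alts_linear_push: "linear s \<Longrightarrow> s (alts F xs) = alts (\<lambda>x ys. s (F x ys)) xs"
  by (induction xs arbitrary: F) (auto simp: linear_0 linear_diff)

lemma pairs_linear_push: "linear s \<Longrightarrow> s (pairs \<gamma> c xs) = pairs \<gamma> (\<lambda>ys. s (c ys)) xs"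
  by (induction xs arbitrary: c) (auto simp: linear_0 linear_diff linear_neg der_linear_push)

lemma altern_map: "altern c \<Longrightarrow> linear f \<Longrightarrow> altern (\<lambda>xs. c (map f xs))"
proof -
  assume c: "altern c" and f: "linear f"
  have "linear (\<lambda>x. c (map f us @ f x # map f vs))" for us vs
    using linear_compose[OF f multilin_linear[OF altern_multilin[OF c], of "map f us" "map f vs"]]
    by (simp add: o_def)
  then show "altern (\<lambda>xs. c (map f xs))"
    using c by (simp add: altern_def multilin_def)
qed

lemma altern_compose: "altern c \<Longrightarrow> linear s \<Longrightarrow> altern (\<lambda>xs. s (c xs))"
  by (simp add: altern_def multilin_def linear_lam_iff linear_0)

lemma multilin_compose: "multilin c \<Longrightarrow> linear s \<Longrightarrow> multilin (\<lambda>xs. s (c xs))"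
  by (simp add: multilin_def linear_lam_iff)

lemma altern_eval: "altern c \<Longrightarrow> altern (\<lambda>xs. c xs x)"
  by (rule altern_compose[where s = "\<lambda>f. f x"]) (simp_all add: linear_lam_iff scaleR_fun_def)

lemma altern_funI: "(\<And>x. altern (\<lambda>xs. c xs x)) \<Longrightarrow> altern c"
  by (simp add: altern_def multilin_def linear_lam_iff fun_eq_iff scaleR_fun_def)

subsection \<open>The chain map given by the symbol\<close>

text \<open>
  The action after the untwisting: translations differentiate, linear parts act on the values, and
  covectors act by zero.
\<close>

definition tact :: "'m::finite sl \<Rightarrow> (real^'m \<Rightarrow> 'm tens) \<Rightarrow> real^'m \<Rightarrow> 'm tens" where
  "tact g T = (\<lambda>x K J. vd (fst g) (\<lambda>y. T y K J) x - trep (fst (snd g)) (T x) K J)"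

text \<open>The bracket of the direct product of the translations with the isotropy algebra of the origin.\<close>

definition hbr :: "'m::finite sl \<Rightarrow> 'm sl \<Rightarrow> 'm sl" where
  "hbr = (\<lambda>(u, A, w) (v, B, z). (0, B ** A - A ** B, transpose A *v z - transpose B *v w))"

text \<open>
  Recentring the arguments at the point of evaluation is what identifies the cochains with values
  in an induced module with cochains of the isotropy algebra.
\<close>

definition smap :: "nat \<Rightarrow> nat \<Rightarrow> nat \<Rightarrow> ('m::finite sl list \<Rightarrow> 'm field \<Rightarrow> 'm field) \<Rightarrow> 'm sl list \<Rightarrow> real^'m \<Rightarrow> 'm tens" where
  "smap l p q c Xs x = symb l p q (c (map (shift x) Xs)) x"

lemma hbr_slbr: "hbr g h = slbr g h - (slbr (fst g, 0, 0) h - slbr (fst h, 0, 0) g)"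
  by (cases g; cases h) (simp add: hbr_def slbr_def mv_simps outer_def vec_eq_iff)

lemma linear_symb: "linear (symb l p q)"
  by (simp add: linear_lam_iff symb_linear)

lemma smap_altern:
  assumes "altern c"
  shows "altern (\<lambda>Xs. smap l p q c Xs x)" "altern (smap l p q c)"
proof -
  show *: "altern (\<lambda>Xs. smap l p q c Xs x)" for x
    unfolding smap_def
    by (rule altern_eval) (intro altern_compose[OF _ linear_symb] altern_map assms linear_shift)
  show "altern (smap l p q c)" by (rule altern_funI) (rule *)
qed

lemma symb_smooth: "D \<in> diff_ops k p q \<Longrightarrow> smooth (\<lambda>y. symb l p q D y K J)"
  using symb_in[of D k p q l] by (simp add: tens_fields_def)

lemma multilin_symb_eval: "multilin c \<Longrightarrow> multilin (\<lambda>Ys y. symb l p q (c Ys) y K J)"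
  by (rule multilin_compose[where s = "\<lambda>D y. symb l p q D y K J"])
    (auto simp: linear_lam_iff symb_linear scaleR_fun_apply)

lemma smooth_smap:
  assumes "multilin c" "\<And>Xs. c Xs \<in> diff_ops k p q"
  shows "smooth (\<lambda>x. smap l p q c Xs x K J)"
proof -
  have "smooth (\<lambda>x. symb l p q (c (map (\<lambda>f. f x) (map (\<lambda>X x. shift x X) Xs))) x K J)"
    by (rule smooth_multilin_subst[of "\<lambda>Ys y. symb l p q (c Ys) y K J"])
      (auto intro: multilin_symb_eval assms symb_smooth smooth_linear_shift[where f = "\<lambda>g. g \<bullet> _"]
        simp: linear_lam_iff inner_add_left)
  then show ?thesis by (simp add: smap_def o_def)
qed

lemma smap_in:
  assumes "c \<in> altcochains (diff_ops l p q) n m"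
  shows "smap l p q c \<in> altcochains (tens_fields l p q) n m"
proof -
  note c = altcochainsD[OF assms]
  have "smap l p q c Xs \<in> tens_fields l p q" for Xs
    using symb_in[OF c(3)] smooth_smap[OF c(2,3)] by (simp add: tens_fields_def smap_def)
  moreover have "smap l p q c Xs = 0" if "length Xs + m \<noteq> n" for Xs
  proof -
    have "c (map (shift x) Xs) = 0" for x by (rule c(4)) (use that in simp)
    then show ?thesis by (intro ext) (simp add: smap_def symb_linear)
  qed
  ultimately show ?thesis using smap_altern(2)[OF c(1)] by (simp add: altcochains_def)
qed

lemma vd_smap:
  assumes c: "multilin c" "\<And>Xs. c Xs \<in> diff_ops k p q"
  shows "vd u (\<lambda>y. smap l p q c Xs y K J) x =
    vd u (\<lambda>y. symb l p q (c (map (shift x) Xs)) y K J) x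
    - der (slbr (u, 0, 0)) (\<lambda>Ys. smap l p q c Ys x K J) Xs"
proof -
  let ?e = "\<lambda>Ys y. symb l p q (c Ys) y K J"
  let ?s = "\<lambda>Ys. smap l p q c Ys x K J"
  have me: "multilin ?e" by (rule multilin_symb_eval[OF c(1)])
  have ms: "multilin ?s"
  proof -
    have "linear (\<lambda>g. ?e (map (shift x) us @ shift x g # map (shift x) vs) x)" for us vs
      using linear_compose[OF linear_shift[of x] multilin_linear[OF me, of "map (shift x) us" "map (shift x) vs"]]
      by (simp add: o_def linear_lam_iff fun_eq_iff scaleR_fun_def)
    then show ?thesis by (simp add: multilin_def smap_def)
  qed
  have 1: "pd i (\<lambda>y. smap l p q c Xs y K J) x = pd i (?e (map (shift x) Xs)) x
      - der (slbr (axis i 1, 0, 0)) ?s Xs" for i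
  proof -
    have "pd i (\<lambda>y. ?e (map (\<lambda>f. f y) (map (\<lambda>X x. shift x X) Xs)) y) x =
        pd i (?e (map (\<lambda>f. f x) (map (\<lambda>X x. shift x X) Xs))) x
        + der (\<lambda>g. - slbr (axis i 1, 0, 0) g) ?e (map (\<lambda>f. f x) (map (\<lambda>X x. shift x X) Xs)) x"
    proof (rule pd_multilin_subst[OF me])
      show "smooth (?e vs)" for vs by (rule symb_smooth[OF c(2)])
      fix f and b :: "'a sl" assume "f \<in> set (map (\<lambda>X x. shift x X) Xs)"
      then obtain X where f: "f = (\<lambda>x. shift x X)" by auto
      have l: "linear (\<lambda>g. g \<bullet> b)" by (simp add: linear_lam_iff inner_add_left)
      show "smooth (\<lambda>x. f x \<bullet> b)" unfolding f by (rule smooth_linear_shift[OF l])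
      show "pd i (\<lambda>x. f x \<bullet> b) x = - slbr (axis i 1, 0, 0) (f x) \<bullet> b"
        unfolding f by (rule fun_cong[OF pd_linear_shift[OF l]])
    qed
    moreover have "der (\<lambda>g. - slbr (axis i 1, 0, 0) g) ?e (map (shift x) Xs) x = - der (slbr (axis i 1, 0, 0)) ?s Xs"
    proof -
      have "der (\<lambda>g. - slbr (axis i 1, 0, 0) g) ?e (map (shift x) Xs) x =
          der (\<lambda>g. - slbr (axis i 1, 0, 0) g) (\<lambda>Ys. ?e (map (shift x) Ys) x) Xs"
        unfolding der_apply[of _ ?e]
        by (rule der_map) (simp add: linear_neg[OF linear_shift] shift_br shift_translation)
      also have "\<dots> = - der (slbr (axis i 1, 0, 0)) ?s Xs"
        using der_fun_scale[OF ms, of "-1" "slbr (axis i 1, 0, 0)" Xs] by (simp add: smap_def)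
      finally show ?thesis .
    qed
    ultimately show ?thesis by (simp add: smap_def o_def)
  qed
  have "(u, 0, 0) = (\<Sum>i\<in>UNIV. u $ i *\<^sub>R (axis i 1, 0, 0) :: 'a sl)"
    by (simp add: prod_eq_iff fst_sum snd_sum flip: vec_basis)
  then have e: "slbr (u, 0, 0) g = (\<Sum>i\<in>UNIV. u $ i *\<^sub>R slbr (axis i 1, 0, 0) g)" for g
    using linear_sum[OF linear_slbr(2), of "\<lambda>i. u $ i *\<^sub>R (axis i 1, 0, 0)" UNIV g]
      linear_scale[OF linear_slbr(2)[of g], of _ "(axis _ 1, 0, 0)"] by simp
  have "slbr (u, 0, 0) = (\<lambda>g. \<Sum>i\<in>UNIV. u $ i *\<^sub>R slbr (axis i 1, 0, 0) g)"
    by (rule ext) (rule e)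
  then have "der (slbr (u, 0, 0)) ?s Xs = (\<Sum>i\<in>UNIV. u $ i * der (slbr (axis i 1, 0, 0)) ?s Xs)"
    using der_fun_sum[OF ms, of "\<lambda>i g. u $ i *\<^sub>R slbr (axis i 1, 0, 0) g" UNIV Xs]
      der_fun_scale[OF ms] by simp
  then show ?thesis
    unfolding vd_def 1 by (simp add: right_diff_distrib sum_subtractf)
qed

text \<open>
  Moving the base point changes the arguments of a cochain by brackets with translations. These
  extra terms turn the bracket of the projective algebra into \<^const>\<open>hbr\<close>.
\<close>

theorem smap_ced:
  assumes "c \<in> altcochains (diff_ops l p q) n m"
  shows "smap l p q (ced slbr (\<lambda>g. op_action \<delta> p (fld g)) c) = ced hbr tact (smap l p q c)"
proof (intro ext)
  fix Xs x K J
  note c = altcochainsD[OF assms]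
  let ?s = "\<lambda>Ys. smap l p q c Ys x K J"
  let ?e = "\<lambda>Ys. symb l p q (c Ys)"
  have as: "altern ?s"
    by (rule altern_eval[of "\<lambda>Ys. smap l p q c Ys x K"], rule altern_eval[of "\<lambda>Ys. smap l p q c Ys x"],
        rule smap_altern[OF c(1)])
  have 1: "symb l p q (op_action \<delta> p (fld X) (c Ys)) = ltens X (?e Ys)" for X Ys
    by (rule symb_op_action[OF c(3)])
  have 2: "ltens (shift x X) (?e (map (shift x) ys)) x K J =
      tact X (smap l p q c ys) x K J + der (slbr (fst X, 0, 0)) ?s ys" for X ys
    unfolding ltens_def tact_def fld_shift jac_shift vd_smap[OF c(2,3)]
    by (simp add: fld_0 jac_0 smap_def)
  have "smap l p q (ced slbr (\<lambda>g. op_action \<delta> p (fld g)) c) Xs x K J =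
      (alts (\<lambda>X ys. ltens X (?e ys)) (map (shift x) Xs) + pairs slbr ?e (map (shift x) Xs)) x K J"
    by (simp add: smap_def ced_def symb_linear alts_linear_push[OF linear_symb] pairs_linear_push[OF linear_symb] 1)
  also have "\<dots> = alts (\<lambda>X ys. ltens (shift x X) (?e (map (shift x) ys)) x K J) Xs
      + pairs slbr (\<lambda>Ys. ?e (map (shift x) Ys) x K J) Xs"
    by (simp add: alts_map pairs_map[where f = "shift x" and \<beta> = slbr and \<gamma> = slbr, OF shift_br[symmetric]] alts_apply pairs_apply)
  also have "\<dots> = alts (\<lambda>X ys. tact X (smap l p q c ys) x K J) Xs
      + (alts (\<lambda>X ys. der (slbr (fst X, 0, 0)) ?s ys) Xs + pairs slbr ?s Xs)"
    unfolding 2 alts_add by (simp add: smap_def)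
  also have "alts (\<lambda>X ys. der (slbr (fst X, 0, 0)) ?s ys) Xs + pairs slbr ?s Xs = pairs hbr ?s Xs"
    unfolding alts_der[OF as, of "\<lambda>X. slbr (fst X, 0, 0)"] hbr_slbr[abs_def]
      pairs_fun_diff[OF altern_multilin[OF as]] by simp
  also have "alts (\<lambda>X ys. tact X (smap l p q c ys) x K J) Xs + pairs hbr ?s Xs = ced hbr tact (smap l p q c) Xs x K J"
    by (simp add: ced_def alts_apply pairs_apply)
  finally show "smap l p q (ced slbr (\<lambda>g. op_action \<delta> p (fld g)) c) Xs x K J = ced hbr tact (smap l p q c) Xs x K J" .
qed

lemma smap_surj:
  fixes b :: "'m::finite sl list \<Rightarrow> real^'m \<Rightarrow> 'm tens"
  assumes "b \<in> altcochains (tens_fields l p q) n m"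
  shows "\<exists>c\<in>altcochains (diff_ops l p q) n m. smap l p q c = b"
proof -
  note b = altcochainsD[OF assms]
  define T where "T = (\<lambda>Ys x. b (map (shift (- x)) Ys) x)"
  have sb: "smooth (\<lambda>y. b Ys y K J)" for Ys K J using b(3)[of Ys] by (simp add: tens_fields_def)
  have mb: "multilin (\<lambda>Ys y. b Ys y K J)" for K J
    using b(2) by (simp add: multilin_def linear_lam_iff fun_eq_iff scaleR_fun_def)
  have "smooth (\<lambda>x. T Ys x K J)" for Ys K J
  proof -
    have s: "smooth (\<lambda>x. shift (- x) X \<bullet> e)" for X :: "'m sl" and e
      using smooth_scaling[OF smooth_linear_shift[of "\<lambda>g. g \<bullet> e" X], of "-1"]
      by (simp add: linear_lam_iff inner_add_left)
    have "smooth (\<lambda>x. b (map (\<lambda>f. f x) (map (\<lambda>X x. shift (- x) X) Ys)) x K J)"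
      by (rule smooth_multilin_subst[OF mb sb]) (auto intro: s)
    then show ?thesis by (simp add: T_def o_def)
  qed
  then have T: "T Ys \<in> tens_fields l p q" for Ys
    using b(3) by (simp add: tens_fields_def T_def)
  have aT: "altern T"
  proof (rule altern_funI)
    show "altern (\<lambda>xs. T xs x)" for x
      unfolding T_def
      by (rule altern_eval) (intro altern_map b(1) linear_shift)
  qed
  define c where "c = (\<lambda>Ys. quant l p q (T Ys))"
  have "linear (quant l p q :: (real^'m \<Rightarrow> 'm tens) \<Rightarrow> _)" by (simp add: linear_lam_iff quant_linear)
  then have "altern c" unfolding c_def by (rule altern_compose[OF aT])
  moreover have "c Xs = 0" if "length Xs + m \<noteq> n" for Xs
  proof -
    have "T Xs = 0" using b(4) that by (simp add: T_def fun_eq_iff)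
    then show ?thesis by (simp add: c_def quant_linear)
  qed
  ultimately have "c \<in> altcochains (diff_ops l p q) n m"
    using quant_in[OF T] by (simp add: altcochains_def c_def)
  moreover have "smap l p q c = b"
    by (simp add: fun_eq_iff smap_def c_def symb_quant[OF T]) (simp add: T_def o_def shift_minus)
  ultimately show ?thesis by blast
qed

lemma smap_kernel:
  assumes "c \<in> altcochains (diff_ops l p q) n m"
  shows "smap l p q c = 0 \<longleftrightarrow> c \<in> altcochains (dops l p q) n m"
proof
  note c = altcochainsD[OF assms]
  assume z: "smap l p q c = 0"
  have "symb l p q (c Ys) x = 0" for Ys x
    using fun_cong[OF fun_cong[OF z], of "map (shift (- x)) Ys" x]
    by (simp add: smap_def o_def shift_minus)
  then have "c Ys \<in> dops l p q" for Ys
    using symb_kernel[OF c(3)] by (simp add: fun_eq_iff)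
  then show "c \<in> altcochains (dops l p q) n m" using c by (simp add: altcochains_def)
next
  assume "c \<in> altcochains (dops l p q) n m"
  then have "symb l p q (c Ys) = 0" for Ys by (rule symb_dops[OF altcochainsD(3)])
  then show "smap l p q c = 0" by (intro ext) (simp add: smap_def)
qed

lemma smap_linear:
  "smap l p q (\<lambda>Xs. c Xs + e Xs) = (\<lambda>Xs. smap l p q c Xs + smap l p q e Xs)"
  "smap l p q (\<lambda>Xs. c Xs - e Xs) = (\<lambda>Xs. smap l p q c Xs - smap l p q e Xs)"
  "smap l p q (\<lambda>Xs. r *\<^sub>R c Xs) = (\<lambda>Xs. r *\<^sub>R smap l p q c Xs)"
  by (simp_all add: fun_eq_iff smap_def symb_linear scaleR_fun_apply)

section \<open>Evaluation at the origin\<close>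

text \<open>The isotropy algebra of the origin, and its action on tensors.\<close>

type_synonym 'm iso = "(real^'m^'m) \<times> (real^'m)"

definition ibr :: "'m::finite iso \<Rightarrow> 'm iso \<Rightarrow> 'm iso" where
  "ibr = (\<lambda>(A, w) (B, z). (B ** A - A ** B, transpose A *v z - transpose B *v w))"

definition iact :: "'m::finite iso \<Rightarrow> 'm tens \<Rightarrow> 'm tens" where
  "iact g T = - trep (fst g) T"

definition const_cochain :: "('m::finite iso list \<Rightarrow> 'm tens) \<Rightarrow> 'm sl list \<Rightarrow> real^'m \<Rightarrow> 'm tens" where
  "const_cochain c Xs x = c (map snd Xs)"

definition eval_cochain :: "('m::finite sl list \<Rightarrow> real^'m \<Rightarrow> 'm tens) \<Rightarrow> 'm iso list \<Rightarrow> 'm tens" where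
  "eval_cochain z Ys = z (map (Pair 0) Ys) 0"

lemma snd_hbr: "ibr (snd X) (snd Y) = snd (hbr X Y)"
  by (cases X; cases Y) (simp add: hbr_def ibr_def)

lemma Pair_ibr: "hbr (0, g) (0, h) = (0, ibr g h)"
  by (cases g; cases h) (simp add: hbr_def ibr_def)

lemma trep_zero_mat: "trep 0 T = 0"
proof -
  have "transpose 0 = (0 :: real^'a^'a)" by (simp add: transpose_def vec_eq_iff)
  then show ?thesis by (simp add: trep_def fun_eq_iff)
qed

lemma linear_Pair0: "linear (Pair 0)" and linear_snd': "linear snd"
  by (simp_all add: linear_lam_iff)

lemma eval_const: "eval_cochain (const_cochain c) = c"
  by (simp add: fun_eq_iff eval_cochain_def const_cochain_def o_def)

lemma const_cochain_ced: "ced hbr tact (const_cochain c) = const_cochain (ced ibr iact c)"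
proof (intro ext)
  fix Xs x K J
  have "alts (\<lambda>X ys. tact X (const_cochain c ys)) Xs x K J = alts (\<lambda>X ys. iact X (c ys)) (map snd Xs) K J"
    by (simp add: alts_apply alts_map tact_def iact_def const_cochain_def)
  moreover have "pairs hbr (const_cochain c) Xs x K J = pairs ibr c (map snd Xs) K J"
    unfolding pairs_map[where f = snd and \<beta> = ibr and \<gamma> = hbr, OF snd_hbr]
    by (simp add: pairs_apply const_cochain_def)
  ultimately show "ced hbr tact (const_cochain c) Xs x K J = const_cochain (ced ibr iact c) Xs x K J"
    by (simp add: const_cochain_def[of "ced ibr iact c"]) (simp add: ced_def)
qed

lemma eval_cochain_ced: "eval_cochain (ced hbr tact z) = ced ibr iact (eval_cochain z)"
proof (intro ext)
  fix Ys K J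
  have "alts (\<lambda>X ys. tact X (z ys)) (map (Pair 0) Ys) 0 K J = alts (\<lambda>X ys. iact X (eval_cochain z ys)) Ys K J"
    by (simp add: alts_apply alts_map tact_def iact_def eval_cochain_def vd_linear)
  moreover have "pairs hbr z (map (Pair 0) Ys) 0 K J = pairs ibr (eval_cochain z) Ys K J"
    unfolding pairs_map[where f = "Pair 0" and \<beta> = hbr and \<gamma> = ibr, OF Pair_ibr]
    by (simp add: pairs_apply eval_cochain_def)
  ultimately show "eval_cochain (ced hbr tact z) Ys K J = ced ibr iact (eval_cochain z) Ys K J"
    by (simp add: eval_cochain_def[of "ced hbr tact z"]) (simp add: ced_def)
qed

lemma const_cochain_in:
  assumes "c \<in> altcochains (tens l p q) n m"
  shows "const_cochain c \<in> altcochains (tens_fields l p q) n m"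
proof -
  note c = altcochainsD[OF assms]
  have "altern (const_cochain c)"
    by (rule altern_funI) (simp add: const_cochain_def[abs_def] altern_map[OF c(1) linear_snd'])
  moreover have "const_cochain c Xs = 0" if "length Xs + m \<noteq> n" for Xs
    using c(4) that by (intro ext) (simp add: const_cochain_def)
  moreover have "const_cochain c Xs \<in> tens_fields l p q" for Xs
    using c(3) by (simp add: tens_fields_def const_cochain_def)
  ultimately show ?thesis by (simp add: altcochains_def)
qed

lemma eval_cochain_in:
  assumes "z \<in> altcochains (tens_fields l p q) n m"
  shows "eval_cochain z \<in> altcochains (tens l p q) n m"
proof -
  note c = altcochainsD[OF assms]
  have "altern (eval_cochain z)"
    unfolding eval_cochain_def[abs_def] by (rule altern_eval[OF altern_map[OF c(1) linear_Pair0]])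
  moreover have "eval_cochain z Xs = 0" if "length Xs + m \<noteq> n" for Xs
    using c(4) that by (intro ext) (simp add: eval_cochain_def)
  moreover have "eval_cochain z Xs \<in> tens l p q" for Xs
    using c(3) by (simp add: tens_fields_def eval_cochain_def)
  ultimately show ?thesis by (simp add: altcochains_def)
qed

subsection \<open>The homotopy\<close>

definition scl :: "real \<Rightarrow> 'm::finite sl \<Rightarrow> 'm sl" where
  "scl t X = (t *\<^sub>R fst X, snd X)"

lemma hbr_scl: "hbr (scl t X) (scl t Y) = scl t (hbr X Y)"
  by (cases X; cases Y) (simp add: hbr_def scl_def)

lemma linear_scl: "linear (scl t)"
  by (simp add: linear_lam_iff scl_def scaleR_add_right)

lemma scl_01: "scl 1 = id" "scl 0 = (\<lambda>X. (0, snd X))"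
  by (simp_all add: fun_eq_iff scl_def)

lemma multilin_scl:
  assumes "multilin c"
  shows "c (scl t X # Ys) = t *\<^sub>R c ((fst X, 0) # Ys) + c ((0, snd X) # Ys)"
proof -
  have "scl t X = t *\<^sub>R (fst X, 0) + (0, snd X)" by (simp add: scl_def)
  then show ?thesis by (simp only: multilin_hd[OF assms])
qed

text \<open>Families that may be integrated over the parameter and differentiated under the integral.\<close>

definition avg_family :: "(real \<Rightarrow> real^'m::finite \<Rightarrow> real) \<Rightarrow> bool" where
  "avg_family F \<longleftrightarrow> (\<forall>t. smooth (F t)) \<and> (\<forall>x. (\<lambda>t. F t x) integrable_on {0..1}) \<and>
     smooth (\<lambda>x. integral {0..1} (\<lambda>t. F t x)) \<and>
     (\<forall>i x. ((\<lambda>t. pd i (F t) x) has_integral pd i (\<lambda>x. integral {0..1} (\<lambda>t. F t x)) x) {0..1})"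

lemma avg_family_ray:
  assumes "smooth f"
  shows "avg_family (\<lambda>t x. t ^ a * f (t *\<^sub>R x))"
proof -
  have i: "(\<lambda>t. t ^ b * h (t *\<^sub>R x)) integrable_on {0..1}" if "smooth h" for b h and x :: "real^'a"
    using integrable_continuous_real[OF continuous_ray[OF that]] .
  have p: "pd i (\<lambda>x. t ^ a * f (t *\<^sub>R x)) = (\<lambda>x. t ^ Suc a * pd i f (t *\<^sub>R x))" for t i
    using assms by (simp add: pd_cmult smooth_scaling pd_scaling smooth_differentiable mult_ac)
  have R: "(\<lambda>x. integral {0..1} (\<lambda>t. t ^ a * f (t *\<^sub>R x))) = ray_mean a f"
    by (simp add: fun_eq_iff ray_mean_def)
  have "((\<lambda>t. t ^ Suc a * pd i f (t *\<^sub>R x)) has_integral ray_mean (Suc a) (pd i f) x) {0..1}" for i x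
    unfolding ray_mean_def by (rule integrable_integral[OF i[OF smooth_pd[OF assms]]])
  then show ?thesis
    unfolding avg_family_def R p pd_ray_mean(2)[OF assms]
    using i[OF assms] smooth_ray_mean[OF assms] smooth_scaling[OF assms] smooth_cmult by blast
qed

lemma avg_family_add:
  assumes "avg_family F" "avg_family G"
  shows "avg_family (\<lambda>t x. F t x + G t x)"
proof -
  have I: "(\<lambda>x. integral {0..1} (\<lambda>t. F t x + G t x)) =
      (\<lambda>x. integral {0..1} (\<lambda>t. F t x) + integral {0..1} (\<lambda>t. G t x))"
    using assms by (intro ext integral_add) (auto simp: avg_family_def)
  show ?thesis
    using assms unfolding avg_family_def I
    by (auto simp: pd_add smooth_add intro!: integrable_add has_integral_add)
qed

lemma avg_family_mult:
  assumes "avg_family F" "smooth g"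
  shows "avg_family (\<lambda>t x. g x * F t x)"
proof -
  have I: "(\<lambda>x. integral {0..1} (\<lambda>t. g x * F t x)) = (\<lambda>x. g x * integral {0..1} (\<lambda>t. F t x))"
    by (intro ext integral_mult_right)
  have "((\<lambda>t. F t x) has_integral integral {0..1} (\<lambda>t. F t x)) {0..1}" for x
    using assms by (intro integrable_integral) (auto simp: avg_family_def)
  then show ?thesis
    using assms unfolding avg_family_def I
    by (auto simp: pd_mult smooth_mult intro!: integrable_on_mult_right has_integral_add has_integral_mult_right
        has_integral_mult_left)
qed

lemma avg_family_sum:
  "finite A \<Longrightarrow> (\<And>a. a \<in> A \<Longrightarrow> avg_family (F a)) \<Longrightarrow> avg_family (\<lambda>t x. \<Sum>a\<in>A. F a t x)"
proof (induction A rule: finite_induct)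
  case empty
  then show ?case using avg_family_ray[OF smooth_const[of 0], of 0] by simp
next
  case (insert a A)
  then show ?case by (simp add: avg_family_add)
qed

lemma avg_family_scl:
  fixes c :: "'m::finite sl list \<Rightarrow> real^'m \<Rightarrow> real"
  assumes "multilin c" "\<And>Ys. smooth (c Ys)"
  shows "avg_family (\<lambda>t x. t ^ a * c (map (scl t) Xs) (t *\<^sub>R x))"
  using assms
proof (induction Xs arbitrary: c a)
  case Nil
  then show ?case by (simp add: avg_family_ray)
next
  case (Cons X Xs)
  have "avg_family (\<lambda>t x. t ^ Suc a * c ((fst X, 0) # map (scl t) Xs) (t *\<^sub>R x)
      + t ^ a * c ((0, snd X) # map (scl t) Xs) (t *\<^sub>R x))"
    using Cons.IH[OF multilin_Cons[OF Cons.prems(1)], of _ "Suc a"] Cons.IH[OF multilin_Cons[OF Cons.prems(1)], of _ a]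
      Cons.prems(2) by (intro avg_family_add) auto
  then show ?case
    by (simp add: multilin_scl[OF Cons.prems(1)] scaleR_fun_def algebra_simps)
qed

lemma deriv_scl:
  fixes c :: "'m::finite sl list \<Rightarrow> real^'m \<Rightarrow> real"
  assumes "altern c" "\<And>Ys. smooth (c Ys)"
  shows "((\<lambda>t. c (map (scl t) Xs) (t *\<^sub>R x)) has_real_derivative
    vd x (c (map (scl t) Xs)) (t *\<^sub>R x) + alts (\<lambda>X ys. c ((fst X, 0) # map (scl t) ys) (t *\<^sub>R x)) Xs) (at t)"
  using assms
proof (induction Xs arbitrary: c)
  case Nil
  have "((\<lambda>t. c [] (t *\<^sub>R x)) has_derivative (\<lambda>s. \<Sum>i\<in>UNIV. (s *\<^sub>R x) $ i * pd i (c []) (t *\<^sub>R x))) (at t)"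
    by (rule has_derivative_compose[OF _ has_derivative_pd[OF smooth_differentiable[OF Nil(2)]]])
      (auto intro!: derivative_eq_intros)
  then show ?case
    by (simp add: has_field_derivative_def vd_def sum_distrib_left mult_ac)
      (erule has_derivative_eq_rhs, simp add: fun_eq_iff sum_distrib_left mult_ac)
next
  case (Cons X Xs)
  let ?Y = "map (scl t) Xs" and ?y = "t *\<^sub>R x"
  note m = altern_multilin[OF Cons.prems(1)]
  have s: "c (scl t X # Ys) y = t * c ((fst X, 0) # Ys) y + c ((0, snd X) # Ys) y" for t Ys y
    by (simp add: multilin_scl[OF m] scaleR_fun_def)
  have IH: "((\<lambda>t. c (Z # map (scl t) Xs) (t *\<^sub>R x)) has_real_derivative
    vd x (c (Z # ?Y)) ?y + alts (\<lambda>X ys. c (Z # (fst X, 0) # map (scl t) ys) ?y) Xs) (at t)" for Z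
    by (rule Cons.IH[OF altern_Cons[OF Cons.prems(1), of Z]]) (rule Cons.prems(2))
  have A: "((\<lambda>t. t * c ((fst X, 0) # map (scl t) Xs) (t *\<^sub>R x) + c ((0, snd X) # map (scl t) Xs) (t *\<^sub>R x)) has_real_derivative
    (1 * c ((fst X, 0) # ?Y) ?y
     + (vd x (c ((fst X, 0) # ?Y)) ?y + alts (\<lambda>X' ys. c ((fst X, 0) # (fst X', 0) # map (scl t) ys) ?y) Xs) * t)
     + (vd x (c ((0, snd X) # ?Y)) ?y + alts (\<lambda>X' ys. c ((0, snd X) # (fst X', 0) # map (scl t) ys) ?y) Xs)) (at t)"
    by (intro DERIV_add DERIV_mult IH DERIV_ident)
  have B: "vd x (c (scl t X # ?Y)) ?y = vd x (c ((fst X, 0) # ?Y)) ?y * t + vd x (c ((0, snd X) # ?Y)) ?y"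
  proof -
    have "c (scl t X # ?Y) = (\<lambda>y. t * c ((fst X, 0) # ?Y) y + c ((0, snd X) # ?Y) y)" by (simp add: fun_eq_iff s)
    then show ?thesis using Cons.prems(2) by (simp add: vd_rules smooth_cmult)
  qed
  have C: "alts (\<lambda>X' ys. c ((fst X', 0) # scl t X # map (scl t) ys) ?y) Xs =
     - (alts (\<lambda>X' ys. c ((fst X, 0) # (fst X', 0) # map (scl t) ys) ?y) Xs * t
      + alts (\<lambda>X' ys. c ((0, snd X) # (fst X', 0) # map (scl t) ys) ?y) Xs)"
  proof -
    have sw: "c ((fst X', 0) # scl t X # Ys) ?y =
      - (t * c ((fst X, 0) # (fst X', 0) # Ys) ?y + c ((0, snd X) # (fst X', 0) # Ys) ?y)" for X' :: "'m sl" and Ys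
      using altern_swap_hd[OF Cons.prems(1), of "(fst X', 0)" "scl t X" Ys] by (simp add: s)
    have sc: "alts (\<lambda>X' ys. t * c ((fst X, 0) # (fst X', 0) # map (scl t) ys) ?y) Xs =
        t * alts (\<lambda>X' ys. c ((fst X, 0) # (fst X', 0) # map (scl t) ys) ?y) Xs"
      using alts_scale[of t "\<lambda>X' ys. c ((fst X, 0) # (fst X', 0) # map (scl t) ys) ?y" Xs] by simp
    show ?thesis unfolding sw alts_neg alts_add sc by (simp add: mult.commute)
  qed
  have e: "(\<lambda>t. c (map (scl t) (X # Xs)) (t *\<^sub>R x)) =
      (\<lambda>t. t * c ((fst X, 0) # map (scl t) Xs) (t *\<^sub>R x) + c ((0, snd X) # map (scl t) Xs) (t *\<^sub>R x))"
    by (simp add: s)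
  have v: "vd x (c (map (scl t) (X # Xs))) ?y + alts (\<lambda>X ys. c ((fst X, 0) # map (scl t) ys) ?y) (X # Xs) =
    1 * c ((fst X, 0) # ?Y) ?y
     + (vd x (c ((fst X, 0) # ?Y)) ?y + alts (\<lambda>X' ys. c ((fst X, 0) # (fst X', 0) # map (scl t) ys) ?y) Xs) * t
     + (vd x (c ((0, snd X) # ?Y)) ?y + alts (\<lambda>X' ys. c ((0, snd X) # (fst X', 0) # map (scl t) ys) ?y) Xs)"
    using B C by (simp add: algebra_simps)
  show ?case unfolding e v by (rule A)
qed

lemma alts_has_integral:
  fixes F :: "real \<Rightarrow> 'g \<Rightarrow> 'g list \<Rightarrow> real"
  assumes "\<And>X ys. ((\<lambda>t. F t X ys) has_integral I X ys) S"
  shows "((\<lambda>t. alts (F t) Xs) has_integral alts I Xs) S"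
  using assms by (induction Xs arbitrary: F I) (auto intro!: has_integral_diff has_integral_0)

lemma der_has_integral:
  fixes F :: "real \<Rightarrow> 'g list \<Rightarrow> real"
  assumes "\<And>ys. ((\<lambda>t. F t ys) has_integral I ys) S"
  shows "((\<lambda>t. der f (F t) Xs) has_integral der f I Xs) S"
  using assms by (induction Xs arbitrary: F I) (auto intro!: has_integral_add has_integral_0)

lemma pairs_has_integral:
  fixes F :: "real \<Rightarrow> 'g list \<Rightarrow> real"
  assumes "\<And>ys. ((\<lambda>t. F t ys) has_integral I ys) S"
  shows "((\<lambda>t. pairs \<gamma> (F t) Xs) has_integral pairs \<gamma> I Xs) S"
  using assms
  by (induction Xs arbitrary: F I)
    (auto intro!: has_integral_diff has_integral_neg der_has_integral has_integral_0)

lemma trep_has_integral: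
  assumes "\<And>K J. ((\<lambda>t. F t K J) has_integral I K J) S"
  shows "((\<lambda>t. trep A (F t) K J) has_integral trep A I K J) S"
  unfolding trep_def tensor_rep_def
  by (intro has_integral_diff has_integral_sum has_integral_mult_right assms) auto

text \<open>
  The Poincare lemma: the translational arguments are contracted along the rays from the origin.
\<close>

theorem eval_homotopy:
  fixes z :: "'m::finite sl list \<Rightarrow> real^'m \<Rightarrow> 'm tens"
  assumes z: "z \<in> altcochains (tens_fields l p q) n 0" and cocycle: "ced hbr tact z = 0"
  shows "\<exists>b\<in>altcochains (tens_fields l p q) n (Suc 0).
    z = (\<lambda>Xs. ced hbr tact b Xs + const_cochain (eval_cochain z) Xs)"
proof -
  note zz = altcochainsD[OF z]
  have sz: "smooth (\<lambda>y. z Ys y K J)" for Ys K J using zz(3)[of Ys] by (simp add: tens_fields_def)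
  have az: "altern (\<lambda>Ys y. z Ys y K J)" for K J
    using altern_compose[OF zz(1), of "\<lambda>f y. f y K J"] by (simp add: linear_lam_iff fun_eq_iff scaleR_fun_def)
  \<comment> \<open>The integrand of the contraction: the radial translation is inserted, and the other translations scale with the ray.\<close>
  define F where "F = (\<lambda>Xs K J t x. z ((x, 0) # map (scl t) Xs) (t *\<^sub>R x) K J)"
  have F_sum: "F Xs K J t x = (\<Sum>k\<in>UNIV. x $ k * (t ^ 0 * z ((axis k 1, 0) # map (scl t) Xs) (t *\<^sub>R x) K J))" for Xs K J t x
  proof -
    have lin: "linear (\<lambda>X. z (X # map (scl t) Xs) (t *\<^sub>R x) K J)"
      using multilin_linear_hd[OF altern_multilin[OF az], of "map (scl t) Xs" K J]
      by (simp add: linear_lam_iff fun_eq_iff scaleR_fun_def)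
    have "(x, 0) = (\<Sum>k\<in>UNIV. x $ k *\<^sub>R (axis k 1, 0) :: 'm sl)"
      by (simp add: prod_eq_iff fst_sum snd_sum flip: vec_basis)
    then have "F Xs K J t x = z ((\<Sum>k\<in>UNIV. x $ k *\<^sub>R (axis k 1, 0)) # map (scl t) Xs) (t *\<^sub>R x) K J"
      by (simp add: F_def)
    then show ?thesis
      unfolding linear_sum[OF lin] linear_scale[OF lin] by simp
  qed
  have good: "avg_family (F Xs K J)" for Xs K J
    unfolding F_sum[abs_def]
    by (intro avg_family_sum avg_family_mult smooth_coord finite
        avg_family_scl[where c = "\<lambda>Ys y. z ((axis _ 1, 0) # Ys) y K J"]
        multilin_Cons[OF altern_multilin[OF az]] sz)
  define b where "b = (\<lambda>Xs x K J. integral {0..1} (\<lambda>t. F Xs K J t x))"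
  have bI: "((\<lambda>t. F Xs K J t x) has_integral b Xs x K J) {0..1}" for Xs K J x
    unfolding b_def using good by (intro integrable_integral) (auto simp: avg_family_def)
  have bP: "((\<lambda>t. vd u (F Xs K J t) x) has_integral vd u (\<lambda>y. b Xs y K J) x) {0..1}" for Xs K J x u
    unfolding vd_def b_def using good
    by (intro has_integral_sum has_integral_mult_right) (auto simp: avg_family_def)
  have b_in: "b \<in> altcochains (tens_fields l p q) n (Suc 0)"
  proof -
    have aF: "altern (\<lambda>Xs. F Xs K J t x)" for K J t x
    proof -
      have "altern (\<lambda>Xs. (\<lambda>Ys y. z Ys y K J) ((x, 0) # map (scl t) Xs) (t *\<^sub>R x))"
        by (rule altern_eval[OF altern_map[OF altern_Cons[OF az] linear_scl]])
      then show ?thesis by (simp add: F_def)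
    qed
    have "altern (\<lambda>Xs. b Xs x K J)" for x K J
      unfolding altern_def multilin_def linear_lam_iff
    proof (intro conjI allI)
      fix us vs and g h :: "'m sl" and r
      have l: "linear (\<lambda>g. F (us @ g # vs) K J t x)" for t
        using aF by (intro multilin_linear altern_multilin)
      show "b (us @ (g + h) # vs) x K J = b (us @ g # vs) x K J + b (us @ h # vs) x K J"
        using has_integral_unique[OF bI[of "us @ (g + h) # vs" K J x]]
          has_integral_add[OF bI[of "us @ g # vs" K J x] bI[of "us @ h # vs" K J x]]
        by (simp add: linear_add[OF l])
      show "b (us @ (r *\<^sub>R g) # vs) x K J = r *\<^sub>R b (us @ g # vs) x K J"
        using has_integral_unique[OF bI[of "us @ (r *\<^sub>R g) # vs" K J x]]
          has_integral_mult_right[OF bI[of "us @ g # vs" K J x], of r]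
        by (simp add: linear_scale[OF l])
      have "F (us @ g # g # vs) K J t x = 0" for t
        using aF[of K J t x] unfolding altern_def by blast
      then show "b (us @ g # g # vs) x K J = 0"
        by (simp add: b_def)
    qed
    then have "altern b" by (intro altern_funI)
    moreover have "b Xs = 0" if "length Xs + Suc 0 \<noteq> n" for Xs
    proof -
      have "z (X # map (scl t) Xs) = 0" for X t using that by (intro zz(4)) simp
      then show ?thesis by (intro ext) (simp add: b_def F_def)
    qed
    moreover have "b Xs \<in> tens_fields l p q" for Xs
    proof -
      have T: "z Ys y \<in> tens l p q" for Ys y using zz(3)[of Ys] by (simp add: tens_fields_def)
      have "b Xs x \<in> tens l p q" for x
        unfolding tens_def msym_def
      proof (intro CollectI conjI allI impI)
        fix K J :: "'m list" assume "\<not> (length K = l + q \<and> length J = p)"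
        then have "F Xs K J t x = 0" for t using T unfolding tens_def F_def by blast
        then show "b Xs x K J = 0" by (simp add: b_def)
      next
        fix I J L L' :: "'m list" assume "length I = q" "mset L = mset L'"
        then have "F Xs (L @ I) J t x = F Xs (L' @ I) J t x" for t
          using T unfolding tens_def F_def by (auto intro: msymD[of "\<lambda>L. z _ _ (L @ I) J"])
        then show "b Xs x (L @ I) J = b Xs x (L' @ I) J" by (simp add: b_def)
      next
        fix L J I I' :: "'m list" assume "length L = l" "mset I = mset I'"
        then have "F Xs (L @ I) J t x = F Xs (L @ I') J t x" for t
          using T unfolding tens_def F_def by (auto intro: msymD[of "\<lambda>I. z _ _ (L @ I) J"])
        then show "b Xs x (L @ I) J = b Xs x (L @ I') J" by (simp add: b_def)
      next
        fix K J J' :: "'m list" assume "mset J = mset J'"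
        then have "F Xs K J t x = F Xs K J' t x" for t
          using T unfolding tens_def F_def by (auto intro: msymD[of "z _ _ K"])
        then show "b Xs x K J = b Xs x K J'" by (simp add: b_def)
      qed
      then show ?thesis using good by (simp add: tens_fields_def avg_family_def b_def)
    qed
    ultimately show ?thesis by (simp add: altcochains_def)
  qed
  \<comment> \<open>Since \<open>z\<close> is closed, the differential of the integrand is the derivative in \<open>t\<close> of the scaled cochain.\<close>
  have D: "ced hbr tact b Xs x K J = z Xs x K J - const_cochain (eval_cochain z) Xs x K J" for Xs x K J
  proof -
    let ?b = "\<lambda>t Xs x K J. F Xs K J t x"
    have I1: "((\<lambda>t. ced hbr tact (?b t) Xs x K J) has_integral ced hbr tact b Xs x K J) {0..1}"
      unfolding ced_def by (simp add: alts_apply pairs_apply tact_def)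
        (intro has_integral_add alts_has_integral pairs_has_integral has_integral_diff trep_has_integral bI bP)
    have P: "ced hbr tact (?b t) Xs x K J = vd x (\<lambda>y. z (map (scl t) Xs) y K J) (t *\<^sub>R x)
        + alts (\<lambda>X ys. z ((fst X, 0) # map (scl t) ys) (t *\<^sub>R x) K J) Xs" for t
    proof -
      let ?R = "(x, 0) :: 'm sl" and ?y = "t *\<^sub>R x"
      have 1: "tact X (?b t ys) x K J = z ((fst X, 0) # map (scl t) ys) ?y K J
          + tact (scl t X) (z (?R # map (scl t) ys)) ?y K J" for X ys
      proof -
        have sp: "smooth (\<lambda>x. z ((axis k 1, 0) # map (scl t) ys) (t *\<^sub>R x) K J)" for k
          by (rule smooth_scaling[OF sz])
        have lin: "linear (\<lambda>X. \<lambda>y. z (X # map (scl t) ys) y K J)"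
          by (rule multilin_linear_hd[OF altern_multilin[OF az]])
        have ex: "(v, 0) = (\<Sum>k\<in>UNIV. v $ k *\<^sub>R (axis k 1, 0) :: 'm sl)" for v
          by (simp add: prod_eq_iff fst_sum snd_sum flip: vec_basis)
        have zs: "(\<lambda>y. z ((v, 0) # map (scl t) ys) y K J) =
            (\<lambda>y. \<Sum>k\<in>UNIV. v $ k * z ((axis k 1, 0) # map (scl t) ys) y K J)" for v
        proof
          fix y
          have liny: "linear (\<lambda>X. z (X # map (scl t) ys) y K J)"
            using lin by (simp add: linear_lam_iff fun_eq_iff scaleR_fun_def)
          have "z ((v, 0) # map (scl t) ys) y K J = z ((\<Sum>k\<in>UNIV. v $ k *\<^sub>R (axis k 1, 0)) # map (scl t) ys) y K J"
            by (simp only: ex[symmetric])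
          then show "z ((v, 0) # map (scl t) ys) y K J = (\<Sum>k\<in>UNIV. v $ k * z ((axis k 1, 0) # map (scl t) ys) y K J)"
            unfolding linear_sum[OF liny] linear_scale[OF liny] by simp
        qed
        have "vd (fst X) (F ys K J t) x = (\<Sum>k\<in>UNIV. fst X $ k * z ((axis k 1, 0) # map (scl t) ys) ?y K J)
          + (\<Sum>k\<in>UNIV. x $ k * vd (fst X) (\<lambda>x. z ((axis k 1, 0) # map (scl t) ys) (t *\<^sub>R x) K J) x)"
          unfolding F_sum[abs_def]
          by (simp add: vd_sum vd_rules smooth_mult sp sum.distrib)
            (simp add: vd_def pd_coord if_distrib[where f = "\<lambda>x. _ * x"] cong: if_cong)
        also have "(\<Sum>k\<in>UNIV. fst X $ k * z ((axis k 1, 0) # map (scl t) ys) ?y K J) = z ((fst X, 0) # map (scl t) ys) ?y K J"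
          using fun_cong[OF zs[of "fst X"], of ?y] by simp
        also have "(\<Sum>k\<in>UNIV. x $ k * vd (fst X) (\<lambda>x. z ((axis k 1, 0) # map (scl t) ys) (t *\<^sub>R x) K J) x)
           = vd (t *\<^sub>R fst X) (\<lambda>y. z (?R # map (scl t) ys) y K J) ?y"
        proof -
          have "vd (fst X) (\<lambda>x. h (t *\<^sub>R x)) x = t * vd (fst X) h ?y" if "smooth h" for h :: "real^'m \<Rightarrow> real"
            using that by (simp add: vd_def pd_scaling smooth_differentiable sum_distrib_left mult.left_commute)
          from this[OF sz] have "vd (fst X) (\<lambda>x. z ((axis k 1, 0) # map (scl t) ys) (t *\<^sub>R x) K J) x
              = t * vd (fst X) (\<lambda>y. z ((axis k 1, 0) # map (scl t) ys) y K J) ?y" for k .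
          then show ?thesis
            unfolding zs[of x] using sz
            by (simp add: vd_sum smooth_cmult vd_rules vd_linear sum_distrib_left mult.left_commute)
        qed
        finally show ?thesis by (simp add: tact_def scl_def[of t X] F_def)
      qed
      have "ced hbr tact (?b t) Xs x K J = alts (\<lambda>X ys. z ((fst X, 0) # map (scl t) ys) ?y K J) Xs
          + ced hbr tact (\<lambda>Ys. z (?R # Ys)) (map (scl t) Xs) ?y K J"
        unfolding ced_def
        by (simp add: alts_apply pairs_apply 1 alts_add alts_map
            pairs_map[where f = "scl t" and \<beta> = hbr and \<gamma> = hbr, OF hbr_scl])
          (simp add: F_def)
      moreover have "ced hbr tact (\<lambda>Ys. z (?R # Ys)) (map (scl t) Xs) ?y K J = vd x (\<lambda>y. z (map (scl t) Xs) y K J) ?y"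
      proof -
        have h0: "hbr ?R = (\<lambda>_. 0)"
          by (auto simp: fun_eq_iff hbr_def zero_prod_def matrix_vector_mult_def matrix_matrix_mult_def
              transpose_def vec_eq_iff)
        have "0 = ced hbr tact z (?R # map (scl t) Xs) ?y K J" using cocycle by simp
        also have "\<dots> = tact ?R (z (map (scl t) Xs)) ?y K J - der (hbr ?R) z (map (scl t) Xs) ?y K J
            - ced hbr tact (\<lambda>Ys. z (?R # Ys)) (map (scl t) Xs) ?y K J"
          by (simp add: ced_def)
        finally show ?thesis
          using der_fun_zero[OF zz(2)] by (simp add: h0 tact_def trep_zero_mat)
      qed
      ultimately show ?thesis by simp
    qed
    have "((\<lambda>t. ced hbr tact (?b t) Xs x K J) has_integral
       z (map (scl 1) Xs) (1 *\<^sub>R x) K J - z (map (scl 0) Xs) (0 *\<^sub>R x) K J) {0..1}"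
    proof (rule fundamental_theorem_of_calculus)
      fix t :: real
      have "((\<lambda>t. z (map (scl t) Xs) (t *\<^sub>R x) K J) has_real_derivative ced hbr tact (?b t) Xs x K J) (at t)"
        unfolding P by (rule deriv_scl[OF az sz])
      then show "((\<lambda>t. z (map (scl t) Xs) (t *\<^sub>R x) K J) has_vector_derivative ced hbr tact (?b t) Xs x K J)
          (at t within {0..1})"
        using has_field_derivative_at_within has_real_derivative_iff_has_vector_derivative by blast
    qed simp
    from has_integral_unique[OF I1 this] show ?thesis
      by (simp add: scl_01 const_cochain_def eval_cochain_def o_def)
  qed
  have "z = (\<lambda>Xs. ced hbr tact b Xs + const_cochain (eval_cochain z) Xs)"
    by (intro ext) (simp add: D)
  then show ?thesis using b_in by blast
qed

section \<open>A Hodge decomposition for the isotropy algebra\<close>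

subsection \<open>Semidefinite operators on a finite-dimensional space\<close>

text \<open>
  An operator that is injective on its finite-dimensional range maps the range onto itself, and so
  every vector is the sum of one in the kernel and one in the range. Finite dimension is expressed by
  finitely many functionals that separate the points of \<open>S\<close>.
\<close>

lemma finite_dim_splitting:
  fixes f :: "'v::real_vector \<Rightarrow> 'v" and \<phi> :: "'k \<Rightarrow> 'v \<Rightarrow> real"
  assumes S: "real_subspace S" and f: "linear f" "\<And>v. v \<in> S \<Longrightarrow> f v \<in> S"
    and \<phi>: "finite N" "\<And>k. linear (\<phi> k)" "\<And>v. v \<in> S \<Longrightarrow> (\<forall>k\<in>N. \<phi> k v = 0) \<Longrightarrow> v = 0"
    and ker: "\<And>v. v \<in> S \<Longrightarrow> f (f v) = 0 \<Longrightarrow> f v = 0"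
    and v: "v \<in> S"
  shows "\<exists>w\<in>S. f (v - f w) = 0"
proof -
  \<comment> \<open>The functionals embed \<open>S\<close> into a space of functions with support in \<open>N\<close>.\<close>
  define \<Phi> where "\<Phi> v = (\<lambda>k. if k \<in> N then \<phi> k v else 0)" for v
  have lin: "linear \<Phi>"
    using \<phi>(2) by (simp add: linear_lam_iff \<Phi>_def fun_eq_iff scaleR_fun_def)
  have fin: "finite C" if C: "independent C" "C \<subseteq> S" for C
  proof -
    have sp: "span C \<subseteq> S" using C(2) S by (rule span_minimal)
    have "inj_on \<Phi> (span C)"
    proof (rule inj_onI)
      fix a b assume ab: "a \<in> span C" "b \<in> span C" "\<Phi> a = \<Phi> b"
      have "\<Phi> (a - b) = 0" using linear_diff[OF lin] ab(3) by simp
      then have "\<forall>k\<in>N. \<phi> k (a - b) = 0" by (auto simp: \<Phi>_def fun_eq_iff split: if_splits)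
      moreover have "a - b \<in> S" using sp ab S by (blast intro: subspace_diff)
      ultimately show "a = b" using \<phi>(3) by fastforce
    qed
    then have ind: "independent (\<Phi> ` C)" "inj_on \<Phi> C"
      using linear_independent_injective_image[OF lin C(1)] inj_on_subset[OF _ span_superset] by auto
    let ?E = "(\<lambda>k j. if j = k then 1 else (0::real)) ` N"
    have "\<Phi> a \<in> span ?E" for a
    proof -
      have "\<Phi> a = (\<Sum>k\<in>N. \<phi> k a *\<^sub>R (\<lambda>j. if j = k then 1 else 0))"
        using \<phi>(1) by (simp add: fun_eq_iff \<Phi>_def sum_fun_apply scaleR_fun_def if_distrib[where f = "\<lambda>x. _ * x"]
            cong: if_cong)
      also have "\<dots> \<in> span ?E" by (intro span_sum span_scale span_base) auto
      finally show ?thesis .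
    qed
    then have "finite (\<Phi> ` C)"
      using independent_span_bound[of ?E "\<Phi> ` C"] ind(1) \<phi>(1) by blast
    then show ?thesis using finite_imageD ind(2) by blast
  qed
  let ?R = "f ` S"
  have R: "real_subspace ?R" "?R \<subseteq> S" using linear_subspace_image[OF f(1) S] f(2) by auto
  obtain B where B: "B \<subseteq> ?R" "independent B" "?R \<subseteq> span B"
    using maximal_independent_subset[of ?R] by blast
  have sB: "span B = ?R" using B R(1) by (intro antisym span_minimal) auto
  have inj: "inj_on f ?R"
  proof (rule inj_onI)
    fix a b assume ab: "a \<in> ?R" "b \<in> ?R" "f a = f b"
    then have "a - b \<in> ?R" using subspace_diff[OF R(1)] by simp
    then obtain s where s: "s \<in> S" "a - b = f s" by auto
    have "f (f s) = 0" using ab(3) s(2) linear_diff[OF f(1), of a b] by simp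
    then show "a = b" using ker[OF s(1)] s(2) by simp
  qed
  have fB: "independent (f ` B)"
    using linear_independent_injective_image[OF f(1) B(2)] inj sB by simp
  have cB: "finite B" "card (f ` B) = card B"
    using fin[OF B(2)] B(1) R(2) card_image[OF inj_on_subset[OF inj B(1)]] by auto
  have "f v \<in> span (f ` B)"
  proof (rule ccontr)
    assume n: "f v \<notin> span (f ` B)"
    then have "independent (insert (f v) (f ` B))" using fB by (rule independent_insertI)
    moreover have "insert (f v) (f ` B) \<subseteq> span B" using B(1) R(2) v f(2) sB by auto
    ultimately have "card (insert (f v) (f ` B)) \<le> card B"
      using independent_span_bound[OF cB(1)] by blast
    moreover have "f v \<notin> f ` B" using n span_base[of "f v" "f ` B"] by auto
    ultimately show False using cB by simp
  qed
  also have "span (f ` B) = f ` ?R" using linear_span_image[OF f(1)] sB by blast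
  finally obtain w where "w \<in> S" "f v = f (f w)" by auto
  then show ?thesis by (intro bexI[of _ w]) (simp_all add: linear_diff[OF f(1)])
qed

lemma multilin_zero:
  assumes "multilin c" "span H = UNIV" "\<And>xs. set xs \<subseteq> H \<Longrightarrow> c xs = 0"
  shows "c xs = 0"
  using assms(1,3)
proof (induction xs arbitrary: c)
  case (Cons x xs)
  have "c (h # xs) = 0" if "h \<in> H" for h
    using Cons.prems that by (intro Cons.IH[of "\<lambda>ys. c (h # ys)"] multilin_Cons) auto
  moreover have "x \<in> span H" using assms(2) by simp
  ultimately show ?case
    using linear_eq_0_on_span[OF multilin_linear_hd[OF Cons.prems(1), of xs]] by blast
qed simp

subsection \<open>Adjoints of derivations\<close>

fun mder :: "'a set \<Rightarrow> ('a \<Rightarrow> 'a \<Rightarrow> real) \<Rightarrow> ('a list \<Rightarrow> real) \<Rightarrow> 'a list \<Rightarrow> real" where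
  "mder X M T [] = 0"
| "mder X M T (x # xs) = (\<Sum>y\<in>X. M x y * T (y # xs)) + mder X M (\<lambda>ys. T (x # ys)) xs"

definition words :: "'a set \<Rightarrow> nat \<Rightarrow> 'a list set" where
  "words X n = {xs. set xs \<subseteq> X \<and> length xs = n}"

lemma sum_words_Suc: "sum h (words X (Suc n)) = (\<Sum>x\<in>X. \<Sum>xs\<in>words X n. h (x # xs))"
proof -
  have "words X (Suc n) = (\<lambda>(xs, n). n # xs) ` (words X n \<times> X)"
    unfolding words_def by (rule lists_length_Suc_eq)
  moreover have "inj_on (\<lambda>(xs, n). n # xs) (words X n \<times> X)" by (auto simp: inj_on_def)
  then have "sum h ((\<lambda>(xs, n). n # xs) ` (words X n \<times> X)) = sum (h \<circ> (\<lambda>(xs, n). n # xs)) (words X n \<times> X)"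
    by (rule sum.reindex)
  ultimately have "sum h (words X (Suc n)) = (\<Sum>(xs, x)\<in>words X n \<times> X. h (x # xs))"
    by (simp add: split_beta o_def)
  also have "\<dots> = (\<Sum>xs\<in>words X n. \<Sum>x\<in>X. h (x # xs))" by (rule sum.cartesian_product[symmetric])
  finally show ?thesis by (simp add: sum.swap[of _ X])
qed

lemma mder_adjoint:
  "(\<Sum>xs\<in>words X n. mder X M T xs * S xs) = (\<Sum>xs\<in>words X n. T xs * mder X (\<lambda>x y. M y x) S xs)"
proof (induction n arbitrary: T S)
  case 0
  have "words X 0 = {[]}" by (auto simp: words_def)
  then show ?case by simp
next
  case (Suc n)
  have "(\<Sum>x\<in>X. \<Sum>xs\<in>words X n. (\<Sum>y\<in>X. M x y * T (y # xs)) * S (x # xs)) =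
      (\<Sum>x\<in>X. \<Sum>xs\<in>words X n. T (x # xs) * (\<Sum>y\<in>X. M y x * S (y # xs)))"
  proof -
    have "(\<Sum>x\<in>X. \<Sum>xs\<in>words X n. (\<Sum>y\<in>X. M x y * T (y # xs)) * S (x # xs)) =
        (\<Sum>xs\<in>words X n. \<Sum>x\<in>X. \<Sum>y\<in>X. M x y * T (y # xs) * S (x # xs))"
      by (subst sum.swap) (simp add: sum_distrib_right)
    also have "\<dots> = (\<Sum>xs\<in>words X n. \<Sum>y\<in>X. \<Sum>x\<in>X. M x y * T (y # xs) * S (x # xs))"
      by (rule sum.cong[OF refl], rule sum.swap)
    also have "\<dots> = (\<Sum>xs\<in>words X n. \<Sum>x\<in>X. T (x # xs) * (\<Sum>y\<in>X. M y x * S (y # xs)))"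
      by (simp add: sum_distrib_left mult_ac)
    also have "\<dots> = (\<Sum>x\<in>X. \<Sum>xs\<in>words X n. T (x # xs) * (\<Sum>y\<in>X. M y x * S (y # xs)))"
      by (rule sum.swap)
    finally show ?thesis .
  qed
  then show ?case
    by (simp add: sum_words_Suc distrib_left distrib_right sum.distrib Suc.IH)
qed

lemma tensor_rep_mder: "tensor_rep A T I = mder UNIV (\<lambda>i j. A $ i $ j) T I"
  by (induction I arbitrary: T) (simp_all add: tensor_rep_Cons)

lemma words_UNIV: "words UNIV n = {I. length I = n}"
  by (simp add: words_def)

lemma tensor_rep_adjoint:
  "(\<Sum>I | length I = n. tensor_rep A T I * S I) = (\<Sum>I | length I = n. T I * tensor_rep (transpose A) S I)"
  using mder_adjoint[of UNIV "\<lambda>i j. A $ i $ j" T S n]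
  by (simp add: tensor_rep_mder words_UNIV transpose_def)

lemma der_mder:
  fixes c :: "'g::euclidean_space list \<Rightarrow> real"
  assumes "multilin c"
  shows "der f c xs = mder Basis (\<lambda>b b'. f b \<bullet> b') c xs"
  using assms
proof (induction xs arbitrary: c)
  case (Cons x xs)
  then show ?case
    using multilin_expand_hd[OF Cons.prems, of "f x" xs] Cons.IH[OF multilin_Cons[OF Cons.prems, of x]] by simp
qed simp

lemma der_adjoint:
  fixes c e :: "'g::euclidean_space list \<Rightarrow> real"
  assumes "multilin c" "multilin e" "\<And>a b. f a \<bullet> b = a \<bullet> f' b"
  shows "(\<Sum>xs\<in>words Basis n. der f c xs * e xs) = (\<Sum>xs\<in>words Basis n. c xs * der f' e xs)"
proof -
  have "(\<lambda>x y. f y \<bullet> x) = (\<lambda>x y. f' x \<bullet> y)"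
    unfolding assms(3) by (intro ext) (rule inner_commute)
  then show ?thesis
    using mder_adjoint[of Basis "\<lambda>b b'. f b \<bullet> b'" c e n]
    by (simp only: der_mder[OF assms(1)] der_mder[OF assms(2)])
qed

subsection \<open>The operators\<close>

definition dmap :: "real^'m^'m \<Rightarrow> 'm::finite iso \<Rightarrow> 'm iso" where
  "dmap B Y = (0, transpose B *v snd Y)"

definition admap :: "real^'m^'m \<Rightarrow> 'm::finite iso \<Rightarrow> 'm iso" where
  "admap B Y = (fst Y ** B - B ** fst Y, 0)"

text \<open>
  The action of \<open>B\<close> on the values and on the covector arguments only. It arises because a cochain of
  the isotropy algebra is a form on the matrices whose values are forms on the covectors.
\<close>

definition theta :: "real^'m^'m \<Rightarrow> ('m::finite iso list \<Rightarrow> 'm tens) \<Rightarrow> 'm iso list \<Rightarrow> 'm tens" where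
  "theta B c xs = iact (B, 0) (c xs) - der (dmap B) c xs"

definition lieop :: "real^'m^'m \<Rightarrow> ('m::finite iso list \<Rightarrow> 'm tens) \<Rightarrow> 'm iso list \<Rightarrow> 'm tens" where
  "lieop B = ceL ibr iact (B, 0)"

lemma lieop_def': "lieop B c xs = iact (B, 0) (c xs) - der (ibr (B, 0)) c xs"
  by (simp add: lieop_def ceL_def)

lemma ibr_split: "ibr (B, 0) Y = admap B Y + dmap B Y"
  by (cases Y) (simp add: ibr_def admap_def dmap_def)

lemma linear_dmap: "linear (dmap B)"
  by (simp add: linear_lam_iff dmap_def mv_simps)

lemma linear_ibr: "linear (ibr X)" "linear (\<lambda>X. ibr X Y)"
  by (cases X; simp add: linear_lam_iff ibr_def mm_simps mv_simps split_beta algebra_simps)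
    (cases Y; simp add: linear_lam_iff ibr_def mm_simps mv_simps split_beta transpose_linear algebra_simps)

lemma trep_linear: "trep A (S + T) = trep A S + trep A T" "trep A (r *\<^sub>R T) = r *\<^sub>R trep A T"
  using tensor_rep_add[of _ "S _" "T _"] tensor_rep_scale[of _ r "T _"]
  by (simp_all add: trep_def fun_eq_iff scaleR_fun_def plus_fun_def tensor_rep_add tensor_rep_scale algebra_simps)

lemma trep_mat_linear: "trep (A + B) T = trep A T + trep B T" "trep (r *\<^sub>R A) T = r *\<^sub>R trep A T"
  by (simp_all add: trep_def fun_eq_iff scaleR_fun_def transpose_linear tensor_rep_mat_add
      tensor_rep_mat_scale algebra_simps)

lemma linear_iact: "linear (iact X)" "linear (\<lambda>X. iact X T)"
  by (simp_all add: linear_lam_iff iact_def trep_linear trep_mat_linear)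

lemma transpose_diff: "transpose (A - B) = transpose A - transpose B" for A :: "real^'m^'n"
  by (simp add: vec_eq_iff transpose_def)

lemma sum_swap4:
  "(\<Sum>a\<in>A. \<Sum>b\<in>B. \<Sum>c\<in>C. \<Sum>d\<in>D. f a b c d) = (\<Sum>c\<in>C. \<Sum>d\<in>D. \<Sum>a\<in>A. \<Sum>b\<in>B. f a b c d)"
proof -
  have "(\<Sum>a\<in>A. \<Sum>b\<in>B. \<Sum>c\<in>C. \<Sum>d\<in>D. f a b c d) = (\<Sum>a\<in>A. \<Sum>c\<in>C. \<Sum>b\<in>B. \<Sum>d\<in>D. f a b c d)"
    by (rule sum.cong[OF refl], rule sum.swap)
  also have "\<dots> = (\<Sum>c\<in>C. \<Sum>a\<in>A. \<Sum>b\<in>B. \<Sum>d\<in>D. f a b c d)" by (rule sum.swap)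
  also have "\<dots> = (\<Sum>c\<in>C. \<Sum>a\<in>A. \<Sum>d\<in>D. \<Sum>b\<in>B. f a b c d)"
    by (rule sum.cong[OF refl], rule sum.cong[OF refl], rule sum.swap)
  also have "\<dots> = (\<Sum>c\<in>C. \<Sum>d\<in>D. \<Sum>a\<in>A. \<Sum>b\<in>B. f a b c d)"
    by (rule sum.cong[OF refl], rule sum.swap)
  finally show ?thesis .
qed

lemma trep_comm: "trep A (trep B T) - trep B (trep A T) = trep (A ** B - B ** A) T"
proof (intro ext)
  fix K J
  have e: "trep A (trep B T) K J = tensor_rep A (tensor_rep B (\<lambda>K. T K J)) K
      - tensor_rep A (\<lambda>K. tensor_rep (transpose B) (T K) J) K
      - tensor_rep (transpose A) (\<lambda>J. tensor_rep B (\<lambda>K. T K J) K) J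
      + tensor_rep (transpose A) (tensor_rep (transpose B) (T K)) J" for A B
    by (simp add: trep_def tensor_rep_diff)
  have c: "tensor_rep A (\<lambda>K. tensor_rep B (T K) J) K = tensor_rep B (\<lambda>J. tensor_rep A (\<lambda>K. T K J) K) J"
    for A B
  proof -
    have "tensor_rep A (\<lambda>K. tensor_rep B (T K) J) K = (\<Sum>r<length K. \<Sum>j\<in>UNIV. \<Sum>s<length J. \<Sum>k\<in>UNIV.
        A $ (K ! r) $ j * (B $ (J ! s) $ k * T (K[r := j]) (J[s := k])))"
      by (simp add: tensor_rep_def sum_distrib_left)
    also have "\<dots> = (\<Sum>s<length J. \<Sum>k\<in>UNIV. \<Sum>r<length K. \<Sum>j\<in>UNIV.
        A $ (K ! r) $ j * (B $ (J ! s) $ k * T (K[r := j]) (J[s := k])))"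
      by (rule sum_swap4)
    also have "\<dots> = tensor_rep B (\<lambda>J. tensor_rep A (\<lambda>K. T K J) K) J"
      by (simp add: tensor_rep_def sum_distrib_left mult.left_commute)
    finally show ?thesis .
  qed
  have t: "transpose (A ** B - B ** A) = transpose B ** transpose A - transpose A ** transpose B"
    by (simp add: transpose_diff matrix_transpose_mul)
  have "(trep A (trep B T) - trep B (trep A T)) K J =
     (tensor_rep A (tensor_rep B (\<lambda>K. T K J)) K - tensor_rep B (tensor_rep A (\<lambda>K. T K J)) K)
     + (tensor_rep (transpose A) (tensor_rep (transpose B) (T K)) J
      - tensor_rep (transpose B) (tensor_rep (transpose A) (T K)) J)"
    using c[of A "transpose B"] c[of B "transpose A"] by (simp add: e)
  also have "\<dots> = trep (A ** B - B ** A) T K J"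
    unfolding tensor_rep_comm trep_def t by (simp add: tensor_rep_mat_diff)
  finally show "(trep A (trep B T) - trep B (trep A T)) K J = trep (A ** B - B ** A) T K J" .
qed

lemma iact_comm: "iact X (iact Y T) - iact Y (iact X T) = iact (ibr X Y) T"
proof -
  have n: "trep A (- T) = - trep A T" for A and T :: "'a tens"
    using trep_linear(2)[of A "-1" T] by simp
  have "trep (fst Y ** fst X - fst X ** fst Y) T = - trep (fst X ** fst Y - fst Y ** fst X) T"
    using trep_mat_linear(2)[of "-1" "fst X ** fst Y - fst Y ** fst X" T] by simp
  then show ?thesis
    using trep_comm[of "fst X" "fst Y" T] by (simp add: iact_def n ibr_def split_beta)
qed

lemma msym_tensor_rep_param:
  fixes F :: "'l list \<Rightarrow> 'm::finite list \<Rightarrow> real"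
  assumes "\<And>K. length K = length I \<Longrightarrow> msym (\<lambda>L. F L K)"
  shows "msym (\<lambda>L. tensor_rep A (F L) I)"
  unfolding msym_def
proof (intro allI impI)
  fix L L' :: "'l list" assume "mset L = mset L'"
  then have "F L K = F L' K" if "length K = length I" for K
    using msymD[OF assms[OF that]] by blast
  then show "tensor_rep A (F L) I = tensor_rep A (F L') I" by (rule tensor_rep_cong)
qed

lemma trep_in:
  assumes T: "T \<in> tens l p q"
  shows "trep A T \<in> tens l p q"
  unfolding tens_def
proof (intro CollectI conjI allI impI)
  have z: "T K J = 0" if "\<not> (length K = l + q \<and> length J = p)" for K J
    using T that unfolding tens_def by blast
  have s1: "msym (\<lambda>L. T (L @ I) J)" if "length I = q" for I J using T that by (simp add: tens_def)
  have s2: "msym (\<lambda>I. T (L @ I) J)" if "length L = l" for L J using T that by (simp add: tens_def)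
  have s3: "msym (T K)" for K using T by (simp add: tens_def)
  show "trep A T K J = 0" if "\<not> (length K = l + q \<and> length J = p)" for K J
  proof -
    have "tensor_rep A (\<lambda>K. T K J) K = tensor_rep A (\<lambda>K. 0) K" using that by (intro tensor_rep_cong z) auto
    moreover have "tensor_rep (transpose A) (T K) J = tensor_rep (transpose A) (\<lambda>K. 0) J"
      using that by (intro tensor_rep_cong z) auto
    ultimately show ?thesis by (simp add: trep_def)
  qed
  show "msym (\<lambda>L. trep A T (L @ I) J)" if "length I = q" for I J
    unfolding trep_def tensor_rep_append using that
    by (intro msym_add msym_diff msym_tensor_rep msym_tensor_rep_param s1) auto
  show "msym (\<lambda>I. trep A T (L @ I) J)" if "length L = l" for L J
    unfolding trep_def tensor_rep_append using that
    by (intro msym_add msym_diff msym_tensor_rep msym_tensor_rep_param s2) auto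
  show "msym (trep A T K)" for K
    unfolding trep_def by (intro msym_diff msym_tensor_rep msym_tensor_rep_param s3)
qed

lemma subspace_tens: "real_subspace (tens l p q :: 'm tens set)"
  unfolding real_vector.subspace_def
proof (intro conjI ballI allI)
  show "0 \<in> (tens l p q :: 'm tens set)" by (auto simp: tens_def msym_def)
  fix S :: "'m tens" assume S: "S \<in> tens l p q"
  show "r *\<^sub>R S \<in> tens l p q" for r
    using S unfolding tens_def scaleR_fun_def by (auto intro: msym_scale)
  fix T :: "'m tens" assume "T \<in> tens l p q"
  then show "S + T \<in> tens l p q"
    using S unfolding tens_def plus_fun_def by (auto intro: msym_add)
qed

lemma mm_diff:
  fixes A B :: "real^'m::finite^'n" and C D :: "real^'k^'m"
  shows "(A - B) ** C = A ** C - B ** C" "A ** (C - D) = A ** C - A ** D"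
  by (simp_all add: vec_eq_iff matrix_matrix_mult_def algebra_simps sum_subtractf)

lemma ibr_jacobi: "ibr X (ibr Y Z) = ibr (ibr X Y) Z + ibr Y (ibr X Z)"
proof -
  obtain A w B y C z where "X = (A, w)" "Y = (B, y)" "Z = (C, z)" by (cases X, cases Y, cases Z)
  then show ?thesis
    by (simp add: ibr_def mv_simps transpose_diff matrix_transpose_mul matrix_mul_assoc
        mm_diff vector_matrix_mul_assoc algebra_simps)
qed

lemma lie_module_iso: "lie_module ibr iact (tens l p q :: 'm::finite tens set)"
proof (rule lie_module.intro)
  show "ibr X X = 0" for X :: "'m iso" by (cases X) (simp add: ibr_def zero_prod_def)
  show "iact X T \<in> tens l p q" if "T \<in> tens l p q" for X and T :: "'m tens"
    unfolding iact_def by (intro subspace_neg subspace_tens trep_in that)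
  show "iact X (S + T) = iact X S + iact X T" for X and S T :: "'m tens" by (rule linear_add[OF linear_iact(1)])
  show "iact X (r *\<^sub>R T) = r *\<^sub>R iact X T" for X r and T :: "'m tens" by (rule linear_scale[OF linear_iact(1)])
  show "iact (ibr X Y) T = iact X (iact Y T) - iact Y (iact X T)" for X Y and T :: "'m tens"
    by (rule iact_comm[symmetric])
qed (rule linear_ibr ibr_jacobi subspace_tens linear_iact)+

subsection \<open>The Laplacian\<close>

abbreviation "dI \<equiv> ced ibr iact"

lemma iact_fst: "iact X T = iact (fst X, 0) T"
  by (simp add: iact_def)

lemma theta_linear:
  "theta B (\<lambda>xs. c xs + e xs) = (\<lambda>xs. theta B c xs + theta B e xs)"
  "theta B (\<lambda>xs. r *\<^sub>R c xs) = (\<lambda>xs. r *\<^sub>R theta B c xs)"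
  by (auto simp: theta_def der_add der_scale linear_add[OF linear_iact(1)] linear_scale[OF linear_iact(1)]
      algebra_simps)

lemma lieop_linear:
  "lieop B (\<lambda>xs. c xs + e xs) = (\<lambda>xs. lieop B c xs + lieop B e xs)"
  "lieop B (\<lambda>xs. r *\<^sub>R c xs) = (\<lambda>xs. r *\<^sub>R lieop B c xs)"
  by (auto simp: lieop_def' der_add der_scale linear_add[OF linear_iact(1)] linear_scale[OF linear_iact(1)]
      algebra_simps)

lemma linear_theta: "linear (theta B)" and linear_lieop: "linear (lieop B)"
  by (simp_all add: linear_lam_iff theta_linear lieop_linear plus_fun_def[of _ "_ :: _ iso list \<Rightarrow> _"]
      scaleR_fun_def[of _ "_ :: _ iso list \<Rightarrow> _"])

lemma theta_mat_linear:
  assumes "multilin c"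
  shows "linear (\<lambda>B. theta B c xs)"
proof -
  have d: "dmap (A + B) = (\<lambda>Y. dmap A Y + dmap B Y)" "dmap (r *\<^sub>R A) = (\<lambda>Y. r *\<^sub>R dmap A Y)"
    for A B :: "real^'a^'a" and r
    by (auto simp: fun_eq_iff dmap_def transpose_linear mv_simps vector_matrix_mult_diff_distrib)
  have i: "iact (A + B, 0) T = iact (A, 0) T + iact (B, 0) T" "iact (r *\<^sub>R A, 0) T = r *\<^sub>R iact (A, 0) T"
    for A B :: "real^'a^'a" and r T
    by (simp_all add: iact_def trep_mat_linear)
  show ?thesis
    unfolding linear_lam_iff theta_def d i der_fun_add[OF assms] der_fun_scale[OF assms]
    by (simp add: algebra_simps)
qed

lemma lieop_mat_linear:
  assumes "multilin c"
  shows "linear (\<lambda>B. lieop B c xs)"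
proof -
  have d: "ibr (A + B, 0) = (\<lambda>Y. ibr (A, 0) Y + ibr (B, 0) Y)" "ibr (r *\<^sub>R A, 0) = (\<lambda>Y. r *\<^sub>R ibr (A, 0) Y)"
    for A B :: "real^'a^'a" and r
  proof -
    show "ibr (A + B, 0) = (\<lambda>Y. ibr (A, 0) Y + ibr (B, 0) Y)"
    proof
      fix Y show "ibr (A + B, 0) Y = ibr (A, 0) Y + ibr (B, 0) Y"
        using linear_add[OF linear_ibr(2)[of Y], of "(A, 0)" "(B, 0)"] by simp
    qed
    show "ibr (r *\<^sub>R A, 0) = (\<lambda>Y. r *\<^sub>R ibr (A, 0) Y)"
    proof
      fix Y show "ibr (r *\<^sub>R A, 0) Y = r *\<^sub>R ibr (A, 0) Y"
        using linear_scale[OF linear_ibr(2)[of Y], of r "(A, 0)"] by simp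
    qed
  qed
  have i: "iact (A + B, 0) T = iact (A, 0) T + iact (B, 0) T" "iact (r *\<^sub>R A, 0) T = r *\<^sub>R iact (A, 0) T"
    for A B :: "real^'a^'a" and r T
    by (simp_all add: iact_def trep_mat_linear)
  show ?thesis
    unfolding linear_lam_iff lieop_def' d i der_fun_add[OF assms] der_fun_scale[OF assms]
    by (simp add: algebra_simps)
qed

lemma der_length_zero: "(\<And>vs. length vs = length xs \<Longrightarrow> c vs = 0) \<Longrightarrow> der f c xs = 0"
  by (induction xs arbitrary: c) auto

lemma derivation_in:
  assumes "c \<in> altcochains (tens l p q) n m" "linear f"
  shows "(\<lambda>xs. iact X (c xs) - der f c xs) \<in> altcochains (tens l p q) n m"
proof -
  note c = altcochainsD[OF assms(1)]
  have "altern (\<lambda>xs. iact X (c xs) + (-1) *\<^sub>R der f c xs)"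
    by (intro altern_add altern_compose[OF c(1) linear_iact(1)] altern_scale altern_der assms(2) c(1))
  moreover have "iact X (c xs) - der f c xs \<in> tens l p q" for xs
    using lie_module.act_in[OF lie_module_iso c(3)] der_in[OF subspace_tens c(3)]
    by (intro subspace_diff[OF subspace_tens])
  moreover have "iact X (c xs) - der f c xs = 0" if "length xs + m \<noteq> n" for xs
    using c(4) that by (simp add: der_length_zero linear_0[OF linear_iact(1)])
  ultimately show ?thesis by (simp add: altcochains_def)
qed

lemma theta_in: "c \<in> altcochains (tens l p q) n m \<Longrightarrow> theta B c \<in> altcochains (tens l p q) n m"
  unfolding theta_def[abs_def] by (intro derivation_in linear_dmap)

lemma lieop_in: "c \<in> altcochains (tens l p q) n m \<Longrightarrow> lieop B c \<in> altcochains (tens l p q) n m"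
  unfolding lieop_def'[abs_def] by (intro derivation_in linear_ibr)

definition contr :: "real^'m^'m \<Rightarrow> ('m::finite iso list \<Rightarrow> 'm tens) \<Rightarrow> 'm iso list \<Rightarrow> 'm tens" where
  "contr B c ys = c ((B, 0) # ys)"

lemma contr_in:
  assumes "c \<in> altcochains (tens l p q) n m"
  shows "contr B c \<in> altcochains (tens l p q) n (Suc m)"
  using altcochainsD[OF assms] altern_Cons[OF altcochainsD(1)[OF assms], of "(B, 0)"]
  by (simp add: altcochains_def contr_def[abs_def])

lemma linear_contr_mat: "multilin c \<Longrightarrow> linear (\<lambda>B. contr B c)"
  using multilin_linear_hd[of c]
  by (auto simp: linear_lam_iff contr_def fun_eq_iff scaleR_fun_def)
    (metis (no_types, opaque_lifting) add_0 add_Pair mult_zero_right scaleR_Pair scaleR_zero_right)+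

definition mbr :: "'m::finite iso \<Rightarrow> 'm iso \<Rightarrow> 'm iso" where
  "mbr X Y = (fst Y ** fst X - fst X ** fst Y, 0)"

lemma ibr_mbr: "ibr X Y = mbr X Y + (dmap (fst X) Y - dmap (fst Y) X)"
  by (cases X; cases Y) (simp add: ibr_def mbr_def dmap_def)

lemma dI_theta:
  assumes "altern c"
  shows "dI c xs = alts (\<lambda>X ys. theta (fst X) c ys) xs + pairs mbr c xs"
proof -
  note m = altern_multilin[OF assms]
  have "alts (\<lambda>X ys. theta (fst X) c ys) xs =
     alts (\<lambda>X ys. iact X (c ys)) xs - alts (\<lambda>X ys. der (dmap (fst X)) c ys) xs"
    unfolding theta_def alts_diff by (simp flip: iact_fst)
  then show ?thesis
    unfolding ced_def alts_der[OF assms] ibr_mbr[abs_def] pairs_fun_add[OF m] by simp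
qed

lemma theta_comm:
  assumes "multilin c"
  shows "theta A (theta B c) xs - theta B (theta A c) xs = theta (B ** A - A ** B) c xs"
proof -
  have 1: "theta A (theta B c) xs = iact (A, 0) (iact (B, 0) (c xs)) - der (dmap B) (\<lambda>ys. iact (A, 0) (c ys)) xs
      - der (dmap A) (\<lambda>ys. iact (B, 0) (c ys)) xs + der (dmap A) (der (dmap B) c) xs" for A B
    unfolding theta_def[abs_def]
    by (simp add: der_diff linear_diff[OF linear_iact(1)] der_linear_push[OF linear_iact(1)])
  have "dmap (B ** A - A ** B) = (\<lambda>Y. dmap A (dmap B Y) - dmap B (dmap A Y))"
    by (auto simp: dmap_def fun_eq_iff transpose_diff matrix_transpose_mul mv_simps vector_matrix_mul_assoc
        vector_matrix_mult_diff_distrib)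
  then have 2: "der (dmap (B ** A - A ** B)) c xs =
      der (\<lambda>Y. dmap A (dmap B Y)) c xs - der (\<lambda>Y. dmap B (dmap A Y)) c xs"
    by (simp add: der_fun_diff[OF assms])
  have 3: "iact (B ** A - A ** B, 0) (c xs) = iact (A, 0) (iact (B, 0) (c xs)) - iact (B, 0) (iact (A, 0) (c xs))"
    unfolding iact_comm by (simp add: ibr_def)
  show ?thesis
    unfolding 1 using der_comm[of "dmap A" "dmap B" c xs] unfolding theta_def 2 3
    by (simp add: algebra_simps)
qed

lemma theta_alts:
  assumes "\<And>X ys. F (dmap B X) ys = 0"
  shows "theta B (alts F) xs = alts (\<lambda>X ys. theta B (F X) ys) xs"
  unfolding theta_def alts_linear_push[OF linear_iact(1)] der_alts assms alts_diff by simp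

lemma theta_0: "multilin c \<Longrightarrow> theta 0 c xs = 0"
  using linear_0[OF theta_mat_linear] .

lemma dI_theta_comm:
  assumes "altern c"
  shows "dI (theta B c) xs - theta B (dI c) xs = alts (\<lambda>X ys. theta (B ** fst X - fst X ** B) c ys) xs"
proof -
  note m = altern_multilin[OF assms]
  have a: "altern (theta B c)"
  proof -
    have "altern (\<lambda>xs. iact (B, 0) (c xs) + (-1) *\<^sub>R der (dmap B) c xs)"
      by (intro altern_add altern_compose[OF assms linear_iact(1)] altern_scale altern_der linear_dmap assms)
    then show ?thesis by (simp add: theta_def[abs_def])
  qed
  have p: "theta B (pairs mbr c) xs = pairs mbr (theta B c) xs"
  proof -
    have "der (dmap B) (pairs mbr c) xs = pairs mbr (der (dmap B) c) xs"
      by (rule der_pairs[OF _ m]) (simp add: dmap_def mbr_def zero_prod_def matrix_matrix_mult_def vec_eq_iff)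
    then show ?thesis
      using pairs_add[of mbr "\<lambda>xs. iact (B, 0) (c xs)" "\<lambda>xs. (-1) *\<^sub>R der (dmap B) c xs" xs]
        pairs_scale[of mbr "-1" "der (dmap B) c" xs]
      by (simp add: theta_def[abs_def] pairs_linear_push[OF linear_iact(1)])
  qed
  have t: "theta B (alts (\<lambda>X ys. theta (fst X) c ys)) xs = alts (\<lambda>X ys. theta B (theta (fst X) c) ys) xs"
    by (rule theta_alts) (simp add: dmap_def theta_0[OF m])
  have "theta B (dI c) xs = alts (\<lambda>X ys. theta B (theta (fst X) c) ys) xs + pairs mbr (theta B c) xs"
  proof -
    have "dI c = (\<lambda>xs. alts (\<lambda>X ys. theta (fst X) c ys) xs + pairs mbr c xs)"
      by (rule ext) (rule dI_theta[OF assms])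
    then show ?thesis using p t by (simp add: theta_linear)
  qed
  moreover have "dI (theta B c) xs = alts (\<lambda>X ys. theta (fst X) (theta B c) ys) xs + pairs mbr (theta B c) xs"
    by (rule dI_theta[OF a])
  ultimately show ?thesis
    using alts_diff[of "\<lambda>X ys. theta (fst X) (theta B c) ys" "\<lambda>X ys. theta B (theta (fst X) c) ys" xs]
    by (simp add: theta_comm[OF m])
qed

definition munit :: "'m \<Rightarrow> 'm \<Rightarrow> real^'m^'m::finite" where
  "munit i j = outer (axis i 1) (axis j 1)"

lemma munit_nth: "munit i j $ a $ b = (if i = a then 1 else 0) * (if j = b then 1 else 0)"
  by (simp add: munit_def outer_def axis_def)

lemma matrix_munit: "B = (\<Sum>i\<in>UNIV. \<Sum>j\<in>UNIV. B $ i $ j *\<^sub>R munit i j)"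
proof -
  have "(\<Sum>i\<in>UNIV. \<Sum>j\<in>UNIV. B $ i $ j *\<^sub>R munit i j) $ a $ b =
      (\<Sum>i\<in>UNIV. (if i = a then 1 else 0) * (\<Sum>j\<in>UNIV. (if j = b then 1 else 0) * B $ i $ j))" for a b
    by (simp add: munit_nth sum_distrib_left mult_ac)
  then show ?thesis by (simp add: vec_eq_iff sum_delta_mult)
qed

lemma munit_mult: "munit i j ** A = (\<Sum>k\<in>UNIV. A $ j $ k *\<^sub>R munit i k)"
  "A ** munit i j = (\<Sum>k\<in>UNIV. A $ k $ i *\<^sub>R munit k j)"
proof -
  have "(munit i j ** A) $ a $ b = (\<Sum>k\<in>UNIV. A $ j $ k *\<^sub>R munit i k) $ a $ b" for a b
  proof -
    have "(munit i j ** A) $ a $ b = (\<Sum>k\<in>UNIV. (if j = k then 1 else 0) * ((if i = a then 1 else 0) * A $ k $ b))"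
      by (simp add: matrix_matrix_mult_def munit_nth mult_ac)
    moreover have "(\<Sum>k\<in>UNIV. A $ j $ k *\<^sub>R munit i k) $ a $ b =
        (\<Sum>k\<in>UNIV. (if k = b then 1 else 0) * ((if i = a then 1 else 0) * A $ j $ k))"
      by (simp add: munit_nth mult_ac)
    ultimately show ?thesis by (simp add: sum_delta_mult)
  qed
  then show "munit i j ** A = (\<Sum>k\<in>UNIV. A $ j $ k *\<^sub>R munit i k)" by (simp add: vec_eq_iff)
  have "(A ** munit i j) $ a $ b = (\<Sum>k\<in>UNIV. A $ k $ i *\<^sub>R munit k j) $ a $ b" for a b
  proof -
    have "(A ** munit i j) $ a $ b = (\<Sum>k\<in>UNIV. (if i = k then 1 else 0) * ((if j = b then 1 else 0) * A $ a $ k))"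
      by (simp add: matrix_matrix_mult_def munit_nth mult_ac)
    moreover have "(\<Sum>k\<in>UNIV. A $ k $ i *\<^sub>R munit k j) $ a $ b =
        (\<Sum>k\<in>UNIV. (if k = a then 1 else 0) * ((if j = b then 1 else 0) * A $ k $ i))"
      by (simp add: munit_nth mult_ac)
    ultimately show ?thesis by (simp add: sum_delta_mult)
  qed
  then show "A ** munit i j = (\<Sum>k\<in>UNIV. A $ k $ i *\<^sub>R munit k j)" by (simp add: vec_eq_iff)
qed

lemma transpose_munit: "transpose (munit i j) = munit j i"
  by (simp add: vec_eq_iff transpose_def munit_nth)

text \<open>Invariance of the Casimir element of the trace form.\<close>

lemma casimir_invariant:
  fixes b :: "real^'m::finite^'m \<Rightarrow> real^'m^'m \<Rightarrow> 'w::real_vector"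
  assumes l1: "\<And>Q. linear (\<lambda>P. b P Q)" and l2: "\<And>P. linear (b P)"
  shows "(\<Sum>i\<in>UNIV. \<Sum>j\<in>UNIV. b (munit j i ** A - A ** munit j i) (munit i j)) =
    (\<Sum>i\<in>UNIV. \<Sum>j\<in>UNIV. b (munit j i) (A ** munit i j - munit i j ** A))"
proof -
  let ?G = "\<lambda>i k j. A $ i $ k *\<^sub>R b (munit j k) (munit i j)"
  let ?H = "\<lambda>i k j. A $ k $ j *\<^sub>R b (munit k i) (munit i j)"
  have "(\<Sum>i\<in>UNIV. \<Sum>j\<in>UNIV. b (munit j i ** A) (munit i j)) = (\<Sum>i\<in>UNIV. \<Sum>j\<in>UNIV. \<Sum>k\<in>UNIV. ?G i k j)"
    unfolding munit_mult by (simp add: linear_sum[OF l1] linear_scale[OF l1])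
  also have "\<dots> = (\<Sum>j\<in>UNIV. \<Sum>k\<in>UNIV. \<Sum>i\<in>UNIV. ?G i k j)"
    by (subst sum.swap) (rule sum.cong[OF refl], rule sum.swap)
  also have "\<dots> = (\<Sum>i\<in>UNIV. \<Sum>j\<in>UNIV. b (munit j i) (A ** munit i j))"
    unfolding munit_mult by (subst sum.swap) (simp add: linear_sum[OF l2] linear_scale[OF l2])
  finally have 1: "(\<Sum>i\<in>UNIV. \<Sum>j\<in>UNIV. b (munit j i ** A) (munit i j)) =
     (\<Sum>i\<in>UNIV. \<Sum>j\<in>UNIV. b (munit j i) (A ** munit i j))" .
  have "(\<Sum>i\<in>UNIV. \<Sum>j\<in>UNIV. b (A ** munit j i) (munit i j)) = (\<Sum>i\<in>UNIV. \<Sum>j\<in>UNIV. \<Sum>k\<in>UNIV. ?H i k j)"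
    unfolding munit_mult by (simp add: linear_sum[OF l1] linear_scale[OF l1])
  also have "\<dots> = (\<Sum>i\<in>UNIV. \<Sum>k\<in>UNIV. \<Sum>j\<in>UNIV. ?H i k j)"
    by (rule sum.cong[OF refl], rule sum.swap)
  also have "\<dots> = (\<Sum>i\<in>UNIV. \<Sum>j\<in>UNIV. b (munit j i) (munit i j ** A))"
    unfolding munit_mult by (simp add: linear_sum[OF l2] linear_scale[OF l2])
  finally show ?thesis
    using 1 by (simp add: linear_diff[OF l1] linear_diff[OF l2] sum_subtractf)
qed

text \<open>
  Contraction with the elementary matrices, followed by the two actions of the dual basis with respect
  to the trace form.
\<close>

definition iota :: "('m::finite iso list \<Rightarrow> 'm tens) \<Rightarrow> 'm iso list \<Rightarrow> 'm tens" where
  "iota c = (\<Sum>i\<in>UNIV. \<Sum>j\<in>UNIV. theta (munit j i) (contr (munit i j) c) + lieop (munit j i) (contr (munit i j) c))"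

text \<open>
  The Casimir operators of the two actions, for the trace form. The pairing of \<open>munit j i\<close> with
  \<open>munit i j\<close> is also what makes each summand an operator preceded by its adjoint (\<open>theta_adjoint\<close>,
  \<open>lieop_adjoint\<close>).
\<close>

definition laplace :: "('m::finite iso list \<Rightarrow> 'm tens) \<Rightarrow> 'm iso list \<Rightarrow> 'm tens" where
  "laplace c = (\<Sum>i\<in>UNIV. \<Sum>j\<in>UNIV. theta (munit j i) (theta (munit i j) c) + lieop (munit j i) (lieop (munit i j) c))"

lemma iota_in:
  assumes "c \<in> altcochains (tens l p q) n m"
  shows "iota c \<in> altcochains (tens l p q) n (Suc m)"
  unfolding iota_def
  by (intro subspace_sum subspace_add subspace_altcochains subspace_tens theta_in lieop_in contr_in assms)

lemma laplace_in:
  assumes "c \<in> altcochains (tens l p q) n m"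
  shows "laplace c \<in> altcochains (tens l p q) n m"
  unfolding laplace_def
  by (intro subspace_sum subspace_add subspace_altcochains subspace_tens theta_in lieop_in assms)

lemma linear_laplace: "linear laplace"
  unfolding laplace_def[abs_def]
  by (intro linear_compose_sum ballI linear_compose_add
      linear_compose[OF linear_theta linear_theta, unfolded o_def]
      linear_compose[OF linear_lieop linear_lieop, unfolded o_def])

lemma linear_dI: "linear dI"
  unfolding linear_lam_iff
proof (intro conjI allI; rule ext)
  fix c e :: "'a iso list \<Rightarrow> 'a tens" and xs
  show "dI (c + e) xs = (dI c + dI e) xs"
    by (simp add: ced_def linear_add[OF linear_iact(1)] alts_add pairs_add plus_fun_def[of c])
next
  fix r and c :: "'a iso list \<Rightarrow> 'a tens" and xs
  show "dI (r *\<^sub>R c) xs = (r *\<^sub>R dI c) xs"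
    by (simp add: ced_def linear_scale[OF linear_iact(1)] alts_scale pairs_scale scaleR_fun_apply[of r "dI c"]
        scaleR_fun_def[of r c] scaleR_add_right)
qed

lemma dI_contr: "contr B (dI c) ys = lieop B c ys - dI (contr B c) ys"
  using lie_module.d_Cons[OF lie_module_iso, of c "(B, 0)" ys]
  by (simp add: contr_def lieop_def contr_def[abs_def])

text \<open>
  The Cartan formula for the two halves of \<^const>\<open>iota\<close>. For the first half the commutators of
  \<^const>\<open>theta\<close> with the differential complete \<^const>\<open>lieop\<close> to \<^const>\<open>theta\<close>, by
  invariance of the Casimir element.
\<close>

theorem laplace_homotopy:
  fixes c :: "'m::finite iso list \<Rightarrow> 'm tens"
  assumes "c \<in> altcochains (tens l p q) n m"
  shows "dI (iota c) + iota (dI c) = laplace c"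
proof
  fix xs
  note cc = altcochainsD[OF assms]
  note M = lie_module_iso[of l p q]
  have ain: "contr B c \<in> altcochains (tens l p q) n (Suc m)" for B by (rule contr_in[OF assms])
  have ac: "altern (contr B c)" "multilin (contr B c)" "contr B c ys \<in> tens l p q" for B ys
    using altcochainsD[OF ain] by auto
  \<comment> \<open>Cartan's formula for the contraction with a matrix.\<close>
  have sub: "contr B (dI c) = lieop B c - dI (contr B c)" for B
    by (rule ext) (simp add: dI_contr)
  have dl: "dI (lieop B' e) = lieop B' (dI e)" if "multilin e" "\<And>ys. e ys \<in> tens l p q" for B' e
    unfolding lieop_def by (rule ext) (rule lie_module.d_L[OF M that])
  have L: "dI (lieop B' (contr B c)) + lieop B' (contr B (dI c)) = lieop B' (lieop B c)" for B B'
    unfolding sub linear_diff[OF linear_lieop] dl[OF ac(2,3)] by simp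
  have T: "dI (theta B' (contr B c)) xs + theta B' (contr B (dI c)) xs =
      alts (\<lambda>X ys. theta (B' ** fst X - fst X ** B') (contr B c) ys) xs + theta B' (lieop B c) xs" for B B'
    using dI_theta_comm[OF ac(1), of B' B xs] unfolding sub linear_diff[OF linear_theta]
    by (simp add: algebra_simps)
  have lie: "theta B' (lieop B c) xs = theta B' (theta B c) xs
      - alts (\<lambda>X ys. theta B' (contr (fst X ** B - B ** fst X) c) ys) xs" for B B'
  proof -
    have "ibr (B, 0) = (\<lambda>Y. dmap B Y + admap B Y)" by (rule ext) (simp add: ibr_split add.commute)
    then have "lieop B c = theta B c - der (admap B) c"
      by (intro ext) (simp add: lieop_def' theta_def der_fun_add[OF cc(2)])
    also have "der (admap B) c = alts (\<lambda>X ys. c (admap B X # ys))"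
      by (rule ext) (rule alts_insert[OF cc(1), symmetric])
    finally have 1: "lieop B c = theta B c - alts (\<lambda>X ys. c (admap B X # ys))" .
    have 2: "theta B' (alts (\<lambda>X ys. c (admap B X # ys))) xs = alts (\<lambda>X ys. theta B' (\<lambda>ys. c (admap B X # ys)) ys) xs"
    proof (rule theta_alts)
      fix X ys
      have "admap B (dmap B' X) = 0" by (simp add: admap_def dmap_def zero_prod_def)
      then show "c (admap B (dmap B' X) # ys) = 0" using multilin_hd(4)[OF cc(2)] by simp
    qed
    have 3: "(\<lambda>ys. c (admap B X # ys)) = contr (fst X ** B - B ** fst X) c" for X
      by (simp add: admap_def contr_def[abs_def])
    show ?thesis unfolding 1 linear_diff[OF linear_theta] using 2 unfolding 3 by simp
  qed
  have cas: "(\<Sum>i\<in>UNIV. \<Sum>j\<in>UNIV. theta (munit j i ** A - A ** munit j i) (contr (munit i j) c) ys) =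
      (\<Sum>i\<in>UNIV. \<Sum>j\<in>UNIV. theta (munit j i) (contr (A ** munit i j - munit i j ** A) c) ys)" for A ys
  proof (rule casimir_invariant)
    show "linear (\<lambda>P. theta P (contr Q c) ys)" for Q by (rule theta_mat_linear[OF ac(2)])
    show "linear (\<lambda>Q. theta P (contr Q c) ys)" for P
    proof -
      have "linear (\<lambda>Q. theta P (contr Q c))"
        using linear_compose[OF linear_contr_mat[OF cc(2)] linear_theta] by (simp add: o_def)
      then show ?thesis by (simp add: linear_lam_iff scaleR_fun_apply)
    qed
  qed
  have "(dI (iota c) + iota (dI c)) xs = (\<Sum>i\<in>UNIV. \<Sum>j\<in>UNIV.
      (dI (theta (munit j i) (contr (munit i j) c)) xs + theta (munit j i) (contr (munit i j) (dI c)) xs)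
      + (dI (lieop (munit j i) (contr (munit i j) c)) + lieop (munit j i) (contr (munit i j) (dI c))) xs)"
    unfolding iota_def linear_sum[OF linear_dI] linear_add[OF linear_dI]
    by (simp add: sum_fun_apply[where x = xs] sum.distrib algebra_simps)
  also have "\<dots> = (\<Sum>i\<in>UNIV. \<Sum>j\<in>UNIV. alts (\<lambda>X ys. theta (munit j i ** fst X - fst X ** munit j i) (contr (munit i j) c) ys) xs)
      - (\<Sum>i\<in>UNIV. \<Sum>j\<in>UNIV. alts (\<lambda>X ys. theta (munit j i) (contr (fst X ** munit i j - munit i j ** fst X) c) ys) xs)
      + (\<Sum>i\<in>UNIV. \<Sum>j\<in>UNIV. theta (munit j i) (theta (munit i j) c) xs + lieop (munit j i) (lieop (munit i j) c) xs)"
    unfolding T L lie by (simp add: sum.distrib sum_subtractf algebra_simps)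
  also have "(\<Sum>i\<in>UNIV. \<Sum>j\<in>UNIV. alts (\<lambda>X ys. theta (munit j i ** fst X - fst X ** munit j i) (contr (munit i j) c) ys) xs)
      = (\<Sum>i\<in>UNIV. \<Sum>j\<in>UNIV. alts (\<lambda>X ys. theta (munit j i) (contr (fst X ** munit i j - munit i j ** fst X) c) ys) xs)"
    unfolding alts_sum[symmetric] cas ..
  finally show "(dI (iota c) + iota (dI c)) xs = laplace c xs"
    unfolding laplace_def sum_fun_apply[where x = xs] plus_fun_apply[of _ _ xs] diff_self add_0 .
qed

subsection \<open>Harmonic cochains\<close>

definition harmonic :: "('m::finite iso list \<Rightarrow> 'm tens) \<Rightarrow> bool" where
  "harmonic c \<longleftrightarrow> (\<forall>B. theta B c = 0 \<and> lieop B c = 0)"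

text \<open>
  The Euclidean inner product of components, for which transposed matrices act as adjoints.
\<close>

definition ip :: "nat \<Rightarrow> nat \<Rightarrow> nat \<Rightarrow> nat \<Rightarrow> ('m::finite iso list \<Rightarrow> 'm tens) \<Rightarrow> ('m iso list \<Rightarrow> 'm tens) \<Rightarrow> real" where
  "ip l p q k c e = (\<Sum>xs\<in>words Basis k. \<Sum>K | length K = l + q. \<Sum>J | length J = p. c xs K J * e xs K J)"

lemma finite_words [simp]: "finite X \<Longrightarrow> finite (words X k)"
  unfolding words_def by (rule finite_lists_length_eq)

lemma ip_linear:
  "ip l p q k (c + c') e = ip l p q k c e + ip l p q k c' e"
  "ip l p q k (sum C A) e = (\<Sum>a\<in>A. ip l p q k (C a) e)"
proof -
  show add: "ip l p q k (c + c') e = ip l p q k c e + ip l p q k c' e" for c c'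
    by (simp add: ip_def distrib_right sum.distrib)
  have "ip l p q k 0 e = 0" by (simp add: ip_def)
  then show "ip l p q k (sum C A) e = (\<Sum>a\<in>A. ip l p q k (C a) e)"
    by (induction A rule: infinite_finite_induct) (auto simp: add)
qed

lemma ip_adjoint:
  assumes c: "multilin c" and e: "multilin e" and f: "\<And>a b. f a \<bullet> b = a \<bullet> f' b"
  shows "ip l p q k (\<lambda>xs. iact (A, 0) (c xs) - der f c xs) e =
    ip l p q k c (\<lambda>xs. iact (transpose A, 0) (e xs) - der f' e xs)"
proof -
  let ?K = "{K :: 'a list. length K = l + q}" and ?J = "{J :: 'a list. length J = p}"
  have m: "multilin (\<lambda>xs. c xs K J)" if "multilin c" for c :: "'a iso list \<Rightarrow> 'a tens" and K J
    using that by (simp add: multilin_def linear_lam_iff scaleR_fun_def)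
  have 1: "(\<Sum>xs\<in>words Basis k. \<Sum>K\<in>?K. \<Sum>J\<in>?J. tensor_rep A (\<lambda>K. c xs K J) K * e xs K J) =
      (\<Sum>xs\<in>words Basis k. \<Sum>K\<in>?K. \<Sum>J\<in>?J. c xs K J * tensor_rep (transpose A) (\<lambda>K. e xs K J) K)"
  proof (rule sum.cong[OF refl])
    fix xs
    show "(\<Sum>K\<in>?K. \<Sum>J\<in>?J. tensor_rep A (\<lambda>K. c xs K J) K * e xs K J) =
      (\<Sum>K\<in>?K. \<Sum>J\<in>?J. c xs K J * tensor_rep (transpose A) (\<lambda>K. e xs K J) K)"
      by (subst (1 2) sum.swap) (simp add: tensor_rep_adjoint[of A])
  qed
  have 2: "(\<Sum>xs\<in>words Basis k. \<Sum>K\<in>?K. \<Sum>J\<in>?J. tensor_rep (transpose A) (c xs K) J * e xs K J) =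
      (\<Sum>xs\<in>words Basis k. \<Sum>K\<in>?K. \<Sum>J\<in>?J. c xs K J * tensor_rep A (e xs K) J)"
    using tensor_rep_adjoint[of "transpose A"] by simp
  have 3: "(\<Sum>xs\<in>words Basis k. \<Sum>K\<in>?K. \<Sum>J\<in>?J. der f (\<lambda>xs. c xs K J) xs * e xs K J) =
      (\<Sum>xs\<in>words Basis k. \<Sum>K\<in>?K. \<Sum>J\<in>?J. c xs K J * der f' (\<lambda>xs. e xs K J) xs)"
  proof -
    have sw: "(\<Sum>xs\<in>words Basis k. \<Sum>K\<in>?K. \<Sum>J\<in>?J. h xs K J) = (\<Sum>K\<in>?K. \<Sum>J\<in>?J. \<Sum>xs\<in>words Basis k. h xs K J)"
      for h :: "'a iso list \<Rightarrow> 'a list \<Rightarrow> 'a list \<Rightarrow> real"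
      by (subst sum.swap, rule sum.cong[OF refl], rule sum.swap)
    show ?thesis unfolding sw der_adjoint[OF m[OF c] m[OF e] f] ..
  qed
  have l: "(iact (A, 0) (c xs) - der f c xs) K J * e xs K J = - (tensor_rep A (\<lambda>K. c xs K J) K * e xs K J)
      + tensor_rep (transpose A) (c xs K) J * e xs K J - der f (\<lambda>xs. c xs K J) xs * e xs K J" for xs K J
    by (simp add: iact_def trep_def der_apply algebra_simps)
  have r: "c xs K J * (iact (transpose A, 0) (e xs) - der f' e xs) K J = - (c xs K J * tensor_rep (transpose A) (\<lambda>K. e xs K J) K)
      + c xs K J * tensor_rep A (e xs K) J - c xs K J * der f' (\<lambda>xs. e xs K J) xs" for xs K J
    by (simp add: iact_def trep_def der_apply algebra_simps)
  show ?thesis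
    unfolding ip_def l r sum.distrib sum_subtractf sum_negf 1 2 3 ..
qed

lemma matrix_inner: "(X ** B) \<bullet> Y = X \<bullet> (Y ** transpose B)" "(B ** X) \<bullet> Y = X \<bullet> (transpose B ** Y)"
  for X Y B :: "real^'m::finite^'m"
proof -
  have "(X ** B) \<bullet> Y = (\<Sum>i\<in>UNIV. \<Sum>j\<in>UNIV. \<Sum>k\<in>UNIV. X $ i $ k * B $ k $ j * Y $ i $ j)"
    by (simp add: inner_vec_def matrix_matrix_mult_def sum_distrib_right)
  also have "\<dots> = (\<Sum>i\<in>UNIV. \<Sum>k\<in>UNIV. \<Sum>j\<in>UNIV. X $ i $ k * B $ k $ j * Y $ i $ j)"
    by (rule sum.cong[OF refl], rule sum.swap)
  also have "\<dots> = X \<bullet> (Y ** transpose B)"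
    by (simp add: inner_vec_def matrix_matrix_mult_def sum_distrib_left transpose_def mult_ac)
  finally show "(X ** B) \<bullet> Y = X \<bullet> (Y ** transpose B)" .
  have "(B ** X) \<bullet> Y = (\<Sum>i\<in>UNIV. \<Sum>j\<in>UNIV. \<Sum>k\<in>UNIV. B $ i $ k * X $ k $ j * Y $ i $ j)"
    by (simp add: inner_vec_def matrix_matrix_mult_def sum_distrib_right)
  also have "\<dots> = (\<Sum>i\<in>UNIV. \<Sum>k\<in>UNIV. \<Sum>j\<in>UNIV. B $ i $ k * X $ k $ j * Y $ i $ j)"
    by (rule sum.cong[OF refl], rule sum.swap)
  also have "\<dots> = (\<Sum>k\<in>UNIV. \<Sum>i\<in>UNIV. \<Sum>j\<in>UNIV. B $ i $ k * X $ k $ j * Y $ i $ j)"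
    by (rule sum.swap)
  also have "\<dots> = (\<Sum>k\<in>UNIV. \<Sum>j\<in>UNIV. \<Sum>i\<in>UNIV. B $ i $ k * X $ k $ j * Y $ i $ j)"
    by (rule sum.cong[OF refl], rule sum.swap)
  also have "\<dots> = X \<bullet> (transpose B ** Y)"
    by (simp add: inner_vec_def matrix_matrix_mult_def sum_distrib_left transpose_def mult_ac)
  finally show "(B ** X) \<bullet> Y = X \<bullet> (transpose B ** Y)" .
qed

lemma dmap_adjoint: "dmap B a \<bullet> b = a \<bullet> dmap (transpose B) b"
  using dot_lmul_matrix[of "snd a" B "snd b"] by (simp add: dmap_def inner_prod_def)

lemma admap_adjoint: "admap B a \<bullet> b = a \<bullet> admap (transpose B) b"
  unfolding admap_def inner_prod_def fst_conv snd_conv inner_diff_left inner_diff_right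
    matrix_inner(1)[of "fst a" B "fst b"] matrix_inner(2)[of B "fst a" "fst b"] by simp

lemma theta_adjoint: "multilin c \<Longrightarrow> multilin e \<Longrightarrow> ip l p q k (theta B c) e = ip l p q k c (theta (transpose B) e)"
  unfolding theta_def[abs_def] by (rule ip_adjoint) (auto intro: dmap_adjoint)

lemma lieop_adjoint: "multilin c \<Longrightarrow> multilin e \<Longrightarrow> ip l p q k (lieop B c) e = ip l p q k c (lieop (transpose B) e)"
  unfolding lieop_def'[abs_def]
  by (rule ip_adjoint) (auto simp: ibr_split inner_add_left inner_add_right dmap_adjoint admap_adjoint)

lemma ip_definite:
  assumes c: "c \<in> altcochains (tens l p q) n m" and k: "k + m = n" and z: "ip l p q k c c = 0"
  shows "c = 0"
proof -
  note cc = altcochainsD[OF c]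
  have "c xs K J = 0" if "set xs \<subseteq> Basis" for xs K J
  proof (cases "length xs = k \<and> length K = l + q \<and> length J = p")
    case True
    have n: "\<forall>xs\<in>words Basis k. (\<Sum>K | length K = l + q. \<Sum>J | length J = p. c xs K J * c xs K J) = 0"
      using z unfolding ip_def by (subst (asm) sum_nonneg_eq_0_iff) (auto intro!: sum_nonneg)
    then have "(\<Sum>K | length K = l + q. \<Sum>J | length J = p. c xs K J * c xs K J) = 0"
      using True that by (auto simp: words_def)
    then have "(\<Sum>J | length J = p. c xs K J * c xs K J) = 0"
      using True by (subst (asm) sum_nonneg_eq_0_iff) (auto intro!: sum_nonneg)
    then show ?thesis
      using True by (subst (asm) sum_nonneg_eq_0_iff) auto
  next
    case False
    then consider "length xs + m \<noteq> n" | "\<not> (length K = l + q \<and> length J = p)" using k by auto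
    then show ?thesis
    proof cases
      case 2
      then show ?thesis using cc(3)[of xs] unfolding tens_def by blast
    qed (simp add: cc(4))
  qed
  then have "c xs = 0" if "set xs \<subseteq> Basis" for xs using that by (simp add: fun_eq_iff)
  then have "c xs = 0" for xs
    using multilin_zero[OF cc(2) span_Basis] by blast
  then show ?thesis by (simp add: fun_eq_iff)
qed

text \<open>
  The inner product of \<open>laplace c\<close> with \<open>c\<close> is a sum of squares.
\<close>

lemma laplace_harmonic:
  assumes c: "c \<in> altcochains (tens l p q) n m" and z: "laplace c = 0"
  shows "harmonic c"
proof (cases "m \<le> n")
  case False
  then have "c = 0" using altcochainsD(4)[OF c] by (simp add: fun_eq_iff)
  then show ?thesis by (simp add: harmonic_def linear_0[OF linear_theta] linear_0[OF linear_lieop])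
next
  case True
  define k where "k = n - m"
  have k: "k + m = n" using True by (simp add: k_def)
  note ml = altcochainsD(2)[OF c] altcochainsD(2)[OF theta_in[OF c]] altcochainsD(2)[OF lieop_in[OF c]]
  have "0 = ip l p q k (laplace c) c" unfolding z by (simp add: ip_def)
  also have "\<dots> = (\<Sum>i\<in>UNIV. \<Sum>j\<in>UNIV. ip l p q k (theta (munit i j) c) (theta (munit i j) c)
      + ip l p q k (lieop (munit i j) c) (lieop (munit i j) c))"
    unfolding laplace_def ip_linear
    by (simp add: theta_adjoint[OF ml(2,1)] lieop_adjoint[OF ml(3,1)] transpose_munit)
  finally have s: "(\<Sum>i\<in>UNIV. \<Sum>j\<in>UNIV. ip l p q k (theta (munit i j) c) (theta (munit i j) c)
      + ip l p q k (lieop (munit i j) c) (lieop (munit i j) c)) = 0" by simp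
  have nn: "ip l p q k e e \<ge> 0" for e by (auto simp: ip_def intro!: sum_nonneg)
  have "ip l p q k (theta (munit i j) c) (theta (munit i j) c) + ip l p q k (lieop (munit i j) c) (lieop (munit i j) c) = 0" for i j
  proof -
    have "(\<Sum>j\<in>UNIV. ip l p q k (theta (munit i j) c) (theta (munit i j) c)
      + ip l p q k (lieop (munit i j) c) (lieop (munit i j) c)) = 0"
      using s by (subst (asm) sum_nonneg_eq_0_iff) (auto intro!: sum_nonneg add_nonneg_nonneg nn)
    then show ?thesis by (subst (asm) sum_nonneg_eq_0_iff) (auto intro!: add_nonneg_nonneg nn)
  qed
  then have 0: "theta (munit i j) c = 0" "lieop (munit i j) c = 0" for i j
    using ip_definite[OF theta_in[OF c] k] ip_definite[OF lieop_in[OF c] k] nn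
    by (meson add_nonneg_eq_0_iff)+
  have "theta B c xs = 0" "lieop B c xs = 0" for B xs
    by (subst matrix_munit[of B],
        simp add: linear_sum[OF theta_mat_linear[OF ml(1)]] linear_scale[OF theta_mat_linear[OF ml(1)]]
          linear_sum[OF lieop_mat_linear[OF ml(1)]] linear_scale[OF lieop_mat_linear[OF ml(1)]] 0)+
  then show ?thesis by (simp add: harmonic_def fun_eq_iff)
qed

lemma harmonic_laplace: "harmonic c \<Longrightarrow> laplace c = 0"
  by (simp add: harmonic_def laplace_def linear_0[OF linear_theta] linear_0[OF linear_lieop])

text \<open>
  Here \<open>laplace c\<close> is harmonic, hence orthogonal to the range of the Laplacian, and so to itself.
\<close>

lemma laplace_kernel:
  assumes c: "c \<in> altcochains (tens l p q) n m" and z: "laplace (laplace c) = 0"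
  shows "laplace c = 0"
proof (cases "m \<le> n")
  case False
  then show ?thesis using altcochainsD(4)[OF laplace_in[OF c]] by (simp add: fun_eq_iff)
next
  case True
  define k where "k = n - m"
  have k: "k + m = n" using True by (simp add: k_def)
  have h: "theta B (laplace c) = 0" "lieop B (laplace c) = 0" for B
    using laplace_harmonic[OF laplace_in[OF c] z] by (simp_all add: harmonic_def)
  note ml = altcochainsD(2)[OF theta_in[OF c]] altcochainsD(2)[OF lieop_in[OF c]] altcochainsD(2)[OF laplace_in[OF c]]
  have z0: "ip l p q k e 0 = 0" for e by (simp add: ip_def)
  have "ip l p q k (laplace c) (laplace c) = 0"
    by (subst (1) laplace_def, unfold ip_linear)
      (simp add: theta_adjoint[OF ml(1,3)] lieop_adjoint[OF ml(2,3)] h z0)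
  then show ?thesis by (rule ip_definite[OF laplace_in[OF c] k])
qed

lemma laplace_split:
  assumes c: "c \<in> altcochains (tens l p q) n m"
  shows "\<exists>w\<in>altcochains (tens l p q) n m. laplace (c - laplace w) = 0"
proof (rule finite_dim_splitting[where S = "altcochains (tens l p q) n m" and N = "words Basis (n - m) \<times> ({K. length K = l + q} \<times> {J. length J = p})"
      and \<phi> = "\<lambda>(xs, K, J) c. c xs K J"])
  show "real_subspace (altcochains (tens l p q) n m :: ('a iso list \<Rightarrow> 'a tens) set)"
    by (intro subspace_altcochains subspace_tens)
  show "linear (case k of (xs, K, J) \<Rightarrow> \<lambda>c. c xs K J)" for k :: "'a iso list \<times> 'a list \<times> 'a list"
    by (cases k) (simp add: linear_lam_iff scaleR_fun_def)
  fix v :: "'a iso list \<Rightarrow> 'a tens" assume v: "v \<in> altcochains (tens l p q) n m"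
  show "v = 0" if z: "\<forall>k\<in>words Basis (n - m) \<times> {K. length K = l + q} \<times> {J. length J = p}. (case k of (xs, K, J) \<Rightarrow> \<lambda>c. c xs K J) v = 0"
  proof (cases "m \<le> n")
    case True
    then have k: "(n - m) + m = n" by simp
    have "ip l p q (n - m) v v = 0" unfolding ip_def using z by (intro sum.neutral ballI) auto
    then show ?thesis by (rule ip_definite[OF v k])
  next
    case False
    then show ?thesis using altcochainsD(4)[OF v] by (simp add: fun_eq_iff)
  qed
qed (use c in \<open>auto intro: linear_laplace laplace_in laplace_kernel finite_words finite_Basis\<close>)

lemma harmonic_admap:
  assumes h: "harmonic c" and c: "multilin c"
  shows "der (admap B) c xs = 0"
proof -
  have th: "theta B c = 0" and li: "lieop B c = 0" using h by (auto simp: harmonic_def)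
  have "ibr (B, 0) = (\<lambda>Y. dmap B Y + admap B Y)" by (rule ext) (simp add: ibr_split add.commute)
  then show ?thesis
    using fun_cong[OF th, of xs] fun_cong[OF li, of xs]
    by (simp add: lieop_def' theta_def der_fun_add[OF c])
qed

text \<open>
  The differential is built from \<^const>\<open>theta\<close> and from a contraction with the matrix bracket. Twice
  this contraction is an antisymmetrization of the adjoint action, under which \<open>c\<close> is invariant.
\<close>

lemma harmonic_closed:
  assumes c: "c \<in> altcochains (tens l p q) n m" and h: "harmonic c"
  shows "dI c = 0"
proof
  fix xs
  note cc = altcochainsD[OF c]
  have th: "theta B c = 0" for B using h by (auto simp: harmonic_def)
  have ad: "der (admap B) c xs = 0" for B xs by (rule harmonic_admap[OF h cc(2)])
  have m2: "(\<lambda>X Y :: 'a iso. mbr X Y - mbr Y X) = (\<lambda>X Y. mbr X Y + mbr X Y)"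
    by (intro ext) (simp add: mbr_def)
  have "pairs (\<lambda>X Y. mbr X Y - mbr Y X) c xs = pairs mbr c xs + pairs mbr c xs"
    unfolding m2 pairs_fun_add[OF cc(2)] ..
  moreover have "alts (\<lambda>X ys. der (mbr X) c ys) xs = 0"
  proof -
    have "mbr X = admap (fst X)" for X :: "'a iso" by (simp add: fun_eq_iff mbr_def admap_def)
    then show ?thesis by (simp add: ad)
  qed
  ultimately have "pairs mbr c xs + pairs mbr c xs = 0"
    using alts_der[OF cc(1), of mbr xs] by simp
  then have "2 *\<^sub>R pairs mbr c xs = 0" by (simp add: scaleR_2)
  then have "pairs mbr c xs = 0" by simp
  then show "dI c xs = 0 xs" by (simp add: dI_theta[OF cc(1)] th)
qed

lemma dI_laplace:
  assumes c: "c \<in> altcochains (tens l p q) n (Suc m)"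
  shows "dI (laplace c) = laplace (dI c)"
proof -
  note M = lie_module_iso[of l p q]
  have dd: "dI (dI e) = 0" if "e \<in> altcochains (tens l p q) n' m'" for e n' m'
    by (rule ext) (simp add: lie_module.d_d[OF M altcochainsD(2,3)[OF that]])
  have "dI (laplace c) = dI (iota (dI c))"
    unfolding laplace_homotopy[OF c, symmetric] linear_add[OF linear_dI] dd[OF iota_in[OF c]] by simp
  also have "\<dots> = laplace (dI c)"
    using laplace_homotopy[OF lie_module.d_altcochains[OF M c]] dd[OF c]
    by (simp add: iota_def contr_def[abs_def] linear_0[OF linear_theta] linear_0[OF linear_lieop] flip: zero_fun_def)
  finally show ?thesis .
qed

text \<open>
  Splitting twice gives a harmonic \<open>h\<close> and a \<open>u\<close> in the range of the Laplacian with \<open>z = h + laplace u\<close>.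
  The Laplacian commutes with the differential and is injective on its range, so \<open>u\<close> is closed like
  \<open>z\<close>, and the homotopy formula reduces to \<open>laplace u = dI (iota u)\<close>.
\<close>

lemma hodge_decomposition:
  assumes z: "z \<in> altcochains (tens l p q) n 0" and c: "dI z = 0"
  shows "\<exists>h\<in>altcochains (tens l p q) n 0. \<exists>b\<in>altcochains (tens l p q) n (Suc 0). harmonic h \<and> z = h + dI b"
proof -
  note M = lie_module_iso[of l p q]
  have dd: "dI (dI e) = 0" if "e \<in> altcochains (tens l p q) n' m'" for e n' m'
    by (rule ext) (simp add: lie_module.d_d[OF M altcochainsD(2,3)[OF that]])
  have up: "altcochains (tens l p q) n 0 = altcochains (tens l p q) (Suc n) (Suc 0)"
    by (simp add: altcochains_Suc_Suc)
  obtain v1 where v1: "v1 \<in> altcochains (tens l p q) n 0" "laplace (z - laplace v1) = 0"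
    using laplace_split[OF z] by blast
  obtain v2 where v2: "v2 \<in> altcochains (tens l p q) n 0" "laplace (v1 - laplace v2) = 0"
    using laplace_split[OF v1(1)] by blast
  define h where "h = z - laplace v1"
  define u where "u = laplace v2"
  have uin: "u \<in> altcochains (tens l p q) n 0" unfolding u_def by (rule laplace_in[OF v2(1)])
  have hin: "h \<in> altcochains (tens l p q) n 0"
    unfolding h_def by (rule Real_Vector_Spaces.subspace_diff[OF subspace_altcochains[OF subspace_tens] z laplace_in[OF v1(1)]])
  have h: "harmonic h" by (rule laplace_harmonic[OF hin]) (simp add: h_def v1(2))
  have "laplace v1 = laplace u" using v2(2) by (simp add: linear_diff[OF linear_laplace] u_def)
  then have zh: "z = h + laplace u" by (simp add: h_def)
  have dl: "dI (laplace e) = laplace (dI e)" if "e \<in> altcochains (tens l p q) n 0" for e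
    using dI_laplace[of e l p q "Suc n" 0] that unfolding up .
  have "laplace (dI u) = dI z"
    unfolding dl[OF uin, symmetric] by (simp add: zh linear_add[OF linear_dI] harmonic_closed[OF hin h])
  then have "laplace (laplace (dI v2)) = 0" unfolding c by (simp add: u_def dl[OF v2(1)])
  moreover have "dI v2 \<in> altcochains (tens l p q) (Suc n) 0"
    by (rule lie_module.d_altcochains[OF M v2(1)[unfolded up]])
  ultimately have "laplace (dI v2) = 0" using laplace_kernel by blast
  then have du: "dI u = 0" by (simp add: u_def dl[OF v2(1)])
  have i0: "iota 0 = 0"
    by (simp add: iota_def contr_def[abs_def] linear_0[OF linear_theta] linear_0[OF linear_lieop] flip: zero_fun_def)
  have "laplace u = dI (iota u)"
    using laplace_homotopy[OF uin[unfolded up]] by (simp add: du i0)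
  moreover have "iota u \<in> altcochains (tens l p q) n (Suc 0)"
    by (rule iota_in[OF uin])
  ultimately have "z = h + dI (iota u)" "iota u \<in> altcochains (tens l p q) n (Suc 0)" using zh by simp_all
  then show ?thesis using hin h by (intro bexI[of _ h] bexI[of _ "iota u"] conjI)
qed

text \<open>
  The differential only sees the part of \<open>b\<close> in the range of the Laplacian, and a harmonic cochain in
  the range of the Laplacian is zero.
\<close>

lemma exact_harmonic:
  assumes b: "b \<in> altcochains (tens l p q) n (Suc m)" and h: "harmonic (dI b)"
  shows "dI b = 0"
proof -
  note M = lie_module_iso[of l p q]
  obtain b1 where b1: "b1 \<in> altcochains (tens l p q) n (Suc m)" "laplace (b - laplace b1) = 0"
    using laplace_split[OF b] by blast
  have b0in: "b - laplace b1 \<in> altcochains (tens l p q) n (Suc m)"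
    by (rule Real_Vector_Spaces.subspace_diff[OF subspace_altcochains[OF subspace_tens] b laplace_in[OF b1(1)]])
  have "dI (b - laplace b1) = 0"
    by (rule harmonic_closed[OF b0in laplace_harmonic[OF b0in b1(2)]])
  then have e: "dI b = laplace (dI b1)"
    by (simp add: linear_diff[OF linear_dI] dI_laplace[OF b1(1)])
  have "laplace (laplace (dI b1)) = 0" using harmonic_laplace[OF h] e by simp
  then show ?thesis using laplace_kernel[OF lie_module.d_altcochains[OF M b1(1)]] e by simp
qed

section \<open>Harmonic cochains and invariant forms\<close>

lemma harmonic_theta:
  assumes "harmonic c"
  shows "tensor_rep B (\<lambda>K. c Xs K J) K - tensor_rep (transpose B) (c Xs K) J + der (dmap B) (\<lambda>Ys. c Ys K J) Xs = 0"
proof -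
  have "theta B c Xs K J = 0" using assms by (simp add: harmonic_def)
  then show ?thesis
    using der_apply[of "dmap B" c Xs K] der_apply[of "dmap B" "\<lambda>Ys. c Ys K" Xs J]
    by (simp add: theta_def iact_def trep_def)
qed

lemma der_closed: "der f c xs = (\<Sum>i<length xs. c (xs[i := f (xs ! i)]))"
  by (induction xs arbitrary: c) (simp_all add: sum.lessThan_Suc_shift del: sum.lessThan_Suc)

text \<open>
  The root vector \<^term>\<open>munit j e\<close> turns one covariant index \<open>e\<close> into \<open>j\<close>; by invariance a harmonic
  cochain is therefore determined by its components whose covariant indices all equal \<open>e\<close>.
\<close>

lemma harmonic_top:
  assumes c: "c \<in> altcochains (tens l p q) n m" and h: "harmonic c"
    and z: "\<And>Xs K. c Xs K (replicate p e) = 0"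
  shows "c = 0"
proof -
  have ms: "msym (c Xs K)" for Xs K
    using altcochainsD(3)[OF c, of Xs] by (simp add: tens_def)
  have *: "c Xs K (L @ replicate k e) = 0" if "length L + k = p" for L k Xs K
    using that
  proof (induction L arbitrary: k Xs K)
    case (Cons j L)
    define J where "J = L @ replicate k e"
    have 0: "c Xs K (e # J) = 0" for Xs K
    proof -
      have "c Xs K (e # J) = c Xs K (L @ replicate (Suc k) e)"
        by (rule msymD[OF ms]) (simp add: J_def)
      then show ?thesis using Cons.IH[of "Suc k"] Cons.prems by simp
    qed
    have "tensor_rep (munit e j) (c Xs K) (e # J) = 0"
      using harmonic_theta[OF h, of "munit j e" Xs "e # J" K] by (simp add: 0 transpose_munit)
    moreover have "tensor_rep (munit e j) (c Xs K) (e # J) = (1 + count (mset J) e) * c Xs K (j # J)"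
    proof -
      have "(\<Sum>a\<in>UNIV. real (count (mset (e # J)) a) * (\<Sum>i\<in>UNIV. munit e j $ a $ i * c Xs K (i # remove1 a (e # J))))
         = (\<Sum>a\<in>UNIV. (if e = a then 1 else 0) * (real (count (mset (e # J)) a)
             * (\<Sum>i\<in>UNIV. (if j = i then 1 else 0) * c Xs K (i # remove1 a (e # J)))))"
        by (rule sum.cong[OF refl]) (simp add: munit_nth)
      then show ?thesis unfolding tensor_rep_msym[OF ms] sum_delta_mult by simp
    qed
    ultimately have "c Xs K (j # J) = 0" by (simp add: add_nonneg_eq_0_iff)
    then show ?case by (simp add: J_def)
  qed (use z in simp)
  have "c Xs K J = 0" for Xs K J
  proof (cases "length J = p")
    case True
    then show ?thesis using *[of J 0] by simp
  next
    case False
    then show ?thesis using altcochainsD(3)[OF c, of Xs] by (simp add: tens_def)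
  qed
  then show ?thesis by (simp add: fun_eq_iff)
qed

definition basic :: "'m::finite iso set" where
  "basic = range (\<lambda>A. (A, 0)) \<union> range (\<lambda>i. (0, axis i 1))"

lemma span_basic: "span basic = (UNIV :: 'm::finite iso set)"
proof -
  have "X \<in> span basic" for X :: "'m iso"
  proof -
    have e: "(\<Sum>i\<in>UNIV. snd X $ i *\<^sub>R axis i 1) = snd X"
      by (simp add: vec_eq_iff axis_nth if_distrib sum.delta cong: if_cong)
    have "X = (fst X, 0) + (\<Sum>i\<in>UNIV. snd X $ i *\<^sub>R (0, axis i 1))"
      by (simp add: prod_eq_iff fst_sum snd_sum e)
    also have "\<dots> \<in> span basic"
      by (intro span_add span_sum span_scale span_base) (auto simp: basic_def)
    finally show ?thesis .
  qed
  then show ?thesis by auto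
qed

lemma der_basic:
  assumes "multilin c" "set Xs \<subseteq> basic"
  shows "der (dmap (munit b b)) c Xs = real (count_list Xs (0, axis b 1)) *\<^sub>R c Xs"
  using assms
proof (induction Xs arbitrary: c)
  case (Cons X Xs)
  have ax: "transpose (munit b b) *v axis i 1 = (if i = b then axis b 1 else 0)" for i
    unfolding transpose_munit by (simp add: munit_def outer_vec inner_axis_axis)
  have "dmap (munit b b) X = (if X = (0, axis b 1) then X else 0)"
    using Cons.prems(2) ax by (auto simp: basic_def dmap_def zero_prod_def axis_eq_axis simp del: transpose_matrix_vector
        split: if_splits)
  then show ?case
    using Cons.IH[OF multilin_Cons[OF Cons.prems(1)]] Cons.prems multilin_hd(4)[OF Cons.prems(1)]
    by (simp add: scaleR_left_distrib)
qed simp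

lemma tensor_rep_munit_diag: "tensor_rep (munit b b) T K = real (count_list K b) * T K"
proof (induction K arbitrary: T)
  case (Cons i K)
  have "(\<Sum>j\<in>UNIV. munit b b $ i $ j * T (j # K)) = (if b = i then 1 else 0) * (\<Sum>j\<in>UNIV. (if b = j then 1 else 0) * T (j # K))"
    by (simp add: munit_nth sum_distrib_left)
  then show ?case unfolding tensor_rep_Cons Cons.IH sum_delta_mult by (auto simp: algebra_simps)
qed simp

text \<open>
  The weight of a component under the diagonal matrices: a nonzero component with covariant indices
  \<open>e\<dots>e\<close> can only have contravariant indices \<open>e\<close> and vector arguments \<^term>\<open>axis e 1\<close>, and these
  must match the covariant indices in number. Alternation allows at most one vector argument.
\<close>

lemma harmonic_weights:
  assumes c: "c \<in> altcochains (tens l p q) n m" and h: "harmonic c" and X: "set Xs \<subseteq> basic"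
    and nz: "c Xs K (replicate p e) \<noteq> 0"
  shows "K = replicate (l + q) e" "l + q + count_list Xs (0, axis e 1) = p"
    "count_list Xs (0, axis e 1) \<le> 1" "b \<noteq> e \<Longrightarrow> (0, axis b 1) \<notin> set Xs"
proof -
  have ml: "multilin (\<lambda>Ys. c Ys K J)" for J
    by (rule altern_multilin[OF altern_eval[OF altern_eval[OF altcochainsD(1)[OF c]]]])
  have "real (count_list K b) * c Xs K (replicate p e) - real (count_list (replicate p e) b) * c Xs K (replicate p e)
      + real (count_list Xs (0, axis b 1)) * c Xs K (replicate p e) = 0" for b
    using harmonic_theta[OF h, of "munit b b" Xs "replicate p e" K]
    by (simp add: der_basic[OF ml X] transpose_munit tensor_rep_munit_diag)
  then have "(real (count_list K b) - real (count_list (replicate p e) b) + real (count_list Xs (0, axis b 1))) * c Xs K (replicate p e) = 0" for b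
    by (simp add: algebra_simps)
  then have w: "count_list K b + count_list Xs (0, axis b 1) = count_list (replicate p e) b" for b
    using nz by (simp add: algebra_simps flip: of_nat_add)
  have cr: "count_list (replicate r e) b = (if b = e then r else 0)" for r b by (induction r) auto
  have n: "count_list K b = 0" "count_list Xs (0, axis b 1) = 0" if "b \<noteq> e" for b
    using w[of b] that by (simp_all add: cr)
  have "c Xs \<in> tens l p q" by (rule altcochainsD(3)[OF c])
  then have len: "length K = l + q" using nz by (auto simp: tens_def)
  have "set K \<subseteq> {e}" using n(1) by (auto simp: count_list_0_iff)
  then show K: "K = replicate (l + q) e"
    using len by (metis replicate_length_same singletonD subset_iff)
  show "l + q + count_list Xs (0, axis e 1) = p" using w[of e] by (simp add: K cr)
  have "distinct Xs"
  proof (rule ccontr)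
    assume "\<not> distinct Xs"
    then have "c Xs = 0" by (rule altern_not_distinct[OF altcochainsD(1)[OF c]])
    then show False using nz by simp
  qed
  then have "count (mset Xs) (0, axis e 1) \<le> 1" by (simp add: distinct_count_atmost_1)
  then show "count_list Xs (0, axis e 1) \<le> 1" by (simp only: count_mset)
  show "(0, axis b 1) \<notin> set Xs" if "b \<noteq> e" using n(2)[OF that] by (simp add: count_list_0_iff)
qed

lemma harmonic_vanish:
  assumes c: "c \<in> altcochains (tens l p q) n m" and h: "harmonic c" and "l + q \<noteq> p" "l + q + 1 \<noteq> p"
  shows "c = 0"
proof (rule harmonic_top[OF c h, where e = undefined])
  fix Xs :: "'a iso list" and K :: "'a list"
  show "c Xs K (replicate p undefined) = 0"
  proof (rule multilin_zero[OF _ span_basic])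
    show "multilin (\<lambda>Ys. c Ys K (replicate p undefined))"
      by (rule altern_multilin[OF altern_eval[OF altern_eval[OF altcochainsD(1)[OF c]]]])
    show "c Xs K (replicate p undefined) = 0" if "set Xs \<subseteq> basic" for Xs
      using harmonic_weights(2,3)[OF c h that, of K undefined] assms(3,4) by force
  qed
qed

text \<open>
  By the weights, a harmonic cochain with \<open>p = r + 1\<close> is determined by these components.
\<close>

definition base_form :: "nat \<Rightarrow> nat \<Rightarrow> 'm \<Rightarrow> ('m::finite iso list \<Rightarrow> 'm tens) \<Rightarrow> (real^'m^'m) list \<Rightarrow> real" where
  "base_form p r e c As = c ((0, axis e 1) # map (\<lambda>A. (A, 0)) As) (replicate r e) (replicate p e)"

lemma harmonic_determined:
  assumes c: "c \<in> altcochains (tens l p q) n m" and h: "harmonic c" and lq: "l + q + 1 = p"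
    and z: "base_form p (l + q) e c = 0"
  shows "c = 0"
proof (rule harmonic_top[OF c h, where e = e])
  note al = altern_eval[OF altern_eval[OF altcochainsD(1)[OF c]]]
  fix Xs :: "'a iso list" and K :: "'a list"
  show "c Xs K (replicate p e) = 0"
  proof (rule multilin_zero[OF altern_multilin[OF al] span_basic])
    fix Xs :: "'a iso list" assume X: "set Xs \<subseteq> basic"
    show "c Xs K (replicate p e) = 0"
    proof (rule ccontr)
      assume nz: "c Xs K (replicate p e) \<noteq> 0"
      note w = harmonic_weights[OF c h X nz]
      have 1: "count_list Xs (0, axis e 1) = 1" using w(2) lq by simp
      then have "(0, axis e 1) \<in> set Xs" by (metis count_list_0_iff zero_neq_one)
      then obtain us vs where s: "Xs = us @ (0, axis e 1) # vs" by (meson split_list)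
      have "(0, axis e 1) \<notin> set (us @ vs)" using 1 by (simp add: s count_list_0_iff)
      have "Y \<in> range (\<lambda>A. (A, 0))" if Y: "Y \<in> set (us @ vs)" for Y
      proof (rule ccontr)
        assume "Y \<notin> range (\<lambda>A. (A, 0))"
        moreover have "Y \<in> basic" "Y \<in> set Xs" using X Y by (auto simp: s)
        ultimately obtain i where i: "Y = (0, axis i 1)" by (auto simp: basic_def)
        then have "i = e" using w(4)[of i] \<open>Y \<in> set Xs\<close> by blast
        then show False using i Y \<open>(0, axis e 1) \<notin> set (us @ vs)\<close> by blast
      qed
      then have "\<exists>As. us @ vs = map (\<lambda>A. (A, 0)) As" unfolding ex_map_conv by auto
      then obtain As where A: "us @ vs = map (\<lambda>A. (A, 0)) As" ..
      have "c ((0, axis e 1) # us @ vs) K (replicate p e) = 0"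
        using fun_cong[OF z, of As] by (simp add: base_form_def A w(1))
      then show False using nz altern_move[OF al, of us "(0, axis e 1)" vs K "replicate p e"] by (simp add: s)
    qed
  qed
qed

lemma base_form_in:
  assumes c: "c \<in> altcochains (tens l p q) (Suc u) 0" and h: "harmonic c"
  shows "base_form p r e c \<in> gl_inv_forms u"
proof -
  note al = altern_eval[OF altern_eval[OF altcochainsD(1)[OF c]]]
  let ?\<iota> = "\<lambda>A :: real^'a^'a. (A, 0 :: real^'a)"
  have lin: "linear ?\<iota>" by (simp add: linear_lam_iff)
  have f: "altern (base_form p r e c)"
    unfolding base_form_def[abs_def] by (rule altern_map[OF altern_Cons[OF al] lin])
  have l: "base_form p r e c As = 0" if "length As \<noteq> u" for As
    using altcochainsD(4)[OF c, of "(0, axis e 1) # map ?\<iota> As"] that by (simp add: base_form_def)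
  have "base_form p r e c \<in> cochains UNIV UNIV u"
    using f l by (simp add: cochains_UNIV altcochains_def)
  moreover have "(\<Sum>i<u. base_form p r e c (xs[i := A ** xs ! i - xs ! i ** A])) = 0" if "length xs = u" for A xs
  proof -
    have "der (admap A) (\<lambda>Ys. c Ys (replicate r e) (replicate p e)) ((0, axis e 1) # map ?\<iota> xs) = 0"
      using fun_cong[OF fun_cong[OF harmonic_admap[OF h altcochainsD(2)[OF c], of A "(0, axis e 1) # map ?\<iota> xs"]],
          of "replicate r e" "replicate p e"]
      unfolding der_apply by simp
    then have "der (admap A) (\<lambda>Ys. c ((0, axis e 1) # Ys) (replicate r e) (replicate p e)) (map ?\<iota> xs) = 0"
      using multilin_hd(4)[OF altern_multilin[OF al]] by (simp add: admap_def flip: zero_prod_def)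
    then have "der (\<lambda>B. B ** A - A ** B) (base_form p r e c) xs = 0"
      by (subst (asm) der_map[where h = "\<lambda>B. B ** A - A ** B"]) (simp_all add: admap_def base_form_def[abs_def])
    moreover have "der (\<lambda>B. A ** B - B ** A) (base_form p r e c) xs
        = - der (\<lambda>B. B ** A - A ** B) (base_form p r e c) xs"
      using der_fun_diff[OF altern_multilin[OF f], of "\<lambda>B. A ** B" "\<lambda>B. B ** A" xs]
        der_fun_diff[OF altern_multilin[OF f], of "\<lambda>B. B ** A" "\<lambda>B. A ** B" xs] by simp
    ultimately show ?thesis using that by (simp add: der_closed)
  qed
  ultimately show ?thesis by (simp add: gl_inv_forms_def)
qed

text \<open>
  The model of the harmonic cochains: a covector \<open>w\<close> inserts itself as one more contravariant index,
  followed by the symmetric pairing \<^const>\<open>perm\<close> of contravariant with covariant indices.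
\<close>

definition pairing :: "nat \<Rightarrow> real^'m \<Rightarrow> 'm::finite tens" where
  "pairing r w K J = (if length K = r then \<Sum>i\<in>UNIV. w $ i * perm (i # K) J else 0)"

definition inv_cochain :: "nat \<Rightarrow> ((real^'m^'m) list \<Rightarrow> real) \<Rightarrow> 'm::finite iso list \<Rightarrow> 'm tens" where
  "inv_cochain r f = alts (\<lambda>X ys. f (map fst ys) *\<^sub>R pairing r (snd X))"

lemma linear_pairing: "linear (pairing r)"
  unfolding linear_lam_iff
  by (intro conjI allI ext) (simp_all add: pairing_def scaleR_fun_apply sum.distrib sum_distrib_left algebra_simps)

lemma pairing_mset:
  assumes "mset K = mset K'" "mset J = mset J'"
  shows "pairing r w K J = pairing r w K' J'"
  using assms mset_eq_length[OF assms(1)] by (simp add: pairing_def perm_def cong: if_cong)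

lemma pairing_in:
  assumes "l + q + 1 = p"
  shows "pairing (l + q) w \<in> tens l p q"
  unfolding tens_def
proof (intro CollectI conjI allI impI)
  fix K J :: "'a list" assume "\<not> (length K = l + q \<and> length J = p)"
  then show "pairing (l + q) w K J = 0"
    using assms by (auto simp: pairing_def perm_length intro!: sum.neutral)
next
  show "msym (\<lambda>L. pairing (l + q) w (L @ I) J)" "msym (\<lambda>I. pairing (l + q) w (L @ I) J)"
    "msym (pairing (l + q) w K)" for I J K L
    unfolding msym_def by (intro allI impI pairing_mset; simp)+
qed

lemma pairing_invariant: "iact (B, 0) (pairing r w) = pairing r (transpose B *v w)"
proof (intro ext)
  fix K J
  show "iact (B, 0) (pairing r w) K J = pairing r (transpose B *v w) K J"
  proof (cases "length K = r")
    case True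
    have 1: "tensor_rep B (\<lambda>K. pairing r w K J) K = (\<Sum>i\<in>UNIV. w $ i * tensor_rep B (\<lambda>K. perm (i # K) J) K)"
      using True by (simp add: pairing_def tensor_rep_sum tensor_rep_scale cong: tensor_rep_cong)
    have e: "pairing r w K = (\<lambda>J. \<Sum>i\<in>UNIV. w $ i * perm (i # K) J)"
      using True by (simp add: pairing_def fun_eq_iff)
    have "tensor_rep (transpose B) (pairing r w K) J = (\<Sum>i\<in>UNIV. w $ i * tensor_rep B (\<lambda>I. perm I J) (i # K))"
      unfolding e tensor_rep_sum tensor_rep_scale perm_adjoint ..
    also have "\<dots> = (\<Sum>i\<in>UNIV. \<Sum>j\<in>UNIV. w $ i * (B $ i $ j * perm (j # K) J)) + (\<Sum>i\<in>UNIV. w $ i * tensor_rep B (\<lambda>K. perm (i # K) J) K)"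
      by (simp add: tensor_rep_Cons distrib_left sum.distrib sum_distrib_left)
    also have "(\<Sum>i\<in>UNIV. \<Sum>j\<in>UNIV. w $ i * (B $ i $ j * perm (j # K) J)) = pairing r (transpose B *v w) K J"
      using True by (subst sum.swap) (simp add: pairing_def matrix_vector_mult_def transpose_def sum_distrib_left sum_distrib_right mult_ac
          del: transpose_matrix_vector)
    finally show ?thesis by (simp add: iact_def trep_def 1 del: transpose_matrix_vector)
  next
    case False
    have "tensor_rep B (\<lambda>K. pairing r w K J) K = 0"
      using tensor_rep_cong[of K "\<lambda>K. pairing r w K J" "\<lambda>_. 0" B] False by (simp add: pairing_def)
    moreover have "pairing r v K = (\<lambda>_. 0)" for v using False by (simp add: pairing_def fun_eq_iff)
    ultimately show ?thesis by (simp add: iact_def trep_def)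
  qed
qed

lemma alts_length_zero: "(\<And>y ys. Suc (length ys) = length xs \<Longrightarrow> F y ys = 0) \<Longrightarrow> alts F xs = 0"
  by (induction xs arbitrary: F) auto

lemma gl_inv_formsD:
  assumes "f \<in> gl_inv_forms u"
  shows "altern f" "length xs \<noteq> u \<Longrightarrow> f xs = 0" "der (\<lambda>A. A ** B - B ** A) f xs = 0"
proof -
  have f: "f \<in> altcochains UNIV u 0" using assms by (simp add: gl_inv_forms_def cochains_UNIV)
  show a: "altern f" by (rule altcochainsD(1)[OF f])
  show z: "f xs = 0" if "length xs \<noteq> u" for xs using altcochainsD(4)[OF f] that by simp
  have "der (\<lambda>A. B ** A - A ** B) f xs = 0"
    using assms z by (cases "length xs = u") (auto simp: der_closed gl_inv_forms_def)
  moreover have "der (\<lambda>A. A ** B - B ** A) f xs = - der (\<lambda>A. B ** A - A ** B) f xs"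
    using der_fun_diff[OF altern_multilin[OF a], of "\<lambda>A. A ** B" "\<lambda>A. B ** A" xs]
      der_fun_diff[OF altern_multilin[OF a], of "\<lambda>A. B ** A" "\<lambda>A. A ** B" xs] by simp
  ultimately show "der (\<lambda>A. A ** B - B ** A) f xs = 0" by simp
qed

lemma inv_cochain_in:
  fixes f :: "(real^'m^'m::finite) list \<Rightarrow> real"
  assumes f: "f \<in> gl_inv_forms u" and lq: "l + q + 1 = p"
  shows "inv_cochain (l + q) f \<in> altcochains (tens l p q) (Suc u) 0"
proof -
  note ff = gl_inv_formsD[OF f]
  have "altern (\<lambda>ys :: 'm iso list. f (map fst ys) *\<^sub>R v)" for v :: "'m tens"
    by (rule altern_compose[OF altern_map[OF ff(1)]]) (simp_all add: linear_lam_iff linear_fst scaleR_left_distrib)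
  then have "altern (inv_cochain (l + q) f)"
    unfolding inv_cochain_def
    by (rule altern_alts)
      (simp add: linear_lam_iff linear_add[OF linear_pairing] linear_scale[OF linear_pairing] scaleR_right_distrib mult.commute)
  moreover have "inv_cochain (l + q) f xs = 0" if "length xs + 0 \<noteq> Suc u" for xs
    unfolding inv_cochain_def using that by (intro alts_length_zero) (simp add: ff(2))
  moreover have "inv_cochain (l + q) f xs \<in> tens l p q" for xs
    unfolding inv_cochain_def
    by (intro alts_in subspace_tens Real_Vector_Spaces.subspace_scale[OF subspace_tens] pairing_in lq)
  ultimately show ?thesis by (simp add: altcochains_def)
qed

lemma harmonic_inv_cochain:
  fixes f :: "(real^'m^'m::finite) list \<Rightarrow> real"
  assumes f: "f \<in> gl_inv_forms u"
  shows "harmonic (inv_cochain r f)"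
proof -
  note ff = gl_inv_formsD[OF f] and ml = altern_multilin[OF gl_inv_formsD(1)[OF f]]
  let ?F = "\<lambda>(X :: 'm iso) ys. f (map fst ys) *\<^sub>R pairing r (snd X)"
  have sc: "linear (\<lambda>a :: real. a *\<^sub>R v)" for v :: "'m tens"
    by (simp add: linear_lam_iff scaleR_left_distrib)
  have p0: "pairing r 0 = (0 :: 'm tens)" by (rule linear_0[OF linear_pairing])
  have "der (dmap B) (\<lambda>ys. f (map fst ys)) ys = der (\<lambda>A. 0) f (map fst ys)" for B and ys :: "'m iso list"
    by (rule der_map[symmetric]) (simp add: dmap_def)
  then have d: "der (dmap B) (?F X) ys = 0" for B X ys
    using der_linear_push[OF sc[of "pairing r (snd X)"], of "dmap B" "\<lambda>ys. f (map fst ys)" ys]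
    by (simp add: der_fun_zero[OF ml])
  have "der (admap B) (\<lambda>ys. f (map fst ys)) ys = der (\<lambda>A. A ** B - B ** A) f (map fst ys)" for B and ys :: "'m iso list"
    by (rule der_map[symmetric]) (simp add: admap_def)
  then have a: "der (admap B) (?F X) ys = 0" for B X ys
    using der_linear_push[OF sc[of "pairing r (snd X)"], of "admap B" "\<lambda>ys. f (map fst ys)" ys]
    by (simp add: ff(3))
  have i: "iact (B, 0) (alts ?F xs) = alts (\<lambda>X ys. ?F (dmap B X) ys) xs" for B xs
  proof -
    have "(\<lambda>X ys. iact (B, 0) (?F X ys)) = (\<lambda>X ys. ?F (dmap B X) ys)"
      by (rule ext, rule ext) (simp only: linear_scale[OF linear_iact(1)] pairing_invariant dmap_def snd_conv)
    then show ?thesis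
      unfolding alts_linear_push[OF linear_iact(1)] by (rule arg_cong[where f = "\<lambda>F. alts F xs"])
  qed
  have t: "theta B (inv_cochain r f) xs = 0" for B xs
    unfolding theta_def inv_cochain_def i der_alts d by simp
  have s: "?F (admap B X) ys = 0" for B X ys by (simp add: admap_def p0)
  have "der (admap B) (inv_cochain r f) xs = 0" for B xs
    unfolding inv_cochain_def der_alts a s by simp
  moreover have "multilin (inv_cochain r f)"
    using f by (rule altcochainsD(2)[OF inv_cochain_in[of f u r 0 "Suc r"], simplified])
  moreover have "ibr (B, 0) = (\<lambda>Y. dmap B Y + admap B Y)" for B :: "real^'m^'m"
    by (rule ext) (simp add: ibr_split add.commute)
  ultimately have "lieop B (inv_cochain r f) xs = 0" for B xs
    using t[of B xs] by (simp add: lieop_def' theta_def der_fun_add)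
  then show ?thesis using t by (simp add: harmonic_def fun_eq_iff)
qed

text \<open>
  All entries but the first have covector part zero, so only the first extraction survives.
\<close>

lemma base_form_inv_cochain:
  fixes f :: "(real^'m^'m::finite) list \<Rightarrow> real"
  assumes f: "f \<in> gl_inv_forms u"
  shows "base_form (Suc r) r e (inv_cochain r f) = fact (Suc r) *\<^sub>R f"
proof
  fix As :: "(real^'m^'m) list"
  have p0: "pairing r 0 = (0 :: 'm tens)" by (rule linear_0[OF linear_pairing])
  have c: "count_list (replicate n e) b = (if b = e then n else 0)" for n b by (induction n) auto
  have "inv_cochain r f ((0, axis e 1) # map (\<lambda>A. (A, 0)) As) = f As *\<^sub>R pairing r (axis e 1)"
    by (simp add: inv_cochain_def alts_map p0 o_def)
  moreover have "pairing r (axis e 1) (replicate r e) (replicate (Suc r) e) = perm (replicate (Suc r) e) (replicate (Suc r) e)"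
    using sum_delta_mult(1)[of e "\<lambda>i. perm (i # replicate r e) (replicate (Suc r) e)"]
    by (simp add: pairing_def axis_nth)
  moreover have "perm (replicate n e) (replicate n e) = fact n" for n
  proof -
    have "(fact (count (mset (replicate n e)) i) :: real) = (if i = e then fact n else 1)" for i by simp
    then show ?thesis unfolding perm_def by (simp only: refl if_True) (simp add: prod.delta)
  qed
  ultimately show "base_form (Suc r) r e (inv_cochain r f) As = (fact (Suc r) *\<^sub>R f) As"
    by (simp add: base_form_def scaleR_fun_apply del: fact_Suc replicate_Suc)
qed

section \<open>Quotients and direct sums of real vector spaces\<close>

lemma field_real_scalars: "field real_scalars"
proof -
  have "cring real_scalars"
  proof (rule cringI)
    show "abelian_group real_scalars"
    proof (rule abelian_groupI)
      show "\<exists>y\<in>carrier real_scalars. y \<oplus>\<^bsub>real_scalars\<^esub> x = \<zero>\<^bsub>real_scalars\<^esub>" for x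
        by (rule bexI[of _ "- x"]) (auto simp: real_scalars_def)
    qed (auto simp: real_scalars_def)
    show "comm_monoid real_scalars" by (rule comm_monoidI) (auto simp: real_scalars_def)
  qed (auto simp: real_scalars_def algebra_simps)
  then show ?thesis
  proof (rule cring.cring_fieldI2)
    show "\<exists>b\<in>carrier real_scalars. a \<otimes>\<^bsub>real_scalars\<^esub> b = \<one>\<^bsub>real_scalars\<^esub>"
      if "a \<noteq> \<zero>\<^bsub>real_scalars\<^esub>" for a
      using that by (intro bexI[of _ "inverse a"]) (auto simp: real_scalars_def)
  qed (simp add: real_scalars_def)
qed

lemma vectorspace_iff: "vectorspace real_scalars V \<longleftrightarrow> module real_scalars V"
  using field_real_scalars by (simp add: vectorspace_def)

lemma moduleI_real:
  assumes "\<And>x y. x \<in> carrier V \<Longrightarrow> y \<in> carrier V \<Longrightarrow> x \<oplus>\<^bsub>V\<^esub> y \<in> carrier V"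
    and "\<zero>\<^bsub>V\<^esub> \<in> carrier V"
    and "\<And>x y z. x \<in> carrier V \<Longrightarrow> y \<in> carrier V \<Longrightarrow> z \<in> carrier V \<Longrightarrow>
      (x \<oplus>\<^bsub>V\<^esub> y) \<oplus>\<^bsub>V\<^esub> z = x \<oplus>\<^bsub>V\<^esub> (y \<oplus>\<^bsub>V\<^esub> z)"
    and "\<And>x y. x \<in> carrier V \<Longrightarrow> y \<in> carrier V \<Longrightarrow> x \<oplus>\<^bsub>V\<^esub> y = y \<oplus>\<^bsub>V\<^esub> x"
    and "\<And>x. x \<in> carrier V \<Longrightarrow> \<zero>\<^bsub>V\<^esub> \<oplus>\<^bsub>V\<^esub> x = x"
    and "\<And>x. x \<in> carrier V \<Longrightarrow> (-1) \<odot>\<^bsub>V\<^esub> x \<oplus>\<^bsub>V\<^esub> x = \<zero>\<^bsub>V\<^esub>"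
    and "\<And>r x. x \<in> carrier V \<Longrightarrow> r \<odot>\<^bsub>V\<^esub> x \<in> carrier V"
    and "\<And>r s x. x \<in> carrier V \<Longrightarrow> (r + s) \<odot>\<^bsub>V\<^esub> x = r \<odot>\<^bsub>V\<^esub> x \<oplus>\<^bsub>V\<^esub> s \<odot>\<^bsub>V\<^esub> x"
    and "\<And>r x y. x \<in> carrier V \<Longrightarrow> y \<in> carrier V \<Longrightarrow> r \<odot>\<^bsub>V\<^esub> (x \<oplus>\<^bsub>V\<^esub> y) = r \<odot>\<^bsub>V\<^esub> x \<oplus>\<^bsub>V\<^esub> r \<odot>\<^bsub>V\<^esub> y"
    and "\<And>r s x. x \<in> carrier V \<Longrightarrow> (r * s) \<odot>\<^bsub>V\<^esub> x = r \<odot>\<^bsub>V\<^esub> (s \<odot>\<^bsub>V\<^esub> x)"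
    and "\<And>x. x \<in> carrier V \<Longrightarrow> 1 \<odot>\<^bsub>V\<^esub> x = x"
  shows "module real_scalars V"
proof (rule moduleI)
  show "cring real_scalars" using field_real_scalars by (rule fieldE)
  show "abelian_group V"
  proof (rule abelian_groupI)
    show "\<exists>y\<in>carrier V. y \<oplus>\<^bsub>V\<^esub> x = \<zero>\<^bsub>V\<^esub>" if "x \<in> carrier V" for x
      using assms(6,7)[OF that] by blast
  qed (use assms(1-5) in auto)
qed (use assms(7-11) in \<open>simp_all add: real_scalars_def\<close>)

lemma module_subspace: "real_subspace S \<Longrightarrow> module real_scalars (subspace_module S)"
  by (rule moduleI_real)
    (auto simp: subspace_module_def subspace_0 subspace_add subspace_scale algebra_simps)

lemma coset_eq_iff:
  fixes B :: "'v::real_vector set"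
  assumes "real_subspace B"
  shows "x +o B = y +o B \<longleftrightarrow> x - y \<in> B"
proof
  assume "x +o B = y +o B"
  moreover have "x \<in> x +o B" using subspace_0[OF assms] by (force simp: elt_set_plus_def)
  ultimately obtain b where "b \<in> B" "x = y + b" by (auto simp: elt_set_plus_def)
  then show "x - y \<in> B" by simp
next
  have *: "x +o B \<subseteq> y +o B" if "x - y \<in> B" for x y
  proof
    fix v assume "v \<in> x +o B"
    then obtain b where "b \<in> B" "v = x + b" by (auto simp: elt_set_plus_def)
    then have "v = y + ((x - y) + b)" "(x - y) + b \<in> B" using subspace_add[OF assms that] by auto
    then show "v \<in> y +o B" unfolding elt_set_plus_def by blast
  qed
  assume a: "x - y \<in> B"
  moreover have "y - x \<in> B" using subspace_neg[OF assms a] by simp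
  ultimately show "x +o B = y +o B" using *[of x y] *[of y x] by blast
qed

lemma coset_add:
  fixes B :: "'v::real_vector set"
  assumes "real_subspace B"
  shows "(x +o B) + (y +o B) = (x + y) +o B"
proof -
  have "B + B = B"
    using subspace_add[OF assms] subspace_0[OF assms] by (force simp: set_plus_def)
  then show ?thesis by (simp add: set_plus_rearrange)
qed

lemma coset_scale:
  fixes B :: "'v::real_vector set"
  assumes "real_subspace B"
  shows "((*\<^sub>R) r) ` (x +o B) + B = (r *\<^sub>R x) +o B"
proof (intro equalityI subsetI)
  fix v assume "v \<in> ((*\<^sub>R) r) ` (x +o B) + B"
  then obtain b b' where "b \<in> B" "b' \<in> B" "v = r *\<^sub>R (x + b) + b'"
    by (auto simp: elt_set_plus_def set_plus_def)
  then have "v = r *\<^sub>R x + (r *\<^sub>R b + b')" "r *\<^sub>R b + b' \<in> B"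
    by (auto simp: algebra_simps intro: subspace_add subspace_scale assms)
  then show "v \<in> (r *\<^sub>R x) +o B" by (auto simp: elt_set_plus_def)
next
  fix v assume "v \<in> (r *\<^sub>R x) +o B"
  then obtain b where b: "b \<in> B" "v = r *\<^sub>R (x + 0) + b" by (auto simp: elt_set_plus_def)
  moreover have "x + 0 \<in> x +o B" using subspace_0[OF assms] by (auto simp: elt_set_plus_def)
  ultimately show "v \<in> ((*\<^sub>R) r) ` (x +o B) + B" by (auto simp: set_plus_def)
qed

lemma quotient_module_simps:
  assumes "real_subspace B"
  shows "carrier (quotient_module Z B) = (\<lambda>z. z +o B) ` Z"
    "\<zero>\<^bsub>quotient_module Z B\<^esub> = 0 +o B"
    "(x +o B) \<oplus>\<^bsub>quotient_module Z B\<^esub> (y +o B) = (x + y) +o B"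
    "r \<odot>\<^bsub>quotient_module Z B\<^esub> (x +o B) = (r *\<^sub>R x) +o B"
  using coset_add[OF assms] coset_scale[OF assms]
  by (simp_all add: quotient_module_def elt_set_plus_def)

lemma module_quotient:
  assumes "real_subspace Z" "real_subspace B"
  shows "module real_scalars (quotient_module Z B)"
  by (rule moduleI_real)
    (auto simp: quotient_module_simps(1,3,4)[OF assms(2)] quotient_module_simps(2)[OF assms(2), of Z]
      coset_eq_iff[OF assms(2)] algebra_simps subspace_0[OF assms(1)] subspace_0[OF assms(2)]
      simp del: set_zero_plus intro!: imageI subspace_add[OF assms(1)] subspace_scale[OF assms(1)])

lemma module_direct_sum:
  assumes M: "\<And>u. module real_scalars (M u)"
  shows "module real_scalars (direct_sum_module M)"
proof -
  have R: "carrier real_scalars = UNIV" "\<one>\<^bsub>real_scalars\<^esub> = 1" "add real_scalars = (+)" "mult real_scalars = (*)"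
    "\<zero>\<^bsub>real_scalars\<^esub> = 0"
    by (simp_all add: real_scalars_def)
  note a = abelian_groupE[OF module.axioms(2)[OF M]]
  note m = module.smult_closed[OF M] module.smult_l_distr[OF M] module.smult_r_distr[OF M]
    module.smult_assoc1[OF M] module.smult_r_null[OF M]
  note m = m[unfolded R, OF UNIV_I, simplified]
  note m1 = module.smult_one[OF M, unfolded R] module.smult_l_null[OF M, unfolded R]
  have inv: "(-1) \<odot>\<^bsub>M u\<^esub> x \<oplus>\<^bsub>M u\<^esub> x = \<zero>\<^bsub>M u\<^esub>" if "x \<in> carrier (M u)" for u x
    using m(2)[OF that, of "-1" 1] m1[OF that] by simp
  have add: "finite {u. h u \<oplus>\<^bsub>M u\<^esub> h' u \<noteq> \<zero>\<^bsub>M u\<^esub>}"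
    if "finite {u. h u \<noteq> \<zero>\<^bsub>M u\<^esub>}" "finite {u. h' u \<noteq> \<zero>\<^bsub>M u\<^esub>}" for h h'
    by (rule finite_subset[OF _ finite_UnI[OF that]]) (use a(2,5) in auto)
  have sc: "finite {u. r \<odot>\<^bsub>M u\<^esub> h u \<noteq> \<zero>\<^bsub>M u\<^esub>}" if "finite {u. h u \<noteq> \<zero>\<^bsub>M u\<^esub>}" for h r
    by (rule finite_subset[OF _ that]) (use m(5) in auto)
  show ?thesis
    by (rule moduleI_real)
      (auto simp: direct_sum_module_def add sc fun_eq_iff a(1-3,5) m m1 inv intro: a(4))
qed

text \<open>An isomorphism of direct sums may shift the degree.\<close>

lemma vs_iso_direct_sum:
  assumes M: "\<And>u. module real_scalars (M u)" and N: "\<And>u. module real_scalars (N u)"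
    and \<phi>: "\<And>u. \<phi> u \<in> module_hom real_scalars (M (s u)) (N u)"
    and b: "\<And>u. bij_betw (\<phi> u) (carrier (M (s u))) (carrier (N u))"
    and s: "inj s" and z: "\<And>v. v \<notin> range s \<Longrightarrow> carrier (M v) = {\<zero>\<^bsub>M v\<^esub>}"
  shows "vs_iso (direct_sum_module M) (direct_sum_module N) (\<lambda>h u. \<phi> u (h (s u)))"
proof -
  have R: "carrier real_scalars = UNIV" by (simp add: real_scalars_def)
  have zM: "\<zero>\<^bsub>M u\<^esub> \<in> carrier (M u)" for u by (rule abelian_groupE(2)[OF module.axioms(2)[OF M]])
  have zN: "\<zero>\<^bsub>N u\<^esub> \<in> carrier (N u)" for u by (rule abelian_groupE(2)[OF module.axioms(2)[OF N]])
  have cl: "\<phi> u x \<in> carrier (N u)" if "x \<in> carrier (M (s u))" for u x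
    using \<phi>[of u] that by (auto simp: module_hom_def)
  have "\<phi> u (0 \<odot>\<^bsub>M (s u)\<^esub> \<zero>\<^bsub>M (s u)\<^esub>) = 0 \<odot>\<^bsub>N u\<^esub> \<phi> u \<zero>\<^bsub>M (s u)\<^esub>" for u
    using \<phi>[of u] zM by (auto simp: module_hom_def R)
  moreover have "0 \<odot>\<^bsub>M (s u)\<^esub> \<zero>\<^bsub>M (s u)\<^esub> = \<zero>\<^bsub>M (s u)\<^esub>"
    "0 \<odot>\<^bsub>N u\<^esub> \<phi> u \<zero>\<^bsub>M (s u)\<^esub> = \<zero>\<^bsub>N u\<^esub>" for u
    using module.smult_r_null[OF M, of 0 "s u"] module.smult_l_null[OF N cl[OF zM], of u]
    by (simp_all add: real_scalars_def)
  ultimately have p0: "\<phi> u \<zero>\<^bsub>M (s u)\<^esub> = \<zero>\<^bsub>N u\<^esub>" for u by metis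
  have nz: "\<phi> u x = \<zero>\<^bsub>N u\<^esub> \<longleftrightarrow> x = \<zero>\<^bsub>M (s u)\<^esub>" if "x \<in> carrier (M (s u))" for u x
    using bij_betw_imp_inj_on[OF b] that zM p0 by (metis inj_onD)
  define \<Phi> where "\<Phi> = (\<lambda>h u. \<phi> u (h (s u)))"
  have fin: "finite {u. \<phi> u (h (s u)) \<noteq> \<zero>\<^bsub>N u\<^esub>}" if "finite {u. h u \<noteq> \<zero>\<^bsub>M u\<^esub>}" "\<And>u. h u \<in> carrier (M u)" for h
  proof -
    have "{u. \<phi> u (h (s u)) \<noteq> \<zero>\<^bsub>N u\<^esub>} = s -` {u. h u \<noteq> \<zero>\<^bsub>M u\<^esub>}" using nz that(2) by auto
    then show ?thesis using finite_vimageI[OF that(1) s] by simp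
  qed
  have hom: "\<Phi> \<in> module_hom real_scalars (direct_sum_module M) (direct_sum_module N)"
    using \<phi> cl fin by (auto simp: module_hom_def direct_sum_module_def \<Phi>_def fun_eq_iff)
  have "bij_betw \<Phi> (carrier (direct_sum_module M)) (carrier (direct_sum_module N))"
  proof (rule bij_betw_imageI)
    show "inj_on \<Phi> (carrier (direct_sum_module M))"
    proof (rule inj_onI)
      fix h h' assume h: "h \<in> carrier (direct_sum_module M)" "h' \<in> carrier (direct_sum_module M)" and e: "\<Phi> h = \<Phi> h'"
      have c: "h v \<in> carrier (M v)" "h' v \<in> carrier (M v)" for v using h by (auto simp: direct_sum_module_def)
      have "h v = h' v" for v
      proof (cases "v \<in> range s")
        case True
        then obtain u where v: "v = s u" by auto
        have "\<phi> u (h (s u)) = \<phi> u (h' (s u))" using fun_cong[OF e, of u] by (simp add: \<Phi>_def)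
        then show ?thesis using inj_onD[OF bij_betw_imp_inj_on[OF b]] c v by blast
      next
        case False
        then show ?thesis using c[of v] unfolding z[OF False] by simp
      qed
      then show "h = h'" by auto
    qed
    show "\<Phi> ` carrier (direct_sum_module M) = carrier (direct_sum_module N)"
    proof (intro equalityI subsetI)
      show "k \<in> carrier (direct_sum_module N)" if "k \<in> \<Phi> ` carrier (direct_sum_module M)" for k
        using that hom by (auto simp: module_hom_def)
      fix k assume k: "k \<in> carrier (direct_sum_module N)"
      then have kc: "k u \<in> carrier (N u)" and kf: "finite {u. k u \<noteq> \<zero>\<^bsub>N u\<^esub>}" for u
        by (auto simp: direct_sum_module_def)
      have "\<exists>x\<in>carrier (M (s u)). \<phi> u x = k u" for u
        using bij_betw_imp_surj_on[OF b, of u] kc[of u] by (metis imageE)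
      then obtain g where g: "g u \<in> carrier (M (s u))" "\<phi> u (g u) = k u" for u by metis
      define h where "h v = (if v \<in> range s then g (inv_into UNIV s v) else \<zero>\<^bsub>M v\<^esub>)" for v
      have hs: "h (s u) = g u" for u using s by (simp add: h_def)
      have "h v \<in> carrier (M v)" for v
      proof (cases "v \<in> range s")
        case True
        then show ?thesis using g(1) hs by auto
      qed (simp add: h_def zM)
      moreover have "{v. h v \<noteq> \<zero>\<^bsub>M v\<^esub>} \<subseteq> s ` {u. k u \<noteq> \<zero>\<^bsub>N u\<^esub>}"
      proof
        fix v assume "v \<in> {v. h v \<noteq> \<zero>\<^bsub>M v\<^esub>}"
        then have v: "h v \<noteq> \<zero>\<^bsub>M v\<^esub>" by simp
        from v have "v \<in> range s" by (rule contrapos_np) (simp add: h_def)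
        then obtain u where u: "v = s u" by auto
        then have "k u \<noteq> \<zero>\<^bsub>N u\<^esub>" using v nz[OF g(1), of u] g(2) hs by auto
        then show "v \<in> s ` {u. k u \<noteq> \<zero>\<^bsub>N u\<^esub>}" using u by auto
      qed
      then have "finite {v. h v \<noteq> \<zero>\<^bsub>M v\<^esub>}" using finite_subset finite_imageI[OF kf] by blast
      ultimately have "h \<in> carrier (direct_sum_module M)" by (simp add: direct_sum_module_def)
      moreover have "\<Phi> h = k" by (rule ext) (simp add: \<Phi>_def hs g(2))
      ultimately show "k \<in> \<Phi> ` carrier (direct_sum_module M)" by blast
    qed
  qed
  then show ?thesis
    using hom module_direct_sum[OF M] module_direct_sum[OF N]
    by (auto simp: vs_iso_def \<Phi>_def linear_map_def vectorspace_iff mod_hom_def mod_hom_axioms_def)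
qed

lemma zero_module_direct_sum:
  assumes Z: "\<And>u. real_subspace (Z u)" and B: "\<And>u. real_subspace (B u)" and ZB: "\<And>u. Z u \<subseteq> B u"
  shows "zero_module (direct_sum_module (\<lambda>u. quotient_module (Z u) (B u)))"
proof -
  have "carrier (quotient_module (Z u) (B u)) = {\<zero>\<^bsub>quotient_module (Z u) (B u)\<^esub>}" for u
    unfolding quotient_module_simps[OF B]
    using coset_eq_iff[OF B, of _ u 0] ZB[of u] subspace_0[OF Z, of u] by auto
  then have "carrier (direct_sum_module (\<lambda>u. quotient_module (Z u) (B u)))
      = {\<zero>\<^bsub>direct_sum_module (\<lambda>u. quotient_module (Z u) (B u))\<^esub>}"
    by (auto simp: direct_sum_module_def fun_eq_iff)
  then show ?thesis
    using module_direct_sum[OF module_quotient[OF Z B]] by (simp add: zero_module_def vectorspace_iff)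
qed

lemma vs_iso_inclusion:
  assumes s: "\<And>u. real_subspace (Z u)" "\<And>u. real_subspace (B u)" "\<And>u. real_subspace (Z' u)" "\<And>u. real_subspace (B' u)"
    and sub: "\<And>u. Z u \<subseteq> Z' u" "\<And>u. B u \<subseteq> B' u"
    and inj: "\<And>u z. z \<in> Z u \<Longrightarrow> z \<in> B' u \<Longrightarrow> z \<in> B u"
    and sur: "\<And>u z. z \<in> Z' u \<Longrightarrow> \<exists>y\<in>Z u. z - y \<in> B' u"
  shows "vs_iso (direct_sum_module (\<lambda>u. quotient_module (Z u) (B u)))
    (direct_sum_module (\<lambda>u. quotient_module (Z' u) (B' u))) (\<lambda>h u. h u + B' u)"
proof -
  have e: "(x +o B u) + B' u = x +o B' u" for x u
  proof -
    have "B u + B' u = B' u"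
    proof
      show "B u + B' u \<subseteq> B' u" using sub(2)[of u] subspace_add[OF s(4), of _ u] by (auto simp: set_plus_def)
      show "B' u \<subseteq> B u + B' u" using set_plus_intro[OF subspace_0[OF s(2)], of _ "B' u" u] by force
    qed
    then show ?thesis by (simp add: set_plus_rearrange3)
  qed
  show ?thesis
  proof (rule vs_iso_direct_sum[where s = "\<lambda>u. u" and \<phi> = "\<lambda>u A. A + B' u"])
    show "(\<lambda>A. A + B' u) \<in> module_hom real_scalars (quotient_module (Z u) (B u)) (quotient_module (Z' u) (B' u))" for u
      using subsetD[OF sub(1)[of u]] by (auto simp: module_hom_def quotient_module_simps(1,3,4)[OF s(2)] quotient_module_simps(1,3,4)[OF s(4)] e)
    show "bij_betw (\<lambda>A. A + B' u) (carrier (quotient_module (Z u) (B u))) (carrier (quotient_module (Z' u) (B' u)))" for u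
    proof (rule bij_betw_imageI)
      show "inj_on (\<lambda>A. A + B' u) (carrier (quotient_module (Z u) (B u)))"
        by (auto simp: inj_on_def quotient_module_simps(1)[OF s(2)] e coset_eq_iff[OF s(2)] coset_eq_iff[OF s(4)]
            intro!: inj subspace_diff[OF s(1)])
      have "\<exists>y\<in>Z u. z +o B' u = y +o B' u" if "z \<in> Z' u" for z
        using sur[OF that] by (simp add: coset_eq_iff[OF s(4)])
      then show "(\<lambda>A. A + B' u) ` carrier (quotient_module (Z u) (B u)) = carrier (quotient_module (Z' u) (B' u))"
        using subsetD[OF sub(1)[of u]] by (auto simp: quotient_module_simps(1)[OF s(2)] quotient_module_simps(1)[OF s(4)] e image_iff)
    qed
  qed (auto intro: module_quotient s)
qed

text \<open>
  A linear relation between cocycles of degree \<open>u + 1\<close> and a space \<open>G u\<close> that is total, onto, and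
  relates exactly the coboundaries to \<open>0\<close> is the graph of an isomorphism from cohomology.
\<close>

lemma vs_isomorphic_relation:
  fixes R :: "nat \<Rightarrow> 'v::real_vector \<Rightarrow> 'w::real_vector \<Rightarrow> bool"
  assumes s: "\<And>u. real_subspace (Z u)" "\<And>u. real_subspace (B u)" "\<And>u. real_subspace (G u)"
    and Z0: "Z 0 \<subseteq> B 0"
    and add: "\<And>u z f z' f'. R u z f \<Longrightarrow> R u z' f' \<Longrightarrow> R u (z + z') (f + f')"
    and scale: "\<And>u z f r. R u z f \<Longrightarrow> R u (r *\<^sub>R z) (r *\<^sub>R f)"
    and total: "\<And>u z. z \<in> Z (Suc u) \<Longrightarrow> \<exists>f\<in>G u. R u z f"
    and onto: "\<And>u f. f \<in> G u \<Longrightarrow> \<exists>z\<in>Z (Suc u). R u z f"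
    and ker: "\<And>u z f. z \<in> Z (Suc u) \<Longrightarrow> f \<in> G u \<Longrightarrow> R u z f \<Longrightarrow> z \<in> B (Suc u) \<longleftrightarrow> f = 0"
  shows "vs_isomorphic (direct_sum_module (\<lambda>u. quotient_module (Z u) (B u))) (direct_sum_module (\<lambda>u. subspace_module (G u)))"
proof -
  define \<phi> where "\<phi> u A = (SOME f. \<exists>z\<in>Z (Suc u). A = z +o B (Suc u) \<and> f \<in> G u \<and> R u z f)" for u A
  have eq: "z - z' \<in> B (Suc u) \<longleftrightarrow> f = f'" if "z \<in> Z (Suc u)" "z' \<in> Z (Suc u)" "f \<in> G u" "f' \<in> G u" "R u z f" "R u z' f'" for u z z' f f'
  proof -
    have "R u (z + (-1) *\<^sub>R z') (f + (-1) *\<^sub>R f')" by (intro add scale that)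
    then have "R u (z - z') (f - f')" by simp
    then show ?thesis using ker[OF subspace_diff[OF s(1) that(1,2)] subspace_diff[OF s(3) that(3,4)]] by simp
  qed
  have phi: "\<phi> u (z +o B (Suc u)) = f" if "z \<in> Z (Suc u)" "f \<in> G u" "R u z f" for u z f
  proof -
    have "\<exists>f. \<exists>z'\<in>Z (Suc u). z +o B (Suc u) = z' +o B (Suc u) \<and> f \<in> G u \<and> R u z' f" using that by blast
    from someI_ex[OF this] obtain z' where
      "z' \<in> Z (Suc u)" "z +o B (Suc u) = z' +o B (Suc u)" "\<phi> u (z +o B (Suc u)) \<in> G u" "R u z' (\<phi> u (z +o B (Suc u)))"
      unfolding \<phi>_def by blast
    then show ?thesis using eq that by (metis coset_eq_iff[OF s(2)])
  qed
  have G: "carrier (subspace_module (G u)) = G u" "f \<oplus>\<^bsub>subspace_module (G u)\<^esub> f' = f + f'"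
    "r \<odot>\<^bsub>subspace_module (G u)\<^esub> f = r *\<^sub>R f" for u f f' r
    by (simp_all add: subspace_module_def)
  have "vs_iso (direct_sum_module (\<lambda>u. quotient_module (Z u) (B u))) (direct_sum_module (\<lambda>u. subspace_module (G u)))
    (\<lambda>h u. \<phi> u (h (Suc u)))"
  proof (rule vs_iso_direct_sum)
    fix u
    show "\<phi> u \<in> module_hom real_scalars (quotient_module (Z (Suc u)) (B (Suc u))) (subspace_module (G u))"
    proof -
      have 1: "\<phi> u (z +o B (Suc u)) \<in> G u" if "z \<in> Z (Suc u)" for z using total[OF that] phi[OF that] by force
      have 2: "\<phi> u ((z + z') +o B (Suc u)) = \<phi> u (z +o B (Suc u)) + \<phi> u (z' +o B (Suc u))"
        if z: "z \<in> Z (Suc u)" "z' \<in> Z (Suc u)" for z z'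
      proof -
        obtain f f' where f: "f \<in> G u" "f' \<in> G u" "R u z f" "R u z' f'" using total z by blast
        show ?thesis using phi[OF subspace_add[OF s(1) z] subspace_add[OF s(3) f(1,2)] add[OF f(3,4)]]
            phi[OF z(1) f(1,3)] phi[OF z(2) f(2,4)] by simp
      qed
      have 3: "\<phi> u ((r *\<^sub>R z) +o B (Suc u)) = r *\<^sub>R \<phi> u (z +o B (Suc u))" if z: "z \<in> Z (Suc u)" for z r
      proof -
        obtain f where f: "f \<in> G u" "R u z f" using total z by blast
        show ?thesis using phi[OF subspace_scale[OF s(1) z] subspace_scale[OF s(3) f(1)] scale[OF f(2)]]
            phi[OF z f] by simp
      qed
      show ?thesis using 1 2 3 by (auto simp: module_hom_def quotient_module_simps(1,3,4)[OF s(2)] G)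
    qed
    show "bij_betw (\<phi> u) (carrier (quotient_module (Z (Suc u)) (B (Suc u)))) (carrier (subspace_module (G u)))"
    proof (rule bij_betw_imageI)
      show "inj_on (\<phi> u) (carrier (quotient_module (Z (Suc u)) (B (Suc u))))"
      proof (rule inj_onI)
        fix A A' assume "A \<in> carrier (quotient_module (Z (Suc u)) (B (Suc u)))" "A' \<in> carrier (quotient_module (Z (Suc u)) (B (Suc u)))"
          and e: "\<phi> u A = \<phi> u A'"
        then obtain z z' where z: "z \<in> Z (Suc u)" "z' \<in> Z (Suc u)" "A = z +o B (Suc u)" "A' = z' +o B (Suc u)"
          by (auto simp: quotient_module_simps(1)[OF s(2)])
        obtain f f' where f: "f \<in> G u" "f' \<in> G u" "R u z f" "R u z' f'" using total z by blast
        show "A = A'" unfolding z coset_eq_iff[OF s(2)]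
          using eq[OF z(1,2) f] e phi[OF z(1) f(1,3)] phi[OF z(2) f(2,4)] by (simp add: z)
      qed
      show "\<phi> u ` carrier (quotient_module (Z (Suc u)) (B (Suc u))) = carrier (subspace_module (G u))"
        unfolding quotient_module_simps(1)[OF s(2)] G
      proof (intro equalityI subsetI)
        fix f assume "f \<in> \<phi> u ` (\<lambda>z. z +o B (Suc u)) ` Z (Suc u)"
        then obtain z where z: "z \<in> Z (Suc u)" "f = \<phi> u (z +o B (Suc u))" by blast
        then show "f \<in> G u" using total[OF z(1)] phi[OF z(1)] by force
      next
        fix f assume f: "f \<in> G u"
        then obtain z where z: "z \<in> Z (Suc u)" "R u z f" using onto by blast
        then show "f \<in> \<phi> u ` (\<lambda>z. z +o B (Suc u)) ` Z (Suc u)" using phi[OF z(1) f z(2)] by blast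
      qed
    qed
  next
    show "carrier (quotient_module (Z v) (B v)) = {\<zero>\<^bsub>quotient_module (Z v) (B v)\<^esub>}" if "v \<notin> range Suc" for v
    proof -
      have v: "v = 0" using that by (cases v) auto
      show ?thesis unfolding quotient_module_simps[OF s(2)]
        using coset_eq_iff[OF s(2), of _ 0 0] Z0 subspace_0[OF s(1), of 0] by (auto simp: v)
    qed
  qed (auto intro: module_quotient module_subspace s)
  then show ?thesis by (auto simp: vs_isomorphic_def)
qed

section \<open>Descent along the order filtration\<close>

abbreviation dS :: "real \<Rightarrow> nat \<Rightarrow> ('m::finite sl list \<Rightarrow> 'm field \<Rightarrow> 'm field) \<Rightarrow> 'm sl list \<Rightarrow> 'm field \<Rightarrow> 'm field" where
  "dS \<delta> p \<equiv> ced slbr (\<lambda>g. op_action \<delta> p (fld g))"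

lemma dS_linear:
  assumes "c \<in> altcochains (diff_ops k p q) n m" "e \<in> altcochains (diff_ops k p q) n m"
  shows "dS \<delta> p (c + e) = dS \<delta> p c + dS \<delta> p e" "dS \<delta> p (c - e) = dS \<delta> p c - dS \<delta> p e"
    "dS \<delta> p (r *\<^sub>R c) = r *\<^sub>R dS \<delta> p c"
proof -
  note M = lie_module_diff_ops[of \<delta> p k q]
  show "dS \<delta> p (c + e) = dS \<delta> p c + dS \<delta> p e"
    by (rule ext)
      (simp only: plus_fun_def[of c e] lie_module.d_add[OF M altcochainsD(3)[OF assms(1)] altcochainsD(3)[OF assms(2)]] plus_fun_apply)
  show "dS \<delta> p (c - e) = dS \<delta> p c - dS \<delta> p e"
    by (rule ext)
      (simp only: fun_diff_def[of c e] lie_module.d_diff[OF M altcochainsD(3)[OF assms(1)] altcochainsD(3)[OF assms(2)]] minus_apply)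
  show "dS \<delta> p (r *\<^sub>R c) = r *\<^sub>R dS \<delta> p c"
    by (rule ext)
      (simp only: scaleR_fun_def[of r c] lie_module.d_scale[OF M altcochainsD(3)[OF assms(1)]] scaleR_fun_apply)
qed

lemma smap_algebra:
  "smap l p q (c + e) = smap l p q c + smap l p q e"
  "smap l p q (c - e) = smap l p q c - smap l p q e"
  "smap l p q (r *\<^sub>R c) = r *\<^sub>R smap l p q c"
  using smap_linear[of l p q]
  by (simp_all only: plus_fun_def[of c e] fun_diff_def[of c e] scaleR_fun_def[of r c]
      plus_fun_def[of "smap l p q c"] fun_diff_def[of "smap l p q c"] scaleR_fun_def[of r "smap l p q c"])

lemma dS_in: "c \<in> altcochains (diff_ops k p q) n (Suc m) \<Longrightarrow> dS \<delta> p c \<in> altcochains (diff_ops k p q) n m"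
  by (rule lie_module.d_altcochains[OF lie_module_diff_ops])

lemma dS_dS:
  assumes "c \<in> altcochains (diff_ops k p q) n m"
  shows "dS \<delta> p (dS \<delta> p c) = 0"
  by (rule ext) (simp only: lie_module.d_d[OF lie_module_diff_ops altcochainsD(2,3)[OF assms]] zero_fun_apply)

lemma subspace_diff_cochains: "real_subspace (altcochains (diff_ops k p q) n m)"
  by (intro subspace_altcochains subspace_diff_ops)

lemma dS_zero: "dS \<delta> p 0 = 0"
  using dS_linear(3)[OF subspace_0[OF subspace_diff_cochains[of 0 p 0 0 0]]
      subspace_0[OF subspace_diff_cochains[of 0 p 0 0 0]], of \<delta> 0] by simp

lemma subspace_dops: "real_subspace (dops l p q)"
  by (cases l) (simp_all add: dops_def subspace_diff_ops)

lemma dops_mono: "a \<le> b \<Longrightarrow> dops a p q \<subseteq> dops b p q"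
  by (induction rule: dec_induct) (use dops_subset in force)+

text \<open>
  The cohomology of the operators of order \<open>l\<close> modulo those of lower order is represented by harmonic
  cochains: the symbol differs from its value at the origin, and this from its harmonic part, by
  coboundaries, which lift because the symbol map is onto.
\<close>

lemma relative_cocycle:
  assumes c: "c \<in> altcochains (diff_ops l p q) n 0" and dc: "dS \<delta> p c \<in> altcochains (dops l p q) (Suc n) 0"
  shows "\<exists>h\<in>altcochains (tens l p q) n 0. \<exists>b\<in>altcochains (diff_ops l p q) n (Suc 0).
    harmonic h \<and> smap l p q c = const_cochain h + smap l p q (dS \<delta> p b)"
proof -
  have c1: "c \<in> altcochains (diff_ops l p q) (Suc n) (Suc 0)" using c by (simp add: altcochains_Suc_Suc)
  have s0: "smap l p q (dS \<delta> p c) = 0" using smap_kernel[OF dS_in[OF c1]] dc by blast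
  note z = smap_in[OF c]
  have dz: "ced hbr tact (smap l p q c) = 0" using smap_ced[OF c] s0 by simp
  obtain b0 where b0: "b0 \<in> altcochains (tens_fields l p q) n (Suc 0)"
    "smap l p q c = (\<lambda>Xs. ced hbr tact b0 Xs + const_cochain (eval_cochain (smap l p q c)) Xs)"
    using eval_homotopy[OF z dz] by blast
  define y where "y = eval_cochain (smap l p q c)"
  have yin: "y \<in> altcochains (tens l p q) n 0" unfolding y_def by (rule eval_cochain_in[OF z])
  have "dI y = eval_cochain 0" by (simp only: y_def eval_cochain_ced[symmetric] dz)
  then have "dI y = 0" by (simp add: eval_cochain_def[abs_def] flip: zero_fun_def)
  then obtain h b' where h: "h \<in> altcochains (tens l p q) n 0" "harmonic h" "y = h + dI b'"
    and b': "b' \<in> altcochains (tens l p q) n (Suc 0)"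
    using hodge_decomposition[OF yin] by blast
  obtain e0 where e0: "e0 \<in> altcochains (diff_ops l p q) n (Suc 0)" "smap l p q e0 = b0"
    using smap_surj[OF b0(1)] by blast
  obtain e1 where e1: "e1 \<in> altcochains (diff_ops l p q) n (Suc 0)" "smap l p q e1 = const_cochain b'"
    using smap_surj[OF const_cochain_in[OF b']] by blast
  have "smap l p q (dS \<delta> p (e0 + e1)) = ced hbr tact b0 + const_cochain (dI b')"
    unfolding dS_linear(1)[OF e0(1) e1(1)] smap_algebra smap_ced[OF e0(1)] smap_ced[OF e1(1)] e0(2) e1(2)
      const_cochain_ced ..
  moreover have "smap l p q c = ced hbr tact b0 + const_cochain y"
    using b0(2) unfolding y_def plus_fun_def[of "ced hbr tact b0"] .
  moreover have "const_cochain y = const_cochain h + const_cochain (dI b')"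
    unfolding h(3) by (intro ext) (simp add: const_cochain_def)
  ultimately have "smap l p q c = const_cochain h + smap l p q (dS \<delta> p (e0 + e1))" by simp
  moreover have "e0 + e1 \<in> altcochains (diff_ops l p q) n (Suc 0)"
    by (rule subspace_add[OF subspace_diff_cochains e0(1) e1(1)])
  ultimately show ?thesis using h(1,2) by blast
qed

lemma exact_const:
  assumes b: "b \<in> altcochains (diff_ops l p q) n (Suc 0)" and h: "harmonic h"
    and e: "const_cochain h = smap l p q (dS \<delta> p b)"
  shows "h = 0"
proof -
  have "h = eval_cochain (smap l p q (dS \<delta> p b))" by (simp only: e[symmetric] eval_const)
  then have "h = dI (eval_cochain (smap l p q b))" by (simp only: smap_ced[OF b] eval_cochain_ced)
  then show ?thesis using exact_harmonic[OF eval_cochain_in[OF smap_in[OF b]]] h by simp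
qed

text \<open>
  A harmonic cochain is zero for these orders, so the symbol of \<open>c\<close> is exact; correcting \<open>c\<close> by a lift
  of a primitive lowers its order.
\<close>

lemma descent_step:
  assumes lq: "l + q \<noteq> p" "l + q + 1 \<noteq> p"
    and c: "c \<in> altcochains (diff_ops l p q) n 0" and dc: "dS \<delta> p c \<in> altcochains (dops l p q) (Suc n) 0"
  shows "\<exists>b\<in>altcochains (diff_ops l p q) n (Suc 0). c - dS \<delta> p b \<in> altcochains (dops l p q) n 0"
proof -
  obtain h b where h: "h \<in> altcochains (tens l p q) n 0" "harmonic h"
    and b: "b \<in> altcochains (diff_ops l p q) n (Suc 0)"
    and s: "smap l p q c = const_cochain h + smap l p q (dS \<delta> p b)"
    using relative_cocycle[OF c dc] by blast
  have "h = 0" by (rule harmonic_vanish[OF h lq])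
  then have "const_cochain h = 0" by (intro ext) (simp add: const_cochain_def)
  then have "smap l p q (c - dS \<delta> p b) = 0" unfolding smap_algebra s by simp
  then show ?thesis
    using smap_kernel[OF subspace_diff[OF subspace_diff_cochains c dS_in[OF b]]] b by blast
qed

lemma descent:
  assumes "a \<le> k" and "\<And>j. a \<le> j \<Longrightarrow> j < k \<Longrightarrow> j + q \<noteq> p \<and> j + q + 1 \<noteq> p"
    and "c \<in> altcochains (dops k p q) n 0" and "dS \<delta> p c \<in> altcochains (dops a p q) (Suc n) 0"
  shows "\<exists>b\<in>altcochains (dops k p q) n (Suc 0). c - dS \<delta> p b \<in> altcochains (dops a p q) n 0"
  using assms
proof (induction k arbitrary: c rule: dec_induct)
  case base
  show ?case
  proof (rule bexI[of _ 0])
    show "c - dS \<delta> p 0 \<in> altcochains (dops a p q) n 0" unfolding dS_zero diff_zero by (rule base.prems(2))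
    show "0 \<in> altcochains (dops a p q) n (Suc 0)" by (rule subspace_0[OF subspace_altcochains[OF subspace_dops]])
  qed
next
  case (step k)
  have sub: "altcochains (dops k p q) n' m \<subseteq> altcochains (diff_ops k p q) n' m" for n' m
    by (intro altcochains_mono dops_subset)
  have c: "c \<in> altcochains (diff_ops k p q) n 0" using step.prems(2) by simp
  have "dS \<delta> p c \<in> altcochains (dops k p q) (Suc n) 0"
    using step.prems(3) altcochains_mono[OF dops_mono[OF step.hyps(1)]] by blast
  then obtain b where b: "b \<in> altcochains (diff_ops k p q) n (Suc 0)" "c - dS \<delta> p b \<in> altcochains (dops k p q) n 0"
    using descent_step[OF _ _ c] step.prems(1)[of k] step.hyps by auto
  have "dS \<delta> p (c - dS \<delta> p b) = dS \<delta> p c"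
    unfolding dS_linear(2)[OF c dS_in[OF b(1)]] dS_dS[OF b(1)] by simp
  then have dc: "dS \<delta> p (c - dS \<delta> p b) \<in> altcochains (dops a p q) (Suc n) 0" using step.prems(3) by (simp only:)
  have "j + q \<noteq> p \<and> j + q + 1 \<noteq> p" if "a \<le> j" "j < k" for j using step.prems(1) that by auto
  then obtain b' where b': "b' \<in> altcochains (dops k p q) n (Suc 0)"
    "c - dS \<delta> p b - dS \<delta> p b' \<in> altcochains (dops a p q) n 0"
    using step.IH[OF _ b(2) dc] by blast
  have b'2: "b' \<in> altcochains (diff_ops k p q) n (Suc 0)" using b'(1) sub by blast
  have "c - dS \<delta> p (b + b') \<in> altcochains (dops a p q) n 0"
    unfolding dS_linear(1)[OF b(1) b'2] using b'(2) by (simp add: diff_diff_eq)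
  moreover have "b + b' \<in> altcochains (dops (Suc k) p q) n (Suc 0)"
    using subspace_add[OF subspace_diff_cochains b(1) b'2] by simp
  ultimately show ?case by blast
qed

lemma dops_acyclic:
  assumes "\<And>j. j < k \<Longrightarrow> j + q \<noteq> p \<and> j + q + 1 \<noteq> p"
    and c: "c \<in> altcochains (dops k p q) n 0" "dS \<delta> p c = 0"
  shows "\<exists>b\<in>altcochains (dops k p q) n (Suc 0). c = dS \<delta> p b"
proof -
  have "dS \<delta> p c \<in> altcochains (dops 0 p q) (Suc n) 0"
    unfolding c(2) by (rule subspace_0[OF subspace_altcochains[OF subspace_dops]])
  then obtain b where b: "b \<in> altcochains (dops k p q) n (Suc 0)" "c - dS \<delta> p b \<in> altcochains (dops 0 p q) n 0"
    using descent[OF _ _ c(1), of 0] assms(1) by auto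
  have "(c - dS \<delta> p b) Xs = 0" for Xs using altcochainsD(3)[OF b(2), of Xs] by (simp add: dops_def)
  then have "c - dS \<delta> p b = 0" by (intro ext) simp
  then show ?thesis using b(1) by auto
qed

section \<open>Cochains on the vector fields\<close>

definition pull :: "((real^'m \<Rightarrow> real^'m) list \<Rightarrow> 'w) \<Rightarrow> 'm::finite sl list \<Rightarrow> 'w" where
  "pull c Xs = c (map fld Xs)"

definition push :: "('m::finite sl list \<Rightarrow> 'w::real_vector) \<Rightarrow> (real^'m \<Rightarrow> real^'m) list \<Rightarrow> 'w" where
  "push c xs = (if set xs \<subseteq> sl_fields then c (map (inv_into UNIV fld) xs) else 0)"

text \<open>
  Cochains on the vector fields are cochains on their coefficients in the parametrization by
  \<^const>\<open>fld\<close>, extended by zero to arguments outside the algebra.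
\<close>

definition pulled :: "('m::finite sl list \<Rightarrow> 'w::real_vector) set \<Rightarrow> ((real^'m \<Rightarrow> real^'m) list \<Rightarrow> 'w) set" where
  "pulled S = {c. (\<forall>xs. \<not> set xs \<subseteq> sl_fields \<longrightarrow> c xs = 0) \<and> pull c \<in> S}"

lemma sl_fields_map: "set xs \<subseteq> sl_fields \<longleftrightarrow> (\<exists>Xs. xs = map fld Xs)"
  unfolding ex_map_conv fld_range[symmetric] by blast

lemma pull_push: "pull (push c) = c"
proof
  fix Xs :: "'a sl list"
  have "map (inv_into UNIV fld) (map fld Xs) = Xs" by (simp add: inv_o_cancel[OF inj_fld])
  moreover have "set (map fld Xs) \<subseteq> sl_fields" using sl_fields_map by blast
  ultimately show "pull (push c) Xs = c Xs" unfolding pull_def push_def by simp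
qed

lemma push_in: "c \<in> S \<Longrightarrow> push c \<in> pulled S"
  by (simp add: pulled_def pull_push) (simp add: push_def)

lemma pull_linear:
  "pull (c + e) = pull c + pull e" "pull (c - e) = pull c - pull e" "pull (r *\<^sub>R c) = r *\<^sub>R pull c" "pull 0 = 0"
  by (rule ext, simp add: pull_def scaleR_fun_apply)+

lemma pull_eqI:
  assumes "c \<in> pulled UNIV" "e \<in> pulled UNIV" "pull c = pull e"
  shows "c = e"
proof
  fix xs
  show "c xs = e xs"
  proof (cases "set xs \<subseteq> sl_fields")
    case True
    then obtain Xs where "xs = map fld Xs" using sl_fields_map by blast
    then show ?thesis using fun_cong[OF assms(3), of Xs] by (simp add: pull_def)
  qed (use assms in \<open>simp add: pulled_def\<close>)
qed

lemma subspace_pulled: "real_subspace S \<Longrightarrow> real_subspace (pulled S)"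
  unfolding real_vector.subspace_def pulled_def by (auto simp: pull_linear scaleR_fun_apply)

lemma pulled_diff: "c \<in> pulled S \<Longrightarrow> e \<in> pulled T \<Longrightarrow> pull c - pull e \<in> U \<Longrightarrow> c - e \<in> pulled U"
  by (auto simp: pulled_def pull_linear)

lemma cochains_pulled:
  fixes W :: "'w::real_vector set"
  assumes "0 \<in> W"
  shows "cochains (sl_fields :: (real^'m::finite \<Rightarrow> real^'m) set) W u = pulled (altcochains W u 0)"
proof (rule Set.set_eqI)
  fix c :: "(real^'m \<Rightarrow> real^'m) list \<Rightarrow> 'w"
  have sl: "(x :: real^'m \<Rightarrow> real^'m) \<in> sl_fields \<longleftrightarrow> (\<exists>X. x = fld X)" for x unfolding fld_range[symmetric] by blast
  have e: "pull c Xs = c (map fld Xs)" for Xs by (simp add: pull_def)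
  have lin: "fld (a *\<^sub>R X + b *\<^sub>R Y) = a *\<^sub>R fld X + b *\<^sub>R fld Y" for a b and X Y :: "'m sl"
    by (simp add: linear_add[OF linear_fld] linear_scale[OF linear_fld])
  have "c \<in> cochains sl_fields W u \<longleftrightarrow>
      (\<forall>xs. \<not> set xs \<subseteq> sl_fields \<longrightarrow> c xs = 0) \<and> (\<forall>Xs. length Xs \<noteq> u \<longrightarrow> c (map fld Xs) = 0) \<and>
      (\<forall>Xs. length Xs = u \<longrightarrow> c (map fld Xs) \<in> W) \<and>
      (\<forall>Xs. length Xs = u \<longrightarrow> (\<forall>i<u. \<forall>X Y a b. c (map fld (Xs[i := a *\<^sub>R X + b *\<^sub>R Y])) =
         a *\<^sub>R c (map fld (Xs[i := X])) + b *\<^sub>R c (map fld (Xs[i := Y])))) \<and>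
      (\<forall>Xs. length Xs = u \<and> \<not> distinct (map fld Xs) \<longrightarrow> c (map fld Xs) = 0)"
    unfolding cochains_def mem_Collect_eq sl_fields_map Ball_def sl map_update lin
    by (intro iffI conjI; (elim conjE)?; (metis length_map | force))
  also have "\<dots> \<longleftrightarrow> (\<forall>xs. \<not> set xs \<subseteq> sl_fields \<longrightarrow> c xs = 0) \<and> pull c \<in> cochains UNIV W u"
    unfolding cochains_def mem_Collect_eq e by (simp add: distinct_map inj_on_subset[OF inj_fld])
  finally show "c \<in> cochains sl_fields W u \<longleftrightarrow> c \<in> pulled (altcochains W u 0)"
    by (simp add: pulled_def cochains_UNIV[OF assms])
qed

lemma ce_diff_pull:
  "pull (ce_diff sl_fields lie_bracket act c) = ce_diff UNIV slbr (\<lambda>g. act (fld g)) (pull c)"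
proof
  fix Xs :: "'a sl list"
  have om: "omit i (map fld Ys) = map fld (omit i Ys)" for i and Ys :: "'a sl list"
    by (simp add: omit_def take_map drop_map)
  have s: "set (map fld Xs) \<subseteq> sl_fields" using sl_fields_map by blast
  have "(\<Sum>i<length Xs. (- 1) ^ i *\<^sub>R act (map fld Xs ! i) (c (omit i (map fld Xs)))) =
      (\<Sum>i<length Xs. (- 1) ^ i *\<^sub>R act (fld (Xs ! i)) (pull c (omit i Xs)))"
    by (rule sum.cong) (simp_all add: om pull_def)
  moreover have "(\<Sum>j<length Xs. \<Sum>i<j. (- 1) ^ (i + j) *\<^sub>R c (lie_bracket (map fld Xs ! i) (map fld Xs ! j) # omit i (omit j (map fld Xs)))) =
      (\<Sum>j<length Xs. \<Sum>i<j. (- 1) ^ (i + j) *\<^sub>R pull c (slbr (Xs ! i) (Xs ! j) # omit i (omit j Xs)))"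
    by (rule sum.cong[OF refl], rule sum.cong[OF refl]) (simp add: om pull_def lie_bracket_fld)
  ultimately show "pull (ce_diff sl_fields lie_bracket act c) Xs = ce_diff UNIV slbr (\<lambda>g. act (fld g)) (pull c) Xs"
    using s by (simp add: ce_diff_def pull_def)
qed

lemma ce_diff_pulled: "ce_diff sl_fields br act c \<in> pulled UNIV"
  by (simp add: pulled_def ce_diff_def)

definition op_cocycles :: "real \<Rightarrow> nat \<Rightarrow> nat \<Rightarrow> nat \<Rightarrow> nat \<Rightarrow> ('m::finite sl list \<Rightarrow> 'm field \<Rightarrow> 'm field) set" where
  "op_cocycles \<delta> k p q u = {c \<in> altcochains (diff_ops k p q) u 0. dS \<delta> p c = 0}"

definition op_coboundaries :: "real \<Rightarrow> nat \<Rightarrow> nat \<Rightarrow> nat \<Rightarrow> nat \<Rightarrow> ('m::finite sl list \<Rightarrow> 'm field \<Rightarrow> 'm field) set" where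
  "op_coboundaries \<delta> k p q u = dS \<delta> p ` altcochains (diff_ops k p q) u (Suc 0)"

lemma cocycles_pulled:
  "cocycles sl_fields lie_bracket (op_action \<delta> p) (diff_ops k p q) u = pulled (op_cocycles \<delta> k p q u)"
proof (rule Set.set_eqI)
  fix c :: "(real^'a \<Rightarrow> real^'a) list \<Rightarrow> 'a field \<Rightarrow> 'a field"
  have z: "ce_diff sl_fields lie_bracket (op_action \<delta> p) c = 0 \<longleftrightarrow>
      ce_diff UNIV slbr (\<lambda>g. op_action \<delta> p (fld g)) (pull c) = 0"
    using pull_eqI[OF ce_diff_pulled, of 0 lie_bracket "op_action \<delta> p" c] subspace_0[OF subspace_pulled[OF subspace_UNIV]]
    by (metis ce_diff_pull pull_linear(4))
  show "c \<in> cocycles sl_fields lie_bracket (op_action \<delta> p) (diff_ops k p q) u \<longleftrightarrow> c \<in> pulled (op_cocycles \<delta> k p q u)"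
    unfolding cocycles_def cochains_pulled[OF subspace_0[OF subspace_diff_ops]] mem_Collect_eq z
    using ce_diff_eq_ced[OF altcochainsD(1), of "pull c" "diff_ops k p q" u 0]
    by (auto simp: pulled_def op_cocycles_def)
qed

lemma coboundaries_pulled:
  "coboundaries sl_fields lie_bracket (op_action \<delta> p) (diff_ops k p q) u =
    pulled (op_coboundaries \<delta> k p q u :: ('m::finite sl list \<Rightarrow> 'm field \<Rightarrow> 'm field) set)"
proof -
  have cb: "(op_coboundaries \<delta> k p q u :: ('m sl list \<Rightarrow> 'm field \<Rightarrow> 'm field) set) = coboundaries UNIV slbr (\<lambda>g. op_action \<delta> p (fld g)) (diff_ops k p q) u"
    unfolding op_coboundaries_def by (rule lie_module.coboundaries_iff[OF lie_module_diff_ops, symmetric])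
  have W: "0 \<in> (diff_ops k p q :: ('m field \<Rightarrow> 'm field) set)" by (rule subspace_0[OF subspace_diff_ops])
  show ?thesis
  proof (cases u)
    case 0
    have "pulled {0 :: 'm sl list \<Rightarrow> 'm field \<Rightarrow> 'm field} = {0}"
    proof (intro equalityI subsetI)
      fix c :: "(real^'m \<Rightarrow> real^'m) list \<Rightarrow> 'm field \<Rightarrow> 'm field"
      assume "c \<in> pulled {0}"
      then have "c \<in> pulled UNIV" "pull c = pull 0" by (auto simp: pulled_def pull_linear)
      then show "c \<in> {0}" using pull_eqI subspace_0[OF subspace_pulled[OF subspace_UNIV]] by blast
    qed (simp add: pulled_def pull_linear)
    then show ?thesis unfolding cb by (simp add: 0 coboundaries_def)
  next
    case (Suc v)
    have "ce_diff sl_fields lie_bracket (op_action \<delta> p) ` cochains sl_fields (diff_ops k p q) v =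
        pulled (ce_diff UNIV slbr (\<lambda>g. op_action \<delta> p (fld g)) ` cochains UNIV (diff_ops k p q) v :: ('m sl list \<Rightarrow> 'm field \<Rightarrow> 'm field) set)"
    proof (intro equalityI subsetI)
      fix c :: "(real^'m \<Rightarrow> real^'m) list \<Rightarrow> 'm field \<Rightarrow> 'm field"
      assume "c \<in> ce_diff sl_fields lie_bracket (op_action \<delta> p) ` cochains sl_fields (diff_ops k p q) v"
      then obtain e where e: "e \<in> pulled (altcochains (diff_ops k p q) v 0)" "c = ce_diff sl_fields lie_bracket (op_action \<delta> p) e"
        unfolding cochains_pulled[OF W] by blast
      then show "c \<in> pulled (ce_diff UNIV slbr (\<lambda>g. op_action \<delta> p (fld g)) ` cochains UNIV (diff_ops k p q) v)"
        using ce_diff_pulled[of lie_bracket "op_action \<delta> p" e]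
        by (auto simp: pulled_def ce_diff_pull cochains_UNIV[OF W])
    next
      fix c :: "(real^'m \<Rightarrow> real^'m) list \<Rightarrow> 'm field \<Rightarrow> 'm field"
      assume c: "c \<in> pulled (ce_diff UNIV slbr (\<lambda>g. op_action \<delta> p (fld g)) ` cochains UNIV (diff_ops k p q) v)"
      then obtain e where e: "e \<in> altcochains (diff_ops k p q) v 0" "pull c = ce_diff UNIV slbr (\<lambda>g. op_action \<delta> p (fld g)) e"
        by (auto simp: pulled_def cochains_UNIV[OF W])
      have "c = ce_diff sl_fields lie_bracket (op_action \<delta> p) (push e)"
      proof (rule pull_eqI[OF _ ce_diff_pulled])
        show "c \<in> pulled UNIV" using c by (simp add: pulled_def)
        show "pull c = pull (ce_diff sl_fields lie_bracket (op_action \<delta> p) (push e))"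
          by (simp only: ce_diff_pull pull_push e(2))
      qed
      then show "c \<in> ce_diff sl_fields lie_bracket (op_action \<delta> p) ` cochains sl_fields (diff_ops k p q) v"
        unfolding cochains_pulled[OF W] using push_in[OF e(1)] by blast
    qed
    then show ?thesis unfolding cb by (simp add: Suc coboundaries_def)
  qed
qed

lemma sl_cohomology_pulled:
  "sl_cohomology TYPE('m::finite) \<delta> k p q =
     direct_sum_module (\<lambda>u. quotient_module (pulled (op_cocycles \<delta> k p q u)) (pulled (op_coboundaries \<delta> k p q u)))"
  by (simp add: sl_cohomology_def cohomology_def cocycles_pulled coboundaries_pulled)

lemma subspace_op_cocycles: "real_subspace (op_cocycles \<delta> k p q u :: ('a::finite sl list \<Rightarrow> 'a field \<Rightarrow> 'a field) set)"
  and subspace_op_coboundaries: "real_subspace (op_coboundaries \<delta> k p q u :: ('a::finite sl list \<Rightarrow> 'a field \<Rightarrow> 'a field) set)"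
proof -
  note sub = subspace_0[OF subspace_diff_cochains] subspace_add[OF subspace_diff_cochains] subspace_scale[OF subspace_diff_cochains]
  show "real_subspace (op_cocycles \<delta> k p q u :: ('a sl list \<Rightarrow> 'a field \<Rightarrow> 'a field) set)"
    unfolding real_vector.subspace_def op_cocycles_def mem_Collect_eq Ball_def
    by (intro conjI allI impI; (elim conjE)?) (simp_all add: sub dS_zero dS_linear)
  show "real_subspace (op_coboundaries \<delta> k p q u :: ('a sl list \<Rightarrow> 'a field \<Rightarrow> 'a field) set)"
    unfolding op_coboundaries_def
  proof (rule real_vector.subspaceI)
    show "0 \<in> dS \<delta> p ` altcochains (diff_ops k p q :: ('a field \<Rightarrow> 'a field) set) u (Suc 0)"
      by (rule image_eqI[where x = 0]) (simp_all only: dS_zero sub(1))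
  next
    fix x y :: "'a sl list \<Rightarrow> 'a field \<Rightarrow> 'a field"
    assume "x \<in> dS \<delta> p ` altcochains (diff_ops k p q) u (Suc 0)" "y \<in> dS \<delta> p ` altcochains (diff_ops k p q) u (Suc 0)"
    then obtain x' y' where xy: "x' \<in> altcochains (diff_ops k p q) u (Suc 0)" "x = dS \<delta> p x'"
      "y' \<in> altcochains (diff_ops k p q) u (Suc 0)" "y = dS \<delta> p y'" by blast
    show "x + y \<in> dS \<delta> p ` altcochains (diff_ops k p q) u (Suc 0)"
      unfolding xy(2,4) by (rule image_eqI[OF _ sub(2)[OF xy(1,3)]]) (rule dS_linear(1)[OF xy(1,3), symmetric])
  next
    fix r and x :: "'a sl list \<Rightarrow> 'a field \<Rightarrow> 'a field"
    assume "x \<in> dS \<delta> p ` altcochains (diff_ops k p q) u (Suc 0)"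
    then obtain x' where x: "x' \<in> altcochains (diff_ops k p q) u (Suc 0)" "x = dS \<delta> p x'" by blast
    show "r *\<^sub>R x \<in> dS \<delta> p ` altcochains (diff_ops k p q) u (Suc 0)"
      unfolding x(2) by (rule image_eqI[OF _ sub(3)[OF x(1)]]) (rule dS_linear(3)[OF x(1) x(1), symmetric])
  qed
qed

section \<open>The cohomology of differential operators\<close>

text \<open>Without symbols admitting harmonic cochains, every cocycle bounds.\<close>

lemma zero_sl_cohomology:
  assumes "\<And>j. j \<le> k \<Longrightarrow> j + q \<noteq> p \<and> j + q + 1 \<noteq> p"
  shows "zero_module (sl_cohomology TYPE('m::finite) \<delta> k p q)"
  unfolding sl_cohomology_pulled
proof (rule zero_module_direct_sum)
  fix u
  have "c \<in> op_coboundaries \<delta> k p q u" if c: "c \<in> op_cocycles \<delta> k p q u" for c :: "'m sl list \<Rightarrow> 'm field \<Rightarrow> 'm field"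
  proof -
    have "c \<in> altcochains (dops (Suc k) p q) u 0" "dS \<delta> p c = 0" using c by (simp_all add: op_cocycles_def)
    then obtain b where "b \<in> altcochains (dops (Suc k) p q) u (Suc 0)" "c = dS \<delta> p b"
      using dops_acyclic[of "Suc k" q p c u \<delta>] assms by (metis less_Suc_eq_le)
    then show ?thesis by (auto simp: op_coboundaries_def)
  qed
  then show "pulled (op_cocycles \<delta> k p q u :: ('m sl list \<Rightarrow> 'm field \<Rightarrow> 'm field) set) \<subseteq> pulled (op_coboundaries \<delta> k p q u)"
    by (auto simp: pulled_def)
qed (intro subspace_pulled subspace_op_cocycles subspace_op_coboundaries)+

text \<open>Orders whose symbols admit no harmonic cochains do not change the cohomology.\<close>

lemma sl_cohomology_inclusion:
  assumes nk: "n \<le> k" and lq: "\<And>j. n < j \<Longrightarrow> j \<le> k \<Longrightarrow> j + q \<noteq> p \<and> j + q + 1 \<noteq> p"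
  shows "vs_iso (sl_cohomology TYPE('m::finite) \<delta> n p q) (sl_cohomology TYPE('m) \<delta> k p q)
    (inclusion_map TYPE('m) \<delta> k p q)"
proof -
  have sub: "altcochains (diff_ops n p q :: ('m field \<Rightarrow> 'm field) set) u v \<subseteq> altcochains (diff_ops k p q) u v" for u v
    by (intro altcochains_mono diff_ops_mono nk)
  have desc: "\<exists>b\<in>altcochains (diff_ops k p q) u (Suc 0). c - dS \<delta> p b \<in> altcochains (diff_ops n p q) u 0"
    if "c \<in> altcochains (diff_ops k p q) u 0" "dS \<delta> p c \<in> altcochains (diff_ops n p q) (Suc u) 0"
    for u and c :: "'m sl list \<Rightarrow> 'm field \<Rightarrow> 'm field"
    using descent[of "Suc n" "Suc k" q p c u \<delta>] that nk lq by simp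
  have ZZ: "op_cocycles \<delta> n p q u \<subseteq> (op_cocycles \<delta> k p q u :: ('m sl list \<Rightarrow> 'm field \<Rightarrow> 'm field) set)" for u
    using sub by (auto simp: op_cocycles_def)
  have BB: "op_coboundaries \<delta> n p q u \<subseteq> (op_coboundaries \<delta> k p q u :: ('m sl list \<Rightarrow> 'm field \<Rightarrow> 'm field) set)" for u
    unfolding op_coboundaries_def by (intro image_mono sub)
  have inj: "z \<in> op_coboundaries \<delta> n p q u"
    if z: "z \<in> op_cocycles \<delta> n p q u" "z \<in> op_coboundaries \<delta> k p q u" for u and z :: "'m sl list \<Rightarrow> 'm field \<Rightarrow> 'm field"
  proof -
    obtain b where b: "b \<in> altcochains (diff_ops k p q) u (Suc 0)" "z = dS \<delta> p b"
      using z(2) by (auto simp: op_coboundaries_def)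
    show ?thesis
    proof (cases u)
      case 0
      have W: "0 \<in> (diff_ops j p q :: ('m field \<Rightarrow> 'm field) set)" for j by (rule subspace_0[OF subspace_diff_ops])
      show ?thesis using b unfolding op_coboundaries_def 0 altcochains_0_1[OF W] by blast
    next
      case (Suc v)
      have bv: "b \<in> altcochains (diff_ops k p q) v 0" using b(1) by (simp add: Suc altcochains_Suc_Suc)
      have "dS \<delta> p b \<in> altcochains (diff_ops n p q) (Suc v) 0" using z(1) b(2) by (simp add: op_cocycles_def Suc)
      then obtain e where e: "e \<in> altcochains (diff_ops k p q) v (Suc 0)" "b - dS \<delta> p e \<in> altcochains (diff_ops n p q) v 0"
        using desc[OF bv] by blast
      have "z = dS \<delta> p (b - dS \<delta> p e)"
        unfolding dS_linear(2)[OF bv dS_in[OF e(1)]] dS_dS[OF e(1)] b(2) by (rule diff_zero[symmetric])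
      then show ?thesis using e(2) by (auto simp: op_coboundaries_def Suc altcochains_Suc_Suc)
    qed
  qed
  have sur: "\<exists>y\<in>op_cocycles \<delta> n p q u. z - y \<in> op_coboundaries \<delta> k p q u"
    if z: "z \<in> op_cocycles \<delta> k p q u" for u and z :: "'m sl list \<Rightarrow> 'm field \<Rightarrow> 'm field"
  proof -
    have zk: "z \<in> altcochains (diff_ops k p q) u 0" and dz: "dS \<delta> p z = 0" using z by (auto simp: op_cocycles_def)
    have "dS \<delta> p z \<in> altcochains (diff_ops n p q) (Suc u) 0"
      unfolding dz by (rule subspace_0[OF subspace_diff_cochains])
    then obtain b where b: "b \<in> altcochains (diff_ops k p q) u (Suc 0)" "z - dS \<delta> p b \<in> altcochains (diff_ops n p q) u 0"
      using desc[OF zk] by blast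
    have "dS \<delta> p (z - dS \<delta> p b) = 0"
      unfolding dS_linear(2)[OF zk dS_in[OF b(1)]] dS_dS[OF b(1)] dz by (rule diff_zero)
    then have "z - dS \<delta> p b \<in> op_cocycles \<delta> n p q u" using b(2) by (simp add: op_cocycles_def)
    moreover have "z - (z - dS \<delta> p b) = dS \<delta> p b" by (rule diff_diff_eq2[THEN trans]) (rule add_diff_cancel_left')
    then have "z - (z - dS \<delta> p b) \<in> op_coboundaries \<delta> k p q u" using b(1) by (simp only: op_coboundaries_def) blast
    ultimately show ?thesis by blast
  qed
  have map: "inclusion_map TYPE('m) \<delta> k p q = (\<lambda>h u. h u + pulled (op_coboundaries \<delta> k p q u))"
    by (intro ext) (simp add: inclusion_map_def cohomology_map_def coboundaries_pulled o_def)
  show ?thesis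
    unfolding sl_cohomology_pulled map
  proof (rule vs_iso_inclusion)
    fix u
    show "pulled (op_cocycles \<delta> n p q u :: ('m sl list \<Rightarrow> 'm field \<Rightarrow> 'm field) set) \<subseteq> pulled (op_cocycles \<delta> k p q u)"
      "pulled (op_coboundaries \<delta> n p q u :: ('m sl list \<Rightarrow> 'm field \<Rightarrow> 'm field) set) \<subseteq> pulled (op_coboundaries \<delta> k p q u)"
      using ZZ BB by (auto simp: pulled_def)
    fix z :: "(real^'m \<Rightarrow> real^'m) list \<Rightarrow> 'm field \<Rightarrow> 'm field"
    show "z \<in> pulled (op_coboundaries \<delta> n p q u)"
      if "z \<in> pulled (op_cocycles \<delta> n p q u)" "z \<in> pulled (op_coboundaries \<delta> k p q u)"
      using that inj by (simp add: pulled_def)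
    show "\<exists>y\<in>pulled (op_cocycles \<delta> n p q u). z - y \<in> pulled (op_coboundaries \<delta> k p q u)"
      if z: "z \<in> pulled (op_cocycles \<delta> k p q u)"
    proof -
      have "pull z \<in> op_cocycles \<delta> k p q u" using z by (simp add: pulled_def)
      then obtain y where y: "y \<in> op_cocycles \<delta> n p q u" "pull z - y \<in> op_coboundaries \<delta> k p q u"
        using sur by blast
      have "z - push y \<in> pulled (op_coboundaries \<delta> k p q u)"
        by (rule pulled_diff[OF z push_in[OF y(1)]]) (simp only: pull_push y(2))
      then show ?thesis using push_in[OF y(1)] by blast
    qed
  qed (intro subspace_pulled subspace_op_cocycles subspace_op_coboundaries)+
qed

text \<open>
  A cocycle of order \<open>l\<close> is related to the invariant form of the harmonic representative of its symbol.
\<close>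

definition residue_rel :: "real \<Rightarrow> nat \<Rightarrow> nat \<Rightarrow> nat \<Rightarrow> 'm \<Rightarrow> nat
    \<Rightarrow> ('m::finite sl list \<Rightarrow> 'm field \<Rightarrow> 'm field) \<Rightarrow> ((real^'m^'m) list \<Rightarrow> real) \<Rightarrow> bool" where
  "residue_rel \<delta> l p q e u z f \<longleftrightarrow> (\<exists>h b. h \<in> altcochains (tens l p q) (Suc u) 0 \<and> harmonic h \<and>
     b \<in> altcochains (diff_ops l p q) (Suc u) (Suc 0) \<and>
     smap l p q z = const_cochain h + smap l p q (dS \<delta> p b) \<and> f = base_form p (l + q) e h)"

lemma harmonic_add: "harmonic c \<Longrightarrow> harmonic c' \<Longrightarrow> harmonic (c + c')"
  and harmonic_scale: "harmonic c \<Longrightarrow> harmonic (r *\<^sub>R c)"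
  by (simp_all add: harmonic_def linear_add[OF linear_theta] linear_add[OF linear_lieop]
      linear_scale[OF linear_theta] linear_scale[OF linear_lieop])

lemma residue_rel_linear:
  "residue_rel \<delta> l p q e u z f \<Longrightarrow> residue_rel \<delta> l p q e u z' f' \<Longrightarrow> residue_rel \<delta> l p q e u (z + z') (f + f')"
  "residue_rel \<delta> l p q e u z f \<Longrightarrow> residue_rel \<delta> l p q e u (r *\<^sub>R z) (r *\<^sub>R f)"
proof -
  have ca: "const_cochain (h + h') = const_cochain h + const_cochain h'"
    "const_cochain (r *\<^sub>R h) = r *\<^sub>R const_cochain h" for h h' :: "'a iso list \<Rightarrow> 'a tens"
    by (intro ext; simp add: const_cochain_def scaleR_fun_apply)+
  have ba: "base_form p (l + q) e (h + h') = base_form p (l + q) e h + base_form p (l + q) e h'"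
    "base_form p (l + q) e (r *\<^sub>R h) = r *\<^sub>R base_form p (l + q) e h" for h h' :: "'a iso list \<Rightarrow> 'a tens"
    by (intro ext; simp add: base_form_def scaleR_fun_apply)+
  show "residue_rel \<delta> l p q e u (z + z') (f + f')" if R: "residue_rel \<delta> l p q e u z f" "residue_rel \<delta> l p q e u z' f'"
  proof -
    obtain h b where h: "h \<in> altcochains (tens l p q) (Suc u) 0" "harmonic h" "b \<in> altcochains (diff_ops l p q) (Suc u) (Suc 0)"
      "smap l p q z = const_cochain h + smap l p q (dS \<delta> p b)" "f = base_form p (l + q) e h"
      using R(1) unfolding residue_rel_def by blast
    obtain h' b' where h': "h' \<in> altcochains (tens l p q) (Suc u) 0" "harmonic h'" "b' \<in> altcochains (diff_ops l p q) (Suc u) (Suc 0)"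
      "smap l p q z' = const_cochain h' + smap l p q (dS \<delta> p b')" "f' = base_form p (l + q) e h'"
      using R(2) unfolding residue_rel_def by blast
    have "smap l p q (z + z') = const_cochain (h + h') + smap l p q (dS \<delta> p (b + b'))"
      unfolding dS_linear(1)[OF h(3) h'(3)] smap_algebra ca h(4) h'(4) by (simp only: ac_simps)
    then show ?thesis
      unfolding residue_rel_def
      using subspace_add[OF subspace_altcochains[OF subspace_tens] h(1) h'(1)] harmonic_add[OF h(2) h'(2)]
        subspace_add[OF subspace_diff_cochains h(3) h'(3)] ba(1)[of h h'] h(5) h'(5) by metis
  qed
  show "residue_rel \<delta> l p q e u (r *\<^sub>R z) (r *\<^sub>R f)" if R: "residue_rel \<delta> l p q e u z f"
  proof -
    obtain h b where h: "h \<in> altcochains (tens l p q) (Suc u) 0" "harmonic h" "b \<in> altcochains (diff_ops l p q) (Suc u) (Suc 0)"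
      "smap l p q z = const_cochain h + smap l p q (dS \<delta> p b)" "f = base_form p (l + q) e h"
      using R unfolding residue_rel_def by blast
    have "smap l p q (r *\<^sub>R z) = const_cochain (r *\<^sub>R h) + smap l p q (dS \<delta> p (r *\<^sub>R b))"
      unfolding dS_linear(3)[OF h(3) h(3)] smap_algebra ca h(4) by (rule scaleR_right_distrib)
    then show ?thesis
      unfolding residue_rel_def
      using subspace_scale[OF subspace_altcochains[OF subspace_tens] h(1)] harmonic_scale[OF h(2)]
        subspace_scale[OF subspace_diff_cochains h(3)] ba(2)[of h] h(5) by metis
  qed
qed

text \<open>
  The lower orders are acyclic, so that cocycles of symbols can be lifted to cocycles of operators and
  primitives likewise. Harmonic cochains of degree \<open>u + 1\<close> correspond to invariant forms of degree
  \<open>u\<close>, and there is none in degree zero, because one covector argument is needed.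
\<close>

lemma sl_cohomology_top:
  assumes lq: "l + q + 1 = p"
  shows "vs_isomorphic (sl_cohomology TYPE('m::finite) \<delta> l p q) (gl_inv_algebra TYPE('m))"
proof -
  define e :: 'm where "e = undefined"
  have ac: "\<exists>b\<in>altcochains (diff_ops l p q) u (Suc 0). c = dS \<delta> p b"
    if "c \<in> altcochains (dops l p q) u 0" "dS \<delta> p c = 0" for c u
    using dops_acyclic[OF _ that] lq altcochains_mono[OF dops_subset] by fastforce
  have bound: "z \<in> op_coboundaries \<delta> l p q u"
    if z: "z \<in> op_cocycles \<delta> l p q u" and b: "b \<in> altcochains (diff_ops l p q) u (Suc 0)"
      and s: "smap l p q z = smap l p q (dS \<delta> p b)"
    for u and z b :: "'m sl list \<Rightarrow> 'm field \<Rightarrow> 'm field"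
  proof -
    have zl: "z \<in> altcochains (diff_ops l p q) u 0" "dS \<delta> p z = 0" using z by (auto simp: op_cocycles_def)
    have "smap l p q (z - dS \<delta> p b) = 0" unfolding smap_algebra s by (rule diff_self)
    then have "z - dS \<delta> p b \<in> altcochains (dops l p q) u 0"
      using smap_kernel[OF subspace_diff[OF subspace_diff_cochains zl(1) dS_in[OF b]]] by blast
    moreover have "dS \<delta> p (z - dS \<delta> p b) = 0"
      unfolding dS_linear(2)[OF zl(1) dS_in[OF b]] dS_dS[OF b] zl(2) by (rule diff_zero)
    ultimately obtain b' where b': "b' \<in> altcochains (diff_ops l p q) u (Suc 0)" "z - dS \<delta> p b = dS \<delta> p b'"
      using ac by blast
    have "z = dS \<delta> p (b' + b)" unfolding dS_linear(1)[OF b'(1) b] b'(2)[symmetric] by (rule diff_add_cancel[symmetric])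
    then show ?thesis using subspace_add[OF subspace_diff_cochains b'(1) b] by (simp only: op_coboundaries_def) blast
  qed
  have rep: "\<exists>h\<in>altcochains (tens l p q) u 0. \<exists>b\<in>altcochains (diff_ops l p q) u (Suc 0).
      harmonic h \<and> smap l p q z = const_cochain h + smap l p q (dS \<delta> p b)"
    if z: "z \<in> op_cocycles \<delta> l p q u" for z u
  proof -
    have zl: "z \<in> altcochains (diff_ops l p q) u 0" and dz: "dS \<delta> p z = 0" using z by (auto simp: op_cocycles_def)
    have "dS \<delta> p z \<in> altcochains (dops l p q) (Suc u) 0"
      unfolding dz by (rule subspace_0[OF subspace_altcochains[OF subspace_dops]])
    then show ?thesis by (rule relative_cocycle[OF zl])
  qed
  have c0: "const_cochain 0 = (0 :: 'm sl list \<Rightarrow> real^'m \<Rightarrow> 'm tens)" by (intro ext) (simp add: const_cochain_def)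
  have b0: "base_form p (l + q) e 0 = 0" by (intro ext) (simp add: base_form_def)
  have Z0: "op_cocycles \<delta> l p q 0 \<subseteq> (op_coboundaries \<delta> l p q 0 :: ('m sl list \<Rightarrow> 'm field \<Rightarrow> 'm field) set)"
  proof
    fix z :: "'m sl list \<Rightarrow> 'm field \<Rightarrow> 'm field" assume z: "z \<in> op_cocycles \<delta> l p q 0"
    then obtain h b where h: "h \<in> altcochains (tens l p q) 0 0" "harmonic h" and b: "b \<in> altcochains (diff_ops l p q) 0 (Suc 0)"
      and s: "smap l p q z = const_cochain h + smap l p q (dS \<delta> p b)" using rep by blast
    have "h (X # Xs) = 0" for X Xs using altcochainsD(4)[OF h(1), of "X # Xs"] by simp
    then have "base_form p (l + q) e h = 0" by (intro ext) (simp add: base_form_def)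
    then have "h = 0" by (rule harmonic_determined[OF h lq])
    then have "smap l p q z = smap l p q (dS \<delta> p b)" unfolding s by (simp only: c0 add_0)
    then show "z \<in> op_coboundaries \<delta> l p q 0" by (rule bound[OF z b])
  qed
  have total: "\<exists>f\<in>gl_inv_forms u. residue_rel \<delta> l p q e u z f" if z: "z \<in> op_cocycles \<delta> l p q (Suc u)" for u z
  proof -
    obtain h b where h: "h \<in> altcochains (tens l p q) (Suc u) 0" "harmonic h" and b: "b \<in> altcochains (diff_ops l p q) (Suc u) (Suc 0)"
      and s: "smap l p q z = const_cochain h + smap l p q (dS \<delta> p b)" using rep[OF z] by blast
    then have "residue_rel \<delta> l p q e u z (base_form p (l + q) e h)" unfolding residue_rel_def by blast
    then show ?thesis using base_form_in[OF h] by blast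
  qed
  have Gsub: "real_subspace (gl_inv_forms u :: ((real^'m^'m) list \<Rightarrow> real) set)" for u
  proof -
    have s: "real_subspace (altcochains UNIV u 0 :: ((real^'m^'m) list \<Rightarrow> real) set)"
      by (rule subspace_altcochains[OF subspace_UNIV])
    show ?thesis
      unfolding real_vector.subspace_def gl_inv_forms_def
      using subspace_0[OF s] subspace_add[OF s] subspace_scale[OF s]
      by (auto simp: cochains_UNIV scaleR_fun_apply sum.distrib simp flip: sum_distrib_left)
  qed
  have onto: "\<exists>z\<in>op_cocycles \<delta> l p q (Suc u). residue_rel \<delta> l p q e u z f"
    if f: "f \<in> gl_inv_forms u" for u f
  proof -
    \<comment> \<open>The factor compensates the value of the pairing at equal indices.\<close>
    define h where "h = inv_cochain (l + q) ((1 / fact p) *\<^sub>R f)"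
    have f': "(1 / fact p) *\<^sub>R f \<in> gl_inv_forms u" by (rule subspace_scale[OF Gsub f])
    have h: "h \<in> altcochains (tens l p q) (Suc u) 0" "harmonic h"
      unfolding h_def by (rule inv_cochain_in[OF f' lq], rule harmonic_inv_cochain[OF f'])
    have "base_form p (l + q) e h = fact p *\<^sub>R ((1 / fact p) *\<^sub>R f)"
      using base_form_inv_cochain[OF f', of "l + q" e] lq by (simp only: h_def Suc_eq_plus1)
    then have bf: "base_form p (l + q) e h = f" by simp
    obtain c where c: "c \<in> altcochains (diff_ops l p q) (Suc u) 0" "smap l p q c = const_cochain h"
      using smap_surj[OF const_cochain_in[OF h(1)]] by blast
    have c1: "c \<in> altcochains (diff_ops l p q) (Suc (Suc u)) (Suc 0)" using c(1) by (simp add: altcochains_Suc_Suc)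
    have "smap l p q (dS \<delta> p c) = 0"
      unfolding smap_ced[OF c(1)] c(2) const_cochain_ced harmonic_closed[OF h] by (rule c0)
    then have "dS \<delta> p c \<in> altcochains (dops l p q) (Suc (Suc u)) 0" using smap_kernel[OF dS_in[OF c1]] by blast
    then obtain b where b: "b \<in> altcochains (dops l p q) (Suc (Suc u)) (Suc 0)" "dS \<delta> p c = dS \<delta> p b"
      using dops_acyclic[of l q p "dS \<delta> p c" "Suc (Suc u)" \<delta>] dS_dS[OF c(1)] lq by force
    have b1: "b \<in> altcochains (dops l p q) (Suc u) 0" using b(1) by (simp add: altcochains_Suc_Suc)
    then have b2: "b \<in> altcochains (diff_ops l p q) (Suc u) 0" using altcochains_mono[OF dops_subset] by blast
    have "c - b \<in> altcochains (diff_ops l p q) (Suc u) 0" by (rule subspace_diff[OF subspace_diff_cochains c(1) b2])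
    moreover have "dS \<delta> p (c - b) = 0" unfolding dS_linear(2)[OF c(1) b2] b(2) by (rule diff_self)
    ultimately have "c - b \<in> op_cocycles \<delta> l p q (Suc u)" by (simp only: op_cocycles_def mem_Collect_eq)
    moreover have "smap l p q b = 0" using smap_kernel[OF b2] b1 by blast
    then have "smap l p q (c - b) = const_cochain h + smap l p q (dS \<delta> p 0)"
      unfolding smap_algebra c(2) dS_zero using linear_0[of "smap l p q"] smap_algebra(2)[of l p q b b]
      by (simp only: diff_zero diff_self add_0_right)
    then have "residue_rel \<delta> l p q e u (c - b) f"
      unfolding residue_rel_def using h bf subspace_0[OF subspace_diff_cochains] by metis
    ultimately show ?thesis by blast
  qed
  have ker: "z \<in> op_coboundaries \<delta> l p q (Suc u) \<longleftrightarrow> f = 0"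
    if z: "z \<in> op_cocycles \<delta> l p q (Suc u)" and R: "residue_rel \<delta> l p q e u z f" for u z f
  proof -
    obtain h b where h: "h \<in> altcochains (tens l p q) (Suc u) 0" "harmonic h" and b: "b \<in> altcochains (diff_ops l p q) (Suc u) (Suc 0)"
      and s: "smap l p q z = const_cochain h + smap l p q (dS \<delta> p b)" and f: "f = base_form p (l + q) e h"
      using R unfolding residue_rel_def by blast
    show ?thesis
    proof
      assume "z \<in> op_coboundaries \<delta> l p q (Suc u)"
      then obtain b' where b': "b' \<in> altcochains (diff_ops l p q) (Suc u) (Suc 0)" "z = dS \<delta> p b'"
        by (auto simp: op_coboundaries_def)
      have "const_cochain h = smap l p q (dS \<delta> p b') - smap l p q (dS \<delta> p b)"
        using s unfolding b'(2) by (simp only: add_diff_cancel_right')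
      then have "const_cochain h = smap l p q (dS \<delta> p (b' - b))"
        unfolding dS_linear(2)[OF b'(1) b] smap_algebra .
      then have "h = 0" by (rule exact_const[OF subspace_diff[OF subspace_diff_cochains b'(1) b] h(2)])
      then show "f = 0" using f b0 by (simp only:)
    next
      assume "f = 0"
      then have "base_form p (l + q) e h = 0" using f by (simp only:)
      then have "h = 0" by (rule harmonic_determined[OF h lq])
      then have "smap l p q z = smap l p q (dS \<delta> p b)" unfolding s by (simp only: c0 add_0)
      then show "z \<in> op_coboundaries \<delta> l p q (Suc u)" by (rule bound[OF z b])
    qed
  qed
  show ?thesis
    unfolding sl_cohomology_pulled gl_inv_algebra_def
  proof (rule vs_isomorphic_relation[where R = "\<lambda>u z f. residue_rel \<delta> l p q e u (pull z) f"])
    show "pulled (op_cocycles \<delta> l p q 0 :: ('m sl list \<Rightarrow> 'm field \<Rightarrow> 'm field) set) \<subseteq> pulled (op_coboundaries \<delta> l p q 0)"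
      using Z0 by (auto simp: pulled_def)
    show "\<exists>z\<in>pulled (op_cocycles \<delta> l p q (Suc u)). residue_rel \<delta> l p q e u (pull z) f" if f: "f \<in> gl_inv_forms u" for u f
    proof -
      obtain z where "z \<in> op_cocycles \<delta> l p q (Suc u)" "residue_rel \<delta> l p q e u z f" using onto[OF f] by blast
      then show ?thesis using push_in[of z] pull_push[of z] by metis
    qed
    show "z \<in> pulled (op_coboundaries \<delta> l p q (Suc u)) \<longleftrightarrow> f = 0"
      if "z \<in> pulled (op_cocycles \<delta> l p q (Suc u))" "residue_rel \<delta> l p q e u (pull z) f" for u z f
      using ker[of "pull z" u f] that by (simp add: pulled_def)
    show "\<exists>f\<in>gl_inv_forms u. residue_rel \<delta> l p q e u (pull z) f" if "z \<in> pulled (op_cocycles \<delta> l p q (Suc u))" for u z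
      using total[of "pull z" u] that by (simp add: pulled_def)
    show "residue_rel \<delta> l p q e u (pull (z + z')) (f + f')"
      if "residue_rel \<delta> l p q e u (pull z) f" "residue_rel \<delta> l p q e u (pull z') f'" for u z z' f f'
      unfolding pull_linear by (rule residue_rel_linear(1)[OF that])
    show "residue_rel \<delta> l p q e u (pull (r *\<^sub>R z)) (r *\<^sub>R f)" if "residue_rel \<delta> l p q e u (pull z) f" for u z f r
      unfolding pull_linear by (rule residue_rel_linear(2)[OF that])
  qed (intro subspace_pulled subspace_op_cocycles subspace_op_coboundaries Gsub)+
qed

theorem theorem6p1:
  fixes \<delta> :: real and p q k :: nat
  shows
    "(p < q \<longrightarrow> zero_module (sl_cohomology TYPE('m::finite) \<delta> k p q)) \<and>
     (\<forall>n::nat.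
        (int k < int n - 1 \<longrightarrow>
           zero_module (sl_cohomology TYPE('m) \<delta> k (q + n) q)) \<and>
        (n \<ge> 1 \<longrightarrow>
           vs_isomorphic (sl_cohomology TYPE('m) \<delta> (n - 1) (q + n) q) (gl_inv_algebra TYPE('m))) \<and>
        (k > n \<longrightarrow>
           vs_iso (sl_cohomology TYPE('m) \<delta> n (q + n) q)
                  (sl_cohomology TYPE('m) \<delta> k (q + n) q)
                  (inclusion_map TYPE('m) \<delta> k (q + n) q)))"
proof (intro conjI impI allI)
  show "zero_module (sl_cohomology TYPE('m) \<delta> k p q)" if "p < q"
    using that by (intro zero_sl_cohomology) simp
  fix n :: nat
  show "zero_module (sl_cohomology TYPE('m) \<delta> k (q + n) q)" if "int k < int n - 1"
    using that by (intro zero_sl_cohomology) simp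
  show "vs_isomorphic (sl_cohomology TYPE('m) \<delta> (n - 1) (q + n) q) (gl_inv_algebra TYPE('m))" if "n \<ge> 1"
    using that by (intro sl_cohomology_top) simp
  show "vs_iso (sl_cohomology TYPE('m) \<delta> n (q + n) q) (sl_cohomology TYPE('m) \<delta> k (q + n) q)
      (inclusion_map TYPE('m) \<delta> k (q + n) q)" if "k > n"
    using that by (intro sl_cohomology_inclusion) simp_all
qed

end
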